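(* Let $n\ge 3$, let $\gamma:[0,T]\to\mathbb{R}^n$ be an ample and equiregular (normal) geodesic in the Carnot group $\mathbb{J}^n$, with $\gamma(0)=x_0$ and initial covector $\lambda_0\in T^*_{x_0}\mathbb{R}^n$. Then there is an orthonormal basis of $\mathscr{D}_{x_0}$ in which the quadratic form $d^2_{x_0}\dot c_t|_{\mathscr{D}_{x_0}}$ (equivalently, the operator $\mathcal{Q}_{\lambda_0}(t)$) has, as $t\to 0$, the expansion $$d^2_{x_0}\dot{c}_t|_{\mathscr{D}}=\frac{1}{t^2}\mathcal{I}_{\lambda_0}+\frac{1}{3}\mathcal{R}_{\lambda_0}+O(t)=\frac{1}{t^2}\begin{pmatrix}(n-1)^2&0\\0&1\end{pmatrix}+\frac13\begin{pmatrix}\frac{3(n-1)}{4(n-1)^2-1}R_{11}(\lambda_0)&0\\0&0\end{pmatrix}+O(t),$$ where $$R_{11}(\lambda_0)=-\frac16(n-1)\bigl(12+n(4n-17)\bigr)\bigl(h_3^2+h_2h_4\bigr)-(n-1)(n-2)(n-3)\,h_3^2\,\frac{h_2^2}{h_1^2},$$ all $h_i$ being evaluated at $\lambda_0$, with the convention $h_4\equiv 0$ when $n=3$ (and, when $n=3$, the last term, which carries the factor $n-3$, is zero).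
   Context: The group $\mathbb{J}^n$. On $\mathbb{R}^n$ ($n\ge3$) with coordinates $(x,y_0,\dots,y_{n-2})$ put $X_1=\partial_x$ and $X_{i+2}=\sum_{j=i}^{n-2}\frac{x^{j-i}}{(j-i)!}\partial_{y_j}$, $i=0,\dots,n-2$. Then $[X_1,X_i]=X_{i+1}$ for $i=2,\dots,n-1$ and all other brackets vanish. $\mathbb{J}^n$ is $\mathbb{R}^n$ with the Lie group structure for which $X_1,\dots,X_n$ are left-invariant, with the sub-Riemannian structure $(\mathscr{D},g)$: $\mathscr{D}=\mathrm{span}\{X_1,X_2\}$ and $X_1,X_2$ orthonormal for $g$. Let $d$ be the sub-Riemannian distance (infimum of $g$-lengths of Lipschitz curves tangent a.e. to $\mathscr{D}$). Normal geodesics. $h_i(\lambda)=\langle\lambda,X_i\rangle$ for $\lambda\in T^*\mathbb{R}^n$, $H=\frac12(h_1^2+h_2^2)$, and $\vec H$ is the Hamiltonian vector field of $H$ ($dH=\sigma(\cdot,\vec H)$, $\sigma$ the differential of the Liouville form). A normal geodesic with initial covector $\lambda_0$ is $\gamma(t)=\pi(\lambda(t))$, $\lambda(t)=e^{t\vec H}(\lambda_0)$, $\pi:T^*\mathbb{R}^n\to\mathbb{R}^n$ the projection. Ample/equiregular. For a smooth admissible curve $\gamma$ choose a horizontal vector field $\mathsf T$ with $\mathsf T|_{\gamma(t)}=\dot\gamma(t)$. The flag of $\gamma$ is $\mathscr{F}^i_\gamma(t)=\mathrm{span}\{\mathcal{L}^j_{\mathsf T}(X)|_{\gamma(t)}: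 X \text{ a horizontal vector field},\ j\le i-1\}\subset T_{\gamma(t)}\mathbb{R}^n$ (independent of $\mathsf T$), where $\mathcal L_{\mathsf T}$ is the Lie derivative, and the growth vector is $\mathcal{G}_\gamma(t)=(k_1(t),k_2(t),\dots)$ with $k_i(t)=\dim\mathscr{F}^i_\gamma(t)$. $\gamma$ is equiregular at $t$ if its growth vector is locally constant at $t$, and ample at $t$ if $\mathscr{F}^m_\gamma(t)=T_{\gamma(t)}\mathbb{R}^n$ for some $m$. It is ample (equiregular) if it is so at every $t\in[0,T]$. Geodesic cost and curvature operator. $c_t(x)=-\frac{1}{2t}d^2(x,\gamma(t))$ for $t>0$ and $\dot c_t=\frac{\partial}{\partial t}c_t$. For an ample normal geodesic it is known that $(t,x)\mapsto c_t(x)$ is smooth for small $t>0$ and $x$ near $x_0$, and that $x_0$ is a critical point of $\dot c_t$, so the second differential (Hessian) $d^2_{x_0}\dot c_t$ is a well-defined quadratic form on $T_{x_0}\mathbb{R}^n$. The symmetric operators $\mathcal{Q}_{\lambda_0}(t):\mathscr{D}_{x_0}\to\mathscr{D}_{x_0}$ are defined by $d^2_{x_0}\dot c_t(v)=g(\mathcal{Q}_{\lambda_0}(t)v,v)$ for $v\in\mathscr{D}_{x_0}$. It is known that $t^2\mathcal{Q}_{\lambda_0}(t)$ extends smoothly to $t=0$. One sets $\mathcal{I}_{\lambda_0}=\lim_{t\to0^+}t^2\mathcal{Q}_{\lambda_0}(t)$ and $\mathcal{R}_{\lambda_0}=\frac32\frac{d^2}{dt^2}\big|_{t=0}t^2\mathcal{Q}_{\lambda_0}(t)$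 (the curvature operator). *)

theory Defs
  imports "HOL-Analysis.Analysis" "HOL-Library.Landau_Symbols"
begin

section \<open>The vector fields on \<open>\<real>\<^sup>n\<close> and the sub-Riemannian structure\<close>

text \<open>
  The space is \<open>real ^ 'n\<close> with \<open>n = CARD('n)\<close>.  The coordinates \<open>(x, y\<^sub>0, \<dots>, y\<^bsub>n-2\<^esub>)\<close> are
  numbered \<open>0, \<dots>, n - 1\<close> through the bijection \<open>from_nat_into UNIV\<close> between \<open>{..<CARD('n)}\<close>
  and the index type.
\<close>

definition coord_ix :: "nat \<Rightarrow> 'n::finite" where
  "coord_ix = from_nat_into UNIV"

lemma bij_betw_coord_ix: "bij_betw (coord_ix :: nat \<Rightarrow> 'n::finite) {..<CARD('n)} UNIV"
  unfolding coord_ix_def by (rule bij_betw_from_nat_into_finite) simp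

definition coord_x :: "real ^ 'n::finite \<Rightarrow> real" where
  "coord_x q = q $ coord_ix 0"

definition d_x :: "real ^ 'n::finite" where
  "d_x = axis (coord_ix 0) 1"

definition d_y :: "nat \<Rightarrow> real ^ 'n::finite" where
  "d_y j = axis (coord_ix (Suc j)) 1"

text \<open>\<open>jet_field k\<close> is \<open>X\<^sub>k\<close> for \<open>1 \<le> k \<le> n\<close>; the value at \<open>k = 0\<close> is irrelevant.\<close>

fun jet_field :: "nat \<Rightarrow> real ^ 'n::finite \<Rightarrow> real ^ 'n" where
  "jet_field 0 q = 0"
| "jet_field (Suc 0) q = d_x"
| "jet_field (Suc (Suc i)) q =
     (\<Sum>j = i..CARD('n) - 2. (coord_x q ^ (j - i) / fact (j - i)) *\<^sub>R d_y j)"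

lemma jet_field_eq_0:
  fixes q :: "real ^ 'n::finite"
  assumes "CARD('n) \<ge> 2" "k > CARD('n)"
  shows "jet_field k q = 0"
proof -
  obtain i where "k = Suc (Suc i)"
    using assms by (metis Suc_le_D less_imp_le_nat numeral_2_eq_2 order_trans Suc_le_mono)
  with assms show ?thesis by simp
qed

definition hor :: "real ^ 'n::finite \<Rightarrow> (real ^ 'n) set" where
  "hor q = span {jet_field 1 q, jet_field 2 q}"

text \<open>
  For \<open>v \<in> hor q\<close>, \<open>hor_coeffs q v\<close> is the pair of coefficients of \<open>v\<close> with respect to
  \<open>X\<^sub>1, X\<^sub>2\<close>, so that \<open>sr_metric q\<close> on \<open>hor q\<close> is the inner product for which \<open>X\<^sub>1, X\<^sub>2\<close> are
  orthonormal.  Both are meaningful on \<open>hor q\<close> only.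
\<close>

definition hor_coeffs :: "real ^ 'n::finite \<Rightarrow> real ^ 'n \<Rightarrow> real \<times> real" where
  "hor_coeffs q v = (THE u. v = fst u *\<^sub>R jet_field 1 q + snd u *\<^sub>R jet_field 2 q)"

definition sr_metric :: "real ^ 'n::finite \<Rightarrow> real ^ 'n \<Rightarrow> real ^ 'n \<Rightarrow> real" where
  "sr_metric q v w = hor_coeffs q v \<bullet> hor_coeffs q w"

definition admissible_curve :: "real \<Rightarrow> real \<Rightarrow> (real \<Rightarrow> real ^ 'n::finite) \<Rightarrow> bool" where
  "admissible_curve a b c \<longleftrightarrow>
     a \<le> b \<and> (\<exists>L. L-lipschitz_on {a..b} c) \<and>
     (AE s in lebesgue_on {a..b}.
        c differentiable (at s) \<and> vector_derivative c (at s) \<in> hor (c s))"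

definition sr_length :: "real \<Rightarrow> real \<Rightarrow> (real \<Rightarrow> real ^ 'n::finite) \<Rightarrow> real" where
  "sr_length a b c =
     integral {a..b}
       (\<lambda>s. sqrt (sr_metric (c s) (vector_derivative c (at s)) (vector_derivative c (at s))))"

definition sr_dist :: "real ^ 'n::finite \<Rightarrow> real ^ 'n \<Rightarrow> real" where
  "sr_dist p q =
     Inf {sr_length a b c | a b c. admissible_curve a b c \<and> c a = p \<and> c b = q}"


section \<open>Normal geodesics\<close>

text \<open>
  A point of \<open>T\<^sup>*\<real>\<^sup>n\<close> is a pair \<open>(q, p)\<close> of a base point and a covector, and the pairing of
  covectors with vectors is the Euclidean inner product of coordinate vectors.  With the Liouville
  form \<open>\<Sum>\<^sub>i p\<^sub>i dq\<^sub>i\<close>, its differential is \<open>\<sigma> = \<Sum>\<^sub>i dp\<^sub>i \<and> dq\<^sub>i\<close>.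
\<close>

definition cov_h :: "nat \<Rightarrow> (real ^ 'n::finite) \<times> (real ^ 'n) \<Rightarrow> real" where
  "cov_h k l = snd l \<bullet> jet_field k (fst l)"

definition sr_ham :: "(real ^ 'n::finite) \<times> (real ^ 'n) \<Rightarrow> real" where
  "sr_ham l = 1/2 * ((cov_h 1 l)\<^sup>2 + (cov_h 2 l)\<^sup>2)"

definition symp ::
  "(real ^ 'n::finite) \<times> (real ^ 'n) \<Rightarrow> (real ^ 'n) \<times> (real ^ 'n) \<Rightarrow> real" where
  "symp W V = snd W \<bullet> fst V - snd V \<bullet> fst W"

definition ham_field ::
  "((real ^ 'n::finite) \<times> (real ^ 'n) \<Rightarrow> real) \<Rightarrow>
   (real ^ 'n) \<times> (real ^ 'n) \<Rightarrow> (real ^ 'n) \<times> (real ^ 'n)" where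
  "ham_field F l = (THE V. (F has_derivative (\<lambda>W. symp W V)) (at l))"

definition normal_geodesic ::
  "real \<Rightarrow> (real \<Rightarrow> real ^ 'n::finite) \<Rightarrow> (real ^ 'n) \<times> (real ^ 'n) \<Rightarrow> bool" where
  "normal_geodesic T \<gamma> l0 \<longleftrightarrow>
     (\<exists>l. l 0 = l0 \<and>
        (\<forall>t\<in>{0..T}. (l has_vector_derivative ham_field sr_ham (l t)) (at t within {0..T})) \<and>
        (\<forall>t\<in>{0..T}. \<gamma> t = fst (l t)))"


section \<open>The flag of a curve\<close>

primrec Ck :: "nat \<Rightarrow> ('a::euclidean_space \<Rightarrow> 'b::real_normed_vector) \<Rightarrow> bool" where
  "Ck 0 f \<longleftrightarrow> continuous_on UNIV f"
| "Ck (Suc k) f \<longleftrightarrow>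
     (\<forall>x. f differentiable (at x)) \<and> (\<forall>v. Ck k (\<lambda>x. frechet_derivative f (at x) v))"

definition smooth_map :: "('a::euclidean_space \<Rightarrow> 'b::real_normed_vector) \<Rightarrow> bool" where
  "smooth_map f \<longleftrightarrow> (\<forall>k. Ck k f)"

definition horizontal_field :: "(real ^ 'n::finite \<Rightarrow> real ^ 'n) \<Rightarrow> bool" where
  "horizontal_field V \<longleftrightarrow> smooth_map V \<and> (\<forall>q. V q \<in> hor q)"

definition lie_deriv ::
  "(real ^ 'n::finite \<Rightarrow> real ^ 'n) \<Rightarrow> (real ^ 'n \<Rightarrow> real ^ 'n) \<Rightarrow> real ^ 'n \<Rightarrow> real ^ 'n" where
  "lie_deriv V X q = frechet_derivative X (at q) (V q) - frechet_derivative V (at q) (X q)"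

text \<open>
  \<open>V\<close> extends the velocity of \<open>\<gamma> : [0,T] \<rightarrow> \<real>\<^sup>n\<close> near time \<open>t\<close>.  The flag at time \<open>t\<close> depends only
  on the germ of \<open>\<gamma>\<close> at \<open>t\<close>, and a local requirement keeps extensions available for curves
  that revisit a point.
\<close>

definition extends_velocity ::
  "real \<Rightarrow> (real \<Rightarrow> real ^ 'n::finite) \<Rightarrow> real \<Rightarrow> (real ^ 'n \<Rightarrow> real ^ 'n) \<Rightarrow> bool" where
  "extends_velocity T \<gamma> t V \<longleftrightarrow>
     (\<exists>\<epsilon>>0. \<forall>s\<in>{0..T}. \<bar>s - t\<bar> < \<epsilon> \<longrightarrow>
        (\<gamma> has_vector_derivative V (\<gamma> s)) (at s within {0..T}))"

text \<open>
  Since the span does not depend on the extension \<open>V\<close>, it is taken over all extensions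
  at once instead of choosing one.
\<close>

definition flag :: "real \<Rightarrow> (real \<Rightarrow> real ^ 'n::finite) \<Rightarrow> nat \<Rightarrow> real \<Rightarrow> (real ^ 'n) set" where
  "flag T \<gamma> i t =
     span {(lie_deriv V ^^ j) X (\<gamma> t) | V X j.
             horizontal_field V \<and> extends_velocity T \<gamma> t V \<and> horizontal_field X \<and> j < i}"

text \<open>The sequence is indexed from \<open>i = 1\<close>; the extra entry at \<open>i = 0\<close> is always \<open>0\<close>.\<close>

definition growth_vector :: "real \<Rightarrow> (real \<Rightarrow> real ^ 'n::finite) \<Rightarrow> real \<Rightarrow> nat \<Rightarrow> nat" where
  "growth_vector T \<gamma> t = (\<lambda>i. dim (flag T \<gamma> i t))"

definition equiregular :: "real \<Rightarrow> (real \<Rightarrow> real ^ 'n::finite) \<Rightarrow> bool" where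
  "equiregular T \<gamma> \<longleftrightarrow>
     (\<forall>t\<in>{0..T}. \<exists>\<epsilon>>0. \<forall>s\<in>{0..T}. \<bar>s - t\<bar> < \<epsilon> \<longrightarrow>
        growth_vector T \<gamma> s = growth_vector T \<gamma> t)"

definition ample :: "real \<Rightarrow> (real \<Rightarrow> real ^ 'n::finite) \<Rightarrow> bool" where
  "ample T \<gamma> \<longleftrightarrow> (\<forall>t\<in>{0..T}. \<exists>m. flag T \<gamma> m t = UNIV)"


section \<open>Geodesic cost and curvature operator\<close>

definition geod_cost :: "(real \<Rightarrow> real ^ 'n::finite) \<Rightarrow> real \<Rightarrow> real ^ 'n \<Rightarrow> real" where
  "geod_cost \<gamma> t x = - (1 / (2 * t)) * (sr_dist x (\<gamma> t))\<^sup>2"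

definition geod_cost_dot :: "(real \<Rightarrow> real ^ 'n::finite) \<Rightarrow> real \<Rightarrow> real ^ 'n \<Rightarrow> real" where
  "geod_cost_dot \<gamma> t x = deriv (\<lambda>s. geod_cost \<gamma> s x) t"

text \<open>At a critical point of \<open>f\<close> this is the coordinate-free second differential.\<close>

definition second_diff :: "('a::real_normed_vector \<Rightarrow> real) \<Rightarrow> 'a \<Rightarrow> 'a \<Rightarrow> real" where
  "second_diff f x v = frechet_derivative (\<lambda>y. frechet_derivative f (at y) v) (at x) v"

text \<open>
  Operators on \<open>hor x\<close> are total functions; the value \<open>0\<close> outside \<open>hor x\<close> serves
  only to make the operator determined by a quadratic form on \<open>hor x\<close> unique.
\<close>

definition hor_operator :: "real ^ 'n::finite \<Rightarrow> (real ^ 'n \<Rightarrow> real ^ 'n) \<Rightarrow> bool" where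
  "hor_operator x A \<longleftrightarrow>
     (\<forall>v\<in>hor x. A v \<in> hor x) \<and> (\<forall>v. v \<notin> hor x \<longrightarrow> A v = 0) \<and>
     (\<forall>v\<in>hor x. \<forall>w\<in>hor x. A (v + w) = A v + A w) \<and>
     (\<forall>c. \<forall>v\<in>hor x. A (c *\<^sub>R v) = c *\<^sub>R A v)"

definition hor_symmetric :: "real ^ 'n::finite \<Rightarrow> (real ^ 'n \<Rightarrow> real ^ 'n) \<Rightarrow> bool" where
  "hor_symmetric x A \<longleftrightarrow>
     (\<forall>v\<in>hor x. \<forall>w\<in>hor x. sr_metric x (A v) w = sr_metric x v (A w))"

definition Q_op :: "(real \<Rightarrow> real ^ 'n::finite) \<Rightarrow> real \<Rightarrow> real ^ 'n \<Rightarrow> real ^ 'n" where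
  "Q_op \<gamma> t =
     (THE A. hor_operator (\<gamma> 0) A \<and> hor_symmetric (\<gamma> 0) A \<and>
        (\<forall>v\<in>hor (\<gamma> 0). second_diff (geod_cost_dot \<gamma> t) (\<gamma> 0) v = sr_metric (\<gamma> 0) (A v) v))"

definition I_op :: "(real \<Rightarrow> real ^ 'n::finite) \<Rightarrow> real ^ 'n \<Rightarrow> real ^ 'n" where
  "I_op \<gamma> v = Lim (at_right 0) (\<lambda>t. t\<^sup>2 *\<^sub>R Q_op \<gamma> t v)"

text \<open>The extension of \<open>t \<mapsto> t\<^sup>2 Q(t) v\<close> to \<open>t = 0\<close>.\<close>

definition tQ_ext :: "(real \<Rightarrow> real ^ 'n::finite) \<Rightarrow> real ^ 'n \<Rightarrow> real \<Rightarrow> real ^ 'n" where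
  "tQ_ext \<gamma> v t = (if t = 0 then I_op \<gamma> v else t\<^sup>2 *\<^sub>R Q_op \<gamma> t v)"

text \<open>
  Since \<open>Q(t)\<close> is defined for \<open>t > 0\<close> only, derivatives of the extension are taken within
  \<open>[0,\<infinity>)\<close>, that is, one-sided at \<open>0\<close>.
\<close>

definition R_op :: "(real \<Rightarrow> real ^ 'n::finite) \<Rightarrow> real ^ 'n \<Rightarrow> real ^ 'n" where
  "R_op \<gamma> v =
     (3/2) *\<^sub>R vector_derivative
       (\<lambda>s. vector_derivative (tQ_ext \<gamma> v) (at s within {0..})) (at 0 within {0..})"

definition hor_orthonormal_basis :: "real ^ 'n::finite \<Rightarrow> (2 \<Rightarrow> real ^ 'n) \<Rightarrow> bool" where
  "hor_orthonormal_basis x e \<longleftrightarrow>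
     range e \<subseteq> hor x \<and> span (range e) = hor x \<and>
     (\<forall>i j. sr_metric x (e i) (e j) = (if i = j then 1 else 0))"

definition op_matrix ::
  "real ^ 'n::finite \<Rightarrow> (2 \<Rightarrow> real ^ 'n) \<Rightarrow> (real ^ 'n \<Rightarrow> real ^ 'n) \<Rightarrow> real ^ 2 ^ 2" where
  "op_matrix x e A = (\<chi> i j. sr_metric x (A (e j)) (e i))"

text \<open>
  If \<open>n = 3\<close> then \<open>cov_h 4\<close> vanishes identically, by \<open>jet_field_eq_0\<close>, as required
  by the convention for that dimension.
\<close>

definition R11 :: "(real ^ 'n::finite) \<times> (real ^ 'n) \<Rightarrow> real" where
  "R11 l =
     (let n = real CARD('n); h = (\<lambda>k. cov_h k l) in
       - (1/6) * (n - 1) * (12 + n * (4 * n - 17)) * ((h 3)\<^sup>2 + h 2 * h 4)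
       - (n - 1) * (n - 2) * (n - 3) * (h 3)\<^sup>2 * ((h 2)\<^sup>2 / (h 1)\<^sup>2))"

end

theory Submission
  imports Defs
begin

text \<open>
  A normal geodesic with \<open>h\<^sub>1 \<noteq> 0\<close> is, for short times, a graph over the \<open>x\<close>-axis, and the
  \<open>y\<close>-components of its covector are constant.  Such a covector defines an action that is calibrated
  by the Cauchy-Schwarz inequality, so the distance of two points is the action of the covector that
  joins them, and by the inverse function theorem this covector depends smoothly on the points.
  Completing the square in \<open>\<partial>\<^sub>t c\<^sub>t\<close> gives \<open>\<partial>\<^sub>t c\<^sub>t(x) = |E(x)|\<^sup>2 / 2 - const\<close>, where \<open>E(x)\<close> is \<open>1/t\<close> times the
  distance times the unit velocity at \<open>\<gamma>(t)\<close> of the minimizer from \<open>x\<close>, minus the velocity of \<open>\<gamma>\<close> at \<open>t\<close>.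
  As \<open>E\<close> vanishes at \<open>x\<^sub>0\<close>, the second differential at \<open>x\<^sub>0\<close> is \<open>|dE|\<^sup>2\<close>.  It equals \<open>1/t\<^sup>2\<close> on the unit tangent.
  On the unit normal it is determined by a linear system whose matrix consists of moments of the weight
  \<open>(1 - slope\<^sup>2)\<^bsup>-3/2\<^esup>\<close>; the relevant number is the value at the end point of the polynomial of degree
  \<open>n - 2\<close> reproducing the value at the initial point, and the expansion of this polynomial to second order
  yields \<open>(n - 1)\<^sup>2\<close> and \<open>R\<^sub>1\<^sub>1\<close>.

  If \<open>n \<ge> 4\<close> and \<open>h\<^sub>1\<close> vanishes initially, then the third entry of the growth vector is at most \<open>3\<close> there but
  \<open>4\<close> wherever \<open>h\<^sub>1 \<noteq> 0\<close>, and the flag never fills the tangent space if \<open>h\<^sub>1\<close> vanishes identically.  If \<open>n = 3\<close>,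
  an isometry that interchanges \<open>X\<^sub>1\<close> and \<open>X\<^sub>2\<close> up to sign reduces the case \<open>h\<^sub>1 = 0\<close> to \<open>h\<^sub>1 \<noteq> 0\<close>.
\<close>

text \<open>The distance is an infimum over Lipschitz curves, so existence and regularity of
  minimizers cannot be presupposed; a calibration provides both near x_0. It controls only curves
  inside a strip over the x-axis, but a curve that leaves the strip is already longer than the
  action, because length dominates the variation of x. The inverse function theorem makes the
  covector merely C^1 in the end points, one derivative short of what a Hessian asks for; a square
  |E|^2 with E(x_0) = 0 is twice differentiable at x_0 as soon as E is C^1. Polynomials enter
  because a covector determines a graph through its pairing with X_2, of degree at most n - 2 in x.
  A normal displacement of the initial point with fixed end point makes the variation of this
  polynomial orthogonal to all those vanishing initially; for weight 1 on [0,1] the one reproducing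
  the value at 0 has the value (-1)^(n-2) (n - 1) at 1, whose square is the leading coefficient. The
  curvature is an iterated one-sided derivative, which an expansion alone does not determine; hence
  the normal coefficient is shown to be C^3 on a closed interval.\<close>

section \<open>The fundamental theorem of calculus for Lipschitz curves\<close>

text \<open>An admissible curve is differentiable only almost everywhere. In a fine tagged division
  the intervals tagged in \<open>N\<close> have small total length, because
  \<open>indicator N\<close> has integral 0, and the Lipschitz constant turns this length into a
  bound for the increments of \<open>f\<close>; the other intervals are handled by differentiability
  at the tag.\<close>

lemma has_integral_vector_derivative_lipschitz:
  fixes f :: "real \<Rightarrow> 'a::banach"
  assumes lip: "L-lipschitz_on {a..b} f" and "a \<le> b" and N: "negligible N"
    and der: "\<And>s. s \<in> {a..b} - N \<Longrightarrow> (f has_vector_derivative f' s) (at s within {a..b})"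
  shows "(f' has_integral f b - f a) {a..b}"
proof -
  define g where "g s = (if s \<in> N then 0 else f' s)" for s
  have "(g has_integral f b - f a) {a..b}"
    unfolding has_integral_real[of g]
  proof safe
    fix e :: real
    assume "e > 0"
    have "L \<ge> 0" using lip by (rule lipschitz_on_nonneg)
    define e1 where "e1 = e / (2 * (b - a + 1))"
    define e2 where "e2 = e / (2 * (L + 1))"
    have e12: "e1 > 0" "e2 > 0"
      using \<open>e > 0\<close> \<open>L \<ge> 0\<close> \<open>a \<le> b\<close> by (auto simp: e1_def e2_def)
    have "((indicator N :: real \<Rightarrow> real) has_integral 0) {a..b}"
      using N unfolding negligible_def by (metis box_real(2))
    note this[unfolded has_integral_real, rule_format, OF e12(2)]
    then obtain d0 where "gauge d0 \<and> (\<forall>p. p tagged_division_of {a..b} \<and> d0 fine p \<longrightarrow>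
        norm ((\<Sum>(x,k)\<in>p. measure lborel k *\<^sub>R indicator N x) - (0::real)) < e2)"
      by (rule exE)
    then have d0: "gauge d0"
      "\<And>p. p tagged_division_of {a..b} \<Longrightarrow> d0 fine p \<Longrightarrow>
        norm ((\<Sum>(x,k)\<in>p. measure lborel k *\<^sub>R indicator N x) - (0::real)) < e2"
      by simp_all
    have "\<forall>x. \<exists>d>0. x \<in> {a..b} - N \<longrightarrow>
         (\<forall>y\<in>{a..b}. norm (y-x) < d \<longrightarrow> norm (f y - f x - (y-x) *\<^sub>R f' x) \<le> e1 * norm (y-x))"
      using der[unfolded has_vector_derivative_def has_derivative_within_alt] e12(1) by blast
    then obtain d where d: "\<And>x. 0 < d x"
      "\<And>x y. \<lbrakk>x \<in> {a..b} - N; y \<in> {a..b}; norm (y-x) < d x\<rbrakk>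
          \<Longrightarrow> norm (f y - f x - (y-x) *\<^sub>R f' x) \<le> e1 * norm (y-x)"
      by metis
    show "\<exists>\<gamma>. gauge \<gamma> \<and> (\<forall>\<D>. \<D> tagged_division_of {a..b} \<and> \<gamma> fine \<D> \<longrightarrow>
        norm ((\<Sum>(x, k)\<in>\<D>. measure lborel k *\<^sub>R g x) - (f b - f a)) < e)"
    proof (intro exI conjI allI impI)
      show "gauge (\<lambda>x. ball x (d x) \<inter> d0 x)"
        using d(1) d0(1) by (intro gauge_Int gauge_ball_dependent) auto
      fix p assume p: "p tagged_division_of {a..b} \<and> (\<lambda>x. ball x (d x) \<inter> d0 x) fine p"
      then have ptag: "p tagged_division_of {a..b}" and f1: "(\<lambda>x. ball x (d x)) fine p"
        and f2: "d0 fine p"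
        by (auto simp: fine_Int)
      have fin: "finite p" using ptag by blast
      have *: "norm (measure lborel K *\<^sub>R g x - (f (Sup K) - f (Inf K)))
          \<le> e1 * (Sup K - Inf K) + L * (measure lborel K *\<^sub>R indicator N x)" if xKp: "(x, K) \<in> p" for x K
      proof -
        obtain u v where K: "K = {u..v}" and xK: "x \<in> K" and Kab: "K \<subseteq> {a..b}"
          using tagged_division_ofD(2,3,4)[OF ptag xKp] by (metis box_real(2))
        have uv: "u \<le> x" "x \<le> v" using xK K by auto
        have uv': "u \<in> {a..b}" "v \<in> {a..b}" using uv K Kab by auto
        have ends: "Sup K = v" "Inf K = u" "measure lborel K = v - u" using uv K by auto
        have ball: "K \<subseteq> ball x (d x)" using f1 xKp by blast
        show ?thesis
        proof (cases "x \<in> N")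
          case True
          have "norm (f v - f u) \<le> L * (v - u)"
            using lipschitz_onD[OF lip uv'(2,1)] uv by (simp add: dist_norm)
          moreover have "0 \<le> e1 * (v - u)" using e12 uv by simp
          ultimately show ?thesis using True by (simp add: g_def ends norm_minus_commute)
        next
          case False
          have x: "x \<in> {a..b} - N" using False xK Kab by auto
          have "u \<in> K" "v \<in> K" using uv K by auto
          then have "u \<in> ball x (d x)" "v \<in> ball x (d x)" using ball by blast+
          then have du: "norm (u - x) < d x" "norm (v - x) < d x"
            by (simp_all add: dist_norm norm_minus_commute)
          have "norm ((v - u) *\<^sub>R f' x - (f v - f u))
              = norm ((f u - f x - (u - x) *\<^sub>R f' x) - (f v - f x - (v - x) *\<^sub>R f' x))"
            by (simp add: algebra_simps)
          also have "\<dots> \<le> e1 * norm (u - x) + e1 * norm (v - x)"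
            by (intro order.trans[OF norm_triangle_ineq4] add_mono d(2) x uv' du)
          also have "\<dots> = e1 * (v - u)"
            using uv by (simp add: algebra_simps)
          finally show ?thesis using False by (simp add: g_def ends)
        qed
      qed
      have "(\<Sum>(x, k)\<in>p. measure lborel k *\<^sub>R g x) - (f b - f a)
          = (\<Sum>(x, K)\<in>p. measure lborel K *\<^sub>R g x - (f (Sup K) - f (Inf K)))"
        using additive_tagged_division_1[OF \<open>a \<le> b\<close> ptag, of f]
        by (simp add: split_def sum_subtractf)
      also have "norm \<dots> \<le> (\<Sum>(x, K)\<in>p. e1 * (Sup K - Inf K) + L * (measure lborel K *\<^sub>R indicator N x))"
        using * by (intro sum_norm_le) auto
      also have "\<dots> = e1 * (b - a) + L * (\<Sum>(x, K)\<in>p. measure lborel K *\<^sub>R indicator N x)"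
        using additive_tagged_division_1[OF \<open>a \<le> b\<close> ptag, of "\<lambda>x. x"]
        by (simp add: split_def sum.distrib sum_distrib_left[symmetric])
      also have "\<dots> \<le> e1 * (b - a) + L * e2"
        using d0(2)[OF ptag f2] \<open>L \<ge> 0\<close> by (intro add_left_mono mult_left_mono) (auto simp: abs_less_iff)
      also have "\<dots> < e1 * (b - a + 1) + (L + 1) * e2"
        using e12 by (simp add: algebra_simps)
      also have "\<dots> = e"
      proof -
        have "e1 * (b - a + 1) = e / 2" "(L + 1) * e2 = e / 2"
          using \<open>L \<ge> 0\<close> \<open>a \<le> b\<close> by (simp_all add: e1_def e2_def divide_simps)
        then show ?thesis by simp
      qed
      finally show "norm ((\<Sum>(x, k)\<in>p. measure lborel k *\<^sub>R g x) - (f b - f a)) < e" .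
    qed
  qed
  then show ?thesis
    by (rule has_integral_spike[OF N, rotated]) (auto simp: g_def)
qed

section \<open>The frame\<close>

text \<open>The frame fields depend on the point only through its abscissa \<xi>. The pairing of a
  covector with \<open>jet_vec 0 \<xi>\<close> is a polynomial in \<xi> of degree at most n - 2,
  with the y-components divided by factorials as coefficients.\<close>

definition jet_vec :: "nat \<Rightarrow> real \<Rightarrow> real ^ 'n::finite" where
  "jet_vec i \<xi> = (\<Sum>j = i..CARD('n) - 2. (\<xi> ^ (j - i) / fact (j - i)) *\<^sub>R d_y j)"

lemma jet_field_Suc_Suc: "jet_field (Suc (Suc i)) q = jet_vec i (coord_x q)"
  by (simp add: jet_vec_def)

lemma jet_field_frame:
  "jet_field 1 q = d_x" "jet_field 2 q = jet_vec 0 (coord_x q)"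
  "jet_field 3 q = jet_vec 1 (coord_x q)" "jet_field 4 q = jet_vec 2 (coord_x q)"
  using jet_field_Suc_Suc[of 0 q] jet_field_Suc_Suc[of 1 q] jet_field_Suc_Suc[of 2 q]
  by (simp_all add: numeral_eq_Suc)

lemma coord_ix_eq_iff:
  assumes "i < CARD('n)" "j < CARD('n)"
  shows "coord_ix i = (coord_ix j :: 'n::finite) \<longleftrightarrow> i = j"
  using bij_betw_coord_ix[where 'n='n] assms unfolding bij_betw_def by (auto dest: inj_onD)

lemma coord_ix_cases:
  fixes k :: "'n::finite"
  obtains "k = coord_ix 0" | j where "j \<le> CARD('n) - 2" "k = coord_ix (Suc j)"
proof -
  have "k \<in> coord_ix ` {..<CARD('n)}"
    using bij_betw_coord_ix[where 'n='n] by (auto simp: bij_betw_def)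
  then obtain i where i: "i < CARD('n)" "k = coord_ix i" by auto
  show thesis
  proof (cases i)
    case 0
    then show ?thesis using i that(1) by simp
  next
    case (Suc j)
    then show ?thesis using i that(2)[of j] by simp
  qed
qed

lemma coord_x_inner: "coord_x q = q \<bullet> d_x"
  by (simp add: coord_x_def d_x_def inner_axis)

lemma coord_x_add [simp]: "coord_x (p + q) = coord_x p + coord_x q"
  and coord_x_diff [simp]: "coord_x (p - q) = coord_x p - coord_x q"
  and coord_x_scaleR [simp]: "coord_x (r *\<^sub>R q) = r * coord_x q"
  and coord_x_minus [simp]: "coord_x (- q) = - coord_x q"
  and coord_x_zero [simp]: "coord_x 0 = 0"
  by (simp_all add: coord_x_def)

lemma bounded_linear_coord_x: "bounded_linear coord_x"
  unfolding coord_x_def by (rule bounded_linear_vec_nth)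

lemmas coord_x_has_derivative [derivative_intros] =
  bounded_linear.has_derivative[OF bounded_linear_coord_x]
lemmas coord_x_has_vector_derivative [derivative_intros] =
  bounded_linear.has_vector_derivative[OF bounded_linear_coord_x]
lemmas continuous_on_coord_x [continuous_intros] =
  bounded_linear.continuous_on[OF bounded_linear_coord_x]
lemmas tendsto_coord_x [tendsto_intros] =
  bounded_linear.tendsto[OF bounded_linear_coord_x]

lemma d_x_inner_d_x [simp]: "d_x \<bullet> d_x = 1" "coord_x d_x = 1"
  by (simp_all add: d_x_def inner_axis_axis coord_x_def)

lemma d_y_inner:
  assumes "CARD('n) \<ge> 2" "i \<le> CARD('n) - 2" "j \<le> CARD('n) - 2"
  shows "d_y i \<bullet> (d_y j :: real ^ 'n::finite) = (if i = j then 1 else 0)"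
  using assms coord_ix_eq_iff[where 'n='n, of "Suc i" "Suc j"]
  by (auto simp: d_y_def inner_axis_axis)

lemma d_x_inner_d_y:
  assumes "CARD('n) \<ge> 2" "j \<le> CARD('n) - 2"
  shows "d_x \<bullet> (d_y j :: real ^ 'n::finite) = 0" "d_y j \<bullet> (d_x :: real ^ 'n) = 0"
    "coord_x (d_y j :: real ^ 'n) = 0"
proof -
  have "coord_ix (Suc j) \<noteq> (coord_ix 0 :: 'n)"
    using assms by (subst coord_ix_eq_iff) auto
  then show "d_x \<bullet> (d_y j :: real ^ 'n) = 0" "d_y j \<bullet> (d_x :: real ^ 'n) = 0"
    "coord_x (d_y j :: real ^ 'n) = 0"
    by (auto simp: d_y_def d_x_def inner_axis_axis coord_x_def, simp add: axis_def)
qed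

lemma coord_x_jet_vec [simp]:
  assumes "CARD('n) \<ge> 2"
  shows "coord_x (jet_vec i \<xi> :: real ^ 'n::finite) = 0"
proof -
  have "coord_x (jet_vec i \<xi> :: real ^ 'n) =
      (\<Sum>j = i..CARD('n) - 2. (\<xi> ^ (j - i) / fact (j - i)) * coord_x (d_y j :: real ^ 'n))"
    unfolding jet_vec_def by (simp add: coord_x_inner inner_sum_left)
  also have "\<dots> = 0"
    using d_x_inner_d_y[OF assms] by (intro sum.neutral) auto
  finally show ?thesis .
qed

lemma d_x_inner_jet_vec [simp]:
  assumes "CARD('n) \<ge> 2"
  shows "d_x \<bullet> (jet_vec i \<xi> :: real ^ 'n::finite) = 0" "jet_vec i \<xi> \<bullet> (d_x :: real ^ 'n) = 0"
  using coord_x_jet_vec[OF assms] by (simp_all add: coord_x_inner inner_commute)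

lemma jet_vec_inner_d_y:
  assumes "CARD('n) \<ge> 2" "j \<le> CARD('n) - 2"
  shows "(jet_vec i \<xi> :: real ^ 'n::finite) \<bullet> d_y j = (if i \<le> j then \<xi> ^ (j - i) / fact (j - i) else 0)"
proof -
  have "(jet_vec i \<xi> :: real ^ 'n) \<bullet> d_y j =
      (\<Sum>k = i..CARD('n) - 2. if k = j then \<xi> ^ (k - i) / fact (k - i) else 0)"
    unfolding jet_vec_def inner_sum_left using assms
    by (intro sum.cong) (auto simp: d_y_inner)
  then show ?thesis using assms by simp
qed

lemma jet_vec_inner_d_y0 [simp]:
  assumes "CARD('n) \<ge> 2"
  shows "(jet_vec 0 \<xi> :: real ^ 'n::finite) \<bullet> d_y 0 = 1"
  using jet_vec_inner_d_y[OF assms, of 0 0 \<xi>] by simp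

text \<open>This is the bracket relation of X_1 with X_(i+2): differentiation in x shifts the index,
  and past the last field the sum is empty.\<close>

lemma jet_vec_has_vector_derivative [derivative_intros]:
  "((jet_vec i :: real \<Rightarrow> real ^ 'n::finite) has_vector_derivative jet_vec (Suc i) \<xi>) (at \<xi> within S)"
proof -
  have d: "((\<lambda>\<xi>::real. \<xi> ^ (j - i) / fact (j - i)) has_real_derivative
      (if j = i then 0 else \<xi> ^ (j - Suc i) / fact (j - Suc i))) (at \<xi> within S)"
    if "i \<le> j" for j
  proof (cases "j = i")
    case False
    define k where "k = j - Suc i"
    have k: "j - i = Suc k" "j - Suc i = k" using that False by (auto simp: k_def)
    have "((\<lambda>\<xi>::real. \<xi> ^ Suc k / fact (Suc k)) has_real_derivative
        (1 + real k) * \<xi> ^ k / fact (Suc k)) (at \<xi> within S)"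
      using DERIV_cdivide[OF DERIV_pow[of "Suc k" \<xi> S], of "fact (Suc k)"] by simp
    moreover have "(1 + real k) * \<xi> ^ k / fact (Suc k) = \<xi> ^ k / fact k"
      by (simp add: divide_simps)
    ultimately show ?thesis using False by (simp only: k if_False)
  qed auto
  have "((jet_vec i :: real \<Rightarrow> real ^ 'n) has_vector_derivative
      (\<Sum>j = i..CARD('n) - 2. (if j = i then 0 else \<xi> ^ (j - Suc i) / fact (j - Suc i)) *\<^sub>R (d_y j :: real ^ 'n)))
      (at \<xi> within S)"
    unfolding jet_vec_def
    by (intro has_vector_derivative_sum has_vector_derivative_scaleR[OF d has_vector_derivative_const, simplified]) simp
  also have "(\<Sum>j = i..CARD('n) - 2. (if j = i then 0 else \<xi> ^ (j - Suc i) / fact (j - Suc i)) *\<^sub>R (d_y j :: real ^ 'n))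
     = jet_vec (Suc i) \<xi>"
    unfolding jet_vec_def by (rule sum.mono_neutral_cong_right) auto
  finally show ?thesis .
qed

lemma continuous_on_jet_vec [continuous_intros]:
  assumes "continuous_on S f"
  shows "continuous_on S (\<lambda>x. jet_vec i (f x))"
proof -
  have "continuous_on UNIV (jet_vec i :: real \<Rightarrow> real ^ 'n)"
    using jet_vec_has_vector_derivative
    by (intro continuous_at_imp_continuous_on ballI has_vector_derivative_continuous) blast
  from continuous_on_compose2[OF this assms] show ?thesis by simp
qed

lemma hor_iff:
  "v \<in> hor q \<longleftrightarrow> (\<exists>a b. v = a *\<^sub>R d_x + b *\<^sub>R jet_vec 0 (coord_x q))"
  unfolding hor_def jet_field_frame span_insert span_empty
  by (auto simp: algebra_simps)

lemma horI [intro]: "a *\<^sub>R d_x + b *\<^sub>R jet_vec 0 (coord_x q) \<in> hor q"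
  using hor_iff by blast

lemma frame_coeffs:
  assumes "CARD('n) \<ge> 2" and "v = a *\<^sub>R d_x + b *\<^sub>R (jet_vec 0 \<xi> :: real ^ 'n::finite)"
  shows "v \<bullet> d_x = a" "v \<bullet> d_y 0 = b"
  using assms d_x_inner_d_y[of 0, where 'n='n] by (auto simp: inner_add_left)

text \<open>X_2 has y_0-component 1 and no x-component, so Euclidean products with
  \<open>d_x\<close> and \<open>d_y 0\<close> read off both coefficients.\<close>

lemma hor_coeffs_eq:
  assumes "CARD('n) \<ge> 2" and "v \<in> hor (q :: real ^ 'n::finite)"
  shows "hor_coeffs q v = (v \<bullet> d_x, v \<bullet> d_y 0)"
proof -
  obtain a b where v: "v = a *\<^sub>R d_x + b *\<^sub>R jet_vec 0 (coord_x q)"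
    using assms(2) by (auto simp: hor_iff)
  show ?thesis
    unfolding hor_coeffs_def jet_field_frame
  proof (rule the_equality)
    show "v = fst (v \<bullet> d_x, v \<bullet> d_y 0) *\<^sub>R d_x + snd (v \<bullet> d_x, v \<bullet> d_y 0) *\<^sub>R jet_vec 0 (coord_x q)"
      using frame_coeffs[OF assms(1) v] v by simp
    show "u = (v \<bullet> d_x, v \<bullet> d_y 0)"
      if "v = fst u *\<^sub>R d_x + snd u *\<^sub>R jet_vec 0 (coord_x q)" for u
      using frame_coeffs[OF assms(1) that] by (simp add: prod_eq_iff)
  qed
qed

lemma sr_metric_eq:
  assumes "CARD('n) \<ge> 2" and "v \<in> hor (q :: real ^ 'n::finite)" "w \<in> hor q"
  shows "sr_metric q v w = (v \<bullet> d_x) * (w \<bullet> d_x) + (v \<bullet> d_y 0) * (w \<bullet> d_y 0)"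
  using assms by (simp add: sr_metric_def hor_coeffs_eq)

lemma sr_metric_frame:
  assumes "CARD('n) \<ge> 2"
  shows "sr_metric (q :: real ^ 'n::finite) (a *\<^sub>R d_x + b *\<^sub>R jet_vec 0 (coord_x q))
      (a' *\<^sub>R d_x + b' *\<^sub>R jet_vec 0 (coord_x q)) = a * a' + b * b'"
  using assms d_x_inner_d_y[of 0, where 'n='n]
  by (simp add: sr_metric_eq[OF assms horI horI] inner_add_left)

section \<open>Lengths of admissible curves\<close>

lemma AE_lebesgue_on_negligible:
  assumes "AE s in lebesgue_on S. P s" "S \<in> sets lebesgue"
  obtains N where "negligible N" "\<And>s. s \<in> S - N \<Longrightarrow> P s"
proof -
  have "AE s in lebesgue. s \<in> S \<longrightarrow> P s"
    using assms by (subst (asm) AE_restrict_space_iff) auto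
  then obtain N where "N \<in> null_sets lebesgue" "{s. \<not> (s \<in> S \<longrightarrow> P s)} \<subseteq> N"
    by (auto simp: eventually_ae_filter)
  then show ?thesis
    using that[of N] by (auto simp: negligible_iff_null_sets)
qed

lemma norm_vector_derivative_le_lipschitz:
  fixes c :: "real \<Rightarrow> 'a::real_normed_vector"
  assumes L: "L-lipschitz_on {a..b} c" and s: "a < s" "s < b"
    and der: "(c has_vector_derivative v) (at s)"
  shows "norm v \<le> L"
proof (rule field_le_epsilon)
  fix e :: real assume "e > 0"
  then obtain d where d: "d > 0" "\<And>y. norm (y - s) < d \<Longrightarrow> norm (c y - c s - (y - s) *\<^sub>R v) \<le> e * norm (y - s)"
    using der unfolding has_vector_derivative_def has_derivative_at_alt by blast
  define h where "h = min d (b - s) / 2"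
  have h: "h > 0" "h < d" "s + h \<le> b" using d(1) s by (auto simp: h_def min_def field_simps)
  have "h * norm v = norm (h *\<^sub>R v)" using h by simp
  also have "\<dots> \<le> norm (c (s + h) - c s) + norm (c (s + h) - c s - h *\<^sub>R v)"
    using norm_triangle_ineq4[of "c (s + h) - c s" "c (s + h) - c s - h *\<^sub>R v"] by simp
  also have "\<dots> \<le> L * h + e * h"
    using lipschitz_onD[OF L, of "s + h" s] d(2)[of "s + h"] h s by (intro add_mono) (auto simp: dist_norm)
  finally have "h * norm v \<le> h * (L + e)" by (simp add: algebra_simps)
  then show "norm v \<le> L + e" using h(1) by simp
qed

text \<open>The integral in \<open>sr_length\<close> has a default value when it does not exist, so
  the speed must be known to be integrable before any length can be bounded from below.\<close>

lemma admissible_curve_speed: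
  fixes c :: "real \<Rightarrow> real ^ 'n::finite"
  assumes n: "CARD('n) \<ge> 2" and adm: "admissible_curve a b c"
  shows "\<exists>N sp. negligible N \<and>
    (\<forall>s\<in>{a..b} - N. (c has_vector_derivative vector_derivative c (at s)) (at s) \<and>
      vector_derivative c (at s) \<in> hor (c s) \<and>
      sp s = sqrt ((vector_derivative c (at s) \<bullet> d_x)\<^sup>2 + (vector_derivative c (at s) \<bullet> d_y 0)\<^sup>2)) \<and>
    (\<forall>s. sp s \<ge> 0) \<and> (sp has_integral sr_length a b c) {a..b}"
proof -
  obtain L where L: "L-lipschitz_on {a..b} c" and ab: "a \<le> b"
    using adm by (auto simp: admissible_curve_def)
  have "AE s in lebesgue_on {a..b}. c differentiable (at s) \<and> vector_derivative c (at s) \<in> hor (c s)"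
    using adm by (simp add: admissible_curve_def)
  from AE_lebesgue_on_negligible[OF this] obtain N0 where N0: "negligible N0"
    "\<And>s. s \<in> {a..b} - N0 \<Longrightarrow> c differentiable (at s) \<and> vector_derivative c (at s) \<in> hor (c s)"
    by auto
  \<comment> \<open>The end points are discarded as well: at the remaining parameters, all interior,
    the Lipschitz constant bounds the derivative.\<close>
  define N where "N = N0 \<union> {a, b}"
  define c' where "c' s = (if s \<in> N then 0 else vector_derivative c (at s))" for s
  define sp where "sp s = sqrt ((c' s \<bullet> d_x)\<^sup>2 + (c' s \<bullet> d_y 0)\<^sup>2)" for s
  have N: "negligible N" using N0 by (simp add: N_def)
  have der: "(c has_vector_derivative c' s) (at s)" if "s \<in> {a..b} - N" for s
    using N0(2)[of s] that by (auto simp: c'_def N_def vector_derivative_works)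
  have I: "(c' has_integral c b - c a) {a..b}"
    using der by (intro has_integral_vector_derivative_lipschitz[OF L ab N])
      (auto intro: has_vector_derivative_at_within)
  have bound: "norm (c' s) \<le> L" if "s \<in> {a..b}" for s
  proof (cases "s \<in> N")
    case True
    then show ?thesis using lipschitz_on_nonneg[OF L] by (simp add: c'_def)
  next
    case False
    then have s: "a < s" "s < b" using that by (auto simp: N_def)
    show ?thesis
      using norm_vector_derivative_le_lipschitz[OF L s der[of s]] that False by simp
  qed
  \<comment> \<open>The derivative is integrable by the fundamental theorem and bounded by
    \<open>L\<close>, hence absolutely integrable; this passes to its linear image and makes the
    norm of that image integrable.\<close>
  have "c' absolutely_integrable_on {a..b}"
    using I bound by (intro absolutely_integrable_integrable_bound[where g="\<lambda>_. L"]) auto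
  then have "((\<lambda>v. (v \<bullet> d_x, v \<bullet> d_y 0)) \<circ> c') absolutely_integrable_on {a..b}"
    by (intro absolutely_integrable_linear bounded_linear_Pair bounded_linear_inner_left)
  then have "(\<lambda>s. norm (((\<lambda>v. (v \<bullet> d_x, v \<bullet> d_y 0)) \<circ> c') s)) integrable_on {a..b}"
    unfolding absolutely_integrable_on_def by blast
  then have "sp integrable_on {a..b}"
    by (simp add: sp_def[abs_def] norm_Pair)
  moreover have "integral {a..b} sp = sr_length a b c"
    unfolding sr_length_def
  proof (rule integral_spike[OF N])
    fix s assume s: "s \<in> {a..b} - N"
    then have "vector_derivative c (at s) \<in> hor (c s)" using N0(2)[of s] by (auto simp: N_def)
    then show "sqrt (sr_metric (c s) (vector_derivative c (at s)) (vector_derivative c (at s))) = sp s"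
      using s by (simp add: sr_metric_eq[OF n] sp_def c'_def power2_eq_square)
  qed
  ultimately have "(sp has_integral sr_length a b c) {a..b}"
    by (simp add: has_integral_iff)
  then show ?thesis
    using N der N0(2) by (intro exI[of _ N] exI[of _ sp]) (auto simp: sp_def c'_def N_def)
qed

text \<open>A calibration: integrating the differential of \<open>g\<close> along the curve bounds
  its increment by the integral of the speed. The estimate stops at an arbitrary parameter
  \<open>r\<close> so that it can be applied where a curve is outside a strip, before its
  end.\<close>

lemma sr_length_ge_calibration:
  fixes c :: "real \<Rightarrow> real ^ 'n::finite" and g :: "real ^ 'n \<Rightarrow> real"
  assumes n: "CARD('n) \<ge> 2" and adm: "admissible_curve a b c" and r: "r \<in> {a..b}"
    and der: "\<And>s. s \<in> {a..r} \<Longrightarrow> (g has_derivative G (c s)) (at (c s))"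
    and lip: "M-lipschitz_on {a..r} (\<lambda>s. g (c s))"
    and le: "\<And>s u v. s \<in> {a..r} \<Longrightarrow>
      G (c s) (u *\<^sub>R d_x + v *\<^sub>R jet_vec 0 (coord_x (c s))) \<le> sqrt (u\<^sup>2 + v\<^sup>2)"
  shows "g (c r) - g (c a) \<le> sr_length a b c"
proof -
  obtain N sp where N: "negligible N"
    and c': "\<And>s. s \<in> {a..b} - N \<Longrightarrow> (c has_vector_derivative vector_derivative c (at s)) (at s)"
    and hor: "\<And>s. s \<in> {a..b} - N \<Longrightarrow> vector_derivative c (at s) \<in> hor (c s)"
    and sp: "\<And>s. s \<in> {a..b} - N \<Longrightarrow> sp s = sqrt ((vector_derivative c (at s) \<bullet> d_x)\<^sup>2 + (vector_derivative c (at s) \<bullet> d_y 0)\<^sup>2)"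
    and sp0: "\<And>s. sp s \<ge> 0" and I: "(sp has_integral sr_length a b c) {a..b}"
    using admissible_curve_speed[OF n adm] by blast
  define f where "f s = (if s \<in> N then 0 else G (c s) (vector_derivative c (at s)))" for s
  have "(f has_integral g (c r) - g (c a)) {a..r}"
  proof (rule has_integral_vector_derivative_lipschitz[OF lip _ N])
    show "a \<le> r" using r by simp
    fix s assume s: "s \<in> {a..r} - N"
    then have s': "s \<in> {a..b} - N" using r by auto
    have "((g \<circ> c) has_derivative G (c s) \<circ> (\<lambda>h. h *\<^sub>R vector_derivative c (at s))) (at s)"
      using c'[OF s'] der[of s] s by (intro diff_chain_at) (auto simp: has_vector_derivative_def)
    moreover have "linear (G (c s))"
      using der[of s] s has_derivative_linear by blast
    ultimately have "((\<lambda>s. g (c s)) has_vector_derivative f s) (at s)"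
      using s by (simp add: has_vector_derivative_def o_def f_def linear_cmul)
    then show "((\<lambda>s. g (c s)) has_vector_derivative f s) (at s within {a..r})"
      by (rule has_vector_derivative_at_within)
  qed
  moreover have I': "sp integrable_on {a..r}"
    using I r by (auto simp: has_integral_iff intro: integrable_subinterval_real[of sp a b a r])
  moreover have "f s \<le> sp s" if "s \<in> {a..r}" for s
  proof (cases "s \<in> N")
    case True
    then show ?thesis using sp0 by (simp add: f_def)
  next
    case False
    then have s: "s \<in> {a..b} - N" using that r by auto
    obtain u v where uv: "vector_derivative c (at s) = u *\<^sub>R d_x + v *\<^sub>R jet_vec 0 (coord_x (c s))"
      using hor[OF s] by (auto simp: hor_iff)
    then show ?thesis
      using le[OF that, of u v] False sp[OF s] frame_coeffs[OF n uv] by (simp add: f_def)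
  qed
  ultimately have "g (c r) - g (c a) \<le> integral {a..r} sp"
    by (metis has_integral_le has_integral_integral)
  also have "\<dots> \<le> integral {a..b} sp"
    using I I' sp0 r by (intro integral_subset_le) (auto simp: has_integral_iff)
  also have "\<dots> = sr_length a b c"
    using I by (simp add: has_integral_iff)
  finally show ?thesis .
qed

text \<open>Both x and -x are calibrations, since the x-component of a horizontal vector is its
  X_1-coefficient.\<close>

lemma coord_x_le_sr_length:
  fixes c :: "real \<Rightarrow> real ^ 'n::finite"
  assumes n: "CARD('n) \<ge> 2" and adm: "admissible_curve a b c" and r: "r \<in> {a..b}"
  shows "\<bar>coord_x (c r) - coord_x (c a)\<bar> \<le> sr_length a b c"
proof -
  obtain L where L: "L-lipschitz_on {a..b} c" using adm by (auto simp: admissible_curve_def)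
  have *: "k * coord_x (c r) - k * coord_x (c a) \<le> sr_length a b c" if "\<bar>k\<bar> = 1" for k
  proof (rule sr_length_ge_calibration[OF n adm r, where G="\<lambda>_ v. k * coord_x v" and M=L])
    show "L-lipschitz_on {a..r} (\<lambda>s. k * coord_x (c s))"
    proof (rule lipschitz_onI)
      show "0 \<le> L" using L by (rule lipschitz_on_nonneg)
      fix s s' assume s: "s \<in> {a..r}" "s' \<in> {a..r}"
      have "\<bar>k * coord_x (c s) - k * coord_x (c s')\<bar> = \<bar>coord_x (c s - c s')\<bar>"
        using that by (simp add: right_diff_distrib[symmetric] abs_mult)
      also have "\<dots> \<le> norm (c s - c s')"
        unfolding coord_x_def by (rule component_le_norm_cart)
      also have "\<dots> \<le> L * dist s s'"
        using lipschitz_onD[OF L, of s s'] s r by (auto simp: dist_norm)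
      finally show "dist (k * coord_x (c s)) (k * coord_x (c s')) \<le> L * dist s s'"
        by (simp add: dist_real_def)
    qed
    fix s u v
    have "k * u \<le> \<bar>u\<bar>" using that by (metis abs_ge_self abs_mult mult_1)
    also have "\<dots> \<le> sqrt (u\<^sup>2 + v\<^sup>2)" by (simp add: real_sqrt_sum_squares_ge1)
    finally show "k * coord_x (u *\<^sub>R d_x + v *\<^sub>R jet_vec 0 (coord_x (c s)) :: real ^ 'n) \<le> sqrt (u\<^sup>2 + v\<^sup>2)"
      using n by simp
    show "((\<lambda>v. k * coord_x v) has_derivative (\<lambda>v. k * coord_x v)) (at (c s))" for s
      by (intro bounded_linear_imp_has_derivative bounded_linear_mult_const bounded_linear_coord_x
          bounded_linear_const_mult)
  qed
  show ?thesis using *[of 1] *[of "-1"] by simp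
qed

section \<open>Integrals over a variable segment\<close>

text \<open>The oriented integral of \<open>\<lambda>\<xi>. \<theta> (q, \<xi>)\<close> from
  \<open>a\<close> to \<open>b\<close> at z = (q, a, b). Rescaling to [0,1] turns the limits into
  parameters of the integrand, on the same footing as \<open>q\<close>, and allows b < a.\<close>

definition segment_integral ::
  "('q \<times> real \<Rightarrow> 'b::euclidean_space) \<Rightarrow> 'q \<times> real \<times> real \<Rightarrow> 'b" where
  "segment_integral \<theta> z = integral {0..1} (\<lambda>r. (snd (snd z) - fst (snd z)) *\<^sub>R
     \<theta> (fst z, fst (snd z) + r * (snd (snd z) - fst (snd z))))"

locale C1_family =
  fixes W :: "'q::euclidean_space set" and I :: "real set"
    and \<theta> :: "'q \<times> real \<Rightarrow> 'b::euclidean_space" and \<theta>' :: "'q \<times> real \<Rightarrow> 'q \<times> real \<Rightarrow> 'b"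
  assumes open_W: "open W" and convex_W: "convex W" and open_I: "open I" and convex_I: "convex I"
    and deriv: "\<And>z. z \<in> W \<times> I \<Longrightarrow> (\<theta> has_derivative \<theta>' z) (at z)"
    and cont_deriv: "\<And>v. continuous_on (W \<times> I) (\<lambda>z. \<theta>' z v)"
begin

lemma in_segment:
  assumes "a \<in> I" "b \<in> I" "r \<in> {0..1}"
  shows "a + r * (b - a) \<in> I"
proof -
  have "(1 - r) *\<^sub>R a + r *\<^sub>R b \<in> I"
    using assms by (intro convexD[OF convex_I]) auto
  then show ?thesis by (simp add: algebra_simps)
qed

lemma cont: "continuous_on (W \<times> I) \<theta>"
  using deriv by (meson continuous_at_imp_continuous_on has_derivative_continuous)

lemma linear_deriv: "z \<in> W \<times> I \<Longrightarrow> bounded_linear (\<theta>' z)"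
  using deriv has_derivative_bounded_linear by blast

lemma segment_integrable:
  assumes "q \<in> W" "a \<in> I" "b \<in> I"
  shows "(\<lambda>r. c *\<^sub>R \<theta> (q, a + r * (b - a))) integrable_on {0..1}"
  by (intro integrable_continuous_real continuous_intros continuous_on_compose2[OF cont])
    (use assms in_segment in auto)

lemma continuous_on_segment_deriv:
  "continuous_on (W \<times> I \<times> I) (\<lambda>z. integral {0..1} (\<lambda>r. (snd (snd z) - fst (snd z)) *\<^sub>R
     \<theta>' (fst z, fst (snd z) + r * (snd (snd z) - fst (snd z))) v))"
proof -
  have "continuous_on ((W \<times> I \<times> I) \<times> cbox 0 1) (\<lambda>(z, r). (snd (snd z) - fst (snd z)) *\<^sub>R
     \<theta>' (fst z, fst (snd z) + r * (snd (snd z) - fst (snd z))) v)"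
    unfolding split_def
    by (intro continuous_intros continuous_on_compose2[OF cont_deriv])
      (use in_segment in auto)
  from integral_continuous_on_param[OF this] show ?thesis by simp
qed

text \<open>Moving the limits changes the rescaled integrand by the r-derivative of
  \<open>(da + r * (db - da)) *\<^sub>R \<theta> (q, a + r * (b - a))\<close>, so its integral
  collapses to boundary terms.\<close>

lemma segment_total_derivative:
  assumes q: "q \<in> W" and a: "a \<in> I" and b: "b \<in> I"
  shows "((\<lambda>r. (db - da) *\<^sub>R \<theta> (q, a + r * (b - a)) +
      (b - a) *\<^sub>R \<theta>' (q, a + r * (b - a)) (0, da + r * (db - da)))
    has_integral db *\<^sub>R \<theta> (q, b) - da *\<^sub>R \<theta> (q, a)) {0..1}"
proof -
  have "((\<lambda>r. (db - da) *\<^sub>R \<theta> (q, a + r * (b - a)) +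
      (b - a) *\<^sub>R \<theta>' (q, a + r * (b - a)) (0, da + r * (db - da)))
    has_integral (da + 1 * (db - da)) *\<^sub>R \<theta> (q, a + 1 * (b - a)) - (da + 0 * (db - da)) *\<^sub>R \<theta> (q, a + 0 * (b - a)))
    {0..1}"
  proof (rule fundamental_theorem_of_calculus)
    fix r :: real assume r: "r \<in> {0..1}"
    have z: "(q, a + r * (b - a)) \<in> W \<times> I" using q in_segment[OF a b r] by simp
    have 1: "((\<lambda>r. \<theta> (q, a + r * (b - a))) has_vector_derivative \<theta>' (q, a + r * (b - a)) (0, b - a))
        (at r within {0..1})"
    proof -
      have "((\<lambda>r. (q, a + r * (b - a))) has_vector_derivative (0, b - a)) (at r within {0..1})"
        by (auto intro!: derivative_eq_intros)
      from vector_derivative_diff_chain_within[OF this has_derivative_at_withinI[OF deriv[OF z]]]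
      show ?thesis by (simp add: o_def)
    qed
    have lin: "linear (\<theta>' (q, a + r * (b - a)))"
      using linear_deriv[OF z] bounded_linear.linear by blast
    have cmul: "\<theta>' (q, a + r * (b - a)) (0, k) = k *\<^sub>R \<theta>' (q, a + r * (b - a)) (0, 1)" for k
      using linear_cmul[OF lin, of k "(0, 1)"] by simp
    have eq: "(da + r * (db - da)) *\<^sub>R \<theta>' (q, a + r * (b - a)) (0, b - a)
       = (b - a) *\<^sub>R \<theta>' (q, a + r * (b - a)) (0, da + r * (db - da))"
      unfolding cmul[of "b - a"] cmul[of "da + r * (db - da)"] by (simp add: mult.commute)
    have "((\<lambda>r. (da + r * (db - da)) *\<^sub>R \<theta> (q, a + r * (b - a))) has_vector_derivative
        (da + r * (db - da)) *\<^sub>R \<theta>' (q, a + r * (b - a)) (0, b - a) + (db - da) *\<^sub>R \<theta> (q, a + r * (b - a)))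
        (at r within {0..1})"
      by (rule has_vector_derivative_scaleR[OF _ 1]) (auto intro!: derivative_eq_intros)
    then show "((\<lambda>r. (da + r * (db - da)) *\<^sub>R \<theta> (q, a + r * (b - a))) has_vector_derivative
        (db - da) *\<^sub>R \<theta> (q, a + r * (b - a)) +
      (b - a) *\<^sub>R \<theta>' (q, a + r * (b - a)) (0, da + r * (db - da))) (at r within {0..1})"
      unfolding eq by (simp add: add.commute)
  qed simp
  then show ?thesis by simp
qed

text \<open>Differentiation under the integral sign in all three parameters at once; the part
  belonging to the limits is then evaluated as a total derivative.\<close>

lemma segment_integral_has_derivative:
  assumes q: "q \<in> W" and a: "a \<in> I" and b: "b \<in> I"
  shows "(segment_integral \<theta> has_derivative (\<lambda>(dq, da, db).
      integral {0..1} (\<lambda>r. (b - a) *\<^sub>R \<theta>' (q, a + r * (b - a)) (dq, 0)) + db *\<^sub>R \<theta> (q, b) - da *\<^sub>R \<theta> (q, a)))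
    (at (q, a, b))"
proof -
  define f where "f z r = (snd (snd z) - fst (snd z)) *\<^sub>R
     \<theta> (fst z, fst (snd z) + r * (snd (snd z) - fst (snd z)))" for z :: "'q \<times> real \<times> real" and r
  define f' where "f' z r v = (snd (snd v) - fst (snd v)) *\<^sub>R
       \<theta> (fst z, fst (snd z) + r * (snd (snd z) - fst (snd z)))
     + (snd (snd z) - fst (snd z)) *\<^sub>R \<theta>' (fst z, fst (snd z) + r * (snd (snd z) - fst (snd z)))
         (fst v, fst (snd v) + r * (snd (snd v) - fst (snd v)))" for z v :: "'q \<times> real \<times> real" and r
  have W: "open (W \<times> I \<times> I)" "convex (W \<times> I \<times> I)" "(q, a, b) \<in> W \<times> I \<times> I"
    using open_W open_I convex_W convex_I assms by (auto intro!: open_Times convex_Times)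
  have der: "((\<lambda>z. f z r) has_derivative f' z r) (at z within S)"
    if z: "z \<in> W \<times> I \<times> I" and r: "r \<in> {0..1}" for z r S
  proof -
    have zz: "(fst z, fst (snd z) + r * (snd (snd z) - fst (snd z))) \<in> W \<times> I"
      using z in_segment[OF _ _ r] by auto
    define k where "k z = (fst z, fst (snd z) + r * (snd (snd z) - fst (snd z)))" for z :: "'q \<times> real \<times> real"
    have "bounded_linear k"
      unfolding k_def by (intro bounded_linear_intros)
    then have "(k has_derivative k) (at z within S)"
      by (rule bounded_linear_imp_has_derivative)
    then have 1: "((\<lambda>z. \<theta> (k z)) has_derivative (\<lambda>v. \<theta>' (k z) (k v))) (at z within S)"
      using deriv[of "k z"] zz has_derivative_compose[of k k z S \<theta> "\<theta>' (k z)"] by (simp add: k_def)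
    have 2: "((\<lambda>z :: 'q \<times> real \<times> real. snd (snd z) - fst (snd z)) has_derivative (\<lambda>v. snd (snd v) - fst (snd v)))
        (at z within S)"
      by (intro derivative_intros)
    show ?thesis
      using has_derivative_scaleR[OF 2 1] by (simp add: f_def[abs_def] f'_def[abs_def] k_def add.commute)
  qed
  have bl: "blinfun_apply (Blinfun (f' z r)) = f' z r" if "z \<in> W \<times> I \<times> I" "r \<in> {0..1}" for z r
    using der[OF that] has_derivative_bounded_linear bounded_linear_Blinfun_apply by blast
  have cont: "continuous_on ((W \<times> I \<times> I) \<times> cbox 0 1) (\<lambda>(z, r). Blinfun (f' z r))"
  proof (rule continuous_on_blinfun_componentwise)
    fix i :: "'q \<times> real \<times> real"
    have "continuous_on ((W \<times> I \<times> I) \<times> cbox 0 1) (\<lambda>(z, r). f' z r i)"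
    proof -
      \<comment> \<open>The direction in which \<open>\<theta>'\<close> is evaluated varies with r,
        while its continuity is assumed for fixed directions; linearity splits it into fixed
        ones.\<close>
      have lin: "\<theta>' z (fst i, fst (snd i) + r * k) = \<theta>' z (fst i, fst (snd i)) + r *\<^sub>R \<theta>' z (0, k)"
        if "z \<in> W \<times> I" for z r k
        using linear_deriv[OF that, THEN bounded_linear.linear]
          linear_add[of "\<theta>' z" "(fst i, fst (snd i))" "(0, r * k)"]
          linear_cmul[of "\<theta>' z" r "(0, k)"] by simp
      have "continuous_on ((W \<times> I \<times> I) \<times> cbox 0 1) (\<lambda>(z, r). (snd (snd i) - fst (snd i)) *\<^sub>R
         \<theta> (fst z, fst (snd z) + r * (snd (snd z) - fst (snd z)))
       + (snd (snd z) - fst (snd z)) *\<^sub>R (\<theta>' (fst z, fst (snd z) + r * (snd (snd z) - fst (snd z)))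
           (fst i, fst (snd i)) + r *\<^sub>R \<theta>' (fst z, fst (snd z) + r * (snd (snd z) - fst (snd z)))
             (0, snd (snd i) - fst (snd i))))"
        unfolding split_def
        by (intro continuous_intros continuous_on_compose2[OF cont_deriv] continuous_on_compose2[OF local.cont])
          (use in_segment in auto)
      then show ?thesis
        by (rule continuous_on_eq) (use in_segment in \<open>auto simp: f'_def lin\<close>)
    qed
    then show "continuous_on ((W \<times> I \<times> I) \<times> cbox 0 1) (\<lambda>x. blinfun_apply (case x of (z, r) \<Rightarrow> Blinfun (f' z r)) i)"
      by (rule continuous_on_eq) (auto simp: bl)
  qed
  have int_f: "f z integrable_on cbox 0 1" if "z \<in> W \<times> I \<times> I" for z
    unfolding f_def using that segment_integrable by auto
  have "((\<lambda>z. integral (cbox 0 1) (f z)) has_derivative integral (cbox 0 1) (\<lambda>r. Blinfun (f' (q, a, b) r)))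
      (at (q, a, b) within W \<times> I \<times> I)"
    by (rule leibniz_rule[OF _ int_f cont W(3,2)]) (use der bl in auto)
  moreover have "blinfun_apply (integral (cbox 0 1) (\<lambda>r. Blinfun (f' (q, a, b) r))) =
     (\<lambda>(dq, da, db).
      integral {0..1} (\<lambda>r. (b - a) *\<^sub>R \<theta>' (q, a + r * (b - a)) (dq, 0)) + db *\<^sub>R \<theta> (q, b) - da *\<^sub>R \<theta> (q, a))"
  proof (rule ext, clarify)
    fix dq da db
    have "continuous_on (cbox 0 1) (\<lambda>r. ((q, a, b), r :: real))"
      by (intro continuous_intros)
    then have "continuous_on (cbox 0 1) (\<lambda>r. Blinfun (f' (q, a, b) r))"
      using continuous_on_compose2[OF cont, of "cbox 0 1" "\<lambda>r. ((q, a, b), r)"] W(3) by auto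
    then have "blinfun_apply (integral (cbox 0 1) (\<lambda>r. Blinfun (f' (q, a, b) r))) (dq, da, db)
        = integral (cbox 0 1) (\<lambda>r. blinfun_apply (Blinfun (f' (q, a, b) r)) (dq, da, db))"
      by (intro blinfun_apply_integral integrable_continuous)
    also have "\<dots> = integral {0..1} (\<lambda>r. (b - a) *\<^sub>R \<theta>' (q, a + r * (b - a)) (dq, 0) +
       ((db - da) *\<^sub>R \<theta> (q, a + r * (b - a)) +
      (b - a) *\<^sub>R \<theta>' (q, a + r * (b - a)) (0, da + r * (db - da))))"
      unfolding box_real
    proof (rule integral_cong)
      fix r :: real assume r: "r \<in> {0..1}"
      have z: "(q, a + r * (b - a)) \<in> W \<times> I" using q in_segment[OF a b r] by simp
      have "\<theta>' (q, a + r * (b - a)) (dq, da + r * (db - da))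
          = \<theta>' (q, a + r * (b - a)) (dq, 0) + \<theta>' (q, a + r * (b - a)) (0, da + r * (db - da))"
        using linear_add[OF linear_deriv[OF z, THEN bounded_linear.linear], of "(dq, 0)" "(0, da + r * (db - da))"]
        by simp
      then show "blinfun_apply (Blinfun (f' (q, a, b) r)) (dq, da, db) = (b - a) *\<^sub>R \<theta>' (q, a + r * (b - a)) (dq, 0) +
       ((db - da) *\<^sub>R \<theta> (q, a + r * (b - a)) +
      (b - a) *\<^sub>R \<theta>' (q, a + r * (b - a)) (0, da + r * (db - da)))"
        using bl[OF W(3) r] by (simp add: f'_def scaleR_add_right)
    qed
    also have "\<dots> = integral {0..1} (\<lambda>r. (b - a) *\<^sub>R \<theta>' (q, a + r * (b - a)) (dq, 0)) +
       (db *\<^sub>R \<theta> (q, b) - da *\<^sub>R \<theta> (q, a))"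
    proof -
      have "(\<lambda>r. (b - a) *\<^sub>R \<theta>' (q, a + r * (b - a)) (dq, 0)) integrable_on {0..1}"
        by (intro integrable_continuous_real continuous_intros continuous_on_compose2[OF cont_deriv])
          (use assms in_segment in auto)
      with segment_total_derivative[OF q a b, of db da] show ?thesis
        by (subst integral_add) (auto simp: has_integral_iff)
    qed
    finally show "blinfun_apply (integral (cbox 0 1) (\<lambda>r. Blinfun (f' (q, a, b) r))) (dq, da, db) =
      integral {0..1} (\<lambda>r. (b - a) *\<^sub>R \<theta>' (q, a + r * (b - a)) (dq, 0)) + db *\<^sub>R \<theta> (q, b) - da *\<^sub>R \<theta> (q, a)"
      by simp
  qed
  moreover have "segment_integral \<theta> = (\<lambda>z. integral (cbox 0 1) (f z))"
    by (simp add: fun_eq_iff segment_integral_def f_def[abs_def])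
  ultimately show ?thesis
    using W by (simp add: at_within_open[OF W(3,1)])
qed

end

section \<open>Horizontal graphs and their calibrations\<close>

text \<open>
  The covector \<open>q\<close>, scaled to unit energy, determines the graphs with velocity \<open>graph_vel \<sigma> (q, \<xi>)\<close> over the
  \<open>x\<close>-axis; followed in the direction \<open>\<sigma> = \<plusminus>1\<close>, their unit velocity has the coefficients
  \<open>\<sigma> * graph_root (q, \<xi>)\<close> and \<open>graph_slope (q, \<xi>)\<close> in the frame \<open>X\<^sub>1, X\<^sub>2\<close>.
\<close>

definition graph_slope :: "(real ^ 'n::finite) \<times> real \<Rightarrow> real" where
  "graph_slope z = fst z \<bullet> jet_vec 0 (snd z)"

definition graph_root :: "(real ^ 'n::finite) \<times> real \<Rightarrow> real" where
  "graph_root z = sqrt (1 - (graph_slope z)\<^sup>2)"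

definition graph_vel :: "real \<Rightarrow> (real ^ 'n::finite) \<times> real \<Rightarrow> real ^ 'n" where
  "graph_vel \<sigma> z = d_x + (\<sigma> * graph_slope z / graph_root z) *\<^sub>R jet_vec 0 (snd z)"

definition graph_slope' :: "(real ^ 'n::finite) \<times> real \<Rightarrow> (real ^ 'n) \<times> real \<Rightarrow> real" where
  "graph_slope' z v = fst v \<bullet> jet_vec 0 (snd z) + snd v * (fst z \<bullet> jet_vec 1 (snd z))"

definition graph_root' :: "(real ^ 'n::finite) \<times> real \<Rightarrow> (real ^ 'n) \<times> real \<Rightarrow> real" where
  "graph_root' z v = - (graph_slope z / graph_root z * graph_slope' z v)"

definition graph_vel' :: "real \<Rightarrow> (real ^ 'n::finite) \<times> real \<Rightarrow> (real ^ 'n) \<times> real \<Rightarrow> real ^ 'n" where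
  "graph_vel' \<sigma> z v = (\<sigma> * graph_slope' z v / graph_root z ^ 3) *\<^sub>R jet_vec 0 (snd z) +
     (\<sigma> * graph_slope z / graph_root z * snd v) *\<^sub>R jet_vec 1 (snd z)"

lemma graph_slope_has_derivative: "(graph_slope has_derivative graph_slope' z) (at z)"
proof -
  have "(jet_vec 0 has_derivative (\<lambda>h. h *\<^sub>R jet_vec (Suc 0) (snd z))) (at (snd z))"
    using jet_vec_has_vector_derivative by (auto simp: has_vector_derivative_def)
  then have "((\<lambda>z :: (real ^ 'a) \<times> real. jet_vec 0 (snd z)) has_derivative
      (\<lambda>v. snd v *\<^sub>R jet_vec 1 (snd z))) (at z)"
    using has_derivative_compose[OF has_derivative_snd[OF has_derivative_ident]] by fastforce
  from has_derivative_inner[OF has_derivative_fst[OF has_derivative_ident] this]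
  show ?thesis
    unfolding graph_slope_def[abs_def] graph_slope'_def[abs_def] by (simp add: add.commute)
qed

lemma continuous_on_graph_slope [continuous_intros]:
  "continuous_on S f \<Longrightarrow> continuous_on S (\<lambda>x. graph_slope (f x))"
  unfolding graph_slope_def by (intro continuous_intros)

lemma continuous_on_graph_slope' [continuous_intros]:
  "continuous_on S f \<Longrightarrow> continuous_on S (\<lambda>x. graph_slope' (f x) v)"
  unfolding graph_slope'_def by (intro continuous_intros)

lemma continuous_on_graph_root [continuous_intros]:
  "continuous_on S f \<Longrightarrow> continuous_on S (\<lambda>x. graph_root (f x))"
  unfolding graph_root_def by (intro continuous_intros)

lemma graph_root_pos: "\<bar>graph_slope z\<bar> < 1 \<Longrightarrow> graph_root z > 0"
  by (simp add: graph_root_def abs_square_less_1)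

lemma graph_root_square: "\<bar>graph_slope z\<bar> < 1 \<Longrightarrow> (graph_root z)\<^sup>2 = 1 - (graph_slope z)\<^sup>2"
  by (simp add: graph_root_def abs_square_less_1 less_imp_le)

lemma graph_root_has_derivative:
  assumes "\<bar>graph_slope z\<bar> < 1"
  shows "(graph_root has_derivative graph_root' z) (at z)"
proof -
  have "0 < 1 - (graph_slope z)\<^sup>2" using assms by (simp add: abs_square_less_1)
  then show ?thesis
    unfolding graph_root_def[abs_def]
    by (auto intro!: derivative_eq_intros graph_slope_has_derivative
        simp: graph_root'_def graph_root_def fun_eq_iff field_simps)
qed

text \<open>The weight originates here: the derivative of s / sqrt (1 - s^2) is (1 - s^2)^(-3/2),
  that is, the inverse cube of \<open>graph_root\<close>.\<close>

lemma graph_vel_has_derivative: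
  assumes "\<bar>graph_slope z\<bar> < 1"
  shows "(graph_vel \<sigma> has_derivative graph_vel' \<sigma> z) (at z)"
proof -
  have pos: "graph_root z > 0" using assms by (rule graph_root_pos)
  have "((\<lambda>z. \<sigma> * graph_slope z / graph_root z) has_derivative (\<lambda>v. \<sigma> * graph_slope' z v / graph_root z ^ 3)) (at z)"
  proof (rule has_derivative_eq_rhs)
    show "((\<lambda>z. \<sigma> * graph_slope z / graph_root z) has_derivative
      (\<lambda>v. (\<sigma> * graph_slope' z v * graph_root z - \<sigma> * graph_slope z * graph_root' z v) / (graph_root z * graph_root z))) (at z)"
      using pos by (intro derivative_intros graph_slope_has_derivative graph_root_has_derivative assms) auto
    have "\<sigma> * graph_slope' z v * graph_root z - \<sigma> * graph_slope z * graph_root' z v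
      = \<sigma> * graph_slope' z v * ((graph_root z)\<^sup>2 + (graph_slope z)\<^sup>2) / graph_root z" for v
      using pos by (simp add: graph_root'_def field_simps power2_eq_square)
    then have "\<sigma> * graph_slope' z v * graph_root z - \<sigma> * graph_slope z * graph_root' z v
      = \<sigma> * graph_slope' z v / graph_root z" for v
      by (simp add: graph_root_square[OF assms])
    then show "(\<lambda>v. (\<sigma> * graph_slope' z v * graph_root z - \<sigma> * graph_slope z * graph_root' z v) / (graph_root z * graph_root z))
      = (\<lambda>v. \<sigma> * graph_slope' z v / graph_root z ^ 3)"
      by (simp add: power3_eq_cube mult.assoc)
  qed
  moreover have "((\<lambda>z :: (real ^ 'a) \<times> real. jet_vec 0 (snd z)) has_derivative
      (\<lambda>v. snd v *\<^sub>R jet_vec 1 (snd z))) (at z)"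
  proof -
    have "(jet_vec 0 has_derivative (\<lambda>h. h *\<^sub>R jet_vec (Suc 0) (snd z))) (at (snd z))"
      using jet_vec_has_vector_derivative by (auto simp: has_vector_derivative_def)
    then show ?thesis
      using has_derivative_compose[OF has_derivative_snd[OF has_derivative_ident]] by fastforce
  qed
  ultimately have "((\<lambda>z. d_x + (\<sigma> * graph_slope z / graph_root z) *\<^sub>R jet_vec 0 (snd z)) has_derivative
     (\<lambda>v. 0 + ((\<sigma> * graph_slope z / graph_root z) *\<^sub>R (snd v *\<^sub>R jet_vec 1 (snd z)) +
       (\<sigma> * graph_slope' z v / graph_root z ^ 3) *\<^sub>R jet_vec 0 (snd z)))) (at z)"
    by (intro has_derivative_add has_derivative_const has_derivative_scaleR)
  then show ?thesis
    by (simp add: graph_vel_def[abs_def] graph_vel'_def[abs_def] add.commute)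
qed

locale slope_strip =
  fixes W :: "(real ^ 'n::finite) set" and I :: "real set" and \<sigma> :: real
  assumes n: "CARD('n) \<ge> 2"
    and open_W: "open W" and convex_W: "convex W" and open_I: "open I" and convex_I: "convex I"
    and slope_less: "\<And>q \<xi>. q \<in> W \<Longrightarrow> \<xi> \<in> I \<Longrightarrow> \<bar>graph_slope (q, \<xi>)\<bar> < 1"
    and sigma: "\<sigma>\<^sup>2 = 1"
begin

sublocale root: C1_family W I graph_root graph_root'
proof
  show "continuous_on (W \<times> I) (\<lambda>z. graph_root' z v)" for v
    unfolding graph_root'_def using slope_less graph_root_pos
    by (intro continuous_intros) (force dest: graph_root_pos)
qed (use open_W convex_W open_I convex_I slope_less graph_root_has_derivative in auto)

sublocale vel: C1_family W I "graph_vel \<sigma>" "graph_vel' \<sigma>"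
proof
  show "continuous_on (W \<times> I) (\<lambda>z. graph_vel' \<sigma> z v)" for v
    unfolding graph_vel'_def using slope_less graph_root_pos
    by (intro continuous_intros) (force dest: graph_root_pos)+
qed (use open_W convex_W open_I convex_I slope_less in \<open>auto intro!: graph_vel_has_derivative\<close>)

lemma sigma_cases: "\<sigma> = 1 \<or> \<sigma> = -1" and abs_sigma [simp]: "\<bar>\<sigma>\<bar> = 1"
  using sigma by (auto simp: power2_eq_1_iff)

text \<open>The increment from \<open>a\<close> to \<open>b\<close> of a solution of the eikonal
  equation with constant y-momenta. Its differential has the values
  \<open>\<sigma> * graph_root\<close> on X_1 and \<open>graph_slope\<close> on X_2, whose squares
  add up to 1; the x-component of \<open>q\<close> is removed because it is not a momentum.\<close>

definition action :: "real ^ 'n \<Rightarrow> real ^ 'n \<Rightarrow> real ^ 'n \<Rightarrow> real" where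
  "action q a b = q \<bullet> (b - a) - coord_x q * coord_x (b - a)
     + \<sigma> * segment_integral graph_root (q, coord_x a, coord_x b)"

lemma coord_x_graph_vel [simp]: "coord_x (graph_vel \<sigma> z :: real ^ 'n) = 1"
  using n by (simp add: graph_vel_def)

lemma inner_graph_vel: "(q :: real ^ 'n) \<bullet> graph_vel \<sigma> (q, \<xi>) = coord_x q + \<sigma> * (graph_slope (q, \<xi>))\<^sup>2 / graph_root (q, \<xi>)"
  by (simp add: graph_vel_def inner_add_right coord_x_inner graph_slope_def power2_eq_square)

lemma coord_x_segment_vel:
  assumes "q \<in> W" "a \<in> I" "b \<in> I"
  shows "coord_x (segment_integral (graph_vel \<sigma>) (q, a, b)) = b - a"
  using integral_linear[OF vel.segment_integrable[OF assms, of "b - a"] bounded_linear_coord_x]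
  by (simp add: segment_integral_def o_def)

text \<open>Along the connecting graph the momentum term contributes slope^2 / root. Together with
  root this makes 1 / root, the speed of the graph over the x-axis.\<close>

lemma action_eq:
  assumes q: "q \<in> W" and a: "coord_x a \<in> I" and b: "coord_x b \<in> I"
    and ab: "b - a = segment_integral (graph_vel \<sigma>) (q, coord_x a, coord_x b)"
  shows "action q a b = integral {0..1} (\<lambda>r. \<sigma> * (coord_x b - coord_x a) /
     graph_root (q, coord_x a + r * (coord_x b - coord_x a)))"
proof -
  let ?\<xi> = "\<lambda>r. coord_x a + r * (coord_x b - coord_x a)"
  let ?d = "coord_x b - coord_x a"
  have less: "\<bar>graph_slope (q, ?\<xi> r)\<bar> < 1" if "r \<in> {0..1}" for r
    using slope_less q root.in_segment[OF a b that] by blast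
  have "q \<bullet> (b - a) = integral {0..1} (\<lambda>r. q \<bullet> (?d *\<^sub>R graph_vel \<sigma> (q, ?\<xi> r)))"
    using integral_linear[OF vel.segment_integrable[OF q a b, of ?d] bounded_linear_inner_right[of q]]
    unfolding ab segment_integral_def o_def by (simp only: fst_conv snd_conv)
  moreover have i1: "(\<lambda>r. q \<bullet> (?d *\<^sub>R graph_vel \<sigma> (q, ?\<xi> r))) integrable_on {0..1}"
    using integrable_linear[OF vel.segment_integrable[OF q a b, of ?d] bounded_linear_inner_right[of q]]
    by (simp add: o_def)
  moreover have "\<sigma> * segment_integral graph_root (q, coord_x a, coord_x b)
      = integral {0..1} (\<lambda>r. \<sigma> * (?d * graph_root (q, ?\<xi> r)))"
    by (simp add: segment_integral_def)
  moreover have i2: "(\<lambda>r. \<sigma> * (?d * graph_root (q, ?\<xi> r))) integrable_on {0..1}"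
    using root.segment_integrable[OF q a b, of "\<sigma> * ?d"] by (simp add: mult.assoc)
  moreover have "coord_x q * ?d = integral {0..1} (\<lambda>r::real. coord_x q * ?d)" by simp
  ultimately have "action q a b = integral {0..1} (\<lambda>r. q \<bullet> (?d *\<^sub>R graph_vel \<sigma> (q, ?\<xi> r)) - coord_x q * ?d
      + \<sigma> * (?d * graph_root (q, ?\<xi> r)))"
    by (subst integral_add; (subst integral_diff)?) (auto simp: action_def intro!: integrable_diff)
  also have "\<dots> = integral {0..1} (\<lambda>r. \<sigma> * ?d / graph_root (q, ?\<xi> r))"
  proof (rule integral_cong)
    fix r :: real assume r: "r \<in> {0..1}"
    have pos: "graph_root (q, ?\<xi> r) > 0" by (rule graph_root_pos[OF less[OF r]])
    have "q \<bullet> (?d *\<^sub>R graph_vel \<sigma> (q, ?\<xi> r)) - coord_x q * ?d + \<sigma> * (?d * graph_root (q, ?\<xi> r))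
      = \<sigma> * ?d * ((graph_slope (q, ?\<xi> r))\<^sup>2 + (graph_root (q, ?\<xi> r))\<^sup>2) / graph_root (q, ?\<xi> r)"
    proof -
      have "R > 0 \<Longrightarrow> d * (X + \<sigma> * S\<^sup>2 / R) - X * d + \<sigma> * (d * R) = \<sigma> * d * (S\<^sup>2 + R\<^sup>2) / R" for R S X d :: real
        by (simp add: field_simps power2_eq_square)
      from this[OF pos] show ?thesis unfolding inner_scaleR_right inner_graph_vel .
    qed
    then show "q \<bullet> (?d *\<^sub>R graph_vel \<sigma> (q, ?\<xi> r)) - coord_x q * ?d + \<sigma> * (?d * graph_root (q, ?\<xi> r))
      = \<sigma> * ?d / graph_root (q, ?\<xi> r)"
      by (simp add: graph_root_square[OF less[OF r]])
  qed
  finally show ?thesis .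
qed

text \<open>Cauchy-Schwarz against the unit vector with components
  \<open>\<sigma> * graph_root\<close> and \<open>graph_slope\<close>, in the form of Lagrange's
  identity.\<close>

lemma calibration_le:
  assumes "\<bar>graph_slope (q, \<xi>)\<bar> < 1"
  shows "v * graph_slope (q, \<xi>) + \<sigma> * graph_root (q, \<xi>) * u \<le> sqrt (u\<^sup>2 + v\<^sup>2)"
proof -
  let ?s = "graph_slope (q, \<xi>)" and ?r = "graph_root (q, \<xi>)"
  have rs: "?r\<^sup>2 = 1 - ?s\<^sup>2" by (rule graph_root_square[OF assms])
  have "(v * ?s + \<sigma> * ?r * u)\<^sup>2 + (v * (\<sigma> * ?r) - u * ?s)\<^sup>2 = (u\<^sup>2 + v\<^sup>2) * (?s\<^sup>2 + \<sigma>\<^sup>2 * ?r\<^sup>2)"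
    by (simp add: power2_eq_square algebra_simps)
  also have "\<dots> = u\<^sup>2 + v\<^sup>2" by (simp add: sigma rs)
  finally have "(v * ?s + \<sigma> * ?r * u)\<^sup>2 \<le> u\<^sup>2 + v\<^sup>2" by (smt (verit) zero_le_power2)
  then show ?thesis by (rule real_le_rsqrt)
qed

lemma segment_root_derivative:
  assumes "q \<in> W" "a \<in> I" "\<xi> \<in> I"
  shows "((\<lambda>\<xi>. segment_integral graph_root (q, a, \<xi>)) has_derivative (\<lambda>h. h * graph_root (q, \<xi>))) (at \<xi>)"
proof -
  have "((\<lambda>\<xi>. (q, a, \<xi>)) has_derivative (\<lambda>h. (0, 0, h))) (at \<xi>)"
    by (auto intro!: derivative_eq_intros)
  from has_derivative_compose[OF this root.segment_integral_has_derivative[OF assms]]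
  show ?thesis by (simp add: graph_root'_def graph_slope'_def)
qed

lemma segment_vel_derivative:
  assumes "q \<in> W" "a \<in> I" "\<xi> \<in> I"
  shows "((\<lambda>\<xi>. segment_integral (graph_vel \<sigma>) (q, a, \<xi>)) has_vector_derivative graph_vel \<sigma> (q, \<xi>)) (at \<xi>)"
proof -
  have "((\<lambda>\<xi>. (q, a, \<xi>)) has_derivative (\<lambda>h. (0, 0, h))) (at \<xi>)"
    by (auto intro!: derivative_eq_intros)
  from has_derivative_compose[OF this vel.segment_integral_has_derivative[OF assms]]
  show ?thesis by (simp add: graph_vel'_def graph_slope'_def has_vector_derivative_def)
qed

text \<open>A curve whose abscissa moves further than \<open>\<rho>\<close> is longer than
  \<open>\<rho>\<close>, hence longer than the action. Any other curve stays over \<open>I\<close>,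
  where the action with fixed covector is a calibration.\<close>

lemma action_le_sr_length:
  fixes c :: "real \<Rightarrow> real ^ 'n"
  assumes q: "q \<in> W" and \<rho>: "\<And>\<xi>. \<bar>\<xi> - coord_x a\<bar> \<le> \<rho> \<Longrightarrow> \<xi> \<in> I" and le: "action q a b \<le> \<rho>" "0 \<le> \<rho>"
    and adm: "admissible_curve r s c" and c: "c r = a" "c s = b"
  shows "action q a b \<le> sr_length r s c"
proof (cases "\<forall>t\<in>{r..s}. \<bar>coord_x (c t) - coord_x a\<bar> \<le> \<rho>")
  case False
  then obtain t where "t \<in> {r..s}" "\<bar>coord_x (c t) - coord_x a\<bar> > \<rho>" by (auto simp: not_le)
  with coord_x_le_sr_length[OF n adm, of t] le show ?thesis by (simp add: c)
next
  case True
  then have cI: "coord_x (c t) \<in> I" if "t \<in> {r..s}" for t using \<rho> that by auto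
  have rs: "r \<le> s" using adm by (simp add: admissible_curve_def)
  obtain L where L: "L-lipschitz_on {r..s} c" using adm by (auto simp: admissible_curve_def)
  have aI: "coord_x a \<in> I" using \<rho>[of "coord_x a"] le by simp
  define F where "F \<xi> = segment_integral graph_root (q, coord_x a, \<xi>)" for \<xi>
  have F': "(F has_derivative (\<lambda>h. h * graph_root (q, \<xi>))) (at \<xi> within S)" if "\<xi> \<in> I" for \<xi> S
    unfolding F_def using segment_root_derivative[OF q aI that] by (rule has_derivative_at_withinI)
  define l where "l p = q \<bullet> p - coord_x q * coord_x p" for p :: "real ^ 'n"
  have bl: "bounded_linear l"
    unfolding l_def
    by (intro bounded_linear_sub bounded_linear_inner_right bounded_linear_const_mult bounded_linear_coord_x)
  define g where "g p = l p + \<sigma> * F (coord_x p)" for p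
  have lipF: "1-lipschitz_on I F"
  proof (rule bounded_derivative_imp_lipschitz[OF F' convex_I])
    fix \<xi> assume "\<xi> \<in> I"
    then have "0 \<le> graph_root (q, \<xi>)" "graph_root (q, \<xi>) \<le> 1"
      using slope_less[OF q] graph_root_pos[of "(q, \<xi>)"] by (auto simp: graph_root_def less_imp_le)
    then show "onorm (\<lambda>h. h * graph_root (q, \<xi>)) \<le> 1"
      by (intro onorm_bound) (auto simp: abs_mult mult_left_le)
  qed auto
  obtain B where B: "B-lipschitz_on UNIV l" by (rule bounded_linear.lipschitz_boundE[OF bl])
  obtain B' where B': "B'-lipschitz_on UNIV (coord_x :: real ^ 'n \<Rightarrow> real)"
    by (rule bounded_linear.lipschitz_boundE[OF bounded_linear_coord_x])
  have "(B * L)-lipschitz_on {r..s} (\<lambda>t. l (c t))"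
    by (rule lipschitz_on_compose2[OF L lipschitz_on_subset[OF B]]) auto
  moreover have "(B' * L)-lipschitz_on {r..s} (\<lambda>t. coord_x (c t))"
    by (rule lipschitz_on_compose2[OF L lipschitz_on_subset[OF B']]) auto
  then have "(1 * (B' * L))-lipschitz_on {r..s} (\<lambda>t. F (coord_x (c t)))"
    by (rule lipschitz_on_compose2[OF _ lipschitz_on_subset[OF lipF]]) (use cI in auto)
  then have "(\<bar>\<sigma>\<bar> * (1 * (B' * L)))-lipschitz_on {r..s} (\<lambda>t. \<sigma> * F (coord_x (c t)))"
    by (rule lipschitz_on_cmult_real)
  ultimately have lip: "(B * L + \<bar>\<sigma>\<bar> * (1 * (B' * L)))-lipschitz_on {r..s} (\<lambda>t. g (c t))"
    unfolding g_def by (rule lipschitz_on_add)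
  have "g (c s) - g (c r) \<le> sr_length r s c"
  proof (rule sr_length_ge_calibration[OF n adm _ _ lip])
    show "s \<in> {r..s}" using rs by simp
    fix t assume t: "t \<in> {r..s}"
    have Fd: "((\<lambda>p. F (coord_x p)) has_derivative (\<lambda>v. coord_x v * graph_root (q, coord_x (c t)))) (at (c t))"
      by (rule has_derivative_compose[OF bounded_linear_imp_has_derivative[OF bounded_linear_coord_x] F'[OF cI[OF t]]])
    show "(g has_derivative (\<lambda>v. l v + \<sigma> * (coord_x v * graph_root (q, coord_x (c t))))) (at (c t))"
      unfolding g_def by (intro derivative_intros bounded_linear_imp_has_derivative[OF bl] Fd)
    fix u v
    have less: "\<bar>graph_slope (q, coord_x (c t))\<bar> < 1" using slope_less[OF q cI[OF t]] .
    show "l (u *\<^sub>R d_x + v *\<^sub>R jet_vec 0 (coord_x (c t))) +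
       \<sigma> * (coord_x (u *\<^sub>R d_x + v *\<^sub>R jet_vec 0 (coord_x (c t)) :: real ^ 'n) * graph_root (q, coord_x (c t))) \<le> sqrt (u\<^sup>2 + v\<^sup>2)"
      using calibration_le[OF less, of v u] n
      by (simp add: l_def inner_add_right graph_slope_def coord_x_inner[of q, symmetric] mult.commute mult.left_commute)
  qed
  also have "F (coord_x a) = 0" by (simp add: F_def segment_integral_def)
  then have "g (c s) - g (c r) = action q a b"
    by (simp add: g_def c action_def F_def l_def inner_diff_right algebra_simps)
  finally show ?thesis .
qed

text \<open>The graph of the covector, parametrized proportionally to x, turns the calibration
  inequality into an equality.\<close>

lemma action_attained:
  assumes q: "q \<in> W" and a: "coord_x a \<in> I" and b: "coord_x b \<in> I"
    and ab: "b - a = segment_integral (graph_vel \<sigma>) (q, coord_x a, coord_x b)"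
    and dir: "\<sigma> * (coord_x b - coord_x a) \<ge> 0"
  shows "\<exists>c. admissible_curve 0 1 c \<and> c 0 = a \<and> c 1 = b \<and> sr_length 0 1 c = action q a b"
proof -
  let ?\<xi> = "\<lambda>r. coord_x a + r * (coord_x b - coord_x a)"
  let ?d = "coord_x b - coord_x a"
  define c where "c r = a + segment_integral (graph_vel \<sigma>) (q, coord_x a, ?\<xi> r)" for r
  have \<xi>: "?\<xi> r \<in> I" if "r \<in> {0..1}" for r using vel.in_segment[OF a b that] .
  have c': "(c has_vector_derivative ?d *\<^sub>R graph_vel \<sigma> (q, ?\<xi> r)) (at r)" if "r \<in> {0..1}" for r
  proof -
    have "(?\<xi> has_vector_derivative ?d) (at r)" by (auto intro!: derivative_eq_intros)
    from vector_diff_chain_at[OF this segment_vel_derivative[OF q a \<xi>[OF that]]]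
    show ?thesis
      unfolding c_def o_def
      using has_vector_derivative_add[OF has_vector_derivative_const[of a]] by fastforce
  qed
  have cx: "coord_x (c r) = ?\<xi> r" if "r \<in> {0..1}" for r
    using coord_x_segment_vel[OF q a \<xi>[OF that]] by (simp add: c_def)
  have contv: "continuous_on {0..1} (\<lambda>r. graph_vel \<sigma> (q, ?\<xi> r))"
    by (intro continuous_on_compose2[OF vel.cont] continuous_intros) (use q \<xi> in auto)
  obtain B where "\<forall>v\<in>(\<lambda>r. graph_vel \<sigma> (q, ?\<xi> r)) ` {0..1}. norm v \<le> B"
    using compact_imp_bounded[OF compact_continuous_image[OF contv compact_Icc]]
    unfolding bounded_iff by blast
  then have B: "\<And>r. r \<in> {0..1} \<Longrightarrow> norm (graph_vel \<sigma> (q, ?\<xi> r)) \<le> B" by blast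
  have lip: "(\<bar>?d\<bar> * \<bar>B\<bar>)-lipschitz_on {0..1} c"
  proof (rule bounded_derivative_imp_lipschitz)
    fix r :: real assume r: "r \<in> {0..1}"
    show "(c has_derivative (\<lambda>h. h *\<^sub>R (?d *\<^sub>R graph_vel \<sigma> (q, ?\<xi> r)))) (at r within {0..1})"
      using c'[OF r] unfolding has_vector_derivative_def by (rule has_derivative_at_withinI)
    show "onorm (\<lambda>h. h *\<^sub>R (?d *\<^sub>R graph_vel \<sigma> (q, ?\<xi> r))) \<le> \<bar>?d\<bar> * \<bar>B\<bar>"
    proof (rule onorm_bound)
      show "norm (h *\<^sub>R ?d *\<^sub>R graph_vel \<sigma> (q, ?\<xi> r)) \<le> \<bar>?d\<bar> * \<bar>B\<bar> * norm h" for h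
        using mult_left_mono[OF order.trans[OF B[OF r] abs_ge_self], of "\<bar>h\<bar> * \<bar>?d\<bar>"]
        by (simp add: abs_mult mult.commute mult.left_commute)
    qed simp
  qed auto
  have hor: "?d *\<^sub>R graph_vel \<sigma> (q, ?\<xi> r) =
      ?d *\<^sub>R d_x + (?d * (\<sigma> * graph_slope (q, ?\<xi> r) / graph_root (q, ?\<xi> r))) *\<^sub>R jet_vec 0 (coord_x (c r))"
    if "r \<in> {0..1}" for r
    using cx[OF that] by (simp add: graph_vel_def scaleR_add_right)
  have adm: "admissible_curve 0 1 c"
    unfolding admissible_curve_def
  proof (intro conjI exI AE_I2)
    fix r assume "r \<in> space (lebesgue_on {0..1::real})"
    then have r: "r \<in> {0..1}" by simp
    show "c differentiable at r" using c'[OF r] differentiableI_vector by blast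
    show "vector_derivative c (at r) \<in> hor (c r)"
      using vector_derivative_at[OF c'[OF r]] hor[OF r] hor_iff by metis
  qed (use lip in auto)
  moreover have "sr_length 0 1 c = action q a b"
    unfolding sr_length_def action_eq[OF q a b ab]
  proof (rule integral_cong)
    fix r :: real assume r: "r \<in> {0..1}"
    have less: "\<bar>graph_slope (q, ?\<xi> r)\<bar> < 1" using slope_less[OF q \<xi>[OF r]] .
    have pos: "graph_root (q, ?\<xi> r) > 0" by (rule graph_root_pos[OF less])
    have sq: "(\<sigma> * graph_slope (q, ?\<xi> r) / graph_root (q, ?\<xi> r))\<^sup>2 + 1 = 1 / (graph_root (q, ?\<xi> r))\<^sup>2"
      using pos graph_root_square[OF less] by (simp add: power_mult_distrib power_divide sigma field_simps)
    have "sr_metric (c r) (vector_derivative c (at r)) (vector_derivative c (at r))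
      = ?d\<^sup>2 * ((\<sigma> * graph_slope (q, ?\<xi> r) / graph_root (q, ?\<xi> r))\<^sup>2 + 1)"
      unfolding vector_derivative_at[OF c'[OF r]] hor[OF r] sr_metric_frame[OF n]
      by (simp add: power2_eq_square algebra_simps)
    also have "\<dots> = (\<sigma> * ?d / graph_root (q, ?\<xi> r))\<^sup>2"
      unfolding sq by (simp add: power_mult_distrib power_divide sigma)
    finally show "sqrt (sr_metric (c r) (vector_derivative c (at r)) (vector_derivative c (at r)))
      = \<sigma> * ?d / graph_root (q, ?\<xi> r)"
      using dir pos by (simp add: real_sqrt_unique)
  qed
  moreover have "c 0 = a" "c 1 = b"
    using ab by (auto simp: c_def segment_integral_def algebra_simps)
  ultimately show ?thesis by blast
qed

proposition sr_dist_eq_action: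
  assumes q: "q \<in> W" and \<rho>: "\<And>\<xi>. \<bar>\<xi> - coord_x a\<bar> \<le> \<rho> \<Longrightarrow> \<xi> \<in> I" and le: "action q a b \<le> \<rho>" "0 \<le> \<rho>"
    and b: "coord_x b \<in> I"
    and ab: "b - a = segment_integral (graph_vel \<sigma>) (q, coord_x a, coord_x b)"
    and dir: "\<sigma> * (coord_x b - coord_x a) \<ge> 0"
  shows "sr_dist a b = action q a b"
  unfolding sr_dist_def
proof (rule cInf_eq_minimum)
  have "coord_x a \<in> I" using \<rho>[of "coord_x a"] le by simp
  from action_attained[OF q this b ab dir]
  show "action q a b \<in> {sr_length r s c |r s c. admissible_curve r s c \<and> c r = a \<and> c s = b}"
    by force
  show "action q a b \<le> l" if "l \<in> {sr_length r s c |r s c. admissible_curve r s c \<and> c r = a \<and> c s = b}" for l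
    using that action_le_sr_length[OF q \<rho> le] by auto
qed

end

section \<open>The covector as a function of the end points\<close>

lemma polynomial_eq_0:
  fixes v :: "real ^ 'n::finite"
  assumes n: "CARD('n) \<ge> 2" and x: "coord_x v = 0" and inf: "infinite S"
    and 0: "\<And>\<xi>. \<xi> \<in> S \<Longrightarrow> v \<bullet> jet_vec 0 \<xi> = 0"
  shows "v = 0"
proof -
  have eq: "v \<bullet> jet_vec 0 \<xi> = (\<Sum>j\<le>CARD('n) - 2. (v \<bullet> d_y j / fact j) * \<xi> ^ j)" for \<xi>
    by (auto simp: jet_vec_def inner_sum_right atLeast0AtMost intro!: sum.cong)
  have "v \<bullet> d_y j = 0" if j: "j \<le> CARD('n) - 2" for j
  proof (rule ccontr)
    assume "v \<bullet> d_y j \<noteq> 0"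
    then have "finite {\<xi>. (\<Sum>j\<le>CARD('n) - 2. (v \<bullet> d_y j / fact j) * \<xi> ^ j) = 0}"
      using polyfun_finite_roots[of "\<lambda>j. v \<bullet> d_y j / fact j" "CARD('n) - 2"] j by auto
    moreover have "S \<subseteq> {\<xi>. (\<Sum>j\<le>CARD('n) - 2. (v \<bullet> d_y j / fact j) * \<xi> ^ j) = 0}"
      using 0 eq by auto
    ultimately show False using inf finite_subset by blast
  qed
  then have "v $ k = 0" for k
    using x by (cases k rule: coord_ix_cases) (auto simp: coord_x_def d_y_def inner_axis)
  then show "v = 0" by (simp add: vec_eq_iff)
qed

text \<open>The inverse function theorem describes the derivative of the local inverse as an
  \<open>inv\<close>; its continuity is recovered here. The operator at \<open>y0\<close> is bounded
  below by \<open>m\<close>, and it maps \<open>w y - w y0\<close> to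
  \<open>(A y0 - A y) (w y)\<close>.\<close>

lemma continuous_inverse_derivative:
  fixes A :: "'b::t2_space \<Rightarrow> 'a::euclidean_space \<Rightarrow>\<^sub>L 'a"
  assumes cont: "(A \<longlongrightarrow> A y0) (at y0)" and bij: "\<forall>\<^sub>F y in at y0. bij (blinfun_apply (A y))"
    and bij0: "bij (blinfun_apply (A y0))"
  shows "((\<lambda>y. inv (blinfun_apply (A y)) v) \<longlongrightarrow> inv (blinfun_apply (A y0)) v) (at y0)"
proof -
  define w where "w y = inv (blinfun_apply (A y)) v" for y
  have Aw: "A y (w y) = v" if "bij (blinfun_apply (A y))" for y
    using that by (simp add: w_def bij_is_surj surj_f_inv_f)
  obtain m where m: "m > 0" "\<And>x. m * norm x \<le> norm (A y0 x)"
    using linear_inj_bounded_below_pos[of "blinfun_apply (A y0)"] bij0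
    by (metis bij_is_inj blinfun.bounded_linear_right bounded_linear.linear)
  define \<epsilon> where "\<epsilon> y = norm (A y0 - A y)" for y
  have \<epsilon>0: "(\<epsilon> \<longlongrightarrow> 0) (at y0)"
    using tendsto_norm[OF tendsto_diff[OF tendsto_const[of "A y0"] cont]] by (simp add: \<epsilon>_def[abs_def])
  have "((\<lambda>y. w y - w y0) \<longlongrightarrow> 0) (at y0)"
  proof (rule Lim_null_comparison)
    have "\<forall>\<^sub>F y in at y0. \<epsilon> y < m / 2"
      using \<epsilon>0 m by (intro order_tendstoD(2)) auto
    then show "\<forall>\<^sub>F y in at y0. norm (w y - w y0) \<le> \<epsilon> y * (2 * norm (w y0) / m)"
      using bij
    proof eventually_elim
      case (elim y)
      have "m * norm (w y - w y0) \<le> norm (A y0 (w y - w y0))" by (rule m)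
      also have "A y0 (w y - w y0) = (A y0 - A y) (w y)"
        using Aw[OF elim(2)] Aw[OF bij0] by (simp add: blinfun.bilinear_simps)
      also have "norm ((A y0 - A y) (w y)) \<le> \<epsilon> y * norm (w y)"
        unfolding \<epsilon>_def by (rule norm_blinfun)
      also have "\<dots> \<le> \<epsilon> y * norm (w y - w y0) + \<epsilon> y * norm (w y0)"
        using mult_left_mono[OF norm_triangle_sub[of "w y" "w y0"], of "\<epsilon> y"]
        by (simp add: \<epsilon>_def algebra_simps)
      also have "\<epsilon> y * norm (w y - w y0) \<le> m / 2 * norm (w y - w y0)"
        using elim(1) by (intro mult_right_mono) auto
      finally have "m / 2 * norm (w y - w y0) \<le> \<epsilon> y * norm (w y0)" by simp
      then show ?case using m(1) by (simp add: field_simps)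
    qed
    show "((\<lambda>y. \<epsilon> y * (2 * norm (w y0) / m)) \<longlongrightarrow> 0) (at y0)"
      using tendsto_mult_left_zero[OF \<epsilon>0] .
  qed
  then show ?thesis unfolding w_def by (rule Lim_null[THEN iffD2])
qed

context slope_strip
begin

text \<open>
  The \<open>d_x\<close>-component of a covector does not enter its slope.  It stores the abscissa of the initial point,
  so that \<open>shoot\<close>, which recovers the initial point from the covector and the end point, acts between open
  sets of the same dimension.
\<close>

definition covector_deriv :: "real ^ 'n \<Rightarrow> real \<Rightarrow> real ^ 'n \<Rightarrow> real ^ 'n" where
  "covector_deriv q b v = coord_x v *\<^sub>R graph_vel \<sigma> (q, coord_x q) -
     integral {0..1} (\<lambda>r. (b - coord_x q) *\<^sub>R graph_vel' \<sigma> (q, coord_x q + r * (b - coord_x q)) (v, 0))"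

definition shoot :: "(real ^ 'n) \<times> (real ^ 'n) \<Rightarrow> (real ^ 'n) \<times> (real ^ 'n)" where
  "shoot z = (snd z - segment_integral (graph_vel \<sigma>) (fst z, coord_x (fst z), coord_x (snd z)), snd z)"

definition shoot_dom :: "((real ^ 'n) \<times> (real ^ 'n)) set" where
  "shoot_dom = {z. fst z \<in> W \<and> coord_x (fst z) \<in> I \<and> coord_x (snd z) \<in> I}"

definition shoot' :: "(real ^ 'n) \<times> (real ^ 'n) \<Rightarrow> (real ^ 'n) \<times> (real ^ 'n) \<Rightarrow> (real ^ 'n) \<times> (real ^ 'n)" where
  "shoot' z v = (snd v + covector_deriv (fst z) (coord_x (snd z)) (fst v) -
     coord_x (snd v) *\<^sub>R graph_vel \<sigma> (fst z, coord_x (snd z)), snd v)"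

lemma open_shoot_dom: "open shoot_dom"
proof -
  have "shoot_dom = (fst -` W) \<inter> ((\<lambda>z. coord_x (fst z)) -` I) \<inter> ((\<lambda>z. coord_x (snd z)) -` I)"
    by (auto simp: shoot_dom_def)
  then show ?thesis
    by (simp add: open_Int open_vimage open_W open_I continuous_on_coord_x continuous_on_fst continuous_on_snd)
qed

text \<open>With the end point fixed, the recovered initial point moves by
  \<open>covector_deriv\<close>: one term comes from the lower limit, which is stored in the
  covector, the other from the change of the graph velocity.\<close>

lemma shoot_has_derivative:
  assumes z: "z \<in> shoot_dom"
  shows "(shoot has_derivative shoot' z) (at z)"
proof -
  obtain q b where zqb: "z = (q, b)" by force
  have q: "q \<in> W" "coord_x q \<in> I" "coord_x b \<in> I" using z by (auto simp: shoot_dom_def zqb)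
  define k where "k z = (fst z, coord_x (fst z), coord_x (snd z))" for z :: "(real ^ 'n) \<times> (real ^ 'n)"
  have "bounded_linear k"
    unfolding k_def
    by (intro bounded_linear_Pair bounded_linear_fst bounded_linear_snd
        bounded_linear_compose[OF bounded_linear_coord_x])
  then have "(k has_derivative k) (at z)" by (rule bounded_linear_imp_has_derivative)
  moreover have "(segment_integral (graph_vel \<sigma>) has_derivative (\<lambda>(dq, da, db).
      integral {0..1} (\<lambda>r. (coord_x b - coord_x q) *\<^sub>R graph_vel' \<sigma> (q, coord_x q + r * (coord_x b - coord_x q)) (dq, 0)) +
       db *\<^sub>R graph_vel \<sigma> (q, coord_x b) - da *\<^sub>R graph_vel \<sigma> (q, coord_x q))) (at (k z))"
    using vel.segment_integral_has_derivative[OF q] by (simp add: k_def zqb)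
  ultimately have 1: "((\<lambda>z. segment_integral (graph_vel \<sigma>) (k z)) has_derivative
     (\<lambda>v. (\<lambda>(dq, da, db).
      integral {0..1} (\<lambda>r. (coord_x b - coord_x q) *\<^sub>R graph_vel' \<sigma> (q, coord_x q + r * (coord_x b - coord_x q)) (dq, 0)) +
       db *\<^sub>R graph_vel \<sigma> (q, coord_x b) - da *\<^sub>R graph_vel \<sigma> (q, coord_x q)) (k v))) (at z)"
    by (rule has_derivative_compose)
  show ?thesis
    unfolding shoot_def[abs_def] k_def[symmetric]
    by (rule has_derivative_eq_rhs[OF has_derivative_Pair[OF has_derivative_diff[OF
         has_derivative_snd[OF has_derivative_ident] 1] has_derivative_snd[OF has_derivative_ident]]])
      (simp add: fun_eq_iff shoot'_def k_def zqb covector_deriv_def)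
qed

lemma continuous_on_covector_deriv:
  "continuous_on shoot_dom (\<lambda>z. covector_deriv (fst z) (coord_x (snd z)) v)"
proof -
  have "continuous_on shoot_dom (\<lambda>z. integral {0..1} (\<lambda>r. (coord_x (snd z) - coord_x (fst z)) *\<^sub>R
     graph_vel' \<sigma> (fst z, coord_x (fst z) + r * (coord_x (snd z) - coord_x (fst z))) (v, 0)))"
  proof -
    have "continuous_on shoot_dom (\<lambda>z. (fst z, coord_x (fst z), coord_x (snd z)))"
      by (intro continuous_intros)
    moreover have "(\<lambda>z. (fst z, coord_x (fst z), coord_x (snd z))) ` shoot_dom \<subseteq> W \<times> I \<times> I"
      by (auto simp: shoot_dom_def)
    ultimately show ?thesis
      using continuous_on_compose2[OF vel.continuous_on_segment_deriv[of "(v, 0)"],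
        of shoot_dom "\<lambda>z. (fst z, coord_x (fst z), coord_x (snd z))"]
      by (simp only: fst_conv snd_conv)
  qed
  moreover have "continuous_on shoot_dom (\<lambda>z. graph_vel \<sigma> (fst z, coord_x (fst z)))"
    by (intro continuous_on_compose2[OF vel.cont] continuous_intros) (auto simp: shoot_dom_def)
  ultimately show ?thesis
    unfolding covector_deriv_def by (intro continuous_intros)
qed

lemma Blinfun_shoot': "z \<in> shoot_dom \<Longrightarrow> blinfun_apply (Blinfun (shoot' z)) = shoot' z"
  using shoot_has_derivative has_derivative_bounded_linear bounded_linear_Blinfun_apply by blast

lemma continuous_on_shoot': "continuous_on shoot_dom (\<lambda>z. Blinfun (shoot' z))"
proof (rule continuous_on_blinfun_componentwise)
  fix i :: "(real ^ 'n) \<times> (real ^ 'n)"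
  have "continuous_on shoot_dom (\<lambda>z. graph_vel \<sigma> (fst z, coord_x (snd z)))"
    by (intro continuous_on_compose2[OF vel.cont] continuous_intros) (auto simp: shoot_dom_def)
  then have "continuous_on shoot_dom (\<lambda>z. shoot' z i)"
    unfolding shoot'_def by (intro continuous_intros continuous_on_covector_deriv)
  then show "continuous_on shoot_dom (\<lambda>z. blinfun_apply (Blinfun (shoot' z)) i)"
    by (rule continuous_on_eq) (simp add: Blinfun_shoot')
qed

lemma graph_vel'_0: "graph_vel' \<sigma> (q, \<xi>) (v, 0) = (\<sigma> * (v \<bullet> jet_vec 0 \<xi>) / graph_root (q, \<xi>) ^ 3) *\<^sub>R jet_vec 0 \<xi>"
  by (simp add: graph_vel'_def graph_slope'_def)

lemma segment_deriv_integrable: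
  assumes "q \<in> W" "a \<in> I" "b \<in> I"
  shows "(\<lambda>r. (b - a) *\<^sub>R graph_vel' \<sigma> (q, a + r * (b - a)) v) integrable_on {0..1}"
  by (intro integrable_continuous_real continuous_intros continuous_on_compose2[OF vel.cont_deriv])
    (use assms vel.in_segment in auto)

lemma coord_x_covector_deriv:
  assumes "q \<in> W" "coord_x q \<in> I" "b \<in> I"
  shows "coord_x (covector_deriv q b v) = coord_x v"
proof -
  have "coord_x (integral {0..1} (\<lambda>r. (b - coord_x q) *\<^sub>R graph_vel' \<sigma> (q, coord_x q + r * (b - coord_x q)) (v, 0)))
    = integral {0..1} (\<lambda>r. coord_x ((b - coord_x q) *\<^sub>R graph_vel' \<sigma> (q, coord_x q + r * (b - coord_x q)) (v, 0)))"
    using integral_linear[OF segment_deriv_integrable[OF assms] bounded_linear_coord_x, symmetric]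
    by (simp only: o_def)
  also have "\<dots> = 0" using n by (simp add: graph_vel'_0)
  finally have "coord_x (integral {0..1} (\<lambda>r. (b - coord_x q) *\<^sub>R graph_vel' \<sigma> (q, coord_x q + r * (b - coord_x q)) (v, 0))) = 0" .
  then show ?thesis by (simp add: covector_deriv_def)
qed

text \<open>Absence of conjugate points. Pairing the vanishing variation with \<open>v\<close>
  itself gives the integral of the square of the polynomial
  \<open>v \<bullet> jet_vec 0 \<xi>\<close> against a positive weight, so the polynomial vanishes
  on a whole segment.\<close>

lemma covector_deriv_eq_0:
  assumes q: "q \<in> W" "coord_x q \<in> I" "b \<in> I" and dir: "\<sigma> * (b - coord_x q) > 0"
    and 0: "covector_deriv q b v = 0"
  shows "v = 0"
proof -
  let ?a = "coord_x q"
  let ?\<xi> = "\<lambda>r. ?a + r * (b - ?a)"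
  let ?h = "\<lambda>r. \<sigma> * (b - ?a) * ((v \<bullet> jet_vec 0 (?\<xi> r))\<^sup>2 / graph_root (q, ?\<xi> r) ^ 3)"
  have x: "coord_x v = 0" using coord_x_covector_deriv[OF q, of v] 0 by simp
  have pos: "graph_root (q, ?\<xi> r) > 0" if "r \<in> {0..1}" for r
    using slope_less[OF q(1) vel.in_segment[OF q(2,3) that]] by (rule graph_root_pos)
  have "integral {0..1} (\<lambda>r. (b - ?a) *\<^sub>R graph_vel' \<sigma> (q, ?\<xi> r) (v, 0)) = 0"
    using 0 x by (simp add: covector_deriv_def)
  then have "integral {0..1} (\<lambda>r. v \<bullet> ((b - ?a) *\<^sub>R graph_vel' \<sigma> (q, ?\<xi> r) (v, 0))) = 0"
    using integral_linear[OF segment_deriv_integrable[OF q, of "(v, 0)"] bounded_linear_inner_right[of v]]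
    by (simp only: o_def inner_zero_right)
  moreover have "v \<bullet> ((b - ?a) *\<^sub>R graph_vel' \<sigma> (q, ?\<xi> r) (v, 0)) = ?h r" for r
    by (simp add: graph_vel'_0 power2_eq_square)
  ultimately have "integral {0..1} ?h = 0" by (simp only:)
  moreover have cont: "continuous_on {0..1} ?h"
    using pos q vel.in_segment by (intro continuous_intros) force+
  moreover have nonneg: "?h r \<ge> 0" if "r \<in> {0..1}" for r
    using pos[OF that] by (intro mult_nonneg_nonneg[OF less_imp_le[OF dir]]) simp
  ultimately have "\<forall>r\<in>{0..1}. ?h r = 0"
    using integral_eq_0_iff[OF cont] by auto
  then have "v \<bullet> jet_vec 0 (?\<xi> r) = 0" if "r \<in> {0..1}" for r
    using that pos[OF that] dir by force
  then have "v \<bullet> jet_vec 0 \<eta> = 0" if "\<eta> \<in> ?\<xi> ` {0..1}" for \<eta>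
    using that by auto
  moreover have "infinite (?\<xi> ` {0..1})"
  proof -
    have "inj_on ?\<xi> {0..1}" using dir by (auto simp: inj_on_def)
    then show ?thesis by (simp add: finite_image_iff infinite_Icc_iff)
  qed
  ultimately show "v = 0" using polynomial_eq_0[OF n x] by blast
qed

lemma shoot'_inverse:
  assumes z: "z \<in> shoot_dom" and dir: "\<sigma> * (coord_x (snd z) - coord_x (fst z)) > 0"
  obtains invf where "invf o\<^sub>L Blinfun (shoot' z) = id_blinfun"
proof -
  have bl: "bounded_linear (shoot' z)"
    using shoot_has_derivative[OF z] has_derivative_bounded_linear by blast
  have "inj (shoot' z)"
  proof (rule linear_injective_0[THEN iffD2, rule_format])
    show "linear (shoot' z)" using bl by (rule bounded_linear.linear)
    fix v assume "shoot' z v = 0"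
    then have "snd v = 0" "covector_deriv (fst z) (coord_x (snd z)) (fst v) = 0"
      by (auto simp: shoot'_def zero_prod_def)
    then show "v = 0"
      using covector_deriv_eq_0[of "fst z" "coord_x (snd z)" "fst v"] z dir
      by (auto simp: shoot_dom_def prod_eq_iff)
  qed
  then obtain g where g: "linear g" "g \<circ> shoot' z = id"
    using linear_injective_left_inverse bl bounded_linear.linear by blast
  then have "blinfun_apply (Blinfun g) = g"
    by (simp add: bounded_linear_Blinfun_apply linear_conv_bounded_linear)
  then have "Blinfun g o\<^sub>L Blinfun (shoot' z) = id_blinfun"
    using fun_cong[OF g(2)] Blinfun_shoot'[OF z] by (intro blinfun_eqI) (simp del: split_paired_All)
  then show ?thesis by (rule that)
qed

text \<open>Graph velocities have x-component 1, so integrating back from the end point arrives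
  exactly at the abscissa stored in the covector.\<close>

lemma fst_shoot_eq:
  assumes "z \<in> shoot_dom" "shoot z = (a, b)"
  shows "snd z = b" "coord_x (fst z) = coord_x a"
    "b - a = segment_integral (graph_vel \<sigma>) (fst z, coord_x a, coord_x b)"
proof -
  show 1: "snd z = b" using assms(2) by (simp add: shoot_def)
  have a: "a = b - segment_integral (graph_vel \<sigma>) (fst z, coord_x (fst z), coord_x b)"
    using assms(2) 1 by (auto simp: shoot_def)
  show 2: "coord_x (fst z) = coord_x a"
    using coord_x_segment_vel[of "fst z" "coord_x (fst z)" "coord_x b"] assms(1) 1
    by (subst a) (auto simp: shoot_dom_def)
  show "b - a = segment_integral (graph_vel \<sigma>) (fst z, coord_x a, coord_x b)"
    by (subst a) (simp add: 2)
qed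

text \<open>An envelope theorem: for fixed end points the action is critical at a covector whose
  graph joins them. Hence only the motion of the end points contributes, although the covector will
  later depend on them.\<close>

lemma action_has_derivative:
  assumes q: "q \<in> W" and a: "coord_x a \<in> I" and b: "coord_x b \<in> I"
    and ab: "b - a = segment_integral (graph_vel \<sigma>) (q, coord_x a, coord_x b)"
  shows "((\<lambda>z. action (fst z) (fst (snd z)) (snd (snd z))) has_derivative
    (\<lambda>v. q \<bullet> (snd (snd v) - fst (snd v)) - coord_x q * coord_x (snd (snd v) - fst (snd v))
      + \<sigma> * (coord_x (snd (snd v)) * graph_root (q, coord_x b) - coord_x (fst (snd v)) * graph_root (q, coord_x a))))
    (at (q, a, b))"
proof -
  define k where "k z = (fst z, coord_x (fst (snd z)), coord_x (snd (snd z)))" for z :: "(real ^ 'n) \<times> (real ^ 'n) \<times> (real ^ 'n)"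
  have "bounded_linear k"
    unfolding k_def
    by (intro bounded_linear_Pair bounded_linear_fst bounded_linear_compose[OF bounded_linear_coord_x]
        bounded_linear_compose[OF bounded_linear_fst bounded_linear_snd]
        bounded_linear_compose[OF bounded_linear_snd bounded_linear_snd])
  then have "(k has_derivative k) (at (q, a, b))" by (rule bounded_linear_imp_has_derivative)
  let ?\<xi> = "\<lambda>r. coord_x a + r * (coord_x b - coord_x a)"
  let ?d = "coord_x b - coord_x a"
  let ?R = "\<lambda>(dq, da, db). integral {0..1} (\<lambda>r. ?d *\<^sub>R graph_root' (q, ?\<xi> r) (dq, 0)) +
       db *\<^sub>R graph_root (q, coord_x b) - da *\<^sub>R graph_root (q, coord_x a)"
  have "(segment_integral graph_root has_derivative ?R) (at (k (q, a, b)))"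
    using root.segment_integral_has_derivative[OF q a b] by (simp add: k_def)
  with \<open>(k has_derivative k) (at (q, a, b))\<close>
  have 1: "((\<lambda>z. segment_integral graph_root (k z)) has_derivative (\<lambda>v. ?R (k v))) (at (q, a, b))"
    by (rule has_derivative_compose)
  have 2: "((\<lambda>z. fst z \<bullet> (snd (snd z) - fst (snd z)) - coord_x (fst z) * coord_x (snd (snd z) - fst (snd z))
     + \<sigma> * segment_integral graph_root (k z)) has_derivative
     (\<lambda>v. (q \<bullet> (snd (snd v) - fst (snd v)) + fst v \<bullet> (b - a)) - (coord_x q * coord_x (snd (snd v) - fst (snd v))
       + coord_x (fst v) * coord_x (b - a)) + \<sigma> * ?R (k v))) (at (q, a, b))"
  proof -
    have d: "((\<lambda>z. snd (snd z) - fst (snd z)) has_derivative (\<lambda>v. snd (snd v) - fst (snd v))) (at (q, a, b))"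
      by (rule has_derivative_diff[OF has_derivative_snd[OF has_derivative_snd[OF has_derivative_ident]]
            has_derivative_fst[OF has_derivative_snd[OF has_derivative_ident]]])
    show ?thesis
      by (rule has_derivative_eq_rhs[OF has_derivative_add[OF has_derivative_diff[OF
              has_derivative_inner[OF has_derivative_fst[OF has_derivative_ident] d]
              has_derivative_mult[OF coord_x_has_derivative[OF has_derivative_fst[OF has_derivative_ident]]
                coord_x_has_derivative[OF d]]]
            has_derivative_mult_right[OF 1]]]) simp
  qed
  \<comment> \<open>The q-derivative of the root is minus the pairing with the X_2-part of the graph
    velocity; by \<open>ab\<close> the integral of the latter is the y-part of b - a, and the two
    contributions cancel.\<close>
  have env: "dq \<bullet> (b - a) - coord_x dq * coord_x (b - a)
      + \<sigma> * integral {0..1} (\<lambda>r. ?d *\<^sub>R graph_root' (q, ?\<xi> r) (dq, 0)) = 0" for dq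
  proof -
    have "dq \<bullet> (b - a) = integral {0..1} (\<lambda>r. dq \<bullet> (?d *\<^sub>R graph_vel \<sigma> (q, ?\<xi> r)))"
      using integral_linear[OF vel.segment_integrable[OF q a b, of ?d] bounded_linear_inner_right[of dq]]
      unfolding ab segment_integral_def o_def by (simp only: fst_conv snd_conv)
    also have "\<dots> = integral {0..1} (\<lambda>r. coord_x dq * ?d - \<sigma> * (?d *\<^sub>R graph_root' (q, ?\<xi> r) (dq, 0)))"
      by (intro integral_cong) (simp add: graph_vel_def inner_add_right coord_x_inner graph_root'_def
          graph_slope'_def algebra_simps)
    also have "\<dots> = coord_x dq * ?d - \<sigma> * integral {0..1} (\<lambda>r. ?d *\<^sub>R graph_root' (q, ?\<xi> r) (dq, 0))"
    proof -
      have "(\<lambda>r. ?d *\<^sub>R graph_root' (q, ?\<xi> r) (dq, 0)) integrable_on {0..1}"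
        by (intro integrable_continuous_real continuous_intros continuous_on_compose2[OF root.cont_deriv])
          (use q a b vel.in_segment in auto)
      from integrable_cmul[OF this, of \<sigma>]
      have "(\<lambda>r. \<sigma> * (?d *\<^sub>R graph_root' (q, ?\<xi> r) (dq, 0))) integrable_on {0..1}"
        by (simp only: real_scaleR_def)
      then show ?thesis by (subst integral_diff) auto
    qed
    finally show ?thesis by simp
  qed
  show ?thesis
  proof (rule has_derivative_eq_rhs)
    show "((\<lambda>z. action (fst z) (fst (snd z)) (snd (snd z))) has_derivative
      (\<lambda>v. (q \<bullet> (snd (snd v) - fst (snd v)) + fst v \<bullet> (b - a)) - (coord_x q * coord_x (snd (snd v) - fst (snd v))
       + coord_x (fst v) * coord_x (b - a)) + \<sigma> * ?R (k v))) (at (q, a, b))"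
      using 2 by (simp only: action_def k_def)
  qed (use env in \<open>auto simp: fun_eq_iff k_def algebra_simps\<close>)
qed

section \<open>The time derivative of the cost as a square\<close>

definition tangential :: "(real ^ 'n) \<Rightarrow> real \<Rightarrow> real \<times> real" where
  "tangential q \<xi> = (\<sigma> * graph_root (q, \<xi>), graph_slope (q, \<xi>))"

lemma tangential_inner_self:
  assumes "q \<in> W" "\<xi> \<in> I"
  shows "tangential q \<xi> \<bullet> tangential q \<xi> = 1"
  using graph_root_square[OF slope_less[OF assms]] sigma
  by (simp add: tangential_def power2_eq_square[symmetric] power_mult_distrib)

lemma graph_slope_frame: "q \<bullet> (u *\<^sub>R d_x + w *\<^sub>R jet_vec 0 \<xi>) = u * coord_x q + w * graph_slope (q, \<xi>)"
  by (simp add: inner_add_right graph_slope_def coord_x_inner)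

text \<open>A unit tangent can only turn: its derivative is a multiple of one vector orthogonal to
  it.\<close>

lemma tangential_has_derivative:
  assumes Q: "(Q has_derivative Q') (at x)" and "Q x \<in> W" "\<xi> \<in> I"
  shows "((\<lambda>x. tangential (Q x) \<xi>) has_derivative
    (\<lambda>v. (Q' v \<bullet> jet_vec 0 \<xi>) *\<^sub>R (- (\<sigma> * graph_slope (Q x, \<xi>) / graph_root (Q x, \<xi>)), 1))) (at x)"
proof -
  have less: "\<bar>graph_slope (Q x, \<xi>)\<bar> < 1" using slope_less assms by blast
  have Qd: "((\<lambda>x. (Q x, \<xi>)) has_derivative (\<lambda>v. (Q' v, 0))) (at x)"
    by (intro has_derivative_Pair Q has_derivative_const)
  have "((\<lambda>x. tangential (Q x) \<xi>) has_derivative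
    (\<lambda>v. (\<sigma> * graph_root' (Q x, \<xi>) (Q' v, 0), graph_slope' (Q x, \<xi>) (Q' v, 0)))) (at x)"
    unfolding tangential_def
    by (intro has_derivative_Pair has_derivative_mult_right
        has_derivative_compose[OF Qd graph_root_has_derivative[OF less]]
        has_derivative_compose[OF Qd graph_slope_has_derivative])
  then show ?thesis by (simp add: graph_root'_def graph_slope'_def mult_ac)
qed

text \<open>The last conclusion splits dE at x_0 into orthogonal parts. The change of the distance
  acts along the final unit tangent, and the turning of this tangent acts across it;
  \<open>dq\<close> is the variation of the covector that displaces the initial point as prescribed
  and keeps the end point.\<close>

proposition cost_dot_representation:
  fixes \<gamma> :: "real \<Rightarrow> real ^ 'n"
  assumes q0: "q0 \<in> W" "coord_x q0 = coord_x x0" and t: "t > 0" and c: "c > 0"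
    and \<rho>: "\<And>\<xi>. \<bar>\<xi> - coord_x x0\<bar> < 2 * \<rho> \<Longrightarrow> \<xi> \<in> I" and ct: "c * t < \<rho>"
    and b: "coord_x (\<gamma> t) \<in> I" and dir: "\<sigma> * (coord_x (\<gamma> t) - coord_x x0) > 0"
    and eq: "\<gamma> t - x0 = segment_integral (graph_vel \<sigma>) (q0, coord_x x0, coord_x (\<gamma> t))"
    and act: "action q0 x0 (\<gamma> t) = c * t"
    and \<gamma>': "(\<gamma> has_vector_derivative u *\<^sub>R d_x + w *\<^sub>R jet_vec 0 (coord_x (\<gamma> t))) (at t)"
    and uw: "(u, w) = c *\<^sub>R tangential q0 (coord_x (\<gamma> t))"
  obtains E :: "real ^ 'n \<Rightarrow> real \<times> real" and E' S
  where "open S" "x0 \<in> S" "E x0 = 0"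
    "\<And>x. x \<in> S \<Longrightarrow> geod_cost_dot \<gamma> t x = 1 / 2 * (E x \<bullet> E x) - c\<^sup>2 / 2"
    "\<And>x. x \<in> S \<Longrightarrow> (E has_derivative E' x) (at x)"
    "\<And>v. ((\<lambda>x. E' x v) \<longlongrightarrow> E' x0 v) (at x0)"
    "\<And>v1 v2. \<exists>dq. covector_deriv q0 (coord_x (\<gamma> t)) dq = v1 *\<^sub>R d_x + v2 *\<^sub>R jet_vec 0 (coord_x x0) \<and>
      E' x0 (v1 *\<^sub>R d_x + v2 *\<^sub>R jet_vec 0 (coord_x x0)) \<bullet> E' x0 (v1 *\<^sub>R d_x + v2 *\<^sub>R jet_vec 0 (coord_x x0))
      = (((v1, v2) \<bullet> tangential q0 (coord_x x0)) / t)\<^sup>2 +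
        (c * (dq \<bullet> jet_vec 0 (coord_x (\<gamma> t))) / graph_root (q0, coord_x (\<gamma> t)))\<^sup>2"
proof -
  define bt where "bt = \<gamma> t"
  define xb where "xb = coord_x bt"
  have \<rho>0: "\<rho> > 0" using ct t c by (meson mult_pos_pos order.strict_trans)
  have x0I: "coord_x x0 \<in> I" using \<rho>[of "coord_x x0"] \<rho>0 by simp
  have xbI: "xb \<in> I" using b by (simp add: xb_def bt_def)
  have z0: "(q0, bt) \<in> shoot_dom" using q0 x0I b by (simp add: shoot_dom_def bt_def)
  have shoot0: "shoot (q0, bt) = (x0, bt)"
    using eq q0 by (simp add: shoot_def bt_def algebra_simps)
  obtain invf where invf: "invf o\<^sub>L Blinfun (shoot' (q0, bt)) = id_blinfun"
    using shoot'_inverse[OF z0] dir q0 by (auto simp: bt_def)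
  have der: "\<And>z. z \<in> shoot_dom \<Longrightarrow> (shoot has_derivative blinfun_apply (Blinfun (shoot' z))) (at z)"
    using shoot_has_derivative by (simp add: Blinfun_shoot')
  have "\<exists>U V g. open U \<and> U \<subseteq> shoot_dom \<and> (q0, bt) \<in> U \<and> open V \<and> shoot (q0, bt) \<in> V \<and> homeomorphism U V shoot g \<and>
    (\<forall>y\<in>V. (g has_derivative inv (blinfun_apply (Blinfun (shoot' (g y))))) (at y)) \<and>
    (\<forall>y\<in>V. bij (blinfun_apply (Blinfun (shoot' (g y)))))"
  proof (rule inverse_function_theorem[OF open_shoot_dom der continuous_on_shoot' z0 invf])
    fix U V g g'
    assume *: "open U" "U \<subseteq> shoot_dom" "(q0, bt) \<in> U" "open V" "shoot (q0, bt) \<in> V" "homeomorphism U V shoot g"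
      and 1: "\<And>y. y \<in> V \<Longrightarrow> (g has_derivative g' y) (at y)"
      and 2: "\<And>y. y \<in> V \<Longrightarrow> g' y = inv (blinfun_apply (Blinfun (shoot' (g y))))"
      and 3: "\<And>y. y \<in> V \<Longrightarrow> bij (blinfun_apply (Blinfun (shoot' (g y))))"
    have "(g has_derivative inv (blinfun_apply (Blinfun (shoot' (g y))))) (at y)" if "y \<in> V" for y
      using 1[OF that] 2[OF that] by simp
    with * 3 show ?thesis by blast
  qed
  then obtain U V g where U: "open U" "U \<subseteq> shoot_dom" "(q0, bt) \<in> U"
    and V: "open V" "shoot (q0, bt) \<in> V" and hom: "homeomorphism U V shoot g"
    and g'_inv: "\<forall>y\<in>V. (g has_derivative inv (blinfun_apply (Blinfun (shoot' (g y))))) (at y)"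
    and bij: "\<And>y. y \<in> V \<Longrightarrow> bij (blinfun_apply (Blinfun (shoot' (g y))))"
    by blast
  define g' where "g' y = inv (blinfun_apply (Blinfun (shoot' (g y))))" for y
  have g': "\<And>y. y \<in> V \<Longrightarrow> (g has_derivative g' y) (at y)"
    and g'_eq: "\<And>y. y \<in> V \<Longrightarrow> g' y = inv (blinfun_apply (Blinfun (shoot' (g y))))"
    using g'_inv by (auto simp: g'_def)
  have gU: "g y \<in> shoot_dom" and shoot_g: "shoot (g y) = y" if "y \<in> V" for y
    using hom that U(2) by (auto simp: homeomorphism_def)
  have g0: "g (x0, bt) = (q0, bt)"
    using hom U(3) shoot0 by (metis homeomorphism_def)
  define Q where "Q y = fst (g y)" for y
  have Q0: "Q (x0, bt) = q0" by (simp add: Q_def g0)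
  have Qfacts: "Q (x, y) \<in> W" "coord_x x \<in> I" "coord_x y \<in> I"
      "y - x = segment_integral (graph_vel \<sigma>) (Q (x, y), coord_x x, coord_x y)" "coord_x (Q (x, y)) = coord_x x"
    if "(x, y) \<in> V" for x y
    using gU[OF that] fst_shoot_eq[OF gU[OF that] shoot_g[OF that]] by (auto simp: Q_def shoot_dom_def)
  define D where "D y = action (Q y) (fst y) (snd y)" for y
  define Q' where "Q' y v = fst (g' y v)" for y v
  have Qder: "(Q has_derivative Q' y) (at y)" if "y \<in> V" for y
    unfolding Q_def[abs_def] Q'_def[abs_def] using g'[OF that] by (rule has_derivative_fst)
  define D' where "D' y v = Q y \<bullet> (snd v - fst v) - coord_x (Q y) * coord_x (snd v - fst v)
      + \<sigma> * (coord_x (snd v) * graph_root (Q y, coord_x (snd y)) - coord_x (fst v) * graph_root (Q y, coord_x (fst y)))"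
    for y v
  have Dder: "(D has_derivative D' y) (at y)" if y: "y \<in> V" for y
  proof -
    obtain a b where ab: "y = (a, b)" by force
    have "((\<lambda>y. (Q y, fst y, snd y)) has_derivative (\<lambda>v. (Q' y v, fst v, snd v))) (at y)"
      by (intro has_derivative_Pair Qder[OF y] has_derivative_fst has_derivative_snd has_derivative_ident)
    moreover have "((\<lambda>z. action (fst z) (fst (snd z)) (snd (snd z))) has_derivative
      (\<lambda>v. Q y \<bullet> (snd (snd v) - fst (snd v)) - coord_x (Q y) * coord_x (snd (snd v) - fst (snd v))
      + \<sigma> * (coord_x (snd (snd v)) * graph_root (Q y, coord_x b) - coord_x (fst (snd v)) * graph_root (Q y, coord_x a))))
       (at (Q y, fst y, snd y))"
      using action_has_derivative[OF Qfacts(1-4)[OF y[unfolded ab]]] by (simp add: ab)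
    ultimately show ?thesis
      using has_derivative_compose unfolding D_def[abs_def] D'_def[abs_def] ab by fastforce
  qed
  have y0V: "(x0, bt) \<in> V" using V(2) shoot0 by simp
  \<comment> \<open>The pairs for which the action is known to be the distance: the action is below
    \<open>\<rho>\<close>, the orientation is right, and the initial abscissa is within
    \<open>\<rho>\<close> of that of x_0, so that a further \<open>\<rho>\<close> stays inside
    \<open>I\<close>.\<close>
  define V2 where "V2 = {y \<in> V. D y < \<rho> \<and> \<bar>coord_x (fst y) - coord_x x0\<bar> < \<rho> \<and> \<sigma> * (coord_x (snd y) - coord_x (fst y)) > 0}"
  have "open V2"
  proof -
    have "continuous_on V D"
      using Dder by (meson continuous_at_imp_continuous_on has_derivative_continuous)
    then have o1: "open (V \<inter> D -` {..<\<rho>})"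
      using V(1) by (intro continuous_open_preimage) auto
    have o2: "open {y :: (real ^ 'n) \<times> (real ^ 'n). \<bar>coord_x (fst y) - coord_x x0\<bar> < \<rho>}"
      by (intro open_Collect_less continuous_intros)
    have o3: "open {y :: (real ^ 'n) \<times> (real ^ 'n). \<sigma> * (coord_x (snd y) - coord_x (fst y)) > 0}"
      by (intro open_Collect_less continuous_intros)
    have "open ((V \<inter> D -` {..<\<rho>}) \<inter> {y. \<bar>coord_x (fst y) - coord_x x0\<bar> < \<rho>}
       \<inter> {y. \<sigma> * (coord_x (snd y) - coord_x (fst y)) > 0})"
      by (rule open_Int[OF open_Int[OF o1 o2] o3])
    also have "\<dots> = V2" by (auto simp: V2_def)
    finally show ?thesis .
  qed
  have D0: "D (x0, bt) = c * t" using act Q0 by (simp add: D_def bt_def)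
  have y0V2: "(x0, bt) \<in> V2"
    using y0V D0 ct \<rho>0 dir by (simp add: V2_def bt_def)
  have dist: "sr_dist x y = D (x, y)" if "(x, y) \<in> V2" for x y
    unfolding D_def fst_conv snd_conv
  proof (rule sr_dist_eq_action[where \<rho>=\<rho>])
    have V: "(x, y) \<in> V" using that by (simp add: V2_def)
    show "Q (x, y) \<in> W" "coord_x y \<in> I"
      "y - x = segment_integral (graph_vel \<sigma>) (Q (x, y), coord_x x, coord_x y)"
      using Qfacts[OF V] by auto
    show "action (Q (x, y)) x y \<le> \<rho>" "0 \<le> \<rho>" "0 \<le> \<sigma> * (coord_x y - coord_x x)"
      using that \<rho>0 by (auto simp: V2_def D_def)
    fix \<xi> assume "\<bar>\<xi> - coord_x x\<bar> \<le> \<rho>"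
    moreover have "\<bar>coord_x x - coord_x x0\<bar> < \<rho>" using that by (simp add: V2_def)
    ultimately show "\<xi> \<in> I" by (intro \<rho>) linarith
  qed
  define S where "S = {x. (x, bt) \<in> V2}"
  have "open S"
  proof -
    have "S = (\<lambda>x. (x, bt)) -` V2" by (auto simp: S_def)
    then show ?thesis using \<open>open V2\<close> by (simp add: open_vimage continuous_on_Pair)
  qed
  have x0S: "x0 \<in> S" using y0V2 by (simp add: S_def)
  define E where "E x = (D (x, bt) / t) *\<^sub>R tangential (Q (x, bt)) xb - (u, w)" for x
  define E' where "E' x v = (D' (x, bt) (v, 0) / t) *\<^sub>R tangential (Q (x, bt)) xb +
      (D (x, bt) / t * (Q' (x, bt) (v, 0) \<bullet> jet_vec 0 xb)) *\<^sub>R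
        (- (\<sigma> * graph_slope (Q (x, bt), xb) / graph_root (Q (x, bt), xb)), 1)" for x v
  have Sd: "((\<lambda>x. (x, bt)) has_derivative (\<lambda>v. (v, 0))) (at x)" for x
    by (intro has_derivative_Pair has_derivative_ident has_derivative_const)
  have SV: "(x, bt) \<in> V" if "x \<in> S" for x using that by (simp add: S_def V2_def)
  have Eder: "(E has_derivative E' x) (at x)" if x: "x \<in> S" for x
  proof -
    have "((\<lambda>x. D (x, bt) / t) has_derivative (\<lambda>v. D' (x, bt) (v, 0) / t)) (at x)"
      by (intro bounded_linear.has_derivative[OF bounded_linear_divide] has_derivative_compose[OF Sd Dder[OF SV[OF x]]])
    moreover have "((\<lambda>x. tangential (Q (x, bt)) xb) has_derivative
        (\<lambda>v. (Q' (x, bt) (v, 0) \<bullet> jet_vec 0 xb) *\<^sub>R (- (\<sigma> * graph_slope (Q (x, bt), xb) / graph_root (Q (x, bt), xb)), 1))) (at x)"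
      using Qfacts(1)[OF SV[OF x]] xbI
      by (intro tangential_has_derivative has_derivative_compose[OF Sd Qder[OF SV[OF x]]]) auto
    ultimately have "(E has_derivative (\<lambda>v. ((D (x, bt) / t) *\<^sub>R
         ((Q' (x, bt) (v, 0) \<bullet> jet_vec 0 xb) *\<^sub>R (- (\<sigma> * graph_slope (Q (x, bt), xb) / graph_root (Q (x, bt), xb)), 1))
         + (D' (x, bt) (v, 0) / t) *\<^sub>R tangential (Q (x, bt)) xb) - 0)) (at x)"
      unfolding E_def[abs_def]
      by (intro has_derivative_diff has_derivative_scaleR has_derivative_const)
    then show ?thesis
      by (rule has_derivative_eq_rhs) (simp add: fun_eq_iff E'_def)
  qed
  have E0: "E x0 = 0"
    using uw t D0 Q0 by (simp add: E_def xb_def bt_def)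
  have uw2: "u\<^sup>2 + w\<^sup>2 = c\<^sup>2"
  proof -
    have "(u, w) \<bullet> (u, w) = c\<^sup>2 * (tangential q0 xb \<bullet> tangential q0 xb)"
      unfolding uw xb_def bt_def by (simp add: power2_eq_square)
    then show ?thesis
      using tangential_inner_self[OF q0(1) xbI] by (simp add: power2_eq_square)
  qed
  have cost: "geod_cost_dot \<gamma> t x = 1 / 2 * (E x \<bullet> E x) - c\<^sup>2 / 2" if x: "x \<in> S" for x
  proof -
    let ?\<tau> = "tangential (Q (x, bt)) xb"
    have V: "(x, bt) \<in> V" by (rule SV[OF x])
    have "((\<lambda>s. (x, \<gamma> s)) has_derivative (\<lambda>h. (0, h *\<^sub>R (u *\<^sub>R d_x + w *\<^sub>R jet_vec 0 xb)))) (at t)"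
      using \<gamma>' unfolding has_vector_derivative_def xb_def bt_def
      by (intro has_derivative_Pair has_derivative_const)
    moreover have "(D has_derivative D' (x, bt)) (at (x, \<gamma> t))"
      using Dder[OF V] by (simp add: bt_def)
    ultimately have "((\<lambda>s. D (x, \<gamma> s)) has_derivative
        (\<lambda>h. D' (x, bt) (0, h *\<^sub>R (u *\<^sub>R d_x + w *\<^sub>R jet_vec 0 xb)))) (at t)"
      by (rule has_derivative_compose)
    \<comment> \<open>First variation at the end point: the horizontal gradient of the distance is
      the final unit tangent of the minimizer.\<close>
    moreover have "D' (x, bt) (0, h *\<^sub>R (u *\<^sub>R d_x + w *\<^sub>R jet_vec 0 xb)) = (?\<tau> \<bullet> (u, w)) * h" for h
      using n graph_slope_frame[of "Q (x, bt)" "h * u" "h * w" xb]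
      by (simp add: D'_def tangential_def scaleR_add_right xb_def[symmetric]) (simp add: algebra_simps)
    ultimately have Ds: "((\<lambda>s. D (x, \<gamma> s)) has_real_derivative (?\<tau> \<bullet> (u, w))) (at t)"
      by (simp add: has_field_derivative_def)
    have cd: "((\<lambda>s. - (1 / (2 * s)) * (D (x, \<gamma> s))\<^sup>2) has_real_derivative
       (D (x, bt))\<^sup>2 / (2 * t\<^sup>2) - D (x, bt) * (?\<tau> \<bullet> (u, w)) / t) (at t)"
      using t by (auto intro!: derivative_eq_intros Ds simp: bt_def field_simps power2_eq_square)
    \<comment> \<open>The cost is given by the action only for pairs in \<open>V2\<close>;
      continuity of \<open>\<gamma>\<close> ensures this for all times near t, which is what
      \<open>deriv\<close> sees.\<close>
    have ev: "\<forall>\<^sub>F s in nhds t. - (1 / (2 * s)) * (D (x, \<gamma> s))\<^sup>2 = geod_cost \<gamma> s x"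
    proof -
      have "continuous (at t) (\<lambda>s. (x, \<gamma> s))"
        using has_vector_derivative_continuous[OF \<gamma>'] by (intro continuous_intros)
      then have "((\<lambda>s. (x, \<gamma> s)) \<longlongrightarrow> (x, \<gamma> t)) (nhds t)"
        unfolding continuous_at using tendsto_at_iff_tendsto_nhds[of "\<lambda>s. (x, \<gamma> s)" t] by blast
      from topological_tendstoD[OF this \<open>open V2\<close>] x
      have "\<forall>\<^sub>F s in nhds t. (x, \<gamma> s) \<in> V2" by (simp add: S_def bt_def)
      then show ?thesis
        by eventually_elim (simp add: geod_cost_def dist)
    qed
    have "((\<lambda>s. geod_cost \<gamma> s x) has_real_derivative
       (D (x, bt))\<^sup>2 / (2 * t\<^sup>2) - D (x, bt) * (?\<tau> \<bullet> (u, w)) / t) (at t)"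
      by (rule DERIV_cong_ev[OF refl ev refl, THEN iffD1, OF cd])
    then have "geod_cost_dot \<gamma> t x = (D (x, bt))\<^sup>2 / (2 * t\<^sup>2) - D (x, bt) * (?\<tau> \<bullet> (u, w)) / t"
      unfolding geod_cost_dot_def by (rule DERIV_imp_deriv)
    also have "\<dots> = 1 / 2 * (E x \<bullet> E x) - c\<^sup>2 / 2"
    proof -
      have "E x \<bullet> E x = (D (x, bt) / t)\<^sup>2 * (?\<tau> \<bullet> ?\<tau>) - 2 * (D (x, bt) / t) * (?\<tau> \<bullet> (u, w)) + (u, w) \<bullet> (u, w)"
        by (simp add: E_def inner_diff_left inner_diff_right inner_commute[of "(u, w)"] power2_eq_square algebra_simps)
      also have "\<dots> = (D (x, bt) / t)\<^sup>2 - 2 * (D (x, bt) / t) * (?\<tau> \<bullet> (u, w)) + c\<^sup>2"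
        using tangential_inner_self[OF Qfacts(1)[OF V] xbI] uw2 by (simp add: power2_eq_square)
      finally show ?thesis by (simp add: field_simps power_divide)
    qed
    finally show ?thesis .
  qed
  \<comment> \<open>E is only C^1; continuity of its derivative at x_0 takes the place of a second
    derivative when the square is differentiated twice.\<close>
  have contE: "((\<lambda>x. E' x v) \<longlongrightarrow> E' x0 v) (at x0)" for v
  proof -
    have y: "((\<lambda>x. (x, bt)) \<longlongrightarrow> (x0, bt)) (at x0)"
      by (intro tendsto_intros)
    have ev: "\<forall>\<^sub>F x in at x0. (x, bt) \<in> V"
      using eventually_at_topological \<open>open S\<close> x0S SV by blast
    have contg: "((\<lambda>x. g (x, bt)) \<longlongrightarrow> g (x0, bt)) (at x0)"
      using isCont_tendsto_compose[OF has_derivative_continuous[OF g'[OF y0V]] y] .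
    then have contQ: "((\<lambda>x. Q (x, bt)) \<longlongrightarrow> q0) (at x0)"
      unfolding Q_def using tendsto_fst g0 by fastforce
    have "((\<lambda>x. Blinfun (shoot' (g (x, bt)))) \<longlongrightarrow> Blinfun (shoot' (g (x0, bt)))) (at x0)"
    proof -
      have "isCont (\<lambda>z. Blinfun (shoot' z)) (g (x0, bt))"
        using continuous_on_shoot' open_shoot_dom gU[OF y0V] continuous_on_eq_continuous_at by blast
      then show ?thesis using contg by (rule isCont_tendsto_compose)
    qed
    moreover have "\<forall>\<^sub>F x in at x0. bij (blinfun_apply (Blinfun (shoot' (g (x, bt)))))"
      using ev by eventually_elim (rule bij)
    ultimately have "((\<lambda>x. inv (blinfun_apply (Blinfun (shoot' (g (x, bt))))) (v, 0)) \<longlongrightarrow> g' (x0, bt) (v, 0)) (at x0)"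
      unfolding g'_eq[OF y0V]
      by (rule continuous_inverse_derivative[where A="\<lambda>x. Blinfun (shoot' (g (x, bt)))", OF _ _ bij[OF y0V]])
    then have "((\<lambda>x. g' (x, bt) (v, 0)) \<longlongrightarrow> g' (x0, bt) (v, 0)) (at x0)"
      by (rule Lim_transform_eventually) (use ev in \<open>auto elim!: eventually_mono simp: g'_eq\<close>)
    then have contQ': "((\<lambda>x. Q' (x, bt) (v, 0)) \<longlongrightarrow> Q' (x0, bt) (v, 0)) (at x0)"
      unfolding Q'_def by (rule tendsto_fst)
    have contD: "((\<lambda>x. D (x, bt)) \<longlongrightarrow> D (x0, bt)) (at x0)"
      using has_derivative_continuous[OF Dder[OF y0V]] isCont_tendsto_compose[OF _ y] by blast
    have root_slope: "((\<lambda>x. graph_root (Q (x, bt), h x)) \<longlongrightarrow> graph_root (q0, h0)) (at x0)"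
      "((\<lambda>x. graph_slope (Q (x, bt), h x)) \<longlongrightarrow> graph_slope (q0, h0)) (at x0)"
      if "(h \<longlongrightarrow> h0) (at x0)" for h h0
    proof -
      have "isCont graph_slope (q0, h0)" "isCont graph_root (q0, h0)"
        using continuous_on_graph_slope[of UNIV "\<lambda>x :: (real ^ 'n) \<times> real. x"] continuous_on_graph_root[of UNIV "\<lambda>x :: (real ^ 'n) \<times> real. x"]
        by (simp_all add: continuous_on_eq_continuous_at)
      moreover have "((\<lambda>x. (Q (x, bt), h x)) \<longlongrightarrow> (q0, h0)) (at x0)"
        by (intro tendsto_intros contQ that)
      ultimately show "((\<lambda>x. graph_root (Q (x, bt), h x)) \<longlongrightarrow> graph_root (q0, h0)) (at x0)"
        "((\<lambda>x. graph_slope (Q (x, bt), h x)) \<longlongrightarrow> graph_slope (q0, h0)) (at x0)"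
        using isCont_tendsto_compose by blast+
    qed
    have tx: "((\<lambda>x. coord_x x) \<longlongrightarrow> coord_x x0) (at x0)"
      by (intro tendsto_intros)
    have r0: "graph_root (q0, xb) \<noteq> 0" using graph_root_pos[OF slope_less[OF q0(1) xbI]] by simp
    show ?thesis
      unfolding E'_def D'_def tangential_def fst_conv snd_conv Q0
      by (intro tendsto_intros contQ contQ' contD root_slope tx r0 t[THEN less_imp_neq, symmetric])
  qed
  have final: "\<exists>dq. covector_deriv q0 (coord_x (\<gamma> t)) dq = v1 *\<^sub>R d_x + v2 *\<^sub>R jet_vec 0 (coord_x x0) \<and>
      E' x0 (v1 *\<^sub>R d_x + v2 *\<^sub>R jet_vec 0 (coord_x x0)) \<bullet> E' x0 (v1 *\<^sub>R d_x + v2 *\<^sub>R jet_vec 0 (coord_x x0))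
      = (((v1, v2) \<bullet> tangential q0 (coord_x x0)) / t)\<^sup>2 +
        (c * (dq \<bullet> jet_vec 0 (coord_x (\<gamma> t))) / graph_root (q0, coord_x (\<gamma> t)))\<^sup>2" for v1 v2
  proof -
    let ?v = "v1 *\<^sub>R d_x + v2 *\<^sub>R jet_vec 0 (coord_x x0) :: real ^ 'n"
    define dq where "dq = Q' (x0, bt) (?v, 0)"
    have "shoot' (q0, bt) (g' (x0, bt) (?v, 0)) = (?v, 0)"
      using bij[OF y0V] Blinfun_shoot'[OF z0] by (simp add: g'_eq[OF y0V] g0 bij_is_surj surj_f_inv_f)
    then have dq: "covector_deriv q0 xb dq = ?v"
      by (auto simp: shoot'_def dq_def Q'_def xb_def zero_prod_def)
    define R where "R = graph_root (q0, xb)"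
    define s where "s = graph_slope (q0, xb)"
    have less: "\<bar>s\<bar> < 1" unfolding s_def by (rule slope_less[OF q0(1) xbI])
    have R: "R > 0" "R\<^sup>2 = 1 - s\<^sup>2"
      using graph_root_pos[of "(q0, xb)"] graph_root_square[of "(q0, xb)"] less by (auto simp: R_def s_def)
    define \<tau> where "\<tau> = (v1, v2) \<bullet> tangential q0 (coord_x x0)"
    have D'0: "D' (x0, bt) (?v, 0) = - \<tau>"
      using n graph_slope_frame[of q0 v1 v2 "coord_x x0"]
      by (simp add: D'_def Q0 \<tau>_def tangential_def) (simp add: algebra_simps)
    have E'0: "E' x0 ?v = (- \<tau> / t) *\<^sub>R (\<sigma> * R, s) + (c * (dq \<bullet> jet_vec 0 xb)) *\<^sub>R (- (\<sigma> * s / R), 1)"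
      using t by (simp add: E'_def D'0 Q0 D0 R_def s_def tangential_def dq_def)
    define A where "A = - \<tau> / t"
    define B where "B = c * (dq \<bullet> jet_vec 0 xb)"
    \<comment> \<open>The vectors \<open>(\<sigma> * R, s)\<close> and
      \<open>(- (\<sigma> * s / R), 1)\<close> are orthogonal, of lengths 1 and 1/R, so the mixed
      terms drop out below.\<close>
    have XY: "(\<sigma> * R) * (\<sigma> * R) = R\<^sup>2" "(\<sigma> * R) * (\<sigma> * s / R) = s" "(\<sigma> * s / R) * (\<sigma> * s / R) = s\<^sup>2 / R\<^sup>2"
      using R(1) sigma by (simp_all add: power2_eq_square)
    have "E' x0 ?v \<bullet> E' x0 ?v = A * A * ((\<sigma> * R) * (\<sigma> * R)) - 2 * A * B * ((\<sigma> * R) * (\<sigma> * s / R))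
        + B * B * ((\<sigma> * s / R) * (\<sigma> * s / R)) + (A * s + B)\<^sup>2"
      unfolding E'0 A_def[symmetric] B_def[symmetric] by (simp add: power2_eq_square algebra_simps)
    also have "\<dots> = A\<^sup>2 * (R\<^sup>2 + s\<^sup>2) + B\<^sup>2 * (s\<^sup>2 / R\<^sup>2 + 1)"
      unfolding XY by (simp add: power2_eq_square algebra_simps)
    also have "s\<^sup>2 / R\<^sup>2 + 1 = 1 / R\<^sup>2"
      using R by (simp add: field_simps)
    also have "A\<^sup>2 * (R\<^sup>2 + s\<^sup>2) + B\<^sup>2 * (1 / R\<^sup>2) = (\<tau> / t)\<^sup>2 + (c * (dq \<bullet> jet_vec 0 xb) / R)\<^sup>2"
      by (simp add: R(2) A_def B_def power_divide)
    finally show ?thesis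
      using dq by (intro exI[of _ dq]) (simp add: \<tau>_def R_def xb_def bt_def)
  qed
  show thesis
    by (rule that[OF \<open>open S\<close> x0S E0 cost Eder contE final])
qed

end

section \<open>Functions of class \<open>C\<^sup>k\<close> in one variable\<close>

text \<open>Derivatives are taken within \<open>S\<close> because the relevant sets are intervals
  [0, \<delta>] and all information is extracted at their left end point.\<close>

primrec Cn :: "nat \<Rightarrow> real set \<Rightarrow> (real \<Rightarrow> real) \<Rightarrow> bool" where
  "Cn 0 S f \<longleftrightarrow> continuous_on S f"
| "Cn (Suc k) S f \<longleftrightarrow>
     (\<exists>f'. (\<forall>x\<in>S. (f has_real_derivative f' x) (at x within S)) \<and> Cn k S f')"

lemma CnI: "(\<And>x. x \<in> S \<Longrightarrow> (f has_real_derivative f' x) (at x within S)) \<Longrightarrow> Cn k S f' \<Longrightarrow> Cn (Suc k) S f"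
  by auto

lemma Cn_SucD: "Cn (Suc k) S f \<Longrightarrow> Cn k S f"
proof (induction k arbitrary: f)
  case 0
  then show ?case by (auto intro: DERIV_continuous_on)
next
  case (Suc k)
  then show ?case by (metis Cn.simps(2))
qed

lemma Cn_continuous_on: "Cn k S f \<Longrightarrow> continuous_on S f"
  by (induction k) (auto dest: Cn_SucD simp del: Cn.simps(2))

lemma Cn_const [intro, simp]: "Cn k S (\<lambda>x. c)"
proof (induction k arbitrary: c)
  case (Suc k)
  then show ?case by (intro CnI[of S _ "\<lambda>_. 0"]) auto
qed auto

lemma Cn_ident [intro, simp]: "Cn k S (\<lambda>x. x)"
proof (cases k)
  case (Suc k')
  then show ?thesis by (auto intro!: CnI[of S _ "\<lambda>_. 1"] simp del: Cn.simps)
qed auto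

lemma Cn_add: "Cn k S f \<Longrightarrow> Cn k S g \<Longrightarrow> Cn k S (\<lambda>x. f x + g x)"
proof (induction k arbitrary: f g)
  case (Suc k)
  then obtain f' g' where "\<forall>x\<in>S. (f has_real_derivative f' x) (at x within S)" "Cn k S f'"
    "\<forall>x\<in>S. (g has_real_derivative g' x) (at x within S)" "Cn k S g'" by auto
  then show ?case
    by (intro CnI[of S _ "\<lambda>x. f' x + g' x"] Suc.IH) (auto intro!: derivative_intros)
qed (auto intro: continuous_intros)

lemma Cn_mult: "Cn k S f \<Longrightarrow> Cn k S g \<Longrightarrow> Cn k S (\<lambda>x. f x * g x)"
proof (induction k arbitrary: f g)
  case (Suc k)
  then obtain f' g' where *: "\<forall>x\<in>S. (f has_real_derivative f' x) (at x within S)" "Cn k S f'"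
    "\<forall>x\<in>S. (g has_real_derivative g' x) (at x within S)" "Cn k S g'" by auto
  have "Cn k S f" "Cn k S g" using Suc.prems Cn_SucD by blast+
  with * show ?case
    by (intro CnI[of S _ "\<lambda>x. f' x * g x + f x * g' x"] Cn_add Suc.IH)
      (auto intro!: derivative_eq_intros simp: mult.commute)
qed (auto intro: continuous_intros)

lemma Cn_minus: "Cn k S f \<Longrightarrow> Cn k S (\<lambda>x. - f x)"
  using Cn_mult[OF Cn_const[of k S "-1"]] by simp

lemma Cn_diff: "Cn k S f \<Longrightarrow> Cn k S g \<Longrightarrow> Cn k S (\<lambda>x. f x - g x)"
  using Cn_add[OF _ Cn_minus] by simp

lemma Cn_power: "Cn k S f \<Longrightarrow> Cn k S (\<lambda>x. f x ^ j)"
  by (induction j) (auto intro: Cn_mult)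

lemma Cn_sum: "(\<And>i. i \<in> A \<Longrightarrow> Cn k S (f i)) \<Longrightarrow> Cn k S (\<lambda>x. \<Sum>i\<in>A. f i x)"
  by (induction A rule: infinite_finite_induct) (auto intro: Cn_add)

lemma Cn_prod: "(\<And>i. i \<in> A \<Longrightarrow> Cn k S (f i)) \<Longrightarrow> Cn k S (\<lambda>x. \<Prod>i\<in>A. f i x)"
  by (induction A rule: infinite_finite_induct) (auto intro: Cn_mult)

lemma Cn_inverse:
  assumes "\<And>x. x \<in> S \<Longrightarrow> f x \<noteq> 0"
  shows "Cn k S f \<Longrightarrow> Cn k S (\<lambda>x. inverse (f x))"
proof (induction k)
  case 0
  then show ?case using assms by (auto intro!: continuous_on_inverse)
next
  case (Suc k)
  then obtain f' where *: "\<And>x. x \<in> S \<Longrightarrow> (f has_real_derivative f' x) (at x within S)" "Cn k S f'"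
    by auto
  have "Cn k S (\<lambda>x. inverse (f x))" using Suc Cn_SucD by blast
  then show ?case
    using * assms
    by (intro CnI[of S _ "\<lambda>x. - (inverse (f x) * f' x * inverse (f x))"] Cn_minus Cn_mult)
      (auto intro!: derivative_eq_intros)
qed

lemma Cn_divide:
  "(\<And>x. x \<in> S \<Longrightarrow> g x \<noteq> 0) \<Longrightarrow> Cn k S f \<Longrightarrow> Cn k S g \<Longrightarrow> Cn k S (\<lambda>x. f x / g x)"
  using Cn_mult[OF _ Cn_inverse] by (simp add: divide_inverse)

lemma Cn_compose:
  "Cn k T f \<Longrightarrow> Cn k S g \<Longrightarrow> g ` S \<subseteq> T \<Longrightarrow> Cn k S (\<lambda>x. f (g x))"
proof (induction k arbitrary: f)
  case 0
  then show ?case using continuous_on_compose2 by auto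
next
  case (Suc k)
  then obtain f' g' where *: "\<forall>x\<in>T. (f has_real_derivative f' x) (at x within T)" "Cn k T f'"
    "\<forall>x\<in>S. (g has_real_derivative g' x) (at x within S)" "Cn k S g'" by auto
  have "Cn k S (\<lambda>x. f' (g x))" using Suc Cn_SucD *(2) by blast
  moreover have "((\<lambda>x. f (g x)) has_real_derivative f' (g x) * g' x) (at x within S)" if "x \<in> S" for x
  proof -
    have "(f has_real_derivative f' (g x)) (at (g x) within g ` S)"
      using *(1) that Suc.prems(3) by (auto intro: has_field_derivative_subset)
    from DERIV_image_chain[OF this] *(3) that show ?thesis by (auto simp: o_def)
  qed
  ultimately show ?case
    using *(4) by (intro CnI[of S _ "\<lambda>x. f' (g x) * g' x"] Cn_mult) auto
qed

text \<open>Used to divide by a variable that vanishes at 0: a mean value over a segment starting at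
  0 is as smooth as its integrand, also where the segment degenerates.\<close>

lemma Cn_scaled_integral:
  assumes S: "convex S" "0 \<in> S"
  shows "Cn k S f \<Longrightarrow> continuous_on {0..1} w \<Longrightarrow> Cn k S (\<lambda>x. integral {0..1} (\<lambda>r. w r * f (x * r)))"
proof (induction k arbitrary: f w)
  have xr: "x * r \<in> S" if "x \<in> S" "r \<in> {0..1}" for x r
    using convexD[OF S(1) that(1) S(2), of r "1 - r"] that(2) by (simp add: mult.commute)
  have cont: "continuous_on (S \<times> {0..1}) (\<lambda>(x, r). w r * f (x * r))"
    if "continuous_on S f" "continuous_on {0..1} w" for f w :: "real \<Rightarrow> real"
    unfolding split_def using xr
    by (intro continuous_intros continuous_on_compose2[OF that(1)] continuous_on_compose2[OF that(2)]) auto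
  {
    case 0
    then show ?case
      using integral_continuous_on_param[of S 0 1 "\<lambda>x r. w r * f (x * r)"] cont by simp
  next
    case (Suc k)
    then obtain f' where *: "\<And>x. x \<in> S \<Longrightarrow> (f has_real_derivative f' x) (at x within S)" "Cn k S f'"
      by auto
    have cf: "continuous_on S f" "continuous_on S f'"
      using Suc.prems *(2) Cn_continuous_on by blast+
    have cw: "continuous_on {0..1} (\<lambda>r. w r * r)" using Suc.prems by (intro continuous_intros)
    have "((\<lambda>x. integral {0..1} (\<lambda>r. w r * f (x * r))) has_real_derivative
        integral {0..1} (\<lambda>r. (w r * r) * f' (x * r))) (at x within S)" if x: "x \<in> S" for x
      unfolding box_real(2)[symmetric]
    proof (rule leibniz_rule_field_derivative[OF _ _ _ x S(1)])
      fix y r :: real assume y: "y \<in> S" "r \<in> cbox 0 1"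
      have "(\<lambda>y. y * r) ` S \<subseteq> S" using xr y by auto
      then have "((\<lambda>y. f (y * r)) has_real_derivative f' (y * r) * r) (at y within S)"
      proof -
        have "(f has_real_derivative f' (y * r)) (at (y * r) within (\<lambda>y. y * r) ` S)"
          using *(1) xr[OF y(1)] y(2) \<open>(\<lambda>y. y * r) ` S \<subseteq> S\<close>
          by (auto intro: has_field_derivative_subset)
        moreover have "((\<lambda>y. y * r) has_real_derivative r) (at y within S)"
          by (auto intro!: derivative_eq_intros)
        ultimately show ?thesis
          using DERIV_image_chain[of f "f' (y * r)" "\<lambda>y. y * r" y S r] by (simp add: o_def)
      qed
      from DERIV_cmult[OF this, of "w r"]
      show "((\<lambda>y. w r * f (y * r)) has_real_derivative w r * r * f' (y * r)) (at y within S)"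
        by (simp add: mult_ac)
    next
      fix y assume "y \<in> S"
      then have "continuous_on (cbox 0 1) (\<lambda>r. w r * f (y * r))"
        using xr Suc.prems by (intro continuous_intros continuous_on_compose2[OF cf(1)]) auto
      then show "(\<lambda>r. w r * f (y * r)) integrable_on cbox 0 1" by (rule integrable_continuous)
    qed (use cont[OF cf(2) cw] in simp)
    then show ?case
      using Suc.IH[OF *(2) cw] by (rule CnI)
  }
qed

section \<open>Second order expansions at \<open>0\<close>\<close>

text \<open>The remainder is cubic rather than just smaller than t^2, since the theorem divides by
  t^2 and still asserts O(t).\<close>

definition jet2 :: "(real \<Rightarrow> real) \<Rightarrow> real \<Rightarrow> real \<Rightarrow> real \<Rightarrow> bool" where
  "jet2 f a b c \<longleftrightarrow> (\<lambda>t. f t - (a + b * t + c * t\<^sup>2)) \<in> O[at_right 0](\<lambda>t. t ^ 3)"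

lemma bigo_right_power_mono:
  "i \<le> j \<Longrightarrow> (\<lambda>t::real. t ^ j) \<in> O[at_right 0](\<lambda>t. t ^ i)"
proof (rule bigoI[where c=1])
  assume "i \<le> j"
  have "\<forall>\<^sub>F t :: real in at_right 0. 0 < t \<and> t < 1"
    by (simp add: eventually_at_right_field) (metis less_numeral_extra(1))
  then show "\<forall>\<^sub>F t :: real in at_right 0. norm (t ^ j) \<le> 1 * norm (t ^ i)"
    by eventually_elim (use \<open>i \<le> j\<close> in \<open>auto intro: power_decreasing simp: power_abs\<close>)
qed

lemma jet2_const: "jet2 (\<lambda>t. k) k 0 0"
  by (simp add: jet2_def)

lemma jet2_ident: "jet2 (\<lambda>t. t) 0 1 0"
  by (simp add: jet2_def)

lemma jet2_add:
  assumes "jet2 f a b c" "jet2 g a' b' c'"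
  shows "jet2 (\<lambda>t. f t + g t) (a + a') (b + b') (c + c')"
  using sum_in_bigo(1)[OF assms[unfolded jet2_def]] by (simp add: jet2_def algebra_simps)

lemma bigo_const_mult: "f \<in> O[F](g) \<Longrightarrow> (\<lambda>t. (c::real) * f t) \<in> O[F](g)"
  by (cases "c = 0") auto

lemma jet2_cmult:
  assumes "jet2 f a b c"
  shows "jet2 (\<lambda>t. k * f t) (k * a) (k * b) (k * c)"
  using bigo_const_mult[OF assms[unfolded jet2_def], of k] by (simp add: jet2_def algebra_simps)

lemma jet2_sum:
  "(\<And>i. i \<in> A \<Longrightarrow> jet2 (f i) (a i) (b i) (c i)) \<Longrightarrow>
    jet2 (\<lambda>t. \<Sum>i\<in>A. f i t) (\<Sum>i\<in>A. a i) (\<Sum>i\<in>A. b i) (\<Sum>i\<in>A. c i)"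
  by (induction A rule: infinite_finite_induct) (auto intro: jet2_add jet2_const)

lemma bigo_poly2: "(\<lambda>t. a + b * t + c * t\<^sup>2 :: real) \<in> O[at_right 0](\<lambda>t. 1)"
proof -
  have "(\<lambda>t::real. t ^ 1) \<in> O[at_right 0](\<lambda>t. t ^ 0)" "(\<lambda>t::real. t ^ 2) \<in> O[at_right 0](\<lambda>t. t ^ 0)"
    by (rule bigo_right_power_mono; simp)+
  then have "(\<lambda>t::real. b * t) \<in> O[at_right 0](\<lambda>t. 1)" "(\<lambda>t::real. c * t\<^sup>2) \<in> O[at_right 0](\<lambda>t. 1)"
    using bigo_const_mult by auto
  then show ?thesis by (intro sum_in_bigo) auto
qed

lemma jet2_bounded:
  assumes "jet2 f a b c"
  shows "f \<in> O[at_right 0](\<lambda>t. 1)"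
proof -
  have "(\<lambda>t::real. t ^ 3) \<in> O[at_right 0](\<lambda>t. 1)"
    using bigo_right_power_mono[of 0 3] by simp
  then have "(\<lambda>t. f t - (a + b * t + c * t\<^sup>2)) \<in> O[at_right 0](\<lambda>t. 1)"
    using assms unfolding jet2_def by (rule landau_o.big_trans[rotated])
  from sum_in_bigo(1)[OF this bigo_poly2[of a b c]] show ?thesis by simp
qed

lemma jet2_mult:
  assumes f: "jet2 f a b c" and g: "jet2 g a' b' c'"
  shows "jet2 (\<lambda>t. f t * g t) (a * a') (a * b' + b * a') (a * c' + b * b' + c * a')"
proof -
  let ?p = "\<lambda>t. a + b * t + c * t\<^sup>2" and ?q = "\<lambda>t. a' + b' * t + c' * t\<^sup>2"
  have 1: "(\<lambda>t. (f t - ?p t) * g t) \<in> O[at_right 0](\<lambda>t. t ^ 3)"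
    using landau_o.big.mult[OF f[unfolded jet2_def] jet2_bounded[OF g]] by simp
  have 2: "(\<lambda>t. (g t - ?q t) * ?p t) \<in> O[at_right 0](\<lambda>t. t ^ 3)"
    using landau_o.big.mult[OF g[unfolded jet2_def] bigo_poly2] by simp
  have 3: "(\<lambda>t. t ^ 3 * ((b * c' + c * b') + (c * c') * t + 0 * t\<^sup>2)) \<in> O[at_right 0](\<lambda>t. t ^ 3)"
    using landau_o.big.mult[OF landau_o.big_refl[of "\<lambda>t::real. t ^ 3"] bigo_poly2] by (simp only: mult_1_right)
  have "f t * g t - (a * a' + (a * b' + b * a') * t + (a * c' + b * b' + c * a') * t\<^sup>2)
     = (f t - ?p t) * g t + ((g t - ?q t) * ?p t + t ^ 3 * ((b * c' + c * b') + (c * c') * t + 0 * t\<^sup>2))" for t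
    by (simp add: algebra_simps power2_eq_square power3_eq_cube)
  then show ?thesis
    unfolding jet2_def using sum_in_bigo(1)[OF 1 sum_in_bigo(1)[OF 2 3]] by simp
qed

text \<open>This legitimates comparison of coefficients: an identity between functions that holds
  for small t > 0 becomes a system of equations for their jets.\<close>

lemma jet2_unique:
  assumes "jet2 f a b c" "jet2 f a' b' c'"
  shows "a = a'" "b = b'" "c = c'"
proof -
  have *: "(\<lambda>t::real. A + B * t + C * t\<^sup>2) \<in> O[at_right 0](\<lambda>t. t ^ 3) \<Longrightarrow> A = 0 \<and> B = 0 \<and> C = 0" for A B C
  proof -
    assume "(\<lambda>t::real. A + B * t + C * t\<^sup>2) \<in> O[at_right 0](\<lambda>t. t ^ 3)"
    then obtain K where K: "\<forall>\<^sub>F t in at_right 0. norm (A + B * t + C * t\<^sup>2) \<le> K * norm (t ^ 3)"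
      by (auto elim: landau_o.bigE)
    have lim: "((\<lambda>t::real. K * norm (t ^ j)) \<longlongrightarrow> 0) (at_right 0)" if "j > 0" for j
      using that by (auto intro!: tendsto_eq_intros)
    have "((\<lambda>t::real. A + B * t + C * t\<^sup>2) \<longlongrightarrow> A) (at_right 0)" by (auto intro!: tendsto_eq_intros)
    moreover have "((\<lambda>t::real. A + B * t + C * t\<^sup>2) \<longlongrightarrow> 0) (at_right 0)"
      by (rule Lim_null_comparison[OF K lim]) simp
    ultimately have A: "A = 0" using tendsto_unique trivial_limit_at_right_real by blast
    have K': "\<forall>\<^sub>F t :: real in at_right 0. norm (B + C * t) \<le> K * norm (t ^ 2)"
      using K eventually_at_right_less[of 0]
    proof eventually_elim
      case (elim t)
      have "t * norm (B + C * t) = norm (A + B * t + C * t\<^sup>2)"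
        using elim(2) A by (simp add: abs_mult_pos' power2_eq_square algebra_simps flip: abs_mult_pos)
      also have "\<dots> \<le> t * (K * norm (t ^ 2))"
        using elim by (simp add: power2_eq_square power3_eq_cube mult_ac)
      finally show ?case using elim(2) by simp
    qed
    have "((\<lambda>t::real. B + C * t) \<longlongrightarrow> B) (at_right 0)" by (auto intro!: tendsto_eq_intros)
    moreover have "((\<lambda>t::real. B + C * t) \<longlongrightarrow> 0) (at_right 0)"
      by (rule Lim_null_comparison[OF K' lim]) simp
    ultimately have B: "B = 0" using tendsto_unique trivial_limit_at_right_real by blast
    have K'': "\<forall>\<^sub>F t :: real in at_right 0. norm C \<le> K * norm (t ^ 1)"
      using K' eventually_at_right_less[of 0]
      by eventually_elim (use B in \<open>auto simp: power2_eq_square abs_mult\<close>)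
    have "((\<lambda>t::real. C) \<longlongrightarrow> 0) (at_right 0)"
      by (rule Lim_null_comparison[OF K'' lim]) simp
    then have C: "C = 0" using tendsto_unique[OF trivial_limit_at_right_real _ tendsto_const] by blast
    show "A = 0 \<and> B = 0 \<and> C = 0" using A B C by simp
  qed
  have "(\<lambda>t. (a' - a) + (b' - b) * t + (c' - c) * t\<^sup>2) \<in> O[at_right 0](\<lambda>t. t ^ 3)"
    using sum_in_bigo(2)[OF assms[unfolded jet2_def]] by (simp add: algebra_simps)
  from *[OF this] show "a = a'" "b = b'" "c = c'" by auto
qed

lemma jet2_cong:
  assumes "jet2 f a b c" "\<forall>\<^sub>F t in at_right 0. f t = g t"
  shows "jet2 g a b c"
proof -
  have "\<forall>\<^sub>F t in at_right 0. f t - (a + b * t + c * t\<^sup>2) = g t - (a + b * t + c * t\<^sup>2)"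
    using assms(2) by eventually_elim simp
  from landau_o.big.in_cong[OF this] show ?thesis using assms(1) by (simp add: jet2_def)
qed

text \<open>The third derivative is bounded by compactness of the closed interval; integrating this
  bound three times gives a remainder uniform up to the end points.\<close>

lemma Cn3_taylor:
  assumes d: "\<delta> > 0" and f: "Cn 3 {0..\<delta>} f"
  shows "\<exists>f' f'' C.
    (\<forall>t\<in>{0..\<delta>}. (f has_real_derivative f' t) (at t within {0..\<delta>})) \<and>
    (\<forall>t\<in>{0..\<delta>}. (f' has_real_derivative f'' t) (at t within {0..\<delta>})) \<and>
    C \<ge> 0 \<and> (\<forall>t\<in>{0..\<delta>}. \<bar>f t - (f 0 + f' 0 * t + f'' 0 / 2 * t\<^sup>2)\<bar> \<le> C * t ^ 3)"
proof -
  obtain f' f'' f''' where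
    "\<forall>t\<in>{0..\<delta>}. (f has_real_derivative f' t) (at t within {0..\<delta>})"
    "\<forall>t\<in>{0..\<delta>}. (f' has_real_derivative f'' t) (at t within {0..\<delta>})"
    "\<forall>t\<in>{0..\<delta>}. (f'' has_real_derivative f''' t) (at t within {0..\<delta>})"
    and cont: "continuous_on {0..\<delta>} f'''"
    using f by (auto simp: numeral_3_eq_3)
  then have
    f': "\<And>t. t \<in> {0..\<delta>} \<Longrightarrow> (f has_real_derivative f' t) (at t within {0..\<delta>})" and
    f'': "\<And>t. t \<in> {0..\<delta>} \<Longrightarrow> (f' has_real_derivative f'' t) (at t within {0..\<delta>})" and
    f''': "\<And>t. t \<in> {0..\<delta>} \<Longrightarrow> (f'' has_real_derivative f''' t) (at t within {0..\<delta>})"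
    by blast+
  obtain C where "\<forall>y\<in>f''' ` {0..\<delta>}. norm y \<le> C"
    using compact_imp_bounded[OF compact_continuous_image[OF cont compact_Icc]]
    unfolding bounded_iff by blast
  then have C: "\<And>t. t \<in> {0..\<delta>} \<Longrightarrow> \<bar>f''' t\<bar> \<le> C" by auto
  have C0: "C \<ge> 0" using C[of 0] d by auto
  have mvt: "\<bar>g t\<bar> \<le> B t" if t: "t \<in> {0..\<delta>}" and "g 0 = 0" "B 0 = 0"
    and g: "\<And>t. t \<in> {0..\<delta>} \<Longrightarrow> (g has_real_derivative g' t) (at t within {0..\<delta>})"
    and B: "\<And>t. t \<in> {0..\<delta>} \<Longrightarrow> (B has_real_derivative B' t) (at t within {0..\<delta>})"
    and le: "\<And>t. t \<in> {0..\<delta>} \<Longrightarrow> \<bar>g' t\<bar> \<le> B' t" for g g' B B' :: "real \<Rightarrow> real" and t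
  proof -
    have sub: "{0..t} \<subseteq> {0..\<delta>}" using t by auto
    have "(g has_real_derivative g' x) (at x within {0..t})" "(B has_real_derivative B' x) (at x within {0..t})"
      if "x \<in> {0..t}" for x
      using has_field_derivative_subset[OF g sub] has_field_derivative_subset[OF B sub] that sub by blast+
    then have "(g' has_integral g t - g 0) {0..t}" "(B' has_integral B t - B 0) {0..t}"
      using t by (auto intro!: fundamental_theorem_of_calculus
          simp: has_real_derivative_iff_has_vector_derivative[symmetric])
    then have "norm (g t - g 0) \<le> B t - B 0"
      using le sub by (metis (no_types, lifting) has_integral_integrable has_integral_norm_bound_integral_component
        integral_norm_bound_integral integral_unique real_norm_def subsetD)
    then show ?thesis using that by simp
  qed
  have 1: "\<bar>f'' t - f'' 0\<bar> \<le> C * t" if "t \<in> {0..\<delta>}" for t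
    by (rule mvt[OF that, where g'="f'''" and B'="\<lambda>_. C"]) (auto intro!: derivative_eq_intros f''' C)
  have 2: "\<bar>f' t - (f' 0 + f'' 0 * t)\<bar> \<le> C / 2 * t\<^sup>2" if "t \<in> {0..\<delta>}" for t
    by (rule mvt[OF that, where g'="\<lambda>t. f'' t - f'' 0" and B'="\<lambda>t. C * t"])
      (auto intro!: derivative_eq_intros f'' 1)
  have 3: "\<bar>f t - (f 0 + f' 0 * t + f'' 0 / 2 * t\<^sup>2)\<bar> \<le> C / 6 * t ^ 3" if "t \<in> {0..\<delta>}" for t
  proof (rule mvt[OF that, where g'="\<lambda>t. f' t - (f' 0 + f'' 0 * t)" and B'="\<lambda>t. C / 2 * t\<^sup>2"])
    show "\<bar>f' t - (f' 0 + f'' 0 * t)\<bar> \<le> C / 2 * t\<^sup>2" if "t \<in> {0..\<delta>}" for t by (rule 2[OF that])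
  qed (auto intro!: derivative_eq_intros f')
  show ?thesis
    using f' f'' 3 C0 by (intro exI[of _ f'] exI[of _ f''] exI[of _ "C / 6"]) auto
qed

lemma eventually_at_right_Icc: "\<delta> > 0 \<Longrightarrow> \<forall>\<^sub>F t :: real in at_right 0. t \<in> {0..\<delta>}"
  by (auto simp: eventually_at_right_field intro!: exI[of _ \<delta>])

lemma jet2I_bound:
  assumes "\<delta> > 0" and "\<And>t. t \<in> {0..\<delta>} \<Longrightarrow> \<bar>f t - (a + b * t + c * t\<^sup>2)\<bar> \<le> C * t ^ 3"
  shows "jet2 f a b c"
  unfolding jet2_def
proof (rule bigoI[where c=C])
  show "\<forall>\<^sub>F t in at_right 0. norm (f t - (a + b * t + c * t\<^sup>2)) \<le> C * norm (t ^ 3)"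
    using eventually_at_right_Icc[OF assms(1)]
    by eventually_elim (use assms(2) in auto)
qed

lemma Cn3_jet2:
  assumes "\<delta> > 0" "Cn 3 {0..\<delta>} f"
  shows "\<exists>b c. jet2 f (f 0) b c"
proof -
  obtain f' f'' C where "\<forall>t\<in>{0..\<delta>}. (f has_real_derivative f' t) (at t within {0..\<delta>})"
    and "\<forall>t\<in>{0..\<delta>}. (f' has_real_derivative f'' t) (at t within {0..\<delta>})"
    and C: "\<forall>t\<in>{0..\<delta>}. \<bar>f t - (f 0 + f' 0 * t + f'' 0 / 2 * t\<^sup>2)\<bar> \<le> C * t ^ 3"
    using Cn3_taylor[OF assms] by blast
  have "jet2 f (f 0) (f' 0) (f'' 0 / 2)" using C by (intro jet2I_bound[OF assms(1)]) blast
  then show ?thesis by blast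
qed

text \<open>For a C^3 function an asymptotic expansion does determine the one-sided derivatives,
  because the Taylor polynomial is another expansion and expansions are unique.\<close>

lemma jet2_Cn3_derivs:
  assumes d: "\<delta> > 0" and f: "Cn 3 {0..\<delta>} f" and j: "jet2 f a b c"
  shows "f 0 = a \<and> (\<exists>f'. f' 0 = b \<and>
    (\<forall>t\<in>{0..\<delta>}. (f has_real_derivative f' t) (at t within {0..\<delta>})) \<and>
    (f' has_real_derivative 2 * c) (at 0 within {0..\<delta>}))"
proof -
  obtain f' f'' C where f': "\<forall>t\<in>{0..\<delta>}. (f has_real_derivative f' t) (at t within {0..\<delta>})"
    and f'': "\<forall>t\<in>{0..\<delta>}. (f' has_real_derivative f'' t) (at t within {0..\<delta>})"
    and C: "\<forall>t\<in>{0..\<delta>}. \<bar>f t - (f 0 + f' 0 * t + f'' 0 / 2 * t\<^sup>2)\<bar> \<le> C * t ^ 3"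
    using Cn3_taylor[OF d f] by blast
  have "jet2 f (f 0) (f' 0) (f'' 0 / 2)" using C by (intro jet2I_bound[OF d]) blast
  from jet2_unique[OF this j] have "f 0 = a" "f' 0 = b" "f'' 0 = 2 * c" by auto
  then show ?thesis
    using f' bspec[OF f'', of 0] d by auto
qed

text \<open>The term of order i of the weight meets the integral of r^(l+i) over [0,1], which is 1 /
  (l + i + 1).\<close>

lemma jet2_scaled_integral:
  assumes d: "\<delta> > 0" and W: "Cn 3 {0..\<delta>} W" and j: "jet2 W w0 w1 w2"
  shows "jet2 (\<lambda>s. integral {0..1} (\<lambda>r. r ^ l * W (s * r)))
    (w0 / real (l + 1)) (w1 / real (l + 2)) (w2 / real (l + 3))"
proof -
  obtain f' f'' C where "\<forall>t\<in>{0..\<delta>}. (W has_real_derivative f' t) (at t within {0..\<delta>})"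
    "\<forall>t\<in>{0..\<delta>}. (f' has_real_derivative f'' t) (at t within {0..\<delta>})" and C: "C \<ge> 0"
    "\<forall>t\<in>{0..\<delta>}. \<bar>W t - (W 0 + f' 0 * t + f'' 0 / 2 * t\<^sup>2)\<bar> \<le> C * t ^ 3"
    using Cn3_taylor[OF d W] by blast
  have "jet2 W (W 0) (f' 0) (f'' 0 / 2)" using C(2) by (intro jet2I_bound[OF d]) blast
  from jet2_unique[OF this j] have w: "W 0 = w0" "f' 0 = w1" "f'' 0 / 2 = w2" by auto
  have pow: "((\<lambda>r::real. r ^ k) has_integral 1 / real (k + 1)) {0..1}" for k
  proof -
    have "((\<lambda>r::real. r ^ k) has_integral 1 ^ Suc k / real (Suc k) - 0 ^ Suc k / real (Suc k)) {0..1}"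
    proof (rule fundamental_theorem_of_calculus)
      fix x :: real
      have "((\<lambda>r::real. r ^ Suc k / real (Suc k)) has_real_derivative x ^ k) (at x within {0..1})"
        using DERIV_cdivide[OF DERIV_pow[of "Suc k" x "{0..1}"], of "real (Suc k)"] by (simp del: of_nat_Suc)
      then show "((\<lambda>r::real. r ^ Suc k / real (Suc k)) has_vector_derivative x ^ k) (at x within {0..1})"
        by (simp add: has_real_derivative_iff_has_vector_derivative)
    qed simp
    then show ?thesis by simp
  qed
  show ?thesis
  proof (rule jet2I_bound[OF d])
    fix s assume s: "s \<in> {0..\<delta>}"
    have sr: "s * r \<in> {0..\<delta>}" if "r \<in> {0..1}" for r
      using s that mult_left_le[of r s] by (auto intro: order_trans)
    have cont: "continuous_on {0..1} (\<lambda>r. r ^ l * W (s * r))"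
      using sr by (intro continuous_intros continuous_on_compose2[OF Cn_continuous_on[OF W]]) auto
    have p: "((\<lambda>r. r ^ l * (w0 + w1 * (s * r) + w2 * (s * r)\<^sup>2)) has_integral
        (w0 / real (l + 1) + w1 / real (l + 2) * s + w2 / real (l + 3) * s\<^sup>2)) {0..1}"
      using has_integral_add[OF has_integral_add[OF has_integral_mult_right[OF pow[of l], of w0]
            has_integral_mult_right[OF pow[of "l + 1"], of "w1 * s"]]
            has_integral_mult_right[OF pow[of "l + 2"], of "w2 * s\<^sup>2"]]
      by (simp add: algebra_simps power2_eq_square power_add)
    have "((\<lambda>r. r ^ l * W (s * r) - r ^ l * (w0 + w1 * (s * r) + w2 * (s * r)\<^sup>2)) has_integral
       integral {0..1} (\<lambda>r. r ^ l * W (s * r)) - (w0 / real (l + 1) + w1 / real (l + 2) * s + w2 / real (l + 3) * s\<^sup>2)) {0..1}"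
      by (intro has_integral_diff[OF _ p] integrable_integral integrable_continuous_real cont)
    moreover have "((\<lambda>r::real. C * s ^ 3) has_integral C * s ^ 3) {0..1}"
      using has_integral_const_real[of "C * s ^ 3" 0 1] by simp
    moreover have "norm (r ^ l * W (s * r) - r ^ l * (w0 + w1 * (s * r) + w2 * (s * r)\<^sup>2)) \<le> C * s ^ 3"
      if r: "r \<in> {0..1}" for r
    proof -
      have "norm (r ^ l * W (s * r) - r ^ l * (w0 + w1 * (s * r) + w2 * (s * r)\<^sup>2))
        = r ^ l * \<bar>W (s * r) - (w0 + w1 * (s * r) + w2 * (s * r)\<^sup>2)\<bar>"
        using r by (simp add: right_diff_distrib[symmetric] abs_mult)
      also have "\<dots> \<le> 1 * (C * (s * r) ^ 3)"
        using bspec[OF C(2) sr[OF r]] r by (intro mult_mono) (auto simp: w power_le_one)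
      also have "\<dots> \<le> C * s ^ 3"
        using C(1) s r by (auto intro!: mult_left_mono power_mono simp: mult_left_le)
      finally show ?thesis .
    qed
    ultimately have "norm (integral {0..1} (\<lambda>r. r ^ l * W (s * r)) - (w0 / real (l + 1) + w1 / real (l + 2) * s + w2 / real (l + 3) * s\<^sup>2))
       \<le> C * s ^ 3"
      by (metis (no_types, lifting) has_integral_integrable integral_norm_bound_integral integral_unique)
    then show "\<bar>integral {0..1} (\<lambda>r. r ^ l * W (s * r)) - (w0 / real (l + 1) + w1 / real (l + 2) * s + w2 / real (l + 3) * s\<^sup>2)\<bar>
       \<le> C * s ^ 3" by simp
  qed
qed

section \<open>Reproducing polynomials\<close>

lemma linear_power_dvd_higher_pderiv:
  fixes F :: "real poly"
  shows "[:-a, 1:] ^ (k + j) dvd F \<Longrightarrow> [:-a, 1:] ^ j dvd (pderiv ^^ k) F"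
proof (induction k arbitrary: F)
  case (Suc k)
  then obtain h where "F = [:-a, 1:] ^ Suc (k + j) * h" by (auto simp: dvd_def)
  then have "pderiv F = [:-a, 1:] ^ (k + j) * (smult (real (Suc (k + j))) h + [:-a, 1:] * pderiv h)"
    by (simp add: pderiv_mult pderiv_power_Suc pderiv_pCons algebra_simps del: power_Suc) (simp add: algebra_simps)
  then have "[:-a, 1:] ^ j dvd (pderiv ^^ k) (pderiv F)"
    by (intro Suc.IH) simp
  then show ?case by (simp add: funpow_swap1)
qed auto

lemma poly_higher_pderiv_linear_power:
  fixes h :: "real poly"
  shows "poly ((pderiv ^^ k) ([:-a, 1:] ^ k * h)) a = fact k * poly h a"
proof (induction k arbitrary: h)
  case (Suc k)
  have "pderiv ([:-a, 1:] ^ Suc k * h) = [:-a, 1:] ^ k * (smult (real (Suc k)) h + [:-a, 1:] * pderiv h)"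
    by (simp add: pderiv_mult pderiv_power_Suc pderiv_pCons algebra_simps del: power_Suc) (simp add: algebra_simps)
  then have "(pderiv ^^ Suc k) ([:-a, 1:] ^ Suc k * h)
      = (pderiv ^^ k) ([:-a, 1:] ^ k * (smult (real (Suc k)) h + [:-a, 1:] * pderiv h))"
    by (simp add: funpow_swap1)
  then show ?case by (simp only: Suc.IH) simp
qed simp

definition integral01 :: "real poly \<Rightarrow> real" where
  "integral01 p = integral {0..1} (poly p)"

lemma poly_integrable01: "poly (p :: real poly) integrable_on {0..1}"
  by (intro integrable_continuous_real continuous_intros)

lemma integral01_add: "integral01 (p + q) = integral01 p + integral01 q"
  using integral_add[OF poly_integrable01 poly_integrable01, of p q] by (simp add: integral01_def poly_add[abs_def])

lemma integral01_smult: "integral01 (smult c p) = c * integral01 p"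
  by (simp add: integral01_def poly_smult[abs_def])

lemma integral01_0 [simp]: "integral01 0 = 0"
  using integral01_smult[of 0 0] by simp

lemma integral01_uminus: "integral01 (- p) = - integral01 p"
  using integral01_smult[of "-1" p] by simp

lemma integral01_pderiv: "integral01 (pderiv p) = poly p 1 - poly p 0"
proof -
  have "(poly (pderiv p) has_integral poly p 1 - poly p 0) {0..1}"
  proof (rule fundamental_theorem_of_calculus)
    show "(poly p has_vector_derivative poly (pderiv p) x) (at x within {0..1})" for x
      using has_field_derivative_at_within[OF poly_DERIV[of p x]]
      by (simp add: has_real_derivative_iff_has_vector_derivative)
  qed simp
  then show ?thesis by (simp add: has_integral_iff integral01_def)
qed

lemma integral01_by_parts:
  "integral01 (f * pderiv g) = poly f 1 * poly g 1 - poly f 0 * poly g 0 - integral01 (pderiv f * g)"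
proof -
  have "integral01 (f * pderiv g + pderiv f * g) = poly f 1 * poly g 1 - poly f 0 * poly g 0"
    using integral01_pderiv[of "f * g"] by (simp add: pderiv_mult mult.commute)
  then show ?thesis by (simp add: integral01_add)
qed

text \<open>The Rodrigues argument: in each of the k integrations by parts the boundary terms
  vanish, since F has zeros of order k at both end points, and k derivatives annihilate f.\<close>

lemma integral01_orthogonal:
  assumes "[:-0, 1:] ^ k dvd F" "[:-1, 1:] ^ k dvd F" "\<And>j. j \<ge> k \<Longrightarrow> coeff f j = 0"
  shows "integral01 (f * (pderiv ^^ k) F) = 0"
  using assms
proof (induction k arbitrary: f)
  case 0
  then have "f = 0" by (intro poly_eqI) simp
  then show ?case by simp
next
  case (Suc k)
  have "[:-0, 1:] ^ 1 dvd (pderiv ^^ k) F" "[:-1, 1:] ^ 1 dvd (pderiv ^^ k) F"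
    using linear_power_dvd_higher_pderiv[of 0 k 1 F] linear_power_dvd_higher_pderiv[of 1 k 1 F] Suc.prems(1,2)
    by (simp_all only: Suc_eq_plus1)
  then have "poly ((pderiv ^^ k) F) 0 = 0" "poly ((pderiv ^^ k) F) 1 = 0"
    by (auto simp: poly_eq_0_iff_dvd)
  then have "integral01 (f * (pderiv ^^ Suc k) F) = - integral01 (pderiv f * (pderiv ^^ k) F)"
    by (simp add: integral01_by_parts)
  also have "integral01 (pderiv f * (pderiv ^^ k) F) = 0"
    using Suc.prems(3) by (intro Suc.IH dvd_trans[OF le_imp_power_dvd Suc.prems(1)]
        dvd_trans[OF le_imp_power_dvd Suc.prems(2)]) (auto simp: coeff_pderiv)
  finally show ?case by simp
qed

text \<open>A Bernstein polynomial up to a constant factor. Derivatives of order m + 1 of such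
  products are Rodrigues formulas: for equal exponents m + 1 they give a shifted Legendre polynomial
  of that degree, up to scaling.\<close>

definition bernstein :: "nat \<Rightarrow> nat \<Rightarrow> real poly" where
  "bernstein i j = [:0, 1:] ^ i * [:-1, 1:] ^ j"

lemma bernstein_dvd:
  "k \<le> i \<Longrightarrow> [:-0, 1:] ^ k dvd bernstein i j * h" "k \<le> j \<Longrightarrow> [:-1, 1:] ^ k dvd bernstein i j * h"
  unfolding bernstein_def
  by (auto intro: dvd_mult2 dvd_mult dvd_trans[OF le_imp_power_dvd])

text \<open>The zero at 0 has order m only, one less than full orthogonality requires. So the first
  integration by parts leaves a boundary term at 0, and this term is the evaluation of f.\<close>

lemma integral01_reproducing:
  assumes f: "\<And>j. j > m \<Longrightarrow> coeff f j = 0"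
  shows "integral01 (f * (pderiv ^^ Suc m) (bernstein m (Suc m))) = (-1) ^ m * fact m * poly f 0"
proof -
  let ?F = "bernstein m (Suc m)"
  have 1: "poly ((pderiv ^^ m) ?F) 0 = fact m * (-1) ^ Suc m"
    using poly_higher_pderiv_linear_power[of m 0 "[:-1, 1:] ^ Suc m"] by (simp add: bernstein_def)
  have "[:-1, 1:] ^ 1 dvd (pderiv ^^ m) ?F"
    using bernstein_dvd(2)[of "m + 1" "Suc m" m 1] by (intro linear_power_dvd_higher_pderiv) simp
  then have 2: "poly ((pderiv ^^ m) ?F) 1 = 0" by (auto simp: poly_eq_0_iff_dvd)
  have 3: "integral01 (pderiv f * (pderiv ^^ m) ?F) = 0"
    using bernstein_dvd[of m m "Suc m" 1] bernstein_dvd(2)[of m "Suc m" m 1] f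
    by (intro integral01_orthogonal) (auto simp: coeff_pderiv)
  show ?thesis using 1 2 3 by (simp add: integral01_by_parts)
qed

lemma coeff_bernstein_top:
  "coeff (bernstein i j) (i + j) = 1"
  "j > 0 \<Longrightarrow> coeff (bernstein i j) (i + j - 1) = - real j"
  "l > i + j \<Longrightarrow> coeff (bernstein i j) l = 0"
proof -
  have eq: "bernstein i j = monom 1 i * [:-1, 1:] ^ j"
    by (simp add: bernstein_def monom_altdef)
  show "coeff (bernstein i j) (i + j) = 1"
    by (simp add: eq coeff_monom_mult coeff_linear_poly_power)
  show "coeff (bernstein i j) (i + j - 1) = - real j" if j: "j > 0"
  proof -
    have "coeff (bernstein i j) (i + j - 1) = coeff ([:-1, 1:] ^ j) (j - 1)"
      using j by (simp add: eq coeff_monom_mult)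
    also have "\<dots> = real (j choose (j - 1)) * (-1) ^ (j - (j - 1))"
      using coeff_linear_poly_power[of "j - 1" j "- 1 :: real" 1] by simp
    also have "\<dots> = - real j"
      using j by (cases j) auto
    finally show ?thesis .
  qed
  show "coeff (bernstein i j) l = 0" if "l > i + j"
    using that by (auto simp: eq coeff_monom_mult intro!: coeff_eq_0 le_less_trans[OF degree_power_le])
qed

lemma integral01_definite:
  assumes "integral01 (p * p) = 0"
  shows "p = 0"
proof -
  have "\<forall>x\<in>{0..1}. poly (p * p) x = 0"
    using assms unfolding integral01_def
    by (subst (asm) integral_eq_0_iff) (auto intro!: continuous_intros)
  then have "poly p x = 0" if "x \<in> {0..1}" for x using that by simp
  then have "{0..1} \<subseteq> {x. poly p x = 0}" by auto
  then have "infinite {x. poly p x = 0}"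
    using finite_subset infinite_Icc_iff[of 0 "1 :: real"] by (metis zero_less_one)
  then show ?thesis using poly_roots_finite by blast
qed

text \<open>The difference has degree at most m and vanishing moments up to m, hence is orthogonal
  to itself.\<close>

lemma poly_determined_by_moments:
  assumes deg: "\<And>j. j > m \<Longrightarrow> coeff P j = 0" "\<And>j. j > m \<Longrightarrow> coeff Q j = 0"
    and eq: "\<And>j. j \<le> m \<Longrightarrow> integral01 (monom 1 j * P) = integral01 (monom 1 j * Q)"
  shows "P = Q"
proof -
  define D where "D = P - Q"
  have 0: "integral01 (monom 1 j * D) = 0" if "j \<le> m" for j
    using eq[OF that] integral01_add[of "monom 1 j * D" "monom 1 j * Q"] by (simp add: D_def algebra_simps)
  have "degree D \<le> m" by (rule degree_le) (auto simp: D_def deg)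
  then have "D * D = (\<Sum>j\<le>m. smult (coeff D j) (monom 1 j * D))"
    using poly_as_sum_of_monoms'[of D m]
    by (metis (no_types, lifting) mult_smult_left smult_monom mult.right_neutral sum.cong sum_distrib_right)
  moreover have "integral01 (\<Sum>j\<in>A. smult (coeff D j) (monom 1 j * D)) = (\<Sum>j\<in>A. coeff D j * integral01 (monom 1 j * D))" for A
    by (induction A rule: infinite_finite_induct) (auto simp: integral01_add integral01_smult)
  ultimately have "integral01 (D * D) = 0" using 0 by simp
  then have "D = 0" by (rule integral01_definite)
  then show ?thesis by (simp add: D_def)
qed

text \<open>
  With weight \<open>1 + \<alpha> a r + \<beta> a\<^sup>2 r\<^sup>2 + O(a\<^sup>3)\<close> the polynomial that reproduces the value at \<open>0\<close> is
  \<open>P\<^sub>0 + a P\<^sub>1 + a\<^sup>2 P\<^sub>2 + O(a\<^sup>3)\<close>.  The weighted polynomial is orthogonal to all polynomials of degree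
  at most \<open>m\<close>, up to evaluation at \<open>0\<close>, hence an \<open>(m+1)\<close>-st derivative of a multiple of
  \<open>r\<^sup>m (r - 1)\<^bsup>m+1\<^esup>\<close>, and the degrees determine this multiple order by order.
\<close>

proposition reproducing_polynomial_expansion:
  fixes m :: nat and w0 w1 w2 :: real and P0 P1 P2 :: "real poly"
  defines "N \<equiv> real (m + 1)" and "\<alpha> \<equiv> w1 / w0" and "\<beta> \<equiv> w2 / w0"
  assumes m: "m \<ge> 1" and w0: "w0 \<noteq> 0"
    and deg: "\<And>j. j > m \<Longrightarrow> coeff P0 j = 0" "\<And>j. j > m \<Longrightarrow> coeff P1 j = 0" "\<And>j. j > m \<Longrightarrow> coeff P2 j = 0"
    and e0: "\<And>j. j \<le> m \<Longrightarrow> integral01 (monom 1 j * smult w0 P0) = (if j = 0 then 1 else 0)"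
    and e1: "\<And>j. j \<le> m \<Longrightarrow> integral01 (monom 1 j * (smult w0 P1 + smult w1 (monom 1 1 * P0))) = 0"
    and e2: "\<And>j. j \<le> m \<Longrightarrow> integral01 (monom 1 j * (smult w0 P2 + smult w1 (monom 1 1 * P1) + smult w2 (monom 1 2 * P0))) = 0"
  shows "poly P0 1 = (-1) ^ m * N / w0"
    and "poly P1 1 = - (\<alpha> / 2) * poly P0 1"
    and "poly P2 1 = (\<beta> * (- 4 * N\<^sup>2 + N + 1) / (2 * (4 * N\<^sup>2 - 1)) + \<alpha>\<^sup>2 * (3 * N - 2) / (4 * (2 * N - 1))) * poly P0 1"
proof -
  define M where "M = Suc m"
  define D where "D F = (pderiv ^^ M) F" for F :: "real poly"
  \<comment> \<open>Normalizes the reproducing property of the Bernstein derivative for the constant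
    weight w0.\<close>
  define C where "C = (-1) ^ m / (w0 * fact m)"
  \<comment> \<open>The factor (j + M)! / j! by which M-fold differentiation multiplies the
    coefficient that lands in degree j.\<close>
  define p where "p j = pochhammer (real (Suc j)) M" for j
  have M: "real M = N" "M = m + 1" by (simp_all add: M_def N_def)
  have N2: "N \<ge> 2" using m by (simp add: N_def)
  have pstep: "real (Suc j) * p (Suc j) = (real (Suc j) + N) * p j" for j
    unfolding p_def M(1)[symmetric] using pochhammer_rec[of "real (Suc j)" M] pochhammer_rec'[of "real (Suc j)" M]
    by (simp add: add_ac)
  have p0: "p j > 0" for j unfolding p_def by (rule pochhammer_pos) simp
  have cD: "coeff (D F) j = p j * coeff F (j + M)" for F j
    by (simp add: D_def p_def coeff_higher_pderiv)
  have Dadd: "D (F + G) = D F + D G" and Dsmult: "D (smult c F) = smult c (D F)" for F G c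
    by (simp_all add: D_def higher_pderiv_add higher_pderiv_smult)
  have orth: "integral01 (monom 1 j * D (bernstein M M * h)) = 0" if "j \<le> m" for j h
    unfolding D_def using that bernstein_dvd[of M M M h] bernstein_dvd(2)[of M M M h]
    by (intro integral01_orthogonal) (auto simp: M_def)
  have D1: "poly (D (bernstein i M * h)) 1 = fact M * poly h 1" for i h
    unfolding D_def using poly_higher_pderiv_linear_power[of M 1 "[:0, 1:] ^ i * h"]
    by (simp add: bernstein_def mult_ac)
  have pm: "p M = 2 * p m"
    using pstep[of m] N2 by (simp add: M_def[symmetric] M(1)[symmetric] algebra_simps)
  have pM: "(N + 1) * p (Suc M) = 2 * (2 * N + 1) * p m"
    using pstep[of M] pm by (simp add: M(1) algebra_simps)
  have pm': "real m * p m = (2 * N - 1) * p (m - 1)"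
    using pstep[of "m - 1"] m by (simp add: N_def algebra_simps)
  have m_N: "real m = N - 1" by (simp add: N_def)
  define F0 where "F0 = smult C (bernstein m M)"
  have P0: "P0 = D F0"
  proof (rule poly_determined_by_moments[of m])
    show "coeff (D F0) j = 0" if "j > m" for j
      using that by (simp add: cD F0_def M_def coeff_bernstein_top)
    fix j assume j: "j \<le> m"
    have "integral01 (monom 1 j * D F0) = C * integral01 (monom 1 j * (pderiv ^^ Suc m) (bernstein m (Suc m)))"
      by (simp add: F0_def Dsmult integral01_smult) (simp add: D_def M_def)
    also have "integral01 (monom 1 j * (pderiv ^^ Suc m) (bernstein m (Suc m))) = (-1) ^ m * fact m * poly (monom 1 j) 0"
      using j by (intro integral01_reproducing) simp
    also have "C * \<dots> = (if j = 0 then 1 else 0) / w0"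
      by (simp add: C_def poly_monom power_mult_distrib[symmetric] flip: power_add)
    also have "\<dots> = integral01 (monom 1 j * P0)"
      using e0[OF j] w0 by (simp add: integral01_smult field_simps)
    finally show "integral01 (monom 1 j * P0) = integral01 (monom 1 j * D F0)" by simp
  qed (use deg in auto)
  have P0_1: "poly P0 1 = C * fact M"
    using D1[of m 1] by (simp add: P0 F0_def Dsmult)
  show "poly P0 1 = (-1) ^ m * N / w0"
    unfolding P0_1 by (simp add: C_def M_def N_def)
  have c0: "coeff P0 m = C * p m" "coeff P0 (m - 1) = - N * C * p (m - 1)"
  proof -
    show "coeff P0 m = C * p m"
      using coeff_bernstein_top(1)[of m M] by (simp add: P0 cD F0_def)
    have "m - 1 + M = m + M - 1" using m by simp
    then show "coeff P0 (m - 1) = - N * C * p (m - 1)"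
      using coeff_bernstein_top(2)[of M m] by (simp add: P0 cD F0_def M_def N_def)
  qed
  \<comment> \<open>By \<open>e1\<close>, P1 + \<alpha> r P0 is orthogonal to all degrees up to m
    and has degree at most m + 1, so it is a multiple of the derivative of
    \<open>bernstein M M\<close>. The factor follows from the coefficient of r^(m+1): it must be
    \<alpha> C p(m), while p(M) = 2 p(m).\<close>
  define F1 where "F1 = smult (\<alpha> / 2 * C) (bernstein M M * 1)"
  have c1: "coeff (D F1) M = \<alpha> * C * p m" "coeff (D F1) m = - N * (\<alpha> / 2) * C * p m"
    "\<And>j. j > M \<Longrightarrow> coeff (D F1) j = 0"
  proof -
    show "coeff (D F1) M = \<alpha> * C * p m"
      using coeff_bernstein_top(1)[of M M] by (simp add: cD F1_def pm)
    have "m + M = M + M - 1" by (simp add: M_def)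
    then show "coeff (D F1) m = - N * (\<alpha> / 2) * C * p m"
      using coeff_bernstein_top(2)[of M M] by (simp add: cD F1_def M_def N_def)
    show "coeff (D F1) j = 0" if "j > M" for j
      using that by (simp add: cD F1_def coeff_bernstein_top)
  qed
  have P1: "P1 = D F1 - smult \<alpha> (monom 1 1 * P0)"
  proof (rule poly_determined_by_moments[of m])
    fix j assume j: "j > m"
    show "coeff (D F1 - smult \<alpha> (monom 1 1 * P0)) j = 0"
    proof (cases "j = M")
      case True
      then show ?thesis using c1(1) c0(1) by (simp add: coeff_monom_mult M_def)
    next
      case False
      then have "j > M" using j by (simp add: M_def)
      then show ?thesis using c1(3) deg(1)[of "j - 1"] by (simp add: coeff_monom_mult M_def)
    qed
  next
    fix j assume j: "j \<le> m"
    have "integral01 (monom 1 j * D F1) = 0"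
      using orth[OF j, of 1] by (simp add: F1_def Dsmult integral01_smult)
    then have "integral01 (monom 1 j * (D F1 - smult \<alpha> (monom 1 1 * P0))) = - \<alpha> * integral01 (monom 1 j * (monom 1 1 * P0))"
      using integral01_add[of "monom 1 j * D F1" "smult (- \<alpha>) (monom 1 j * (monom 1 1 * P0))"]
      by (simp add: integral01_smult integral01_uminus right_diff_distrib del: mult_monom)
    also have "\<dots> = integral01 (monom 1 j * P1)"
      using e1[OF j] w0 by (simp add: integral01_add integral01_smult distrib_left \<alpha>_def field_simps)
    finally show "integral01 (monom 1 j * P1) = integral01 (monom 1 j * (D F1 - smult \<alpha> (monom 1 1 * P0)))" by simp
  qed (use deg in auto)
  show P1_1: "poly P1 1 = - (\<alpha> / 2) * poly P0 1"
    using D1[of M 1] by (simp add: P1 F1_def Dsmult P0_1 poly_monom algebra_simps)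
  have c1m: "coeff P1 m = - (\<alpha> * N / (2 * (2 * N - 1))) * C * p m"
  proof -
    have "coeff P1 m = - N * (\<alpha> / 2) * C * p m + \<alpha> * N * C * p (m - 1)"
      using c1(2) c0(2) m by (simp add: P1 coeff_monom_mult)
    also have "p (m - 1) = real m * p m / (2 * N - 1)"
      using pm' N2 by (simp add: field_simps)
    also have "- N * (\<alpha> / 2) * C * p m + \<alpha> * N * C * (real m * p m / (2 * N - 1)) = - (\<alpha> * N / (2 * (2 * N - 1))) * C * p m"
      using N2 by (simp add: m_N field_simps)
    finally show ?thesis .
  qed
  \<comment> \<open>At second order the orthogonal polynomial has degree m + 2, which leaves a
    linear cofactor. \<open>c2\<close> is fixed by the coefficient of r^(m+2) and then
    \<open>c3\<close> by that of r^(m+1), so that P2 has degree at most m after subtracting the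
    weighted lower orders.\<close>
  define c2 where "c2 = \<beta> * (N + 1) / (2 * (2 * N + 1))"
  define c3 where "c3 = N * c2 - N * (\<alpha>\<^sup>2 / 2 + \<beta> * (N - 1)) / (2 * (2 * N - 1))"
  define F2 where "F2 = smult C (bernstein M M * [:c3, c2:])"
  have bX: "bernstein M M * [:c3, c2:] = smult c3 (bernstein M M) + smult c2 (bernstein (Suc M) M)"
    by (simp add: bernstein_def mult_ac)
  have cF2: "coeff (D F2) (Suc M) = \<beta> * C * p m"
    "coeff (D F2) M = \<alpha> * coeff P1 m + \<beta> * coeff P0 (m - 1)"
    "\<And>j. j > Suc M \<Longrightarrow> coeff (D F2) j = 0"
  proof -
    have "coeff (D F2) (Suc M) = C * c2 * p (Suc M)"
      unfolding cD F2_def bX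
      using coeff_bernstein_top(1)[of "Suc M" M] coeff_bernstein_top(3)[of M M "Suc M + M"] by simp
    also have "p (Suc M) = 2 * (2 * N + 1) * p m / (N + 1)"
      using pM N2 by (simp add: field_simps)
    also have "C * c2 * (2 * (2 * N + 1) * p m / (N + 1)) = \<beta> * C * p m"
      using N2 by (simp add: c2_def divide_simps)
    finally show "coeff (D F2) (Suc M) = \<beta> * C * p m" .
    have "coeff (bernstein (Suc M) M) (M + M) = - N"
      using coeff_bernstein_top(2)[of M "Suc M"] M by simp
    then have "coeff (D F2) M = C * (c3 - N * c2) * p M"
      unfolding cD F2_def bX using coeff_bernstein_top(1)[of M M] by (simp add: algebra_simps)
    also have "c3 - N * c2 = - (N * (\<alpha>\<^sup>2 / 2 + \<beta> * (N - 1)) / (2 * (2 * N - 1)))"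
      by (simp add: c3_def)
    also have "C * \<dots> * p M = - N * (\<alpha>\<^sup>2 / 2 + \<beta> * (N - 1)) / (2 * N - 1) * C * p m"
      using N2 unfolding pm by (simp add: divide_simps)
    also have "\<dots> = \<alpha> * coeff P1 m + \<beta> * coeff P0 (m - 1)"
    proof -
      have "p (m - 1) = real m * p m / (2 * N - 1)"
        using pm' N2 by (simp add: field_simps)
      show ?thesis
      proof -
        have "A \<noteq> 0 \<Longrightarrow> - N * (\<alpha>\<^sup>2 / 2 + \<beta> * (N - 1)) / A * C * P
          = \<alpha> * (- (\<alpha> * N / (2 * A)) * C * P) + \<beta> * (- N * C * ((N - 1) * P / A))" for A P
          by (simp add: field_simps power2_eq_square)
        from this[of "2 * N - 1"] show ?thesis
          unfolding c1m c0(2) \<open>p (m - 1) = real m * p m / (2 * N - 1)\<close> m_N using N2 by simp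
      qed
    qed
    finally show "coeff (D F2) M = \<alpha> * coeff P1 m + \<beta> * coeff P0 (m - 1)" .
    show "coeff (D F2) j = 0" if "j > Suc M" for j
      using that unfolding cD F2_def bX by (simp add: coeff_bernstein_top)
  qed
  have P2: "P2 = D F2 - smult \<alpha> (monom 1 1 * P1) - smult \<beta> (monom 1 2 * P0)"
  proof (rule poly_determined_by_moments[of m])
    fix j assume j: "j > m"
    then consider "j = M" | "j = Suc M" | "j > Suc M" by (fastforce simp: M_def)
    then show "coeff (D F2 - smult \<alpha> (monom 1 1 * P1) - smult \<beta> (monom 1 2 * P0)) j = 0"
    proof cases
      case 1
      then show ?thesis using cF2(2) m by (simp add: coeff_monom_mult M_def)
    next
      case 2
      then show ?thesis using cF2(1) c0(1) deg(2)[of "Suc m"] by (simp add: coeff_monom_mult M_def)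
    next
      case 3
      then show ?thesis using cF2(3)[of j] deg(2)[of "j - 1"] deg(1)[of "j - 2"] by (simp add: coeff_monom_mult M_def)
    qed
  next
    fix j assume j: "j \<le> m"
    have "integral01 (monom 1 j * D F2) = 0"
      using orth[OF j] unfolding F2_def Dsmult by (simp add: integral01_smult del: mult_pCons_right)
    then have "integral01 (monom 1 j * (D F2 - smult \<alpha> (monom 1 1 * P1) - smult \<beta> (monom 1 2 * P0)))
       = - \<alpha> * integral01 (monom 1 j * (monom 1 1 * P1)) - \<beta> * integral01 (monom 1 j * (monom 1 2 * P0))"
      using integral01_add[of "monom 1 j * D F2 + smult (- \<alpha>) (monom 1 j * (monom 1 1 * P1))"
          "smult (- \<beta>) (monom 1 j * (monom 1 2 * P0))"]
        integral01_add[of "monom 1 j * D F2" "smult (- \<alpha>) (monom 1 j * (monom 1 1 * P1))"]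
      by (simp add: integral01_smult integral01_uminus right_diff_distrib del: mult_monom)
    also have "\<dots> = integral01 (monom 1 j * P2)"
      using e2[OF j] w0 by (simp add: integral01_add integral01_smult distrib_left \<alpha>_def \<beta>_def field_simps)
    finally show "integral01 (monom 1 j * P2) = integral01 (monom 1 j * (D F2 - smult \<alpha> (monom 1 1 * P1) - smult \<beta> (monom 1 2 * P0)))"
      by simp
  qed (use deg in auto)
  \<comment> \<open>At 1 the derivative of order M of \<open>(r - 1)^M\<close> times a cofactor is
    M! times the value of the cofactor, so only c2 + c3 enters.\<close>
  have "poly P2 1 = C * fact M * (c2 + c3) - \<alpha> * poly P1 1 - \<beta> * poly P0 1"
    using D1[of M "[:c3, c2:]"] by (simp add: P2 F2_def Dsmult poly_monom algebra_simps del: mult_pCons_right)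
  also have "\<dots> = (c2 + c3 + \<alpha>\<^sup>2 / 2 - \<beta>) * poly P0 1"
    by (simp add: P1_1 P0_1 power2_eq_square algebra_simps)
  also have "c2 + c3 + \<alpha>\<^sup>2 / 2 - \<beta> = \<beta> * (- 4 * N\<^sup>2 + N + 1) / (2 * (4 * N\<^sup>2 - 1)) + \<alpha>\<^sup>2 * (3 * N - 2) / (4 * (2 * N - 1))"
  proof -
    have f: "4 * N\<^sup>2 - 1 = (2 * N - 1) * (2 * N + 1)" by (simp add: power2_eq_square algebra_simps)
    have 1: "\<beta> * (N + 1) / (2 * B) + (N * (\<beta> * (N + 1) / (2 * B)) - N * (\<alpha>\<^sup>2 / 2 + \<beta> * (N - 1)) / (2 * A)) + \<alpha>\<^sup>2 / 2 - \<beta>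
        = (2 * \<beta> * (N + 1)\<^sup>2 * A - N * (\<alpha>\<^sup>2 + 2 * \<beta> * (N - 1)) * B + (2 * \<alpha>\<^sup>2 - 4 * \<beta>) * (A * B)) / (4 * A * B)"
      "\<beta> * (- 4 * N\<^sup>2 + N + 1) / (2 * (A * B)) + \<alpha>\<^sup>2 * (3 * N - 2) / (4 * A)
        = (2 * \<beta> * (- 4 * N\<^sup>2 + N + 1) + \<alpha>\<^sup>2 * (3 * N - 2) * B) / (4 * A * B)"
      if "A > 0" "B > 0" for A B
      using that by (simp_all add: field_simps power2_eq_square)
    have 2: "2 * \<beta> * (N + 1)\<^sup>2 * A - N * (\<alpha>\<^sup>2 + 2 * \<beta> * (N - 1)) * B + (2 * \<alpha>\<^sup>2 - 4 * \<beta>) * (A * B)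
        = 2 * \<beta> * (- 4 * N\<^sup>2 + N + 1) + \<alpha>\<^sup>2 * (3 * N - 2) * B"
      if "A = 2 * N - 1" "B = 2 * N + 1" for A B
      unfolding that by (simp add: power2_eq_square algebra_simps)
    have pos: "2 * N - 1 > 0" "2 * N + 1 > 0" using N2 by auto
    show ?thesis
      unfolding c3_def c2_def f 1(1)[OF pos] 1(2)[OF pos] 2[OF refl refl] ..
  qed
  finally show "poly P2 1 = (\<beta> * (- 4 * N\<^sup>2 + N + 1) / (2 * (4 * N\<^sup>2 - 1)) + \<alpha>\<^sup>2 * (3 * N - 2) / (4 * (2 * N - 1))) * poly P0 1" .
qed

section \<open>Dependence of reproducing polynomials on the weight\<close>

lemma Cn_det:
  fixes A :: "real \<Rightarrow> real ^ 'k ^ 'k"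
  assumes "\<And>i j. Cn p S (\<lambda>s. A s $ i $ j)"
  shows "Cn p S (\<lambda>s. det (A s))"
  unfolding det_def using assms by (intro Cn_sum Cn_mult Cn_const Cn_prod)

text \<open>By Cramer's rule the solution is a quotient of determinants, which inherits the
  differentiability of the entries, including one-sided differentiability at end points.\<close>

lemma linear_system_Cn:
  fixes A :: "real \<Rightarrow> real ^ 'k ^ 'k"
  assumes A: "\<And>i j. Cn p S (\<lambda>s. A s $ i $ j)" and inj: "\<And>s x. s \<in> S \<Longrightarrow> A s *v x = 0 \<Longrightarrow> x = 0"
  shows "\<exists>x. (\<forall>k. Cn p S (\<lambda>s. x s $ k)) \<and> (\<forall>s\<in>S. A s *v x s = b)"
proof -
  have det: "det (A s) \<noteq> 0" if "s \<in> S" for s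
    using inj[OF that] matrix_left_invertible_ker[of "A s"] invertible_left_inverse invertible_det_nz by blast
  define x where "x s = (\<chi> k. det (\<chi> i j. if j = k then b $ i else A s $ i $ j) / det (A s))" for s
  have "Cn p S (\<lambda>s. x s $ k)" for k
  proof -
    have "Cn p S (\<lambda>s. (\<chi> i j. if j = k then b $ i else A s $ i $ j) $ i' $ j')" for i' j'
      using A by (cases "j' = k") auto
    then show ?thesis
      unfolding x_def using det A by (auto intro!: Cn_divide Cn_det)
  qed
  moreover have "A s *v x s = b" if "s \<in> S" for s
    using cramer[OF det[OF that], of "x s" b] by (simp add: x_def)
  ultimately show ?thesis by blast
qed

lemma sum_coord_ix:
  fixes f :: "'n::finite \<Rightarrow> real"
  assumes "CARD('n) = m + 2"
  shows "(\<Sum>i\<in>UNIV. f i) = f (coord_ix 0) + (\<Sum>k\<le>m. f (coord_ix (Suc k)))"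
proof -
  have "(\<Sum>i\<in>UNIV. f i) = (\<Sum>k<m + 2. f (coord_ix k))"
    using sum.reindex_bij_betw[OF bij_betw_coord_ix[where 'n='n], of f] assms by simp
  also have "\<dots> = f (coord_ix 0) + (\<Sum>k<m + 1. f (coord_ix (Suc k)))"
    using sum.lessThan_Suc_shift[of "\<lambda>k. f (coord_ix k)" "m + 1"] by simp
  finally show ?thesis by (simp add: lessThan_Suc_atMost)
qed

text \<open>The moments form the Gram matrix of the monomials for a positive weight; a kernel
  element is a polynomial whose square has integral 0, so it vanishes on [0,1].\<close>

lemma moment_form_definite:
  fixes W :: "real \<Rightarrow> real" and d :: "nat \<Rightarrow> real"
  assumes W: "continuous_on {0..\<delta>} W" "\<And>s. s \<in> {0..\<delta>} \<Longrightarrow> W s > 0" and s: "s \<in> {0..\<delta>}"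
    and 0: "\<And>j. j \<le> m \<Longrightarrow> (\<Sum>k\<le>m. d k * integral {0..1} (\<lambda>r. r ^ (j + k) * W (s * r))) = 0"
  shows "k \<le> m \<Longrightarrow> d k = 0"
proof -
  assume k: "k \<le> m"
  have sr: "s * r \<in> {0..\<delta>}" if "r \<in> {0..1}" for r
    using s that mult_left_le[of r s] by (auto intro: order_trans)
  have cW: "continuous_on {0..1} (\<lambda>r. W (s * r))"
    using sr by (intro continuous_on_compose2[OF W(1)] continuous_intros) auto
  let ?p = "\<lambda>r. \<Sum>k\<le>m. d k * r ^ k"
  have c: "continuous_on {0..1} (\<lambda>r. (?p r)\<^sup>2 * W (s * r))"
    by (intro continuous_intros cW)
  have "((\<lambda>r. \<Sum>j\<le>m. d j * (\<Sum>k\<le>m. d k * (r ^ (j + k) * W (s * r)))) has_integral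
     (\<Sum>j\<le>m. d j * (\<Sum>k\<le>m. d k * integral {0..1} (\<lambda>r. r ^ (j + k) * W (s * r))))) {0..1}"
    by (intro has_integral_sum has_integral_mult_right integrable_integral integrable_continuous_real
        continuous_intros cW) auto
  moreover have "(\<Sum>j\<le>m. d j * (\<Sum>k\<le>m. d k * (r ^ (j + k) * W (s * r)))) = (?p r)\<^sup>2 * W (s * r)" for r
    by (simp add: power2_eq_square sum_distrib_left sum_distrib_right power_add mult_ac)
  ultimately have "integral {0..1} (\<lambda>r. (?p r)\<^sup>2 * W (s * r)) = 0"
    using 0 by (simp add: has_integral_iff)
  then have "\<forall>r\<in>{0..1}. (?p r)\<^sup>2 * W (s * r) = 0"
    using integral_eq_0_iff[OF c] W(2)[OF sr] by (simp add: less_imp_le)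
  then have "{0..1} \<subseteq> {r. ?p r = 0}"
    using W(2)[OF sr] by force
  then have "infinite {r. ?p r = 0}"
    using finite_subset infinite_Icc_iff[of 0 "1 :: real"] by (metis zero_less_one)
  then show "d k = 0" using polyfun_finite_roots[of d m] k by auto
qed

lemma integral01_monom: "integral01 (monom c k) = c / real (k + 1)"
proof -
  have "pderiv (monom (c / real (k + 1)) (k + 1)) = monom c k"
    by (simp add: pderiv_monom)
  then show ?thesis
    using integral01_pderiv[of "monom (c / real (k + 1)) (k + 1)"] by (simp add: poly_monom)
qed

lemma integral01_sum: "integral01 (\<Sum>k\<in>A. f k) = (\<Sum>k\<in>A. integral01 (f k))"
  by (induction A rule: infinite_finite_induct) (auto simp: integral01_add)

text \<open>\<rho>(s) is the value at 1 of the polynomial that reproduces the value at 0 for the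
  weight r \<mapsto> W(s r). The last conclusion states this in coefficients: a polynomial that
  represents e times the evaluation at 0 has the value e \<rho>(s) at 1.\<close>

proposition reproducing_value_at_end:
  fixes W :: "real \<Rightarrow> real" and m :: nat and w0 w1 w2 :: real
  defines "N \<equiv> real (m + 1)" and "\<alpha> \<equiv> w1 / w0" and "\<beta> \<equiv> w2 / w0"
  assumes n: "CARD('n::finite) = m + 2" and m: "m \<ge> 1" and d: "\<delta> > 0"
    and W: "Cn 3 {0..\<delta>} W" "\<And>s. s \<in> {0..\<delta>} \<Longrightarrow> W s > 0" "jet2 W w0 w1 w2" and w0: "w0 \<noteq> 0"
  obtains \<rho> where "Cn 3 {0..\<delta>} \<rho>"
    "jet2 \<rho> ((-1) ^ m * N / w0) ((-1) ^ m * N / w0 * (- \<alpha> / 2))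
      ((-1) ^ m * N / w0 * (\<beta> * (- 4 * N\<^sup>2 + N + 1) / (2 * (4 * N\<^sup>2 - 1)) + \<alpha>\<^sup>2 * (3 * N - 2) / (4 * (2 * N - 1))))"
    "\<And>s d e. s \<in> {0..\<delta>} \<Longrightarrow>
      (\<And>j. j \<le> m \<Longrightarrow> (\<Sum>k\<le>m. d k * integral {0..1} (\<lambda>r. r ^ (j + k) * W (s * r))) = (if j = 0 then e else 0)) \<Longrightarrow>
      (\<Sum>k\<le>m. d k) = e * \<rho> s"
proof -
  define M where "M l s = integral {0..1} (\<lambda>r. r ^ l * W (s * r))" for l s
  have S: "convex {0..\<delta>}" "0 \<in> {0..\<delta>}" using d by auto
  have MC: "Cn 3 {0..\<delta>} (M l)" for l
    unfolding M_def by (intro Cn_scaled_integral[OF S W(1)] continuous_intros)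
  have MJ: "jet2 (M l) (w0 / real (l + 1)) (w1 / real (l + 2)) (w2 / real (l + 3))" for l
    unfolding M_def by (rule jet2_scaled_integral[OF d W(1,3)])
  have Wc: "continuous_on {0..\<delta>} W" using W(1) by (rule Cn_continuous_on)
  define ix where "ix = (the_inv_into {..<CARD('n)} coord_ix :: 'n \<Rightarrow> nat)"
  have ix: "ix (coord_ix k) = k" if "k < m + 2" for k
    using bij_betw_coord_ix[where 'n='n] that n unfolding ix_def
    by (intro the_inv_into_f_f) (auto simp: bij_betw_def)
  \<comment> \<open>The m + 1 moment equations are embedded into a square system over the index type
    of size m + 2 by an identity row and column at index 0.\<close>
  define A where "A s = (\<chi> i j. if ix i = 0 \<or> ix j = 0 then (if i = j then 1 else 0)
      else M (ix i - 1 + (ix j - 1)) s :: real ^ 'n ^ 'n)" for s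
  have ne0: "coord_ix (Suc k) \<noteq> (coord_ix 0 :: 'n)" if "k \<le> m" for k
    using coord_ix_eq_iff[where 'n='n, of "Suc k" 0] that n by simp
  have A0: "(A s *v x) $ coord_ix 0 = x $ coord_ix 0" for s x
  proof -
    have "(A s *v x) $ coord_ix 0 = (\<Sum>i\<in>UNIV. A s $ coord_ix 0 $ i * x $ i)"
      by (simp add: matrix_vector_mult_def)
    also have "\<dots> = A s $ coord_ix 0 $ coord_ix 0 * x $ coord_ix 0 + (\<Sum>k\<le>m. 0)"
      unfolding sum_coord_ix[OF n] using ix ne0
      by (intro arg_cong2[where f="(+)"] sum.cong) (auto simp: A_def dest: sym)
    finally show ?thesis using ix by (simp add: A_def)
  qed
  have A1: "(A s *v x) $ coord_ix (Suc j) = (\<Sum>k\<le>m. x $ coord_ix (Suc k) * M (j + k) s)" if "j \<le> m" for s x j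
  proof -
    have "(A s *v x) $ coord_ix (Suc j) = (\<Sum>i\<in>UNIV. A s $ coord_ix (Suc j) $ i * x $ i)"
      by (simp add: matrix_vector_mult_def)
    also have "\<dots> = (\<Sum>k\<le>m. x $ coord_ix (Suc k) * M (j + k) s)"
      unfolding sum_coord_ix[OF n] using ix ne0[OF that] that by (simp add: A_def mult.commute)
    finally show ?thesis .
  qed
  have eq0I: "x = 0" if "x $ coord_ix 0 = 0" "\<And>k. k \<le> m \<Longrightarrow> x $ coord_ix (Suc k) = 0" for x :: "real ^ 'n"
  proof -
    have "x $ i = 0" for i using that n by (cases i rule: coord_ix_cases) auto
    then show ?thesis by (simp add: vec_eq_iff)
  qed
  have inj: "x = 0" if s: "s \<in> {0..\<delta>}" and 0: "A s *v x = 0" for s x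
  proof (rule eq0I)
    show "x $ coord_ix 0 = 0" using A0[of s x] 0 by simp
    fix k assume k: "k \<le> m"
    show "x $ coord_ix (Suc k) = 0"
    proof (rule moment_form_definite[OF Wc W(2) s _ k, where d="\<lambda>k. x $ coord_ix (Suc k)"])
      show "(\<Sum>k\<le>m. x $ coord_ix (Suc k) * integral {0..1} (\<lambda>r. r ^ (j + k) * W (s * r))) = 0" if "j \<le> m" for j
        using A1[OF that, of s x] 0 by (simp add: M_def)
    qed auto
  qed
  have AC: "Cn 3 {0..\<delta>} (\<lambda>s. A s $ i $ j)" for i j
    by (cases "ix i = 0 \<or> ix j = 0") (auto simp: A_def MC)
  define b where "b = (axis (coord_ix (Suc 0)) 1 :: real ^ 'n)"
  obtain x where xC: "\<And>k. Cn 3 {0..\<delta>} (\<lambda>s. x s $ k)" and x: "\<And>s. s \<in> {0..\<delta>} \<Longrightarrow> A s *v x s = b"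
    using linear_system_Cn[where A=A and S="{0..\<delta>}" and b=b, OF AC] inj by blast
  define c where "c k s = x s $ coord_ix (Suc k)" for k s
  have b_Suc: "b $ coord_ix (Suc j) = (if j = 0 then 1 else 0)" if "j \<le> m" for j
    using coord_ix_eq_iff[where 'n='n, of "Suc j" "Suc 0"] that n by (auto simp: b_def axis_def)
  have c: "(\<Sum>k\<le>m. c k s * M (j + k) s) = (if j = 0 then 1 else 0)" if "s \<in> {0..\<delta>}" "j \<le> m" for s j
    using A1[OF that(2), of s "x s"] x[OF that(1)] b_Suc[OF that(2)] by (simp add: c_def)
  have cC: "Cn 3 {0..\<delta>} (c k)" for k unfolding c_def by (rule xC)
  have "\<exists>c0 c1 c2. jet2 (c k) c0 c1 c2" for k using Cn3_jet2[OF d cC[of k]] by blast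
  then obtain c0 c1 c2 where cJ: "\<And>k. jet2 (c k) (c0 k) (c1 k) (c2 k)" by metis
  define P0 where "P0 = (\<Sum>k\<le>m. monom (c0 k) k)"
  define P1 where "P1 = (\<Sum>k\<le>m. monom (c1 k) k)"
  define P2 where "P2 = (\<Sum>k\<le>m. monom (c2 k) k)"
  have deg: "coeff P0 j = 0" "coeff P1 j = 0" "coeff P2 j = 0" if "j > m" for j
    using that by (auto simp: P0_def P1_def P2_def coeff_sum intro!: sum.neutral)
  \<comment> \<open>The moment equations hold for every s in the interval with right-hand sides
    independent of s; comparing orders 0, 1 and 2 gives the three systems whose solutions are known
    explicitly.\<close>
  have jets: "(\<Sum>k\<le>m. c0 k * (w0 / real (j + k + 1))) = (if j = 0 then 1 else 0)"
    "(\<Sum>k\<le>m. c0 k * (w1 / real (j + k + 2)) + c1 k * (w0 / real (j + k + 1))) = 0"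
    "(\<Sum>k\<le>m. c0 k * (w2 / real (j + k + 3)) + c1 k * (w1 / real (j + k + 2)) + c2 k * (w0 / real (j + k + 1))) = 0"
    if j: "j \<le> m" for j
  proof -
    have "jet2 (\<lambda>s. \<Sum>k\<le>m. c k s * M (j + k) s) (\<Sum>k\<le>m. c0 k * (w0 / real (j + k + 1)))
      (\<Sum>k\<le>m. c0 k * (w1 / real (j + k + 2)) + c1 k * (w0 / real (j + k + 1)))
      (\<Sum>k\<le>m. c0 k * (w2 / real (j + k + 3)) + c1 k * (w1 / real (j + k + 2)) + c2 k * (w0 / real (j + k + 1)))"
      by (intro jet2_sum jet2_mult cJ MJ)
    moreover have "\<forall>\<^sub>F s in at_right 0. (\<Sum>k\<le>m. c k s * M (j + k) s) = (if j = 0 then 1 else 0)"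
      using eventually_at_right_Icc[OF d] by eventually_elim (rule c[OF _ j])
    ultimately have J: "jet2 (\<lambda>s. if j = 0 then 1 else 0) (\<Sum>k\<le>m. c0 k * (w0 / real (j + k + 1)))
      (\<Sum>k\<le>m. c0 k * (w1 / real (j + k + 2)) + c1 k * (w0 / real (j + k + 1)))
      (\<Sum>k\<le>m. c0 k * (w2 / real (j + k + 3)) + c1 k * (w1 / real (j + k + 2)) + c2 k * (w0 / real (j + k + 1)))"
      by (rule jet2_cong)
    show "(\<Sum>k\<le>m. c0 k * (w0 / real (j + k + 1))) = (if j = 0 then 1 else 0)"
      "(\<Sum>k\<le>m. c0 k * (w1 / real (j + k + 2)) + c1 k * (w0 / real (j + k + 1))) = 0"
      "(\<Sum>k\<le>m. c0 k * (w2 / real (j + k + 3)) + c1 k * (w1 / real (j + k + 2)) + c2 k * (w0 / real (j + k + 1))) = 0"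
      using jet2_unique[OF J jet2_const] by simp_all
  qed
  have mom: "integral01 (monom 1 j * (monom 1 i * (\<Sum>k\<le>m. monom (a k) k))) = (\<Sum>k\<le>m. a k / real (j + k + i + 1))" for i j a
    by (simp add: sum_distrib_left mult_monom integral01_sum integral01_monom add_ac)
  have mom0: "integral01 (monom 1 j * (\<Sum>k\<le>m. monom (a k) k)) = (\<Sum>k\<le>m. a k / real (j + k + 1))" for j a
    by (simp add: sum_distrib_left mult_monom integral01_sum integral01_monom)
  have e0: "integral01 (monom 1 j * smult w0 P0) = (if j = 0 then 1 else 0)" if "j \<le> m" for j
  proof -
    have "integral01 (monom 1 j * smult w0 P0) = w0 * (\<Sum>k\<le>m. c0 k / real (j + k + 1))"
      unfolding P0_def mult_smult_right integral01_smult mom0 ..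
    also have "\<dots> = (\<Sum>k\<le>m. c0 k * (w0 / real (j + k + 1)))"
      by (simp add: sum_distrib_left mult.commute)
    finally show ?thesis using jets(1)[OF that] by simp
  qed
  have e1: "integral01 (monom 1 j * (smult w0 P1 + smult w1 (monom 1 1 * P0))) = 0" if "j \<le> m" for j
  proof -
    have "integral01 (monom 1 j * (smult w0 P1 + smult w1 (monom 1 1 * P0)))
      = w0 * (\<Sum>k\<le>m. c1 k / real (j + k + 1)) + w1 * (\<Sum>k\<le>m. c0 k / real (j + k + 1 + 1))"
      unfolding P1_def P0_def distrib_left integral01_add mult_smult_right integral01_smult mom mom0 ..
    also have "\<dots> = (\<Sum>k\<le>m. c0 k * (w1 / real (j + k + 2)) + c1 k * (w0 / real (j + k + 1)))"
      by (simp add: sum_distrib_left sum.distrib mult.commute add.commute)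
    finally show ?thesis using jets(2)[OF that] by simp
  qed
  have e2: "integral01 (monom 1 j * (smult w0 P2 + smult w1 (monom 1 1 * P1) + smult w2 (monom 1 2 * P0))) = 0" if "j \<le> m" for j
  proof -
    have "integral01 (monom 1 j * (smult w0 P2 + smult w1 (monom 1 1 * P1) + smult w2 (monom 1 2 * P0)))
      = w0 * (\<Sum>k\<le>m. c2 k / real (j + k + 1)) + w1 * (\<Sum>k\<le>m. c1 k / real (j + k + 1 + 1)) + w2 * (\<Sum>k\<le>m. c0 k / real (j + k + 2 + 1))"
      unfolding P2_def P1_def P0_def distrib_left integral01_add mult_smult_right integral01_smult mom mom0 ..
    also have "\<dots> = (\<Sum>k\<le>m. c0 k * (w2 / real (j + k + 3)) + c1 k * (w1 / real (j + k + 2)) + c2 k * (w0 / real (j + k + 1)))"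
      by (simp add: sum_distrib_left sum.distrib mult.commute add.commute add.left_commute)
    finally show ?thesis using jets(3)[OF that] by simp
  qed
  note vals = reproducing_polynomial_expansion[OF m w0 deg e0 e1 e2, folded N_def \<alpha>_def \<beta>_def]
  have vP: "(\<Sum>k\<le>m. c0 k) = poly P0 1" "(\<Sum>k\<le>m. c1 k) = poly P1 1" "(\<Sum>k\<le>m. c2 k) = poly P2 1"
    by (simp_all add: P0_def P1_def P2_def poly_sum poly_monom)
  show thesis
  proof (rule that)
    show "Cn 3 {0..\<delta>} (\<lambda>s. \<Sum>k\<le>m. c k s)" by (intro Cn_sum cC)
    have "jet2 (\<lambda>s. \<Sum>k\<le>m. c k s) (\<Sum>k\<le>m. c0 k) (\<Sum>k\<le>m. c1 k) (\<Sum>k\<le>m. c2 k)"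
      by (intro jet2_sum cJ)
    moreover have "(\<Sum>k\<le>m. c0 k) = (-1) ^ m * N / w0"
      "(\<Sum>k\<le>m. c1 k) = (-1) ^ m * N / w0 * (- \<alpha> / 2)"
      "(\<Sum>k\<le>m. c2 k) = (-1) ^ m * N / w0 * (\<beta> * (- 4 * N\<^sup>2 + N + 1) / (2 * (4 * N\<^sup>2 - 1)) + \<alpha>\<^sup>2 * (3 * N - 2) / (4 * (2 * N - 1)))"
    proof -
      show v0: "(\<Sum>k\<le>m. c0 k) = (-1) ^ m * N / w0"
        using vP(1) vals(1) by (rule trans)
      have "(\<Sum>k\<le>m. c1 k) = - (\<alpha> / 2) * (\<Sum>k\<le>m. c0 k)"
        using vP(2) vals(2) unfolding vP(1) by (rule trans)
      then show "(\<Sum>k\<le>m. c1 k) = (-1) ^ m * N / w0 * (- \<alpha> / 2)"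
        unfolding v0 by (simp add: mult_ac)
      have "(\<Sum>k\<le>m. c2 k) = (\<beta> * (- 4 * N\<^sup>2 + N + 1) / (2 * (4 * N\<^sup>2 - 1)) + \<alpha>\<^sup>2 * (3 * N - 2) / (4 * (2 * N - 1))) * (\<Sum>k\<le>m. c0 k)"
        using vP(3) vals(3) unfolding vP(1) by (rule trans)
      then show "(\<Sum>k\<le>m. c2 k) = (-1) ^ m * N / w0 * (\<beta> * (- 4 * N\<^sup>2 + N + 1) / (2 * (4 * N\<^sup>2 - 1)) + \<alpha>\<^sup>2 * (3 * N - 2) / (4 * (2 * N - 1)))"
        unfolding v0 by (simp only: mult.commute)
    qed
    ultimately show "jet2 (\<lambda>s. \<Sum>k\<le>m. c k s) ((-1) ^ m * N / w0) ((-1) ^ m * N / w0 * (- \<alpha> / 2))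
      ((-1) ^ m * N / w0 * (\<beta> * (- 4 * N\<^sup>2 + N + 1) / (2 * (4 * N\<^sup>2 - 1)) + \<alpha>\<^sup>2 * (3 * N - 2) / (4 * (2 * N - 1))))"
      by (simp only:)
    fix s d e assume s: "s \<in> {0..\<delta>}"
      and *: "\<And>j. j \<le> m \<Longrightarrow> (\<Sum>k\<le>m. d k * integral {0..1} (\<lambda>r. r ^ (j + k) * W (s * r))) = (if j = 0 then e else 0)"
    have "d k - e * c k s = 0" if "k \<le> m" for k
    proof (rule moment_form_definite[OF Wc W(2) s _ that, where d="\<lambda>k. d k - e * c k s"])
      show "(\<Sum>k\<le>m. (d k - e * c k s) * integral {0..1} (\<lambda>r. r ^ (j + k) * W (s * r))) = 0" if "j \<le> m" for j
        using *[OF that] c[OF s that] by (simp add: left_diff_distrib sum_subtractf M_def mult.assoc sum_distrib_left[symmetric])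
    qed auto
    then show "(\<Sum>k\<le>m. d k) = e * (\<Sum>k\<le>m. c k s)" by (simp add: sum_distrib_left)
  qed
qed

section \<open>Normal extremals\<close>

text \<open>
  The functions \<open>h\<^sub>1\<close> and \<open>h\<^bsub>i+2\<^esub>\<close> along the extremal are \<open>u\<close> and \<open>p \<bullet> jet_vec i (coord_x (\<gamma> t))\<close>: only the
  \<open>d_x\<close>-component of the covector varies, and that component of \<open>p\<close> is not used.
\<close>

definition extremal :: "real \<Rightarrow> (real \<Rightarrow> real ^ 'n::finite) \<Rightarrow> real ^ 'n \<Rightarrow> (real \<Rightarrow> real) \<Rightarrow> bool" where
  "extremal T \<gamma> p u \<longleftrightarrow> (\<forall>t\<in>{0..T}.
     (\<gamma> has_vector_derivative u t *\<^sub>R d_x + (p \<bullet> jet_vec 0 (coord_x (\<gamma> t))) *\<^sub>R jet_vec 0 (coord_x (\<gamma> t)))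
       (at t within {0..T}) \<and>
     (u has_real_derivative - ((p \<bullet> jet_vec 0 (coord_x (\<gamma> t))) * (p \<bullet> jet_vec 1 (coord_x (\<gamma> t)))))
       (at t within {0..T}))"

lemma inner_jet_vec_has_derivative [derivative_intros]:
  "((\<lambda>\<xi>. p \<bullet> jet_vec i \<xi>) has_real_derivative p \<bullet> jet_vec (Suc i) \<xi>) (at \<xi> within S)"
  using bounded_linear.has_vector_derivative[OF bounded_linear_inner_right jet_vec_has_vector_derivative, of p i \<xi> S]
  by (simp add: has_real_derivative_iff_has_vector_derivative)

lemma Cn_inner_jet_vec: "Cn k S (\<lambda>\<xi>. p \<bullet> jet_vec i \<xi>)"
proof (induction k arbitrary: i)
  case 0
  show ?case by (simp add: continuous_intros)
next
  case (Suc k)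
  show ?case by (rule CnI[OF inner_jet_vec_has_derivative Suc.IH])
qed

lemma Cn_sqrt: "Cn k {0<..} sqrt"
proof (induction k)
  case 0
  show ?case by (auto intro: continuous_intros)
next
  case (Suc k)
  have "Cn k {0<..} (\<lambda>x. inverse (2 * sqrt x))"
    by (intro Cn_inverse Cn_mult Cn_const Suc.IH) auto
  then show ?case
    by (rule CnI[rotated]) (auto intro!: derivative_eq_intros simp: field_simps)
qed

text \<open>Positivity of g keeps the inner value to the right of 0, where alone the expansion of f
  holds.\<close>

lemma jet2_compose:
  assumes f: "jet2 f a b c" and g: "jet2 g 0 g1 g2" and pos: "\<forall>\<^sub>F t in at_right 0. g t > 0"
  shows "jet2 (\<lambda>t. f (g t)) a (b * g1) (b * g2 + c * g1\<^sup>2)"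
proof -
  have "(\<lambda>t. g1 * t + g2 * t\<^sup>2) \<in> O[at_right 0](\<lambda>t. t)"
  proof -
    have "(\<lambda>t::real. t ^ 2) \<in> O[at_right 0](\<lambda>t. t ^ 1)" by (rule bigo_right_power_mono) simp
    then show ?thesis using bigo_const_mult by (intro sum_in_bigo) auto
  qed
  moreover have "(\<lambda>t::real. t ^ 3) \<in> O[at_right 0](\<lambda>t. t)"
    using bigo_right_power_mono[of 1 3] by simp
  then have "(\<lambda>t. g t - (0 + g1 * t + g2 * t\<^sup>2)) \<in> O[at_right 0](\<lambda>t. t)"
    using g unfolding jet2_def by (rule landau_o.big_trans[rotated])
  ultimately have gO: "g \<in> O[at_right 0](\<lambda>t. t)"
    using sum_in_bigo(1) by fastforce
  have lim: "filterlim g (at_right 0) (at_right 0)"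
  proof -
    obtain K where K: "\<forall>\<^sub>F t in at_right 0. norm (g t) \<le> K * norm t" using gO by (auto elim: landau_o.bigE)
    have "(g \<longlongrightarrow> 0) (at_right 0)"
      by (rule Lim_null_comparison[OF K]) (auto intro!: tendsto_eq_intros)
    then show ?thesis
      using pos unfolding filterlim_at by (auto elim: eventually_mono)
  qed
  have "(\<lambda>t. f (g t) - (a + b * g t + c * (g t)\<^sup>2)) \<in> O[at_right 0](\<lambda>t. (g t) ^ 3)"
    using landau_o.big.compose[OF f[unfolded jet2_def] lim] .
  also have "(\<lambda>t. (g t) ^ 3) \<in> O[at_right 0](\<lambda>t. t ^ 3)"
    by (rule landau_o.big_power[OF gO])
  finally have 1: "(\<lambda>t. f (g t) - (a + b * g t + c * (g t)\<^sup>2)) \<in> O[at_right 0](\<lambda>t. t ^ 3)" .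
  have 2: "jet2 (\<lambda>t. a + (b * g t + c * (g t * g t))) (a + (b * 0 + c * (0 * 0))) (0 + (b * g1 + c * (0 * g1 + g1 * 0)))
     (0 + (b * g2 + c * (0 * g2 + g1 * g1 + g2 * 0)))"
    by (intro jet2_add jet2_const jet2_cmult jet2_mult g)
  show ?thesis
  proof -
    have "f (g t) - (a + (b * g1) * t + (b * g2 + c * g1\<^sup>2) * t\<^sup>2) = (f (g t) - (a + b * g t + c * (g t)\<^sup>2)) +
      (a + (b * g t + c * (g t * g t)) - (a + (b * 0 + c * (0 * 0)) + (0 + (b * g1 + c * (0 * g1 + g1 * 0))) * t
        + (0 + (b * g2 + c * (0 * g2 + g1 * g1 + g2 * 0))) * t\<^sup>2))" for t
      by (simp add: power2_eq_square)
    then show ?thesis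
      unfolding jet2_def using sum_in_bigo(1)[OF 1 2[unfolded jet2_def]] by (simp only:)
  qed
qed

lemma has_real_derivative_unique_Icc:
  assumes "a < b" "t \<in> {a..b}" "(f has_real_derivative D) (at t within {a..b})"
    "(f has_real_derivative D') (at t within {a..b})"
  shows "D = D'"
  using vector_derivative_unique_within_closed_interval[of a b t f D D'] assms
  by (simp add: has_real_derivative_iff_has_vector_derivative)

lemma jet2I_derivs:
  assumes d: "\<delta> > 0" and f: "Cn 3 {0..\<delta>} f"
    and f': "\<And>t. t \<in> {0..\<delta>} \<Longrightarrow> (f has_real_derivative f' t) (at t within {0..\<delta>})"
    and f'': "(f' has_real_derivative D) (at 0 within {0..\<delta>})"
  shows "jet2 f (f 0) (f' 0) (D / 2)"
proof -
  obtain b c where j: "jet2 f (f 0) b c" using Cn3_jet2[OF d f] by blast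
  obtain g where g: "g 0 = b" "\<forall>t\<in>{0..\<delta>}. (f has_real_derivative g t) (at t within {0..\<delta>})"
    "(g has_real_derivative 2 * c) (at 0 within {0..\<delta>})"
    using jet2_Cn3_derivs[OF d f j] by blast
  have gf: "g t = f' t" if "t \<in> {0..\<delta>}" for t
    by (rule has_real_derivative_unique_Icc[OF d that bspec[OF g(2) that] f'[OF that]])
  have "(g has_real_derivative D) (at 0 within {0..\<delta>})"
    using has_field_derivative_transform_within[OF f'' zero_less_one, of g] gf d by auto
  then have "2 * c = D"
    using has_real_derivative_unique_Icc[OF d _ g(3), of D] d by simp
  then have "c = D / 2" by simp
  moreover have "b = f' 0" using g(1) gf[of 0] d by simp
  ultimately show ?thesis using j by (simp only:)
qed

section \<open>Covectors as polynomials and the linearized end point equation\<close>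

text \<open>Together with its converse \<open>vector_polynomial\<close> this identifies y-parts of
  vectors with polynomials of degree at most n - 2, so that vector equations may be tested against
  monomials.\<close>

lemma polynomial_vector:
  fixes R :: "real poly"
  assumes n: "CARD('n::finite) = m + 2" and R: "degree R \<le> m"
  shows "\<exists>f :: real ^ 'n. \<forall>\<xi>. f \<bullet> jet_vec 0 \<xi> = poly R \<xi>"
proof -
  define f where "f = (\<Sum>j\<le>m. (coeff R j * fact j) *\<^sub>R (d_y j :: real ^ 'n))"
  have "f \<bullet> jet_vec 0 \<xi> = poly R \<xi>" for \<xi>
  proof -
  have "f \<bullet> jet_vec 0 \<xi> = (\<Sum>j\<le>m. (coeff R j * fact j) * (jet_vec 0 \<xi> \<bullet> (d_y j :: real ^ 'n)))"
    by (simp add: f_def inner_sum_left inner_commute[of "jet_vec 0 \<xi>"])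
  also have "\<dots> = (\<Sum>j\<le>m. coeff R j * \<xi> ^ j)"
    using n by (intro sum.cong) (auto simp: jet_vec_inner_d_y)
  also have "\<dots> = poly R \<xi>"
    unfolding poly_altdef using R by (intro sum.mono_neutral_right) (auto simp: coeff_eq_0)
  finally show ?thesis .
  qed
  then show ?thesis by blast
qed

lemma vector_polynomial:
  fixes f :: "real ^ 'n::finite"
  shows "\<exists>R. degree R \<le> CARD('n) - 2 \<and> (\<forall>\<xi>. f \<bullet> jet_vec 0 \<xi> = poly R \<xi>)"
proof (intro exI conjI allI)
  let ?R = "\<Sum>j\<le>CARD('n) - 2. monom (f \<bullet> d_y j / fact j) j"
  show "degree ?R \<le> CARD('n) - 2"
    by (rule degree_sum_le) (auto intro: order_trans[OF degree_monom_le])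
  show "f \<bullet> jet_vec 0 \<xi> = poly ?R \<xi>" for \<xi>
    by (auto simp: jet_vec_def inner_sum_right poly_sum poly_monom atLeast0AtMost intro!: sum.cong)
qed

text \<open>Tested against monomials, the vector equation for \<open>dq\<close> becomes a weighted
  moment system whose right-hand side is a multiple of evaluation at the initial point. The
  polynomial of \<open>dq\<close> is thus a multiple of the reproducing polynomial, and only its
  value at the end point is wanted.\<close>

lemma (in slope_strip) covector_deriv_solution:
  assumes m: "CARD('n) = m + 2" and q: "q \<in> W" "coord_x q \<in> I" "b \<in> I" and dir: "\<sigma> * (b - coord_x q) > 0"
    and dq: "covector_deriv q b dq = v1 *\<^sub>R d_x + v2 *\<^sub>R jet_vec 0 (coord_x q)"
    and repr: "\<And>d e. (\<And>j. j \<le> m \<Longrightarrow> (\<Sum>k\<le>m. d k * integral {0..1} (\<lambda>r. r ^ (j + k) *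
        (1 / graph_root (q, coord_x q + \<sigma> * (\<sigma> * (b - coord_x q) * r)) ^ 3))) = (if j = 0 then e else 0)) \<Longrightarrow>
      (\<Sum>k\<le>m. d k) = e * R"
  shows "\<sigma> * (b - coord_x q) * (dq \<bullet> jet_vec 0 b) =
    (v1 * (\<sigma> * graph_slope (q, coord_x q) / graph_root (q, coord_x q)) - v2) * R"
proof -
  let ?a = "coord_x q"
  let ?\<xi> = "\<lambda>r. ?a + r * (b - ?a)"
  let ?\<mu> = "v1 * (\<sigma> * graph_slope (q, ?a) / graph_root (q, ?a)) - v2"
  have ne: "b - ?a \<noteq> 0" using dir by auto
  have \<xi>: "?a + \<sigma> * (\<sigma> * (b - ?a) * r) = ?\<xi> r" for r
    using sigma by (simp add: power2_eq_square mult.assoc[symmetric] mult.commute)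
  have pos: "graph_root (q, ?\<xi> r) > 0" if "r \<in> {0..1}" for r
    using slope_less[OF q(1) vel.in_segment[OF q(2,3) that]] by (rule graph_root_pos)
  obtain P where P: "degree P \<le> m" "\<And>\<xi>. dq \<bullet> jet_vec 0 \<xi> = poly P \<xi>"
    using vector_polynomial[of dq] m by auto
  define D where "D = pcompose P [:?a, b - ?a:]"
  have degD: "degree D \<le> m" unfolding D_def using P(1) ne by (simp add: degree_pcompose)
  have D: "dq \<bullet> jet_vec 0 (?\<xi> r) = (\<Sum>k\<le>m. coeff D k * r ^ k)" for r
  proof -
    have "dq \<bullet> jet_vec 0 (?\<xi> r) = poly D r" by (simp add: D_def P(2) poly_pcompose)
    also have "\<dots> = (\<Sum>k\<le>m. coeff D k * r ^ k)"
      unfolding poly_altdef using degD by (intro sum.mono_neutral_left) (auto simp: coeff_eq_0)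
    finally show ?thesis .
  qed
  have "coord_x dq = v1"
    using arg_cong[OF dq, of coord_x] coord_x_covector_deriv[OF q, of dq] n by simp
  \<comment> \<open>Subtracting the displacement from v1 times the initial graph velocity cancels
    the x-components; a multiple of X_2 remains, and ?\<mu> is its coefficient.\<close>
  then have I: "integral {0..1} (\<lambda>r. (b - ?a) *\<^sub>R graph_vel' \<sigma> (q, ?\<xi> r) (dq, 0)) = ?\<mu> *\<^sub>R jet_vec 0 ?a"
    using dq by (simp add: covector_deriv_def graph_vel_def algebra_simps)
  have "(\<Sum>k\<le>m. (\<sigma> * (b - ?a) * coeff D k) * integral {0..1} (\<lambda>r. r ^ (j + k) * (1 / graph_root (q, ?\<xi> r) ^ 3)))
     = (if j = 0 then ?\<mu> else 0)" if j: "j \<le> m" for j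
  proof -
    \<comment> \<open>The test vector is to pair with X_2 to r^j in the affine parameter of the
      segment. At the initial point r = 0 this is 1 for j = 0 and 0 otherwise.\<close>
    have "degree ([:- ?a / (b - ?a), 1 / (b - ?a):] ^ j) \<le> m"
      using order_trans[OF degree_power_le, of "[:- ?a / (b - ?a), 1 / (b - ?a):]" j m] j ne by simp
    then obtain f :: "real ^ 'n" where fP: "\<And>\<xi>. f \<bullet> jet_vec 0 \<xi> = poly ([:- ?a / (b - ?a), 1 / (b - ?a):] ^ j) \<xi>"
      using polynomial_vector[OF m] by blast
    have "d \<noteq> 0 \<Longrightarrow> poly [:- a / d, 1 / d:] (a + r * d) = r" for a d r :: real
      by (simp add: field_simps)
    note lin = this[OF ne]
    have f: "f \<bullet> jet_vec 0 (?\<xi> r) = r ^ j" for r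
      unfolding fP poly_power lin ..
    have int: "(\<lambda>r. r ^ (j + k) * (1 / graph_root (q, ?\<xi> r) ^ 3)) integrable_on {0..1}" for k
      by (intro integrable_continuous_real continuous_intros) (use pos in force)
    have "?\<mu> * (f \<bullet> jet_vec 0 ?a) = integral {0..1} (\<lambda>r. f \<bullet> ((b - ?a) *\<^sub>R graph_vel' \<sigma> (q, ?\<xi> r) (dq, 0)))"
      using integral_linear[OF segment_deriv_integrable[OF q] bounded_linear_inner_right[of f], of "(dq, 0)"]
      unfolding I by (simp only: o_def inner_scaleR_right)
    also have "\<dots> = integral {0..1} (\<lambda>r. \<Sum>k\<le>m. (\<sigma> * (b - ?a) * coeff D k) * (r ^ (j + k) * (1 / graph_root (q, ?\<xi> r) ^ 3)))"
    proof (rule integral_cong)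
      fix r :: real
      have "f \<bullet> ((b - ?a) *\<^sub>R graph_vel' \<sigma> (q, ?\<xi> r) (dq, 0))
        = (\<sigma> * (b - ?a)) * (\<Sum>k\<le>m. coeff D k * r ^ k) * r ^ j * (1 / graph_root (q, ?\<xi> r) ^ 3)"
        unfolding graph_vel'_0 inner_scaleR_right f D by simp
      also have "\<dots> = (\<Sum>k\<le>m. (\<sigma> * (b - ?a) * coeff D k) * (r ^ (j + k) * (1 / graph_root (q, ?\<xi> r) ^ 3)))"
        unfolding sum_distrib_left sum_distrib_right by (intro sum.cong) (simp_all add: power_add mult_ac)
      finally show "f \<bullet> ((b - ?a) *\<^sub>R graph_vel' \<sigma> (q, ?\<xi> r) (dq, 0))
        = (\<Sum>k\<le>m. (\<sigma> * (b - ?a) * coeff D k) * (r ^ (j + k) * (1 / graph_root (q, ?\<xi> r) ^ 3)))" .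
    qed
    also have "\<dots> = (\<Sum>k\<le>m. (\<sigma> * (b - ?a) * coeff D k) * integral {0..1} (\<lambda>r. r ^ (j + k) * (1 / graph_root (q, ?\<xi> r) ^ 3)))"
      by (intro integral_unique has_integral_sum has_integral_mult_right integrable_integral int) auto
    finally show ?thesis using f[of 0] by (simp add: power_0_left split: if_splits)
  qed
  then have "(\<Sum>k\<le>m. \<sigma> * (b - ?a) * coeff D k) = ?\<mu> * R"
    by (intro repr) (simp only: \<xi>)
  then show ?thesis
    using D[of 1] by (simp add: sum_distrib_left)
qed

definition curvature_form :: "real \<Rightarrow> real \<Rightarrow> real \<Rightarrow> real \<Rightarrow> real \<Rightarrow> real" where
  "curvature_form n h1 h2 h3 h4 = - (1/6) * (n - 1) * (12 + n * (4 * n - 17)) * (h3\<^sup>2 + h2 * h4)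
       - (n - 1) * (n - 2) * (n - 3) * h3\<^sup>2 * (h2\<^sup>2 / h1\<^sup>2)"

lemma R11_eq_curvature_form:
  "R11 (l :: (real ^ 'n::finite) \<times> _) = curvature_form (real CARD('n)) (cov_h 1 l) (cov_h 2 l) (cov_h 3 l) (cov_h 4 l)"
  by (simp add: R11_def curvature_form_def Let_def)

text \<open>
  Here \<open>(v\<^sub>1 h\<^sub>1 + v\<^sub>2 h\<^sub>2) / |h|\<close> and \<open>(v\<^sub>2 h\<^sub>1 - v\<^sub>1 h\<^sub>2) / |h|\<close> are the components of
  \<open>v\<^sub>1 X\<^sub>1 + v\<^sub>2 X\<^sub>2\<close> along the unit tangent of \<open>\<gamma>\<close> and along its normal.
\<close>

definition cost_expansion_at :: "(real \<Rightarrow> real ^ 'n::finite) \<Rightarrow> real \<Rightarrow> real \<Rightarrow> real \<Rightarrow> real \<Rightarrow> bool" where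
  "cost_expansion_at \<gamma> t h1 h2 F \<longleftrightarrow>
    (\<exists>(E :: real ^ 'n \<Rightarrow> real \<times> real) E' S K. open S \<and> \<gamma> 0 \<in> S \<and> E (\<gamma> 0) = 0 \<and>
      (\<forall>x\<in>S. geod_cost_dot \<gamma> t x = 1 / 2 * (E x \<bullet> E x) - K) \<and>
      (\<forall>x\<in>S. (E has_derivative E' x) (at x)) \<and>
      (\<forall>v. ((\<lambda>x. E' x v) \<longlongrightarrow> E' (\<gamma> 0) v) (at (\<gamma> 0))) \<and>
      (\<forall>v1 v2. let v = v1 *\<^sub>R d_x + v2 *\<^sub>R jet_vec 0 (coord_x (\<gamma> 0)) in
        E' (\<gamma> 0) v \<bullet> E' (\<gamma> 0) v =
          ((v1 * h1 + v2 * h2)\<^sup>2 + F * (v2 * h1 - v1 * h2)\<^sup>2) / ((h1\<^sup>2 + h2\<^sup>2) * t\<^sup>2)))"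

section \<open>Comparison of coefficients for the weight and for the normal coefficient\<close>

text \<open>The polynomial relation \<open>W^2 (1 - P^2)^3 = 1\<close> determines the relative jet
  of the weight order by order, without expanding a fractional power.\<close>

lemma weight_jet:
  fixes P W :: "real \<Rightarrow> real" and c A B u0 :: real
  assumes d: "\<delta> > 0" and W: "Cn 3 {0..\<delta>} W"
    and eq: "\<And>s. s \<in> {0..\<delta>} \<Longrightarrow> (W s)\<^sup>2 * (1 - (P s)\<^sup>2) ^ 3 = 1"
    and P: "jet2 P p0 p1 p2" and pos: "1 - p0\<^sup>2 > 0"
  obtains w1 w2 where "jet2 W (W 0) w1 w2" "W 0 \<noteq> 0" "(W 0)\<^sup>2 * (1 - p0\<^sup>2) ^ 3 = 1"
    "w1 / W 0 = 3 * p0 * p1 / (1 - p0\<^sup>2)"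
    "w2 / W 0 = 15 / 2 * (p0 * p1 / (1 - p0\<^sup>2))\<^sup>2 + 3 / 2 * (p1\<^sup>2 + 2 * p0 * p2) / (1 - p0\<^sup>2)"
proof -
  obtain w1 w2 where j: "jet2 W (W 0) w1 w2" using Cn3_jet2[OF d W] by blast
  define v where "v s = 1 + (- 1) * (P s * P s)" for s
  define v0 where "v0 = 1 - p0\<^sup>2"
  define v1 where "v1 = - 2 * p0 * p1"
  define v2 where "v2 = - (p1\<^sup>2 + 2 * p0 * p2)"
  have "jet2 v (1 + (- 1) * (p0 * p0)) (0 + (- 1) * (p0 * p1 + p1 * p0)) (0 + (- 1) * (p0 * p2 + p1 * p1 + p2 * p0))"
    unfolding v_def by (intro jet2_add jet2_cmult jet2_mult P jet2_const)
  then have v: "jet2 v v0 v1 v2"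
    by (simp add: v0_def v1_def v2_def power2_eq_square algebra_simps)
  have J: "jet2 (\<lambda>s. (W s * W s) * (v s * (v s * v s))) (W 0 * W 0 * (v0 * (v0 * v0)))
     (W 0 * W 0 * (v0 * (v0 * v1 + v1 * v0) + v1 * (v0 * v0)) + (W 0 * w1 + w1 * W 0) * (v0 * (v0 * v0)))
     (W 0 * W 0 * (v0 * (v0 * v2 + v1 * v1 + v2 * v0) + v1 * (v0 * v1 + v1 * v0) + v2 * (v0 * v0)) +
      (W 0 * w1 + w1 * W 0) * (v0 * (v0 * v1 + v1 * v0) + v1 * (v0 * v0)) +
      (W 0 * w2 + w1 * w1 + w2 * W 0) * (v0 * (v0 * v0)))"
    by (intro jet2_mult j v)
  have "\<forall>\<^sub>F s in at_right 0. (W s * W s) * (v s * (v s * v s)) = 1"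
    using eventually_at_right_Icc[OF d]
    by eventually_elim (use eq in \<open>simp add: v_def power2_eq_square power3_eq_cube mult.assoc\<close>)
  note J' = jet2_cong[OF J this]
  have e0: "W 0 * W 0 * (v0 * (v0 * v0)) = 1" by (rule jet2_unique(1)[OF J' jet2_const])
  have e1: "W 0 * W 0 * (v0 * (v0 * v1 + v1 * v0) + v1 * (v0 * v0)) + (W 0 * w1 + w1 * W 0) * (v0 * (v0 * v0)) = 0"
    by (rule jet2_unique(2)[OF J' jet2_const])
  have e2: "W 0 * W 0 * (v0 * (v0 * v2 + v1 * v1 + v2 * v0) + v1 * (v0 * v1 + v1 * v0) + v2 * (v0 * v0)) +
      (W 0 * w1 + w1 * W 0) * (v0 * (v0 * v1 + v1 * v0) + v1 * (v0 * v0)) +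
      (W 0 * w2 + w1 * w1 + w2 * W 0) * (v0 * (v0 * v0)) = 0"
    by (rule jet2_unique(3)[OF J' jet2_const])
  have W0: "W 0 \<noteq> 0" and v0: "v0 \<noteq> 0" using e0 by auto
  have "W 0 * v0\<^sup>2 * (3 * W 0 * v1 + 2 * w1 * v0) = 0"
    using e1 by (simp add: power2_eq_square algebra_simps)
  then have w1: "2 * w1 * v0 = - 3 * W 0 * v1" using W0 v0 by simp
  have "v0 * (W 0 * W 0 * (3 * v0 * v2 + 3 * v1 * v1) + 6 * W 0 * w1 * v0 * v1 + (2 * W 0 * w2 + w1 * w1) * v0 * v0) = 0"
    using e2 by (simp add: algebra_simps)
  then have w2: "W 0 * W 0 * (3 * v0 * v2 + 3 * v1 * v1) + 6 * W 0 * w1 * v0 * v1 + (2 * W 0 * w2 + w1 * w1) * v0 * v0 = 0"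
    using v0 by simp
  define r where "r = v1 / v0"
  define y where "y = v2 / v0"
  have ry: "v1 = r * v0" "v2 = y * v0" using v0 by (auto simp: r_def y_def)
  have "v0 * (2 * w1 + 3 * W 0 * r) = 0" using w1 by (simp add: ry algebra_simps)
  then have w1': "w1 = - 3 / 2 * W 0 * r" using v0 by simp
  have "v0 * v0 * (W 0 * (2 * w2 + W 0 * (3 * y - 15 / 4 * (r * r)))) = 0"
    using w2 unfolding w1' ry by (simp add: algebra_simps)
  then have "2 * w2 + W 0 * (3 * y - 15 / 4 * (r * r)) = 0"
    using W0 v0 by simp
  then have "w2 = W 0 * (15 / 8 * r\<^sup>2 - 3 / 2 * y)"
    by (simp add: power2_eq_square algebra_simps)
  then have "w2 / W 0 = 15 / 8 * r\<^sup>2 - 3 / 2 * y"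
    using W0 by simp
  also have "\<dots> = 15 / 2 * (p0 * p1 / v0)\<^sup>2 + 3 / 2 * (p1\<^sup>2 + 2 * p0 * p2) / v0"
    using v0 by (simp add: r_def y_def v1_def v2_def field_simps power2_eq_square)
  finally have "w2 / W 0 = 15 / 2 * (p0 * p1 / v0)\<^sup>2 + 3 / 2 * (p1\<^sup>2 + 2 * p0 * p2) / v0" .
  moreover have "w1 / W 0 = 3 * p0 * p1 / v0"
    using W0 v0 unfolding w1' by (simp add: r_def v1_def)
  ultimately show ?thesis
    using that[OF j W0] e0 by (simp add: v0_def power2_eq_square power3_eq_cube)
qed

text \<open>Coefficients of F (u 0)^2 (z u)^2 = c^6 \<rho>^2. Here \<open>e\<close> is
  \<open>u 0\<close>, the \<open>a0, a1, a2\<close> form the jet of z u with z the mean of u over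
  [0,t], and \<open>r1\<close>, \<open>r2\<close> are the jet of \<rho> at the travelled abscissa
  relative to its initial value. In first order the turning of the tangent and the change of weight
  balance, so \<open>f1\<close> vanishes.\<close>

lemma normal_jet_algebra:
  fixes e \<sigma> \<alpha> \<gamma> A B N :: real
  assumes e: "e \<noteq> 0" and \<sigma>: "\<sigma>\<^sup>2 = 1" and \<alpha>: "\<alpha> = 3 * \<sigma> * A / e\<^sup>2"
    and r: "r1 = - \<alpha> / 2 * (\<sigma> * e)" "r2 = - \<alpha> / 2 * (\<sigma> * (- A / 2)) + \<gamma> * (\<sigma> * e)\<^sup>2"
    and a: "a0 = e * e" "a1 = e * (- A) + (- A / 2) * e" "a2 = e * (- B * e / 2) + (- A / 2) * (- A) + (- B * e / 6) * e"
    and f: "f0 * (e\<^sup>2 * (a0 * a0)) = N\<^sup>2 * e ^ 6"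
      "f0 * (e\<^sup>2 * (a0 * a1 + a1 * a0)) + f1 * (e\<^sup>2 * (a0 * a0)) = N\<^sup>2 * e ^ 6 * (r1 + r1)"
      "f0 * (e\<^sup>2 * (a0 * a2 + a1 * a1 + a2 * a0)) + f1 * (e\<^sup>2 * (a0 * a1 + a1 * a0)) + f2 * (e\<^sup>2 * (a0 * a0))
         = N\<^sup>2 * e ^ 6 * (r2 + r1 * r1 + r2)"
  shows "f0 = N\<^sup>2" "f1 = 0" "f2 = N\<^sup>2 * (A\<^sup>2 / (2 * e\<^sup>2) + 4 / 3 * B + 2 * \<gamma> * e\<^sup>2)"
proof -
  have p: "e\<^sup>2 * (a0 * a0) = e ^ 6" by (simp add: a power2_eq_square eval_nat_numeral)
  show f0: "f0 = N\<^sup>2" using f(1) e unfolding p by simp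
  have \<sigma>\<sigma>: "\<sigma> * \<sigma> = 1" using \<sigma> by (simp add: power2_eq_square)
  have r1: "r1 = - 3 / 2 * A / e"
    using e \<sigma>\<sigma> unfolding r(1) \<alpha> by (simp add: power2_eq_square field_simps)
  have r2: "r2 = 3 / 4 * A\<^sup>2 / e\<^sup>2 + \<gamma> * e\<^sup>2"
  proof -
    have "- \<alpha> / 2 * (\<sigma> * (- A / 2)) = (\<sigma> * \<sigma>) * (3 / 4 * A\<^sup>2 / e\<^sup>2)"
      unfolding \<alpha> by (simp add: power2_eq_square)
    then show ?thesis unfolding r(2) by (simp add: power_mult_distrib \<sigma> \<sigma>\<sigma>)
  qed
  have "e ^ 6 * (r1 + r1) = e\<^sup>2 * (a0 * a1 + a1 * a0)"
    using e by (simp add: r1 a power2_eq_square eval_nat_numeral field_simps)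
  then have "N\<^sup>2 * (e\<^sup>2 * (a0 * a1 + a1 * a0)) = N\<^sup>2 * e ^ 6 * (r1 + r1)" by (simp only: mult.assoc)
  then have "f1 * e ^ 6 = 0" using f(2) unfolding p f0 by linarith
  then show f1: "f1 = 0" using e by simp
  have "N\<^sup>2 * (e\<^sup>2 * (a0 * a2 + a1 * a1 + a2 * a0)) + f2 * e ^ 6 = N\<^sup>2 * e ^ 6 * (r2 + r1 * r1 + r2)"
    using f(3) unfolding p f0 f1 by simp
  moreover have "e\<^sup>2 * (a0 * a2 + a1 * a1 + a2 * a0) = e ^ 6 * (13 / 4 * A\<^sup>2 / e\<^sup>2 - 4 / 3 * B)"
    using e by (simp add: a power2_eq_square eval_nat_numeral field_simps)
  ultimately have "N\<^sup>2 * (e ^ 6 * (13 / 4 * A\<^sup>2 / e\<^sup>2 - 4 / 3 * B)) + f2 * e ^ 6 = N\<^sup>2 * e ^ 6 * (r2 + r1 * r1 + r2)"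
    by (simp only:)
  moreover have "e ^ 6 * (N\<^sup>2 * (R - Y)) = N\<^sup>2 * e ^ 6 * R - N\<^sup>2 * (e ^ 6 * Y)" for R Y :: real
    by (simp add: algebra_simps)
  ultimately have "e ^ 6 * f2 = e ^ 6 * (N\<^sup>2 * ((r2 + r1 * r1 + r2) - (13 / 4 * A\<^sup>2 / e\<^sup>2 - 4 / 3 * B)))"
    by (simp only: mult.commute[of "e ^ 6" f2])
  then have "f2 = N\<^sup>2 * ((r2 + r1 * r1 + r2) - (13 / 4 * A\<^sup>2 / e\<^sup>2 - 4 / 3 * B))"
    using e by simp
  also have "(r2 + r1 * r1 + r2) - (13 / 4 * A\<^sup>2 / e\<^sup>2 - 4 / 3 * B) = A\<^sup>2 / (2 * e\<^sup>2) + 4 / 3 * B + 2 * \<gamma> * e\<^sup>2"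
    using e by (simp add: r1 r2 power2_eq_square field_simps)
  finally show "f2 = N\<^sup>2 * (A\<^sup>2 / (2 * e\<^sup>2) + 4 / 3 * B + 2 * \<gamma> * e\<^sup>2)" .
qed

text \<open>Multiplied by h_1^2, both \<alpha>^2 and \<beta> become linear combinations of
  \<open>X\<close> and \<open>B\<close>; comparing the coefficients of these two quantities leaves
  identities between polynomials in N = n - 1.\<close>

lemma curvature_form_identity:
  fixes N h1 h2 h3 h4 \<alpha> \<beta> c \<sigma> :: real
  assumes N: "N \<ge> 2" and h1: "h1 \<noteq> 0" and c: "c\<^sup>2 = h1\<^sup>2 + h2\<^sup>2" and \<sigma>: "\<sigma>\<^sup>2 = 1"
    and \<alpha>: "\<alpha> = 3 * \<sigma> * (h2 * h3) / h1\<^sup>2"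
    and \<beta>: "\<beta> = 15 / 2 * (h2 * h3 / h1\<^sup>2)\<^sup>2 + 3 / 2 * (h3\<^sup>2 + h2 * h4) / h1\<^sup>2"
  shows "N\<^sup>2 * ((h2 * h3)\<^sup>2 / (2 * h1\<^sup>2) + 4 / 3 * (h3\<^sup>2 + h2 * h4)
      + 2 * (\<beta> * (- 4 * N\<^sup>2 + N + 1) / (2 * (4 * N\<^sup>2 - 1)) + \<alpha>\<^sup>2 * (3 * N - 2) / (4 * (2 * N - 1))) * h1\<^sup>2)
    = N / (4 * N\<^sup>2 - 1) * curvature_form (N + 1) h1 h2 h3 h4"
proof -
  define k where "k = h1\<^sup>2"
  have k: "k \<noteq> 0" using h1 by (simp add: k_def)
  define X where "X = (h2 * h3)\<^sup>2 / k"
  define B where "B = h3\<^sup>2 + h2 * h4"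
  define M where "M = 4 * N\<^sup>2 - 1"
  have "N\<^sup>2 \<ge> 2\<^sup>2" using N by (intro power_mono) auto
  then have M0: "M \<noteq> 0" by (simp add: M_def)
  have N1: "2 * N - 1 \<noteq> 0" using N by simp
  have \<alpha>2: "\<alpha>\<^sup>2 * k = 9 * X"
    using k by (simp add: \<alpha> k_def[symmetric] X_def power_mult_distrib power_divide \<sigma>) (simp add: power2_eq_square)
  have \<beta>2: "\<beta> * k = 15 / 2 * X + 3 / 2 * B"
  proof -
    have "\<beta> = 15 / 2 * (h2 * h3 / k)\<^sup>2 + 3 / 2 * B / k" by (simp add: \<beta> k_def B_def)
    then show ?thesis using k by (simp add: X_def field_simps power2_eq_square)
  qed
  have MM: "1 / (2 * N - 1) = (2 * N + 1) / M"
    using N1 M0 by (simp add: M_def field_simps power2_eq_square)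
  have 1: "\<beta> * (- 4 * N\<^sup>2 + N + 1) / (2 * M) * k = (15 / 2 * X + 3 / 2 * B) * (- 4 * N\<^sup>2 + N + 1) / (2 * M)"
    unfolding \<beta>2[symmetric] by simp
  have 2: "\<alpha>\<^sup>2 * (3 * N - 2) / (4 * (2 * N - 1)) * k = 9 * X * (3 * N - 2) / 4 * (1 / (2 * N - 1))"
    unfolding \<alpha>2[symmetric] by simp
  have 3: "(h2 * h3)\<^sup>2 / (2 * k) = X / 2" by (simp add: X_def)
  have 4: "N\<^sup>2 * (a + b + 2 * (c + d) * k) = N\<^sup>2 * (a + b + 2 * (c * k + d * k))" for a b c d
    by (simp add: distrib_right mult.assoc)
  have "N\<^sup>2 * ((h2 * h3)\<^sup>2 / (2 * k) + 4 / 3 * B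
      + 2 * (\<beta> * (- 4 * N\<^sup>2 + N + 1) / (2 * M) + \<alpha>\<^sup>2 * (3 * N - 2) / (4 * (2 * N - 1))) * k)
    = N\<^sup>2 * (X / 2 + 4 / 3 * B + 2 * ((15 / 2 * X + 3 / 2 * B) * (- 4 * N\<^sup>2 + N + 1) / (2 * M) + 9 * X * (3 * N - 2) / 4 * ((2 * N + 1) / M)))"
    unfolding 4 1 2 3 MM ..
  also have "\<dots> = N\<^sup>2 * (M * X / 2 + M * 4 / 3 * B + (15 / 2 * X + 3 / 2 * B) * (- 4 * N\<^sup>2 + N + 1) + 9 * X * (3 * N - 2) / 2 * (2 * N + 1)) / M"
    using M0 by (simp add: field_simps)
  also have "\<dots> = N / M * (- (1/6) * N * (12 + (N + 1) * (4 * (N + 1) - 17)) * B - N * (N - 1) * (N - 2) * X)"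
    using M0 unfolding M_def by (simp add: field_simps power2_eq_square)
  also have "\<dots> = N / M * curvature_form (N + 1) h1 h2 h3 h4"
    by (simp add: curvature_form_def B_def X_def k_def power_mult_distrib mult_ac)
  finally show ?thesis unfolding B_def M_def k_def .
qed

section \<open>Conservation laws, regularity and the cost expansion along an extremal\<close>

context
  fixes T :: real and \<gamma> :: "real \<Rightarrow> real ^ 'n::finite" and p :: "real ^ 'n" and u :: "real \<Rightarrow> real"
  assumes n: "CARD('n) \<ge> 3" and T: "T > 0" and ext: "extremal T \<gamma> p u"
begin

private definition x where "x t = coord_x (\<gamma> t)"
private definition w where "w t = p \<bullet> jet_vec 0 (x t)"

lemma extremal_velocity:
  "t \<in> {0..T} \<Longrightarrow> (\<gamma> has_vector_derivative u t *\<^sub>R d_x + w t *\<^sub>R jet_vec 0 (x t)) (at t within {0..T})"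
  using ext by (simp add: extremal_def x_def w_def)

lemma extremal_x: "t \<in> {0..T} \<Longrightarrow> (x has_real_derivative u t) (at t within {0..T})"
  using coord_x_has_vector_derivative[OF extremal_velocity[of t]] n
  by (simp add: x_def[abs_def] has_real_derivative_iff_has_vector_derivative)

lemma extremal_u: "t \<in> {0..T} \<Longrightarrow> (u has_real_derivative - (w t * (p \<bullet> jet_vec 1 (x t)))) (at t within {0..T})"
  using ext by (simp add: extremal_def x_def w_def)

lemma extremal_w: "t \<in> {0..T} \<Longrightarrow> (w has_real_derivative (p \<bullet> jet_vec 1 (x t)) * u t) (at t within {0..T})"
  using DERIV_image_chain[OF inner_jet_vec_has_derivative extremal_x, of t p 0]
  by (simp add: w_def[abs_def] o_def)

lemma extremal_energy:
  assumes "t \<in> {0..T}"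
  shows "(u t)\<^sup>2 + (w t)\<^sup>2 = (u 0)\<^sup>2 + (w 0)\<^sup>2"
proof -
  have "((\<lambda>t. (u t)\<^sup>2 + (w t)\<^sup>2) has_real_derivative 0) (at t within {0..T})" if "t \<in> {0..T}" for t
    using extremal_u[OF that] extremal_w[OF that] by (auto intro!: derivative_eq_intros)
  then show ?thesis
    using has_field_derivative_zero_constant[of "{0..T}" "\<lambda>t. (u t)\<^sup>2 + (w t)\<^sup>2"] assms T
    by fastforce
qed

lemma extremal_stationary:
  assumes "u 0 = 0" "p \<bullet> jet_vec 0 (coord_x (\<gamma> 0)) = 0" "t \<in> {0..T}"
  shows "u t = 0" "p \<bullet> jet_vec 0 (coord_x (\<gamma> t)) = 0"
  using extremal_energy[OF assms(3)] assms(1,2) by (simp_all add: w_def x_def sum_power2_eq_zero_iff)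

text \<open>Bootstrapping: the derivative of x is u, and that of u is a polynomial in x.\<close>

lemma extremal_Cn: "S \<subseteq> {0..T} \<Longrightarrow> Cn k S x \<and> Cn k S u"
proof (induction k)
  case 0
  have "continuous_on {0..T} x" "continuous_on {0..T} u"
    by (rule DERIV_continuous_on[OF extremal_x], simp) (rule DERIV_continuous_on[OF extremal_u], simp)
  then show ?case using 0 continuous_on_subset by auto
next
  case (Suc k)
  have "Cn k S (\<lambda>t. - (w t * (p \<bullet> jet_vec 1 (x t))))"
    unfolding w_def using Suc
    by (intro Cn_minus Cn_mult Cn_compose[OF Cn_inner_jet_vec[of k UNIV]]) auto
  then have "Cn (Suc k) S u"
    by (rule CnI[rotated]) (use Suc.prems in \<open>blast intro: has_field_derivative_subset[OF extremal_u]\<close>)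
  moreover have "Cn (Suc k) S x"
    using Suc by (intro CnI[of S x u]) (auto intro: has_field_derivative_subset[OF extremal_x])
  ultimately show ?case by blast
qed

private abbreviation (input) "A \<equiv> (p \<bullet> jet_vec 0 (x 0)) * (p \<bullet> jet_vec 1 (x 0))"
private abbreviation (input) "B \<equiv> (p \<bullet> jet_vec 1 (x 0))\<^sup>2 + (p \<bullet> jet_vec 0 (x 0)) * (p \<bullet> jet_vec 2 (x 0))"

lemma extremal_u_jet:
  assumes "0 < \<epsilon>" "\<epsilon> \<le> T"
  shows "jet2 u (u 0) (- A) (- B * u 0 / 2)"
proof -
  have sub: "{0..\<epsilon>} \<subseteq> {0..T}" using assms by auto
  define g where "g t = - (w t * (p \<bullet> jet_vec 1 (x t)))" for t
  have z: "0 \<in> {0..T}" using T by simp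
  have x0: "(x has_real_derivative u 0) (at 0 within {0..\<epsilon>})"
    "(w has_real_derivative (p \<bullet> jet_vec 1 (x 0)) * u 0) (at 0 within {0..\<epsilon>})"
    using has_field_derivative_subset[OF extremal_x[OF z] sub] has_field_derivative_subset[OF extremal_w[OF z] sub] .
  have "((\<lambda>t. p \<bullet> jet_vec 1 (x t)) has_real_derivative (p \<bullet> jet_vec 2 (x 0)) * u 0) (at 0 within {0..\<epsilon>})"
    using DERIV_image_chain[OF inner_jet_vec_has_derivative x0(1), of p 1] by (simp add: o_def numeral_2_eq_2)
  then have "(g has_real_derivative - (w 0 * ((p \<bullet> jet_vec 2 (x 0)) * u 0) + (p \<bullet> jet_vec 1 (x 0)) * u 0 * (p \<bullet> jet_vec 1 (x 0))))
      (at 0 within {0..\<epsilon>})"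
    unfolding g_def using x0(2) by (auto intro!: derivative_eq_intros)
  also have "- (w 0 * ((p \<bullet> jet_vec 2 (x 0)) * u 0) + (p \<bullet> jet_vec 1 (x 0)) * u 0 * (p \<bullet> jet_vec 1 (x 0))) = - B * u 0"
    by (simp add: w_def power2_eq_square algebra_simps)
  finally have g': "(g has_real_derivative - B * u 0) (at 0 within {0..\<epsilon>})" .
  have "(u has_real_derivative g t) (at t within {0..\<epsilon>})" if "t \<in> {0..\<epsilon>}" for t
    using has_field_derivative_subset[OF extremal_u sub] that sub unfolding g_def by blast
  from jet2I_derivs[OF assms(1) conjunct2[OF extremal_Cn[OF sub]] this g']
  show ?thesis by (simp add: g_def w_def)
qed

text \<open>Conservation of energy gives the first identity, \<sigma> selecting the sign of the
  root. In the other two the sides agree at time 0 and have equal derivatives; the constant c is the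
  speed, and dividing p by it normalizes the energy.\<close>

lemma extremal_graph:
  assumes strip: "slope_strip W I \<sigma>" and q: "q \<in> W" "coord_x q = x 0"
    and slope: "\<And>\<xi>. c * graph_slope (q, \<xi>) = p \<bullet> jet_vec 0 \<xi>" and c: "c > 0" "c\<^sup>2 = (u 0)\<^sup>2 + (w 0)\<^sup>2"
    and \<epsilon>: "\<epsilon> \<le> T" and I: "\<And>t. t \<in> {0..\<epsilon>} \<Longrightarrow> x t \<in> I" and \<sigma>u: "\<And>t. t \<in> {0..\<epsilon>} \<Longrightarrow> \<sigma> * u t > 0"
    and t: "t \<in> {0..\<epsilon>}"
  shows "(u t, w t) = c *\<^sub>R slope_strip.tangential \<sigma> q (x t)"
    and "\<gamma> t - \<gamma> 0 = segment_integral (graph_vel \<sigma>) (q, x 0, x t)"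
    and "slope_strip.action \<sigma> q (\<gamma> 0) (\<gamma> t) = c * t"
proof -
  interpret slope_strip W I \<sigma> by (rule strip)
  have sub: "{0..\<epsilon>} \<subseteq> {0..T}" using \<epsilon> by auto
  have z: "0 \<in> {0..\<epsilon>}" using t by auto
  have root: "c * graph_root (q, x t) = \<sigma> * u t" and pos: "graph_root (q, x t) > 0"
    and wt: "w t = c * graph_slope (q, x t)" and less: "\<bar>graph_slope (q, x t)\<bar> < 1"
    if t: "t \<in> {0..\<epsilon>}" for t
  proof -
    show less: "\<bar>graph_slope (q, x t)\<bar> < 1" using slope_less[OF q(1) I[OF t]] .
    show wt: "w t = c * graph_slope (q, x t)" by (simp add: slope w_def)
    show pos: "graph_root (q, x t) > 0" by (rule graph_root_pos[OF less])
    have "(c * graph_root (q, x t))\<^sup>2 = c\<^sup>2 - (w t)\<^sup>2"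
      by (simp add: power_mult_distrib graph_root_square[OF less] wt right_diff_distrib)
    also have "\<dots> = (\<sigma> * u t)\<^sup>2"
      using extremal_energy[of t] t sub c(2) by (auto simp: power_mult_distrib sigma)
    finally show "c * graph_root (q, x t) = \<sigma> * u t"
      using c(1) pos \<sigma>u[OF t] by (meson less_imp_le mult_pos_pos power2_eq_iff_nonneg)
  qed
  have ut: "u t = \<sigma> * (c * graph_root (q, x t))" if "t \<in> {0..\<epsilon>}" for t
    using root[OF that] sigma by (metis mult.assoc mult_1 power2_eq_square)
  show "(u t, w t) = c *\<^sub>R tangential q (x t)"
    using ut[OF t] wt[OF t] by (simp add: tangential_def mult_ac)
  have x': "(x has_vector_derivative u t) (at t within {0..\<epsilon>})" if "t \<in> {0..\<epsilon>}" for t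
    using has_field_derivative_subset[OF extremal_x sub] that sub
    by (auto simp: has_real_derivative_iff_has_vector_derivative)
  have \<gamma>': "(\<gamma> has_vector_derivative u t *\<^sub>R d_x + w t *\<^sub>R jet_vec 0 (x t)) (at t within {0..\<epsilon>})"
    if "t \<in> {0..\<epsilon>}" for t
    using has_vector_derivative_within_subset[OF extremal_velocity sub] that sub by auto
  have vel_eq: "u t *\<^sub>R graph_vel \<sigma> (q, x t) = u t *\<^sub>R d_x + w t *\<^sub>R jet_vec 0 (x t)" if "t \<in> {0..\<epsilon>}" for t
  proof -
    have "u t * (\<sigma> * graph_slope (q, x t) / graph_root (q, x t)) = w t"
      using ut[OF that] wt[OF that] pos[OF that] sigma by (simp add: power2_eq_square)
    then show ?thesis by (simp add: graph_vel_def scaleR_add_right)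
  qed
  have "((\<lambda>t. \<gamma> t - segment_integral (graph_vel \<sigma>) (q, x 0, x t)) has_vector_derivative 0) (at t within {0..\<epsilon>})"
    if t: "t \<in> {0..\<epsilon>}" for t
  proof -
    have "((\<lambda>t. segment_integral (graph_vel \<sigma>) (q, x 0, x t)) has_vector_derivative u t *\<^sub>R graph_vel \<sigma> (q, x t))
        (at t within {0..\<epsilon>})"
      using vector_diff_chain_within[OF x'[OF t] has_vector_derivative_at_within[OF segment_vel_derivative[OF q(1) I[OF z] I[OF t]]]]
      by (simp add: o_def)
    from has_vector_derivative_diff[OF \<gamma>'[OF t] this] show ?thesis by (simp add: vel_eq[OF t])
  qed
  then have "\<exists>k. \<forall>t\<in>{0..\<epsilon>}. \<gamma> t - segment_integral (graph_vel \<sigma>) (q, x 0, x t) = k"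
    by (intro has_derivative_zero_constant) (auto simp: has_vector_derivative_def)
  then have eq: "\<gamma> t - segment_integral (graph_vel \<sigma>) (q, x 0, x t) = \<gamma> 0 - segment_integral (graph_vel \<sigma>) (q, x 0, x 0)"
    if "t \<in> {0..\<epsilon>}" for t
    using that z by metis
  then have eq': "\<gamma> t - \<gamma> 0 = segment_integral (graph_vel \<sigma>) (q, x 0, x t)" if "t \<in> {0..\<epsilon>}" for t
    using eq[OF that] by (simp add: segment_integral_def algebra_simps)
  then show "\<gamma> t - \<gamma> 0 = segment_integral (graph_vel \<sigma>) (q, x 0, x t)" using t by blast
  have "((\<lambda>t. action q (\<gamma> 0) (\<gamma> t) - c * t) has_vector_derivative 0) (at t within {0..\<epsilon>})"
    if t: "t \<in> {0..\<epsilon>}" for t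
  proof -
    have "((\<lambda>\<xi>. segment_integral graph_root (q, x 0, \<xi>)) has_vector_derivative graph_root (q, x t)) (at (x t) within S)" for S
      using segment_root_derivative[OF q(1) I[OF z] I[OF t]]
      by (simp add: has_vector_derivative_def has_derivative_at_withinI)
    from vector_diff_chain_within[OF x'[OF t] this]
    have 1: "((\<lambda>t. \<sigma> * segment_integral graph_root (q, x 0, x t)) has_vector_derivative \<sigma> * (u t * graph_root (q, x t)))
        (at t within {0..\<epsilon>})"
      by (intro has_vector_derivative_mult_right) (simp add: o_def)
    have 2: "((\<lambda>t. q \<bullet> (\<gamma> t - \<gamma> 0)) has_vector_derivative q \<bullet> (u t *\<^sub>R d_x + w t *\<^sub>R jet_vec 0 (x t))) (at t within {0..\<epsilon>})"
      using has_vector_derivative_diff[OF \<gamma>'[OF t] has_vector_derivative_const]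
      by (intro bounded_linear.has_vector_derivative[OF bounded_linear_inner_right]) simp
    have 3: "((\<lambda>t. coord_x q * (x t - x 0)) has_vector_derivative coord_x q * u t) (at t within {0..\<epsilon>})"
      using has_vector_derivative_diff[OF x'[OF t] has_vector_derivative_const]
      by (intro has_vector_derivative_mult_right) simp
    have 4: "((\<lambda>t. c * t) has_vector_derivative c) (at t within {0..\<epsilon>})"
      by (auto intro!: derivative_eq_intros)
    have "((\<lambda>t. action q (\<gamma> 0) (\<gamma> t) - c * t) has_vector_derivative
      q \<bullet> (u t *\<^sub>R d_x + w t *\<^sub>R jet_vec 0 (x t)) - coord_x q * u t + \<sigma> * (u t * graph_root (q, x t)) - c) (at t within {0..\<epsilon>})"
      using has_vector_derivative_diff[OF has_vector_derivative_add[OF has_vector_derivative_diff[OF 2 3] 1] 4]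
      by (simp add: action_def x_def)
    moreover have "q \<bullet> (u t *\<^sub>R d_x + w t *\<^sub>R jet_vec 0 (x t)) - coord_x q * u t + \<sigma> * (u t * graph_root (q, x t)) - c
      = c * ((graph_slope (q, x t))\<^sup>2 + (graph_root (q, x t))\<^sup>2 - 1)"
      using ut[OF t] wt[OF t] sigma unfolding graph_slope_frame by (simp add: power2_eq_square algebra_simps)
    ultimately show ?thesis using graph_root_square[OF less[OF t]] by simp
  qed
  then have "\<exists>k. \<forall>t\<in>{0..\<epsilon>}. action q (\<gamma> 0) (\<gamma> t) - c * t = k"
    by (intro has_derivative_zero_constant) (auto simp: has_vector_derivative_def)
  then have "action q (\<gamma> 0) (\<gamma> t) - c * t = action q (\<gamma> 0) (\<gamma> 0) - c * 0"
    using t z by metis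
  then show "action q (\<gamma> 0) (\<gamma> t) = c * t" by (simp add: action_def segment_integral_def)
qed

text \<open>Where h_1 is not 0 the normal coefficient is explicit: apart from elementary factors it
  is the square of the reproducing value at the end point. All factors are C^3 up to t = 0, which
  gives both the regularity of F and its jet.\<close>

proposition extremal_cost_expansion:
  assumes u0: "u 0 \<noteq> 0"
  defines "N \<equiv> real CARD('n) - 1"
  shows "\<exists>\<epsilon> F. \<epsilon> > 0 \<and> Cn 3 {0..\<epsilon>} F \<and>
    jet2 F (N\<^sup>2) 0 (N / (4 * N\<^sup>2 - 1) * curvature_form (real CARD('n)) (u 0) (p \<bullet> jet_vec 0 (coord_x (\<gamma> 0)))
      (p \<bullet> jet_vec 1 (coord_x (\<gamma> 0))) (p \<bullet> jet_vec 2 (coord_x (\<gamma> 0)))) \<and>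
    (\<forall>t\<in>{0<..<\<epsilon>}. cost_expansion_at \<gamma> t (u 0) (p \<bullet> jet_vec 0 (coord_x (\<gamma> 0))) (F t))"
proof -
  define m where "m = CARD('n) - 2"
  have m: "CARD('n) = m + 2" "m \<ge> 1" and N: "N = real (m + 1)" "N \<ge> 2"
    using n by (auto simp: m_def N_def)
  define h2 h3 h4 where "h2 = p \<bullet> jet_vec 0 (x 0)" and "h3 = p \<bullet> jet_vec 1 (x 0)" and "h4 = p \<bullet> jet_vec 2 (x 0)"
  have w0: "w 0 = h2" by (simp add: w_def h2_def)
  define c where "c = sqrt ((u 0)\<^sup>2 + h2\<^sup>2)"
  have c2: "c\<^sup>2 = (u 0)\<^sup>2 + h2\<^sup>2" by (simp add: c_def)
  have c: "c > 0" using u0 by (simp add: c_def sum_power2_gt_zero_iff)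
  define \<sigma> where "\<sigma> = sgn (u 0)"
  have \<sigma>: "\<sigma>\<^sup>2 = 1" "\<sigma> * u 0 = \<bar>u 0\<bar>" using u0 by (auto simp: \<sigma>_def sgn_if power2_eq_square)
  have \<sigma>1: "\<bar>\<sigma>\<bar> = 1" using u0 by (simp add: \<sigma>_def abs_sgn_eq)
  \<comment> \<open>The covector scaled to unit energy, with the abscissa of the initial point
    stored in its x-component.\<close>
  define q where "q = (1 / c) *\<^sub>R (p - coord_x p *\<^sub>R d_x) + x 0 *\<^sub>R d_x"
  have qx: "coord_x q = x 0" by (simp add: q_def)
  have slope: "c * graph_slope (q, \<xi>) = p \<bullet> jet_vec 0 \<xi>" for \<xi>
    using c n by (simp add: graph_slope_def q_def inner_add_left inner_diff_left)
  then have slope': "graph_slope (q, \<xi>) = (p \<bullet> jet_vec 0 \<xi>) / c" for \<xi>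
    using c by (simp add: field_simps)
  have root0: "1 - (h2 / c)\<^sup>2 = (u 0 / c)\<^sup>2"
  proof -
    have "(h2 / c)\<^sup>2 + (u 0 / c)\<^sup>2 = c\<^sup>2 / c\<^sup>2"
      by (simp only: power_divide add_divide_distrib[symmetric] c2 add.commute)
    then show ?thesis using c by simp
  qed
  have "\<bar>graph_slope (q, x 0)\<bar> < 1"
  proof -
    have "(u 0 / c)\<^sup>2 > 0" using u0 c by simp
    then have "(h2 / c)\<^sup>2 < 1" using root0 by linarith
    then show ?thesis by (simp add: slope' h2_def abs_square_less_1)
  qed
  moreover have "open {z :: (real ^ 'n) \<times> real. \<bar>graph_slope z\<bar> < 1}"
    by (intro open_Collect_less continuous_intros)
  ultimately obtain W1 I1 where W1: "open W1" "open I1" "(q, x 0) \<in> W1 \<times> I1" "W1 \<times> I1 \<subseteq> {z. \<bar>graph_slope z\<bar> < 1}"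
    by (auto elim!: open_prod_elim)
  obtain r1 where r1: "r1 > 0" "ball q r1 \<subseteq> W1" using W1 by (auto elim: openE)
  obtain r2 where r2: "r2 > 0" "ball (x 0) r2 \<subseteq> I1" using W1 by (auto elim: openE)
  define W where "W = ball q r1"
  define I where "I = ball (x 0) r2"
  have strip: "slope_strip W I \<sigma>"
  proof
    show "CARD('n) \<ge> 2" using n by simp
    show "\<bar>graph_slope (q', \<xi>)\<bar> < 1" if "q' \<in> W" "\<xi> \<in> I" for q' \<xi>
    proof -
      have "(q', \<xi>) \<in> W1 \<times> I1" using that r1 r2 by (auto simp: W_def I_def)
      then show ?thesis using W1(4) by blast
    qed
  qed (auto simp: W_def I_def \<sigma>)
  interpret slope_strip W I \<sigma> by (rule strip)
  have qW: "q \<in> W" using r1 by (simp add: W_def)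
  have I_iff: "\<xi> \<in> I \<longleftrightarrow> \<bar>\<xi> - x 0\<bar> < r2" for \<xi> by (auto simp: I_def dist_real_def)
  \<comment> \<open>Half the radius of the strip, so that the doubled radius demanded by
    \<open>cost_dot_representation\<close> still fits.\<close>
  define \<delta> where "\<delta> = r2 / 2"
  have \<delta>: "\<delta> > 0" using r2 by (simp add: \<delta>_def)
  have \<sigma>I: "x 0 + \<sigma> * s \<in> I" if "s \<in> {0..\<delta>}" for s
    using that r2(1) \<sigma>1 by (auto simp: I_iff \<delta>_def abs_mult)
  \<comment> \<open>The slope as a function of the distance travelled along the x-axis; \<sigma>
    turns either direction of motion into s \<ge> 0, as one-sided expansions require.\<close>
  define P where "P s = (p \<bullet> jet_vec 0 (x 0 + \<sigma> * s)) / c" for s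
  have P_slope: "P s = graph_slope (q, x 0 + \<sigma> * s)" for s by (simp add: P_def slope')
  have PJ: "jet2 P (h2 / c) (\<sigma> * h3 / c) (h4 / 2 / c)"
  proof -
    have d: "((\<lambda>s. p \<bullet> jet_vec i (x 0 + \<sigma> * s)) has_real_derivative \<sigma> * (p \<bullet> jet_vec (Suc i) (x 0 + \<sigma> * s))) (at s within {0..\<delta>})" for i s
    proof -
      have "((\<lambda>s. x 0 + \<sigma> * s) has_real_derivative \<sigma>) (at s within {0..\<delta>})"
        by (auto intro!: derivative_eq_intros)
      from DERIV_image_chain[OF inner_jet_vec_has_derivative this, of p i]
      show ?thesis by (simp add: o_def mult.commute)
    qed
    have "((\<lambda>s. \<sigma> * (p \<bullet> jet_vec 1 (x 0 + \<sigma> * s))) has_real_derivative h4) (at 0 within {0..\<delta>})"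
      using DERIV_cmult[OF d[of 1 0], of \<sigma>] \<sigma>(1)
      by (simp add: h4_def power2_eq_square mult.assoc[symmetric] numeral_2_eq_2)
    from jet2I_derivs[OF \<delta> Cn_compose[OF Cn_inner_jet_vec[of 3 UNIV] Cn_add[OF Cn_const Cn_mult[OF Cn_const Cn_ident]]] d[of 0, unfolded One_nat_def[symmetric]] this]
    have "jet2 (\<lambda>s. p \<bullet> jet_vec 0 (x 0 + \<sigma> * s)) h2 (\<sigma> * h3) (h4 / 2)"
      by (simp add: h2_def h3_def)
    from jet2_cmult[OF this, of "1 / c"] show ?thesis by (simp add: P_def[abs_def] mult.commute)
  qed
  define wt where "wt s = 1 / graph_root (q, x 0 + \<sigma> * s) ^ 3" for s
  have root_pos: "graph_root (q, \<xi>) > 0" if "\<xi> \<in> I" for \<xi>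
    by (rule graph_root_pos[OF slope_less[OF qW that]])
  have wtC: "Cn 3 {0..\<delta>} wt"
  proof -
    have "Cn 3 {0..\<delta>} P"
      unfolding P_def using c
      by (intro Cn_divide Cn_const Cn_compose[OF Cn_inner_jet_vec[of 3 UNIV]] Cn_add Cn_mult Cn_ident) auto
    then have "Cn 3 {0..\<delta>} (\<lambda>s. 1 - (P s)\<^sup>2)" by (intro Cn_diff Cn_const Cn_power)
    moreover have "(\<lambda>s. 1 - (P s)\<^sup>2) ` {0..\<delta>} \<subseteq> {0<..}"
      using slope_less[OF qW \<sigma>I] by (auto simp: P_slope abs_square_less_1)
    ultimately have "Cn 3 {0..\<delta>} (\<lambda>s. sqrt (1 - (P s)\<^sup>2))" by (rule Cn_compose[OF Cn_sqrt])
    then have "Cn 3 {0..\<delta>} (\<lambda>s. graph_root (q, x 0 + \<sigma> * s))" by (simp add: graph_root_def P_slope)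
    then show ?thesis
      unfolding wt_def using root_pos[OF \<sigma>I] by (intro Cn_divide Cn_const Cn_power) force+
  qed
  have wt_pos: "wt s > 0" if "s \<in> {0..\<delta>}" for s
    using root_pos[OF \<sigma>I[OF that]] by (simp add: wt_def)
  have wt_eq: "(wt s)\<^sup>2 * (1 - (P s)\<^sup>2) ^ 3 = 1" if s: "s \<in> {0..\<delta>}" for s
  proof -
    have "1 - (P s)\<^sup>2 = (graph_root (q, x 0 + \<sigma> * s))\<^sup>2"
      unfolding P_slope by (rule graph_root_square[OF slope_less[OF qW \<sigma>I[OF s]], symmetric])
    then show ?thesis
      using root_pos[OF \<sigma>I[OF s]] by (simp add: wt_def power_divide power_mult[symmetric])
  qed
  have "1 - (h2 / c)\<^sup>2 > 0" using root0 u0 c by simp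
  from weight_jet[OF \<delta> wtC wt_eq PJ this]
  obtain w1 w2 where wJ: "jet2 wt (wt 0) w1 w2" and wt0: "wt 0 \<noteq> 0" and wt0': "(wt 0)\<^sup>2 * ((u 0 / c)\<^sup>2) ^ 3 = 1"
    and \<alpha>0: "w1 / wt 0 = 3 * (h2 / c) * (\<sigma> * h3 / c) / (u 0 / c)\<^sup>2"
    and \<beta>0: "w2 / wt 0 = 15 / 2 * (h2 / c * (\<sigma> * h3 / c) / (u 0 / c)\<^sup>2)\<^sup>2 + 3 / 2 * ((\<sigma> * h3 / c)\<^sup>2 + 2 * (h2 / c) * (h4 / 2 / c)) / (u 0 / c)\<^sup>2"
    unfolding root0 by blast
  define \<alpha> where "\<alpha> = w1 / wt 0"
  define \<beta> where "\<beta> = w2 / wt 0"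
  have \<alpha>: "\<alpha> = 3 * \<sigma> * (h2 * h3) / (u 0)\<^sup>2"
    unfolding \<alpha>_def \<alpha>0 using c by (simp add: power2_eq_square)
  have \<beta>: "\<beta> = 15 / 2 * (h2 * h3 / (u 0)\<^sup>2)\<^sup>2 + 3 / 2 * (h3\<^sup>2 + h2 * h4) / (u 0)\<^sup>2"
  proof -
    have "h2 / c * (\<sigma> * h3 / c) / (u 0 / c)\<^sup>2 = \<sigma> * (h2 * h3 / (u 0)\<^sup>2)"
      using c by (simp add: power2_eq_square)
    moreover have "(\<sigma> * h3 / c)\<^sup>2 + 2 * (h2 / c) * (h4 / 2 / c) = (h3\<^sup>2 + h2 * h4) / c\<^sup>2"
      using \<sigma>(1) by (simp add: power_mult_distrib power_divide add_divide_distrib) (simp add: power2_eq_square)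
    ultimately show ?thesis
      unfolding \<beta>_def \<beta>0 using c \<sigma>(1) by (simp only: power_mult_distrib) (simp add: power_divide)
  qed
  define \<gamma>2 where "\<gamma>2 = \<beta> * (- 4 * N\<^sup>2 + N + 1) / (2 * (4 * N\<^sup>2 - 1)) + \<alpha>\<^sup>2 * (3 * N - 2) / (4 * (2 * N - 1))"
  define \<rho>0 where "\<rho>0 = (-1) ^ m * N / wt 0"
  have "\<exists>\<rho>. Cn 3 {0..\<delta>} \<rho> \<and> jet2 \<rho> \<rho>0 (\<rho>0 * (- \<alpha> / 2)) (\<rho>0 * \<gamma>2) \<and>
    (\<forall>s\<in>{0..\<delta>}. \<forall>d e.
      (\<forall>j\<le>m. (\<Sum>k\<le>m. d k * integral {0..1} (\<lambda>r. r ^ (j + k) * wt (s * r))) = (if j = 0 then e else 0)) \<longrightarrow>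
      (\<Sum>k\<le>m. d k) = e * \<rho> s)"
  proof (rule reproducing_value_at_end[OF m \<delta> wtC wt_pos wJ wt0, folded N(1) \<alpha>_def \<beta>_def, folded \<gamma>2_def \<rho>0_def])
    fix \<rho>
    assume 1: "Cn 3 {0..\<delta>} \<rho>" and 2: "jet2 \<rho> \<rho>0 (\<rho>0 * (- \<alpha> / 2)) (\<rho>0 * \<gamma>2)"
      and 3: "\<And>s d e. s \<in> {0..\<delta>} \<Longrightarrow>
      (\<And>j. j \<le> m \<Longrightarrow> (\<Sum>k\<le>m. d k * integral {0..1} (\<lambda>r. r ^ (j + k) * wt (s * r))) = (if j = 0 then e else 0)) \<Longrightarrow>
      (\<Sum>k\<le>m. d k) = e * \<rho> s"
    show ?thesis using 1 2 3 by blast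
  qed
  then obtain \<rho> where \<rho>C: "Cn 3 {0..\<delta>} \<rho>" and \<rho>J: "jet2 \<rho> \<rho>0 (\<rho>0 * (- \<alpha> / 2)) (\<rho>0 * \<gamma>2)"
    and \<rho>: "\<And>s d e. s \<in> {0..\<delta>} \<Longrightarrow>
      (\<And>j. j \<le> m \<Longrightarrow> (\<Sum>k\<le>m. d k * integral {0..1} (\<lambda>r. r ^ (j + k) * wt (s * r))) = (if j = 0 then e else 0)) \<Longrightarrow>
      (\<Sum>k\<le>m. d k) = e * \<rho> s"
    by blast
  have Tz: "0 \<in> {0..T}" using T by simp
  have contu: "continuous_on {0..T} u" and contx: "continuous_on {0..T} x"
    using extremal_Cn[of "{0..T}" 0] by auto
  obtain d1 where d1: "d1 > 0" "\<And>t. t \<in> {0..T} \<Longrightarrow> dist t 0 < d1 \<Longrightarrow> dist (u t) (u 0) < \<bar>u 0\<bar> / 2"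
    using contu Tz u0 unfolding continuous_on_iff by (metis half_gt_zero zero_less_abs_iff)
  obtain d2 where d2: "d2 > 0" "\<And>t. t \<in> {0..T} \<Longrightarrow> dist t 0 < d2 \<Longrightarrow> dist (x t) (x 0) < \<delta>"
    using contx Tz \<delta> unfolding continuous_on_iff by metis
  \<comment> \<open>Up to this time u keeps its sign and at least half its size, x stays within
    \<delta> of its initial value, and the action c t stays below \<delta>.\<close>
  define \<epsilon> where "\<epsilon> = Min {T, d1 / 2, d2 / 2, r2 / (4 * c)}"
  have \<epsilon>: "\<epsilon> > 0" "\<epsilon> \<le> T" "\<epsilon> < d1" "\<epsilon> < d2" "c * \<epsilon> < r2 / 2"
  proof -
    have "\<epsilon> \<le> d1 / 2" "\<epsilon> \<le> d2 / 2" "\<epsilon> \<le> r2 / (4 * c)" by (simp_all add: \<epsilon>_def)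
    then show "\<epsilon> < d1" "\<epsilon> < d2" "c * \<epsilon> < r2 / 2" using d1 d2 c r2 by (auto simp: field_simps)
    show "\<epsilon> > 0" "\<epsilon> \<le> T" using T d1 d2 r2 c by (auto simp: \<epsilon>_def)
  qed
  have sub: "{0..\<epsilon>} \<subseteq> {0..T}" using \<epsilon> by auto
  have near: "\<bar>u t - u 0\<bar> < \<bar>u 0\<bar> / 2" "\<bar>x t - x 0\<bar> < \<delta>" if "t \<in> {0..\<epsilon>}" for t
    using d1(2)[of t] d2(2)[of t] that sub \<epsilon> by (auto simp: dist_real_def)
  have \<sigma>u: "\<sigma> * u t \<ge> \<bar>u 0\<bar> / 2" if "t \<in> {0..\<epsilon>}" for t
  proof -
    have "\<bar>\<sigma> * (u t - u 0)\<bar> < \<bar>u 0\<bar> / 2" using near(1)[OF that] \<sigma>1 by (simp add: abs_mult)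
    then have "\<bar>\<sigma> * u t - \<bar>u 0\<bar>\<bar> < \<bar>u 0\<bar> / 2" using \<sigma>(2) by (simp only: right_diff_distrib)
    then show ?thesis by linarith
  qed
  have \<sigma>u_pos: "\<sigma> * u t > 0" if "t \<in> {0..\<epsilon>}" for t using \<sigma>u[OF that] u0 by simp
  have xI: "x t \<in> I" if "t \<in> {0..\<epsilon>}" for t using near(2)[OF that] r2 by (simp add: I_iff \<delta>_def)
  have tr: "t * r \<in> {0..\<epsilon>}" if "t \<in> {0..\<epsilon>}" "r \<in> {0..1}" for t r
    using that mult_left_le[of r t] by (auto intro: order_trans)
  have uC: "Cn 3 {0..\<epsilon>} u" and xC: "Cn 3 {0..\<epsilon>} x" using extremal_Cn[OF sub] by auto
  \<comment> \<open>The difference quotient of x at 0, written as a mean of u so that it is C^3 at t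
    = 0 too; the power r^0 brings it into the form of the moment lemmas.\<close>
  define z where "z t = integral {0..1} (\<lambda>r. r ^ 0 * u (t * r))" for t
  have cu: "continuous_on {0..1} (\<lambda>r. u (t * r))" if "t \<in> {0..\<epsilon>}" for t
    using tr[OF that] by (intro continuous_on_compose2[OF Cn_continuous_on[OF uC]] continuous_intros) auto
  have xz: "x t - x 0 = t * z t" if t: "t \<in> {0..\<epsilon>}" for t
  proof -
    have "((\<lambda>r. t * u (t * r)) has_integral x (t * 1) - x (t * 0)) {0..1}"
    proof (rule fundamental_theorem_of_calculus)
      fix r :: real assume r: "r \<in> {0..1}"
      have "(x has_real_derivative u (t * r)) (at (t * r) within (\<lambda>r. t * r) ` {0..1})"
      proof (rule has_field_derivative_subset[OF extremal_x])
        show "t * r \<in> {0..T}" using tr[OF t r] sub by blast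
        show "(\<lambda>r. t * r) ` {0..1} \<subseteq> {0..T}" using tr[OF t] sub by blast
      qed
      moreover have "((\<lambda>r. t * r) has_real_derivative t) (at r within {0..1})"
        by (auto intro!: derivative_eq_intros)
      ultimately have "(x \<circ> (\<lambda>r. t * r) has_real_derivative u (t * r) * t) (at r within {0..1})"
        by (rule DERIV_image_chain)
      then have "((\<lambda>r. x (t * r)) has_real_derivative u (t * r) * t) (at r within {0..1})"
        by (simp only: o_def)
      then show "((\<lambda>r. x (t * r)) has_vector_derivative t * u (t * r)) (at r within {0..1})"
        by (simp add: has_real_derivative_iff_has_vector_derivative mult.commute)
    qed simp
    then show ?thesis by (simp add: z_def has_integral_iff)
  qed
  have \<sigma>z: "\<sigma> * z t \<ge> \<bar>u 0\<bar> / 2" if t: "t \<in> {0..\<epsilon>}" for t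
  proof -
    have "integral {0..1} (\<lambda>r::real. \<bar>u 0\<bar> / 2) \<le> integral {0..1} (\<lambda>r. \<sigma> * u (t * r))"
      by (intro integral_le integrable_continuous_real continuous_intros cu[OF t] \<sigma>u[OF tr[OF t]])
    then show ?thesis by (simp add: z_def)
  qed
  have z_ne: "z t \<noteq> 0" and u_ne: "u t \<noteq> 0" if "t \<in> {0..\<epsilon>}" for t
    using \<sigma>z[OF that] \<sigma>u[OF that] u0 by auto
  define S where "S t = \<sigma> * (x t - x 0)" for t
  have S\<delta>: "S t \<in> {0..\<delta>}" if "t \<in> {0..\<epsilon>}" for t
  proof -
    have "S t = t * (\<sigma> * z t)" unfolding S_def xz[OF that] by simp
    moreover have "\<sigma> * z t \<ge> 0" using order_trans[OF _ \<sigma>z[OF that]] by simp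
    ultimately have "S t \<ge> 0" using that by simp
    moreover have "\<bar>S t\<bar> < \<delta>" using near(2)[OF that] \<sigma>1 by (simp add: S_def abs_mult)
    ultimately show ?thesis by simp
  qed
  have S_pos: "S t > 0" if "t \<in> {0<..\<epsilon>}" for t
  proof -
    have "\<bar>u 0\<bar> / 2 > 0" using u0 by simp
    then have "\<sigma> * z t > 0" using \<sigma>z[of t] that by fastforce
    then have "t * (\<sigma> * z t) > 0" using that by simp
    then show ?thesis using xz[of t] that by (simp add: S_def mult.left_commute)
  qed
  \<comment> \<open>Obtained by solving for F: the normal part of dE is c (dq . X_2) / root with
    root = \<sigma> u / c, and dq . X_2 is \<rho>(S) over S = \<sigma> t z times the normal
    displacement over \<open>u 0\<close>. Squaring and splitting off 1 / (c^2 t^2) leaves this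
    quotient.\<close>
  define F where "F t = c ^ 6 * (\<rho> (S t) * \<rho> (S t)) / ((u 0)\<^sup>2 * ((z t * u t) * (z t * u t)))" for t
  have zC: "Cn 3 {0..\<epsilon>} z"
    unfolding z_def using \<epsilon>(1) by (intro Cn_scaled_integral uC continuous_intros) auto
  have SC: "Cn 3 {0..\<epsilon>} S" unfolding S_def by (intro Cn_mult Cn_diff Cn_const xC)
  have \<rho>SC: "Cn 3 {0..\<epsilon>} (\<lambda>t. \<rho> (S t))" using S\<delta> by (intro Cn_compose[OF \<rho>C SC]) auto
  have FC: "Cn 3 {0..\<epsilon>} F"
    unfolding F_def using z_ne u_ne u0 by (intro Cn_divide Cn_mult Cn_const \<rho>SC zC uC) auto
  define A where "A = h2 * h3"
  define B where "B = h3\<^sup>2 + h2 * h4"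
  have uJ: "jet2 u (u 0) (- A) (- B * u 0 / 2)"
    using extremal_u_jet[OF \<epsilon>(1,2)] by (simp only: A_def B_def h2_def h3_def h4_def)
  have zJ: "jet2 z (u 0) (- A / 2) (- B * u 0 / 6)"
    using jet2_scaled_integral[OF \<epsilon>(1) uC uJ, of 0] by (simp add: z_def[abs_def])
  have SJ: "jet2 S 0 (\<sigma> * u 0) (\<sigma> * (- A / 2))"
  proof -
    have "jet2 (\<lambda>t. \<sigma> * (t * z t)) 0 (\<sigma> * u 0) (\<sigma> * (- A / 2))"
      using jet2_cmult[OF jet2_mult[OF jet2_ident zJ], of \<sigma>] by simp
    moreover have "\<forall>\<^sub>F t in at_right 0. \<sigma> * (t * z t) = S t"
      using eventually_at_right_Icc[OF \<epsilon>(1)] by eventually_elim (simp add: S_def xz)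
    ultimately show ?thesis by (rule jet2_cong)
  qed
  define r1 where "r1 = - \<alpha> / 2 * (\<sigma> * u 0)"
  define r2' where "r2' = - \<alpha> / 2 * (\<sigma> * (- A / 2)) + \<gamma>2 * (\<sigma> * u 0)\<^sup>2"
  have \<rho>SJ: "jet2 (\<lambda>t. \<rho> (S t)) \<rho>0 (\<rho>0 * r1) (\<rho>0 * r2')"
  proof -
    have "\<forall>\<^sub>F t in at_right 0. S t > 0"
      using eventually_at_right_Icc[OF \<epsilon>(1)] eventually_at_right_less[of 0]
      by eventually_elim (rule S_pos, simp)
    from jet2_compose[OF \<rho>J SJ this] show ?thesis
      by (simp add: r1_def r2'_def distrib_left mult.assoc)
  qed
  obtain f1 f2 where FJ: "jet2 F (F 0) f1 f2" using Cn3_jet2[OF \<epsilon>(1) FC] by blast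
  define a0 where "a0 = u 0 * u 0"
  define a1 where "a1 = u 0 * (- A) + (- A / 2) * u 0"
  define a2 where "a2 = u 0 * (- B * u 0 / 2) + (- A / 2) * (- A) + (- B * u 0 / 6) * u 0"
  have zuJ: "jet2 (\<lambda>t. z t * u t) a0 a1 a2"
    unfolding a0_def a1_def a2_def by (rule jet2_mult[OF zJ uJ])
  have GJ: "jet2 (\<lambda>t. (u 0)\<^sup>2 * ((z t * u t) * (z t * u t))) ((u 0)\<^sup>2 * (a0 * a0)) ((u 0)\<^sup>2 * (a0 * a1 + a1 * a0)) ((u 0)\<^sup>2 * (a0 * a2 + a1 * a1 + a2 * a0))"
    by (rule jet2_cmult[OF jet2_mult[OF zuJ zuJ]])
  have "\<forall>\<^sub>F t in at_right 0. F t * ((u 0)\<^sup>2 * ((z t * u t) * (z t * u t))) = c ^ 6 * (\<rho> (S t) * \<rho> (S t))"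
    using eventually_at_right_Icc[OF \<epsilon>(1)]
    by eventually_elim (use z_ne u_ne u0 in \<open>simp add: F_def\<close>)
  note prod = jet2_cong[OF jet2_mult[OF FJ GJ] this]
  note rhs = jet2_cmult[OF jet2_mult[OF \<rho>SJ \<rho>SJ], of "c ^ 6"]
  \<comment> \<open>The sign (-1)^m is lost in the square, and the initial weight is (c / |u 0|)^3,
    so the powers of c cancel.\<close>
  have X: "c ^ 6 * (\<rho>0 * \<rho>0) = N\<^sup>2 * u 0 ^ 6"
  proof -
    have "(wt 0)\<^sup>2 * u 0 ^ 6 = c ^ 6"
      using wt0' c by (simp add: power_divide power_mult[symmetric] field_simps)
    moreover have "\<rho>0 * \<rho>0 = N\<^sup>2 / (wt 0)\<^sup>2"
      by (simp add: \<rho>0_def power2_eq_square power_mult_distrib[symmetric] flip: power_add)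
    ultimately show ?thesis using wt0 by (simp flip: \<open>(wt 0)\<^sup>2 * u 0 ^ 6 = c ^ 6\<close>)
  qed
  have e0: "F 0 * ((u 0)\<^sup>2 * (a0 * a0)) = N\<^sup>2 * u 0 ^ 6"
    using jet2_unique(1)[OF prod rhs] X by simp
  have e1: "F 0 * ((u 0)\<^sup>2 * (a0 * a1 + a1 * a0)) + f1 * ((u 0)\<^sup>2 * (a0 * a0)) = N\<^sup>2 * u 0 ^ 6 * (r1 + r1)"
    using jet2_unique(2)[OF prod rhs] X[symmetric] by (simp add: algebra_simps)
  have e2: "F 0 * ((u 0)\<^sup>2 * (a0 * a2 + a1 * a1 + a2 * a0)) + f1 * ((u 0)\<^sup>2 * (a0 * a1 + a1 * a0)) + f2 * ((u 0)\<^sup>2 * (a0 * a0))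
         = N\<^sup>2 * u 0 ^ 6 * (r2' + r1 * r1 + r2')"
    using jet2_unique(3)[OF prod rhs] X[symmetric] by (simp add: algebra_simps)
  note fs = normal_jet_algebra[OF u0 \<sigma>(1) \<alpha>[folded A_def] r1_def r2'_def a0_def a1_def a2_def e0 e1 e2]
  have "f2 = N / (4 * N\<^sup>2 - 1) * curvature_form (N + 1) (u 0) h2 h3 h4"
    unfolding fs(3) \<gamma>2_def A_def B_def
    using curvature_form_identity[OF N(2) u0 c2 \<sigma>(1) \<alpha> \<beta>] by (simp only: mult.assoc)
  then have FJ': "jet2 F (N\<^sup>2) 0 (N / (4 * N\<^sup>2 - 1) * curvature_form (real CARD('n)) (u 0) h2 h3 h4)"
    using FJ fs(1,2) by (simp add: N_def)
  have exp: "cost_expansion_at \<gamma> t (u 0) h2 (F t)" if t: "t \<in> {0<..<\<epsilon>}" for t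
  proof -
    have t\<epsilon>: "t \<in> {0..\<epsilon>}" and z\<epsilon>: "0 \<in> {0..\<epsilon>}" and t0: "t > 0" using t by auto
    have G: "(u s, w s) = c *\<^sub>R tangential q (x s)" "\<gamma> s - \<gamma> 0 = segment_integral (graph_vel \<sigma>) (q, x 0, x s)"
      "action q (\<gamma> 0) (\<gamma> s) = c * s" if "s \<in> {0..\<epsilon>}" for s
      using extremal_graph[OF strip qW qx slope c c2[folded w0] \<epsilon>(2) _ _ that] xI \<sigma>u_pos by blast+
    have tan0: "(u 0, h2) = c *\<^sub>R tangential q (x 0)" using G(1)[OF z\<epsilon>] w0 by simp
    have rt: "graph_root (q, x s) = \<sigma> * u s / c" if "s \<in> {0..\<epsilon>}" for s
      using G(1)[OF that] c \<sigma>(1) by (simp add: tangential_def power2_eq_square mult.left_commute field_simps)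
    have slope0: "graph_slope (q, x 0) = h2 / c" by (simp add: slope' h2_def)
    have \<gamma>': "(\<gamma> has_vector_derivative u t *\<^sub>R d_x + w t *\<^sub>R jet_vec 0 (coord_x (\<gamma> t))) (at t)"
      using extremal_velocity[of t] t \<epsilon>(2) at_within_interior[of t "{0..T}"] by (simp add: x_def)
    have dir: "\<sigma> * (x t - x 0) > 0" using S_pos[of t] t by (simp add: S_def)
    have ct: "c * t < \<delta>"
    proof -
      have "c * t < c * \<epsilon>" using c t by simp
      then show ?thesis using \<epsilon>(5) by (simp add: \<delta>_def)
    qed
    have nearI: "\<xi> \<in> I" if "\<bar>\<xi> - x 0\<bar> < 2 * \<delta>" for \<xi> using that by (simp add: I_iff \<delta>_def)
    show ?thesis
    proof (rule cost_dot_representation[OF qW qx[unfolded x_def] t0 c nearI[unfolded x_def] ct xI[OF t\<epsilon>, unfolded x_def]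
          dir[unfolded x_def] G(2)[OF t\<epsilon>, unfolded x_def] G(3)[OF t\<epsilon>] \<gamma>' G(1)[OF t\<epsilon>, unfolded x_def], folded x_def])
    fix E :: "real ^ 'n \<Rightarrow> real \<times> real" and E' U
    assume EU: "open U" "\<gamma> 0 \<in> U" "E (\<gamma> 0) = 0"
        "\<And>y. y \<in> U \<Longrightarrow> geod_cost_dot \<gamma> t y = 1 / 2 * (E y \<bullet> E y) - c\<^sup>2 / 2"
        "\<And>y. y \<in> U \<Longrightarrow> (E has_derivative E' y) (at y)"
        "\<And>v. ((\<lambda>y. E' y v) \<longlongrightarrow> E' (\<gamma> 0) v) (at (\<gamma> 0))"
      and E2: "\<And>v1 v2. \<exists>dq. covector_deriv q (x t) dq = v1 *\<^sub>R d_x + v2 *\<^sub>R jet_vec 0 (x 0) \<and>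
          E' (\<gamma> 0) (v1 *\<^sub>R d_x + v2 *\<^sub>R jet_vec 0 (x 0)) \<bullet> E' (\<gamma> 0) (v1 *\<^sub>R d_x + v2 *\<^sub>R jet_vec 0 (x 0))
          = (((v1, v2) \<bullet> tangential q (x 0)) / t)\<^sup>2 + (c * (dq \<bullet> jet_vec 0 (x t)) / graph_root (q, x t))\<^sup>2"
    have "E' (\<gamma> 0) (v1 *\<^sub>R d_x + v2 *\<^sub>R jet_vec 0 (x 0)) \<bullet> E' (\<gamma> 0) (v1 *\<^sub>R d_x + v2 *\<^sub>R jet_vec 0 (x 0))
      = ((v1 * u 0 + v2 * h2)\<^sup>2 + F t * (v2 * u 0 - v1 * h2)\<^sup>2) / (((u 0)\<^sup>2 + h2\<^sup>2) * t\<^sup>2)" for v1 v2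
    proof -
      obtain dq where dq: "covector_deriv q (x t) dq = v1 *\<^sub>R d_x + v2 *\<^sub>R jet_vec 0 (x 0)"
        and E2: "E' (\<gamma> 0) (v1 *\<^sub>R d_x + v2 *\<^sub>R jet_vec 0 (x 0)) \<bullet> E' (\<gamma> 0) (v1 *\<^sub>R d_x + v2 *\<^sub>R jet_vec 0 (x 0))
          = (((v1, v2) \<bullet> tangential q (x 0)) / t)\<^sup>2 + (c * (dq \<bullet> jet_vec 0 (x t)) / graph_root (q, x t))\<^sup>2"
        using E2 by blast
      have "S t * (dq \<bullet> jet_vec 0 (x t)) = (v1 * (\<sigma> * graph_slope (q, x 0) / graph_root (q, x 0)) - v2) * \<rho> (S t)"
        unfolding S_def
      proof (rule covector_deriv_solution[OF m(1) qW, unfolded qx, OF xI[OF z\<epsilon>] xI[OF t\<epsilon>] dir dq])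
        fix d e assume *: "\<And>j. j \<le> m \<Longrightarrow> (\<Sum>k\<le>m. d k * integral {0..1} (\<lambda>r. r ^ (j + k) *
          (1 / graph_root (q, x 0 + \<sigma> * (\<sigma> * (x t - x 0) * r)) ^ 3))) = (if j = 0 then e else 0)"
        show "(\<Sum>k\<le>m. d k) = e * \<rho> (\<sigma> * (x t - x 0))"
          using \<rho>[OF S\<delta>[OF t\<epsilon>], of d e, unfolded S_def wt_def, OF *] .
      qed
      also have "\<sigma> * graph_slope (q, x 0) / graph_root (q, x 0) = h2 / u 0"
      proof -
        have "\<sigma> \<noteq> 0" using \<sigma>(1) by (metis power_zero_numeral zero_neq_one)
        then show ?thesis using c u0 unfolding rt[OF z\<epsilon>] slope0 by simp
      qed
      finally have d: "S t * (dq \<bullet> jet_vec 0 (x t)) = (v1 * (h2 / u 0) - v2) * \<rho> (S t)" .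
      have St: "S t = \<sigma> * (t * z t)" by (simp add: S_def xz[OF t\<epsilon>])
      have "c * (dq \<bullet> jet_vec 0 (x t)) / graph_root (q, x t) = c\<^sup>2 * (dq \<bullet> jet_vec 0 (x t)) / (\<sigma> * u t)"
        unfolding rt[OF t\<epsilon>] using c by (simp add: power2_eq_square)
      also have "\<dots> = c\<^sup>2 * (S t * (dq \<bullet> jet_vec 0 (x t))) / (t * z t * u t)"
        unfolding St using t0 z_ne[OF t\<epsilon>] \<sigma>(1) \<sigma>1 by (auto simp: power2_eq_square abs_if split: if_splits)
      also have "\<dots> = c\<^sup>2 * (v1 * h2 - v2 * u 0) * \<rho> (S t) / (u 0 * t * (z t * u t))"
        unfolding d using u0 by (simp add: field_simps)
      finally have D: "c * (dq \<bullet> jet_vec 0 (x t)) / graph_root (q, x t) = c\<^sup>2 * (v1 * h2 - v2 * u 0) * \<rho> (S t) / (u 0 * t * (z t * u t))" .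
      have "(c * (dq \<bullet> jet_vec 0 (x t)) / graph_root (q, x t))\<^sup>2 = F t * (v2 * u 0 - v1 * h2)\<^sup>2 / (c\<^sup>2 * t\<^sup>2)"
        unfolding D F_def using c u0 t0 z_ne[OF t\<epsilon>] u_ne[OF t\<epsilon>]
        by (simp add: power_divide power_mult_distrib power2_commute[of "v1 * h2"]) (simp add: power2_eq_square eval_nat_numeral mult_ac)
      moreover have "(((v1, v2) \<bullet> tangential q (x 0)) / t)\<^sup>2 = (v1 * u 0 + v2 * h2)\<^sup>2 / (c\<^sup>2 * t\<^sup>2)"
      proof -
        have "(v1, v2) \<bullet> (u 0, h2) = c * ((v1, v2) \<bullet> tangential q (x 0))"
          unfolding tan0 by (simp only: inner_scaleR_right)
        then have "(v1, v2) \<bullet> tangential q (x 0) = (v1 * u 0 + v2 * h2) / c"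
          using c by (simp add: field_simps)
        then show ?thesis by (simp add: power_divide power_mult_distrib)
      qed
      ultimately show ?thesis unfolding E2 c2[symmetric] by (simp add: add_divide_distrib)
    qed
    then show ?thesis
      unfolding cost_expansion_at_def Let_def x_def[symmetric] using EU by blast
    qed
  qed
  show ?thesis
    using \<epsilon>(1) FC FJ' exp unfolding h2_def h3_def h4_def x_def by blast
qed

end

section \<open>From the Hamiltonian flow to extremals\<close>

text \<open>The definite description is resolved by nondegeneracy of the symplectic form: pairing
  with (0, w) and with (w, 0) recovers the two components of the field.\<close>

lemma ham_field_sr_ham:
  fixes q p :: "real ^ 'n::finite"
  assumes n: "CARD('n) \<ge> 2"
  shows "ham_field sr_ham (q, p) =
    (coord_x p *\<^sub>R d_x + (p \<bullet> jet_vec 0 (coord_x q)) *\<^sub>R jet_vec 0 (coord_x q),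
     - ((p \<bullet> jet_vec 0 (coord_x q)) * (p \<bullet> jet_vec 1 (coord_x q))) *\<^sub>R d_x)" (is "_ = ?V")
proof -
  define V0 where "V0 = ?V"
  have *: "(sr_ham has_derivative (\<lambda>W. symp W V0)) (at (q, p))"
  proof -
  have "((\<lambda>l :: (real ^ 'n) \<times> (real ^ 'n). jet_vec 0 (coord_x (fst l)) :: real ^ 'n) has_derivative
      (\<lambda>W. coord_x (fst W) *\<^sub>R jet_vec 1 (coord_x q))) (at (q, p))"
  proof -
    have "((\<lambda>l :: (real ^ 'n) \<times> (real ^ 'n). coord_x (fst l)) has_derivative (\<lambda>W. coord_x (fst W))) (at (q, p))"
      by (auto intro!: derivative_eq_intros)
    from has_derivative_compose[OF this, of "jet_vec 0" "\<lambda>h. h *\<^sub>R jet_vec 1 (coord_x q)"]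
    show ?thesis using jet_vec_has_vector_derivative[of 0 "coord_x q" UNIV] by (simp add: has_vector_derivative_def)
  qed
  note Y = this
  have F: "sr_ham = (\<lambda>l :: (real ^ 'n) \<times> (real ^ 'n). 1/2 * ((snd l \<bullet> d_x)\<^sup>2 + (snd l \<bullet> jet_vec 0 (coord_x (fst l)))\<^sup>2))"
    unfolding sr_ham_def cov_h_def jet_field_frame ..
  have D: "((\<lambda>l. 1/2 * ((f l)\<^sup>2 + (g l)\<^sup>2)) has_derivative (\<lambda>W. f z * f' W + g z * g' W)) (at z)"
    if "(f has_derivative f') (at z)" "(g has_derivative g') (at z)"
    for f g :: "(real ^ 'n) \<times> (real ^ 'n) \<Rightarrow> real" and f' g' z
    by (rule has_derivative_eq_rhs[OF has_derivative_mult_right[OF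
      has_derivative_add[OF has_derivative_power[OF that(1), of 2] has_derivative_power[OF that(2), of 2]], of "1/2"]])
      (rule ext, simp)
  have f: "((\<lambda>l :: (real ^ 'n) \<times> (real ^ 'n). snd l \<bullet> d_x) has_derivative (\<lambda>W. snd W \<bullet> d_x)) (at (q, p))"
    by (intro bounded_linear_imp_has_derivative bounded_linear_inner_left_comp bounded_linear_snd)
  have g: "((\<lambda>l :: (real ^ 'n) \<times> (real ^ 'n). snd l \<bullet> jet_vec 0 (coord_x (fst l))) has_derivative
      (\<lambda>W. p \<bullet> (coord_x (fst W) *\<^sub>R jet_vec 1 (coord_x q)) + snd W \<bullet> jet_vec 0 (coord_x q))) (at (q, p))"
    using has_derivative_inner[OF bounded_linear_imp_has_derivative[OF bounded_linear_snd] Y] by simp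
  have "(sr_ham has_derivative (\<lambda>W. (p \<bullet> d_x) * (snd W \<bullet> d_x) + (p \<bullet> jet_vec 0 (coord_x q)) *
      (p \<bullet> (coord_x (fst W) *\<^sub>R jet_vec 1 (coord_x q)) + snd W \<bullet> jet_vec 0 (coord_x q)))) (at (q, p))"
    unfolding F using D[OF f g] by simp
  also have "(\<lambda>W. (p \<bullet> d_x) * (snd W \<bullet> d_x) + (p \<bullet> jet_vec 0 (coord_x q)) *
      (p \<bullet> (coord_x (fst W) *\<^sub>R jet_vec 1 (coord_x q)) + snd W \<bullet> jet_vec 0 (coord_x q))) = (\<lambda>W. symp W V0)"
    unfolding symp_def V0_def coord_x_inner fst_conv snd_conv
    by (simp add: fun_eq_iff inner_add_right distrib_left inner_commute[of d_x])
    finally show ?thesis .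
  qed
  have "V = V0" if "(sr_ham has_derivative (\<lambda>W. symp W V)) (at (q, p))" for V
  proof -
    have eq: "symp W V = symp W V0" for W using fun_cong[OF has_derivative_unique[OF that *]] .
    have "w \<bullet> fst V = w \<bullet> fst V0" for w using eq[of "(0, w)"] by (simp add: symp_def)
    moreover have "snd V \<bullet> w = snd V0 \<bullet> w" for w using eq[of "(w, 0)"] by (simp add: symp_def)
    ultimately show ?thesis by (metis prod_eqI vector_eq_ldot vector_eq_rdot)
  qed
  with * have "ham_field sr_ham (q, p) = V0"
    unfolding ham_field_def by (intro the_equality)
  then show ?thesis by (simp only: V0_def)
qed

text \<open>The Hamiltonian does not involve y, so the momentum varies only along
  \<open>d_x\<close>, which is orthogonal to every \<open>jet_vec\<close>. Hence p_0 may replace the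
  current momentum in all these pairings.\<close>

lemma normal_geodesic_extremal:
  fixes \<gamma> :: "real \<Rightarrow> real ^ 'n::finite"
  assumes n: "CARD('n) \<ge> 2" and T: "T \<ge> 0" and "normal_geodesic T \<gamma> (x0, p0)"
  shows "\<gamma> 0 = x0 \<and> (\<exists>u. u 0 = coord_x p0 \<and> extremal T \<gamma> p0 u)"
proof -
  obtain l where l0: "l 0 = (x0, p0)"
    and l': "\<And>t. t \<in> {0..T} \<Longrightarrow> (l has_vector_derivative ham_field sr_ham (l t)) (at t within {0..T})"
    and \<gamma>: "\<And>t. t \<in> {0..T} \<Longrightarrow> \<gamma> t = fst (l t)"
    using assms(3) by (auto simp: normal_geodesic_def)
  have z: "0 \<in> {0..T}" using T by simp
  define P where "P t = snd (l t)" for t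
  define b where "b t = P t \<bullet> jet_vec 0 (coord_x (\<gamma> t))" for t
  define b' where "b' t = P t \<bullet> jet_vec 1 (coord_x (\<gamma> t))" for t
  have L: "ham_field sr_ham (l t) = (coord_x (P t) *\<^sub>R d_x + b t *\<^sub>R jet_vec 0 (coord_x (\<gamma> t)), - (b t * b' t) *\<^sub>R d_x)"
    if "t \<in> {0..T}" for t
    using ham_field_sr_ham[OF n, of "fst (l t)" "snd (l t)"] \<gamma>[OF that] by (simp add: P_def b_def b'_def)
  have P': "(P has_vector_derivative - (b t * b' t) *\<^sub>R d_x) (at t within {0..T})" if t: "t \<in> {0..T}" for t
    using bounded_linear.has_vector_derivative[OF bounded_linear_snd l'[OF t]] by (simp add: P_def[abs_def] L[OF t])
  have fst': "((\<lambda>t. fst (l t)) has_vector_derivative coord_x (P t) *\<^sub>R d_x + b t *\<^sub>R jet_vec 0 (coord_x (\<gamma> t))) (at t within {0..T})"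
    if t: "t \<in> {0..T}" for t
    using bounded_linear.has_vector_derivative[OF bounded_linear_fst l'[OF t]] by (simp add: L[OF t])
  have \<gamma>': "(\<gamma> has_vector_derivative coord_x (P t) *\<^sub>R d_x + b t *\<^sub>R jet_vec 0 (coord_x (\<gamma> t))) (at t within {0..T})"
    if t: "t \<in> {0..T}" for t
    by (rule has_vector_derivative_transform[OF t \<gamma> fst'[OF t]])
  have const: "P t \<bullet> jet_vec i \<xi> = p0 \<bullet> jet_vec i \<xi>" if t: "t \<in> {0..T}" for t i \<xi>
  proof -
    have "((\<lambda>t. P t \<bullet> jet_vec i \<xi>) has_real_derivative 0) (at t within {0..T})" if t: "t \<in> {0..T}" for t
      using bounded_linear.has_vector_derivative[OF bounded_linear_inner_left P'[OF t], of "jet_vec i \<xi>"] n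
      by (simp add: has_real_derivative_iff_has_vector_derivative)
    then have "\<exists>c. \<forall>t\<in>{0..T}. P t \<bullet> jet_vec i \<xi> = c"
      by (intro has_field_derivative_zero_constant) auto
    then have "P t \<bullet> jet_vec i \<xi> = P 0 \<bullet> jet_vec i \<xi>" using t z by metis
    then show ?thesis by (simp add: P_def l0)
  qed
  have "((\<lambda>t. coord_x (P t)) has_real_derivative - (b t * b' t)) (at t within {0..T})" if t: "t \<in> {0..T}" for t
    using coord_x_has_vector_derivative[OF P'[OF t]] by (simp add: has_real_derivative_iff_has_vector_derivative)
  then have "extremal T \<gamma> p0 (\<lambda>t. coord_x (P t))"
    using \<gamma>' const by (simp add: extremal_def b_def b'_def)
  moreover have "\<gamma> 0 = x0" using \<gamma>[OF z] l0 by simp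
  moreover have "coord_x (P 0) = coord_x p0" by (simp add: P_def l0)
  ultimately show ?thesis by (intro conjI exI[of _ "\<lambda>t. coord_x (P t)"])
qed

section \<open>Flags of extremals\<close>

lemma CkD: "Ck (Suc k) f \<Longrightarrow> Ck k f"
proof (induction k arbitrary: f)
  case 0
  then show ?case by (auto intro!: differentiable_imp_continuous_on simp: differentiable_on_def differentiable_at_withinI)
qed auto

lemma CkI:
  assumes "\<And>x. (f has_derivative f' x) (at x)" "\<And>v. Ck k (\<lambda>x. f' x v)"
  shows "Ck (Suc k) f"
proof -
  have "frechet_derivative f (at x) = f' x" for x using frechet_derivative_at[OF assms(1)] by simp
  then show ?thesis using assms by (auto simp: differentiable_def)
qed

lemma Ck_has_derivative: "Ck (Suc k) f \<Longrightarrow> (f has_derivative frechet_derivative f (at x)) (at x)"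
  by (simp add: frechet_derivative_works)

lemma Ck_const: "Ck k (\<lambda>x. c)"
proof (induction k arbitrary: c)
  case (Suc k)
  show ?case by (rule CkI[OF has_derivative_const Suc.IH])
qed simp

lemma Ck_bounded_linear: "bounded_linear h \<Longrightarrow> Ck k h"
proof (cases k)
  case (Suc j)
  assume "bounded_linear h"
  then show ?thesis unfolding Suc by (intro CkI[OF bounded_linear_imp_has_derivative Ck_const])
qed (simp add: linear_continuous_on)

lemma Ck_linear_image: "Ck k f \<Longrightarrow> bounded_linear h \<Longrightarrow> Ck k (\<lambda>x. h (f x))"
proof (induction k arbitrary: f)
  case 0
  then show ?case by (simp add: bounded_linear.continuous_on)
next
  case (Suc k)
  show ?case
    by (rule CkI[OF bounded_linear.has_derivative[OF Suc.prems(2) Ck_has_derivative[OF Suc.prems(1)]]])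
      (use Suc in simp)
qed

lemma Ck_add: "Ck k f \<Longrightarrow> Ck k g \<Longrightarrow> Ck k (\<lambda>x. f x + g x)"
proof (induction k arbitrary: f g)
  case 0
  then show ?case by (simp add: continuous_intros)
next
  case (Suc k)
  show ?case
    by (rule CkI[OF has_derivative_add[OF Suc.prems[THEN Ck_has_derivative]]]) (use Suc in simp)
qed

lemma Ck_scaleR: "Ck k f \<Longrightarrow> Ck k g \<Longrightarrow> Ck k (\<lambda>x. f x *\<^sub>R g x)"
proof (induction k arbitrary: f g)
  case 0
  then show ?case by (simp add: continuous_intros)
next
  case (Suc k)
  show ?case
    by (rule CkI[OF has_derivative_scaleR[OF Suc.prems[THEN Ck_has_derivative]]])
      (use Suc CkD[OF Suc.prems(1)] CkD[OF Suc.prems(2)] in \<open>auto intro!: Ck_add\<close>)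
qed

lemma Ck_diff: "Ck k f \<Longrightarrow> Ck k g \<Longrightarrow> Ck k (\<lambda>x. f x - g x)"
  using Ck_add[of k f "\<lambda>x. - g x"] Ck_linear_image[of k g uminus] by (simp add: bounded_linear_minus bounded_linear_ident)

lemma Ck_sum: "finite I \<Longrightarrow> (\<And>i. i \<in> I \<Longrightarrow> Ck k (f i)) \<Longrightarrow> Ck k (\<lambda>x. \<Sum>i\<in>I. f i x)"
  by (induction I rule: finite_induct) (auto intro: Ck_const Ck_add)

lemma Ck_power: "Ck k (f :: _ \<Rightarrow> real) \<Longrightarrow> Ck k (\<lambda>x. f x ^ j)"
  by (induction j) (auto intro: Ck_const dest: Ck_scaleR)

lemma smooth_has_derivative: "smooth_map f \<Longrightarrow> (f has_derivative frechet_derivative f (at x)) (at x)"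
  unfolding smooth_map_def by (blast intro: Ck_has_derivative)

lemma smooth_lie_deriv:
  assumes "smooth_map V" "smooth_map X"
  shows "smooth_map (lie_deriv V X)"
proof -
  have *: "Ck k (\<lambda>q. frechet_derivative X (at q) (V q))" if "smooth_map V" "smooth_map X" for k and V X :: "real ^ 'n \<Rightarrow> real ^ 'n"
  proof -
    \<comment> \<open>\<open>Ck\<close> concerns derivatives in fixed directions, so the moving
      direction \<open>V q\<close> is expanded in the basis.\<close>
    have "frechet_derivative X (at q) (V q) = (\<Sum>b\<in>Basis. (V q \<bullet> b) *\<^sub>R frechet_derivative X (at q) b)" for q
    proof -
      interpret linear "frechet_derivative X (at q)"
        using smooth_has_derivative[OF that(2)] by (rule has_derivative_linear)
      have "frechet_derivative X (at q) (V q) = frechet_derivative X (at q) (\<Sum>b\<in>Basis. (V q \<bullet> b) *\<^sub>R b)"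
        by (simp only: euclidean_representation)
      then show ?thesis by (simp only: sum scaleR)
    qed
    moreover have "Ck k (\<lambda>q. frechet_derivative X (at q) b)" for b
      using that(2) unfolding smooth_map_def by (metis Ck.simps(2))
    moreover have "Ck k (\<lambda>q. V q \<bullet> b)" for b
      using that(1) by (intro Ck_linear_image[OF _ bounded_linear_inner_left]) (simp add: smooth_map_def)
    ultimately show ?thesis by (auto intro!: Ck_sum Ck_scaleR)
  qed
  show ?thesis
    unfolding smooth_map_def lie_deriv_def using *[OF assms] *[OF assms(2,1)] by (auto intro: Ck_diff)
qed

lemma smooth_lie_deriv_power: "smooth_map V \<Longrightarrow> smooth_map X \<Longrightarrow> smooth_map ((lie_deriv V ^^ j) X)"
  by (induction j) (auto intro: smooth_lie_deriv)

lemma smooth_jet_vec: "smooth_map (\<lambda>q :: real ^ 'n::finite. jet_vec i (coord_x q) :: real ^ 'n)"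
proof -
  have "Ck k (coord_x :: real ^ 'n \<Rightarrow> real)" for k by (rule Ck_bounded_linear[OF bounded_linear_coord_x])
  then have "Ck k (\<lambda>q :: real ^ 'n. inverse (fact (j - i)) *\<^sub>R coord_x q ^ (j - i))" for k j
    by (intro Ck_scaleR Ck_const Ck_power)
  then have "Ck k (\<lambda>q :: real ^ 'n. coord_x q ^ (j - i) / fact (j - i))" for k j
    by (simp only: real_scaleR_def divide_inverse mult.commute)
  then show ?thesis
    unfolding smooth_map_def jet_vec_def by (intro allI Ck_sum Ck_scaleR Ck_const) auto
qed

lemma horizontal_fieldI:
  assumes "smooth_map a" "smooth_map b"
  shows "horizontal_field (\<lambda>q. a q *\<^sub>R d_x + b q *\<^sub>R jet_vec 0 (coord_x q))"
  using assms smooth_jet_vec unfolding horizontal_field_def smooth_map_def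
  by (auto intro!: Ck_add Ck_scaleR Ck_const)

text \<open>The coframe dual to \<open>X\<^sub>2, \<dots>, X\<^sub>n\<close>, with \<open>dual_vec i\<close> dual to \<open>X\<^bsub>i+2\<^esub>\<close>.\<close>

definition dual_vec :: "nat \<Rightarrow> real \<Rightarrow> real ^ 'n::finite" where
  "dual_vec i \<xi> = (\<Sum>j\<le>i. ((- \<xi>) ^ (i - j) / fact (i - j)) *\<^sub>R d_y j)"

lemma dual_vec_inner_d_x:
  "CARD('n) \<ge> 2 \<Longrightarrow> i \<le> CARD('n) - 2 \<Longrightarrow> (dual_vec i \<xi> :: real ^ 'n::finite) \<bullet> d_x = 0"
  by (auto simp: dual_vec_def inner_sum_left d_x_inner_d_y intro!: sum.neutral)

text \<open>The sum is the binomial expansion of (\<xi> - \<xi>)^i / i!.\<close>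

lemma dual_vec_inner_jet_vec:
  assumes "CARD('n) \<ge> 2" "i \<le> CARD('n) - 2"
  shows "(dual_vec i \<xi> :: real ^ 'n::finite) \<bullet> jet_vec 0 \<xi> = (if i = 0 then 1 else 0)"
proof -
  have "(dual_vec i \<xi> :: real ^ 'n) \<bullet> jet_vec 0 \<xi> = (\<Sum>j\<le>i. (- \<xi>) ^ (i - j) / fact (i - j) * (\<xi> ^ j / fact j))"
    using assms by (auto simp: dual_vec_def inner_sum_left inner_commute[of "d_y _"] jet_vec_inner_d_y intro!: sum.cong)
  also have "\<dots> = (\<Sum>j\<le>i. of_nat (i choose j) * \<xi> ^ j * (- \<xi>) ^ (i - j)) / fact i"
    by (simp add: sum_divide_distrib binomial_fact field_simps)
  also have "\<dots> = (\<xi> + - \<xi>) ^ i / fact i" by (simp only: binomial_ring)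
  finally show ?thesis by (simp add: power_0_left)
qed

lemma dual_vec_inner_d_y:
  assumes "CARD('n) \<ge> 2" "i \<le> CARD('n) - 2"
  shows "(dual_vec i \<xi> :: real ^ 'n::finite) \<bullet> d_y i = 1"
proof -
  have "(dual_vec i \<xi> :: real ^ 'n) \<bullet> d_y i = (\<Sum>j\<le>i. if j = i then 1 else 0)"
    unfolding dual_vec_def inner_sum_left using assms by (intro sum.cong) (auto simp: d_y_inner)
  then show ?thesis by simp
qed

lemma dual_vec_has_vector_derivative:
  "((dual_vec i :: real \<Rightarrow> real ^ 'n::finite) has_vector_derivative (if i = 0 then 0 else - dual_vec (i - 1) \<xi>)) (at \<xi> within S)"
proof (cases i)
  case 0
  then show ?thesis by (simp add: dual_vec_def[abs_def])
next
  case (Suc k)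
  have d: "((\<lambda>\<xi>. (- \<xi>) ^ (Suc k - j) / fact (Suc k - j)) has_real_derivative - ((- \<xi>) ^ (k - j) / fact (k - j))) (at \<xi> within S)"
    if "j \<le> k" for j
  proof -
    have eq: "Suc k - j = Suc (k - j)" using that by simp
    show ?thesis unfolding eq
      by (rule DERIV_cong[OF DERIV_cdivide[OF DERIV_power[OF DERIV_minus[OF DERIV_ident], of "Suc (k - j)"]]]) (simp add: divide_simps)
  qed
  have d': "((\<lambda>\<xi>. ((- \<xi>) ^ (Suc k - j) / fact (Suc k - j)) *\<^sub>R (d_y j :: real ^ 'n)) has_vector_derivative
      - ((- \<xi>) ^ (k - j) / fact (k - j)) *\<^sub>R d_y j) (at \<xi> within S)" if "j \<le> k" for j
    using has_vector_derivative_scaleR[OF d[OF that] has_vector_derivative_const, of "d_y j"] by simp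
  have "((\<lambda>\<xi>. (\<Sum>j\<le>k. ((- \<xi>) ^ (Suc k - j) / fact (Suc k - j)) *\<^sub>R (d_y j :: real ^ 'n)) + d_y (Suc k)) has_vector_derivative
      (\<Sum>j\<le>k. - ((- \<xi>) ^ (k - j) / fact (k - j)) *\<^sub>R d_y j) + 0) (at \<xi> within S)"
    by (intro has_vector_derivative_add has_vector_derivative_const has_vector_derivative_sum d') simp
  then show ?thesis
    by (simp add: Suc dual_vec_def[abs_def] sum_negf)
qed

text \<open>The Leibniz rule for pairing a Lie derivative with a coframe element. The derivative of
  V is eliminated by differentiating the identity that this element annihilates the horizontal V;
  moving the base point lowers the index by one, and for i = 1 the lowered element no longer
  annihilates V, which causes the last term.\<close>

lemma dual_vec_lie_deriv:
  fixes V Z :: "real ^ 'n::finite \<Rightarrow> real ^ 'n"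
  assumes n: "CARD('n) \<ge> 2" and i: "1 \<le> i" "i \<le> CARD('n) - 2"
    and V: "horizontal_field V" and Z: "smooth_map Z"
  shows "\<exists>D. ((\<lambda>q. dual_vec i (coord_x q) \<bullet> Z q) has_derivative D) (at q) \<and>
    dual_vec i (coord_x q) \<bullet> lie_deriv V Z q =
      D (V q) + (V q \<bullet> d_x) * (dual_vec (i - 1) (coord_x q) \<bullet> Z q) - (if i = 1 then V q \<bullet> d_y 0 * coord_x (Z q) else 0)"
proof -
  let ?d = "\<lambda>q :: real ^ 'n. dual_vec i (coord_x q) :: real ^ 'n"
  let ?d1 = "dual_vec (i - 1) (coord_x q) :: real ^ 'n"
  have d: "(?d has_derivative (\<lambda>v. coord_x v *\<^sub>R - ?d1)) (at q)"
    using has_derivative_compose[OF bounded_linear_imp_has_derivative[OF bounded_linear_coord_x]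
        dual_vec_has_vector_derivative[of i "coord_x q" UNIV, unfolded has_vector_derivative_def]] i by simp
  have smV: "smooth_map V" and hV: "V q \<in> hor q" for q using V by (auto simp: horizontal_field_def)
  note V' = smooth_has_derivative[OF smV, of q] and Z' = smooth_has_derivative[OF Z, of q]
  have zero: "?d q \<bullet> V q = 0" for q
    using hV[of q] n i by (auto simp: hor_iff inner_add_right dual_vec_inner_d_x dual_vec_inner_jet_vec)
  have "((\<lambda>q. ?d q \<bullet> V q) has_derivative (\<lambda>v. ?d q \<bullet> frechet_derivative V (at q) v + (coord_x v *\<^sub>R - ?d1) \<bullet> V q)) (at q)"
    by (rule has_derivative_inner[OF d V'])
  moreover have "((\<lambda>q. ?d q \<bullet> V q) has_derivative (\<lambda>v. 0)) (at q)" by (simp add: zero)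
  ultimately have "(\<lambda>v. ?d q \<bullet> frechet_derivative V (at q) v + (coord_x v *\<^sub>R - ?d1) \<bullet> V q) = (\<lambda>v. 0)"
    by (rule has_derivative_unique)
  then have 1: "?d q \<bullet> frechet_derivative V (at q) v = coord_x v * (?d1 \<bullet> V q)" for v
    by (simp add: fun_eq_iff add_eq_0_iff2)
  have 2: "?d1 \<bullet> V q = (if i = 1 then V q \<bullet> d_y 0 else 0)"
    using hV[of q] n i
    by (auto simp: hor_iff inner_add_right inner_add_left dual_vec_inner_d_x dual_vec_inner_jet_vec d_x_inner_d_y)
  have 3: "((\<lambda>q. ?d q \<bullet> Z q) has_derivative (\<lambda>v. ?d q \<bullet> frechet_derivative Z (at q) v + (coord_x v *\<^sub>R - ?d1) \<bullet> Z q)) (at q)"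
    by (rule has_derivative_inner[OF d Z'])
  show ?thesis
    by (rule exI, rule conjI, rule 3) (simp add: lie_deriv_def inner_diff_right 1 2[unfolded One_nat_def] flip: coord_x_inner)
qed

section \<open>Upper and lower bounds for the flag\<close>

text \<open>New directions beyond index k arise only through the x-velocity of the curve, or through
  its y_0-velocity when k = 1. If these vanish near time 0, all coframe elements from k on
  annihilate every iterated Lie derivative along the curve.\<close>

lemma flag_annihilated:
  fixes \<gamma> :: "real \<Rightarrow> real ^ 'n::finite"
  assumes T: "T > 0" and k: "1 \<le> k" "k \<le> CARD('n) - 2" and \<epsilon>: "\<epsilon> > 0"
    and a: "\<And>s. s \<in> {0..T} \<Longrightarrow> s < \<epsilon> \<Longrightarrow> (\<gamma> has_vector_derivative \<gamma>' s) (at s within {0..T}) \<and> coord_x (\<gamma>' s) = 0 \<and>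
      (k = 1 \<longrightarrow> \<gamma>' s \<bullet> d_y 0 = 0)"
    and v: "v \<in> flag T \<gamma> m 0"
  shows "dual_vec k (coord_x (\<gamma> 0)) \<bullet> v = 0"
proof -
  have n: "CARD('n) \<ge> 2" using k by simp
  have "dual_vec k (coord_x (\<gamma> 0)) \<bullet> (lie_deriv V ^^ j) X (\<gamma> 0) = 0"
    if V: "horizontal_field V" and e: "extends_velocity T \<gamma> 0 V" and X: "horizontal_field X" for V X j
  proof -
    obtain \<delta> where \<delta>: "\<delta> > 0" "\<And>s. s \<in> {0..T} \<Longrightarrow> s < \<delta> \<Longrightarrow> (\<gamma> has_vector_derivative V (\<gamma> s)) (at s within {0..T})"
      using e by (auto simp: extends_velocity_def)
    define r where "r = min \<epsilon> (min \<delta> T)"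
    have r: "r > 0" "r \<le> \<epsilon>" "r \<le> \<delta>" "r \<le> T" using \<epsilon> \<delta> T by (auto simp: r_def)
    have V\<gamma>: "V (\<gamma> s) = \<gamma>' s" if "s \<in> {0..<r}" for s
      using vector_derivative_unique_within_closed_interval[OF T, of s \<gamma> "V (\<gamma> s)" "\<gamma>' s"] \<delta>(2)[of s] a[of s] that r by auto
    have smX: "smooth_map X" and smV: "smooth_map V" and hX: "\<And>q. X q \<in> hor q"
      using X V by (auto simp: horizontal_field_def)
    \<comment> \<open>The induction must range over a time interval: the derivative of the pairing
      in direction V is its derivative along the curve, which vanishes because the pairing vanishes
      at neighbouring times as well.\<close>
    have "\<forall>i\<in>{k..CARD('n) - 2}. \<forall>s\<in>{0..<r}. dual_vec i (coord_x (\<gamma> s)) \<bullet> (lie_deriv V ^^ j) X (\<gamma> s) = 0"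
    proof (induction j)
      case 0
      show ?case
      proof (intro ballI)
        fix i s assume "i \<in> {k..CARD('n) - 2}"
        then show "dual_vec i (coord_x (\<gamma> s)) \<bullet> (lie_deriv V ^^ 0) X (\<gamma> s) = 0"
          using hX[of "\<gamma> s"] n k by (auto simp: hor_iff inner_add_right dual_vec_inner_d_x dual_vec_inner_jet_vec)
      qed
    next
      case (Suc j)
      define Z where "Z = (lie_deriv V ^^ j) X"
      have smZ: "smooth_map Z" unfolding Z_def by (rule smooth_lie_deriv_power[OF smV smX])
      show ?case
      proof (intro ballI)
        fix i s assume i: "i \<in> {k..CARD('n) - 2}" and s: "s \<in> {0..<r}"
        then have i': "1 \<le> i" "i \<le> CARD('n) - 2" using k by auto
        obtain D where D: "((\<lambda>q. dual_vec i (coord_x q) \<bullet> Z q) has_derivative D) (at (\<gamma> s))"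
          and L: "dual_vec i (coord_x (\<gamma> s)) \<bullet> lie_deriv V Z (\<gamma> s) =
            D (V (\<gamma> s)) + (V (\<gamma> s) \<bullet> d_x) * (dual_vec (i - 1) (coord_x (\<gamma> s)) \<bullet> Z (\<gamma> s)) -
              (if i = 1 then V (\<gamma> s) \<bullet> d_y 0 * coord_x (Z (\<gamma> s)) else 0)"
          using dual_vec_lie_deriv[OF n i' V smZ, of "\<gamma> s"] by blast
        have \<gamma>s: "(\<gamma> has_vector_derivative V (\<gamma> s)) (at s within {0..r})"
          using \<delta>(2)[of s] s r by (auto intro: has_vector_derivative_within_subset)
        have "((\<lambda>s. dual_vec i (coord_x (\<gamma> s)) \<bullet> Z (\<gamma> s)) has_vector_derivative D (V (\<gamma> s))) (at s within {0..r})"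
          using vector_derivative_diff_chain_within[OF \<gamma>s has_derivative_at_withinI[OF D]] by (simp add: o_def)
        moreover have "((\<lambda>s. 0 :: real) has_vector_derivative 0) (at s within {0..r})" by simp
        then have "((\<lambda>s. dual_vec i (coord_x (\<gamma> s)) \<bullet> Z (\<gamma> s)) has_vector_derivative 0) (at s within {0..r})"
        proof (rule has_vector_derivative_transform_within[where d="r - s"])
          fix s' assume "s' \<in> {0..r}" "dist s' s < r - s"
          then have "s' \<in> {0..<r}" by (auto simp: dist_real_def)
          then show "0 = dual_vec i (coord_x (\<gamma> s')) \<bullet> Z (\<gamma> s')" using Suc.IH i by (simp add: Z_def)
        qed (use s in auto)
        ultimately have "D (V (\<gamma> s)) = 0"
          using vector_derivative_unique_within_closed_interval[OF r(1), of s] s by force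
        moreover have "V (\<gamma> s) \<bullet> d_x = 0" "i = 1 \<longrightarrow> V (\<gamma> s) \<bullet> d_y 0 = 0"
          using V\<gamma>[OF s] a[of s] s r i k by (auto simp: coord_x_inner)
        ultimately show "dual_vec i (coord_x (\<gamma> s)) \<bullet> (lie_deriv V ^^ Suc j) X (\<gamma> s) = 0"
          using L by (simp add: Z_def)
      qed
    qed
    then show ?thesis using r k by auto
  qed
  then have "flag T \<gamma> m 0 \<subseteq> {v. dual_vec k (coord_x (\<gamma> 0)) \<bullet> v = 0}"
    unfolding flag_def by (intro span_minimal subspace_hyperplane) auto
  then show ?thesis using v by blast
qed

lemma horizontal_annihilated:
  fixes q :: "real ^ 'n::finite"
  assumes "v \<in> hor q" "1 \<le> i" "i \<le> CARD('n) - 2"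
  shows "dual_vec i (coord_x q) \<bullet> v = 0"
  using assms by (auto simp: hor_iff inner_add_right dual_vec_inner_d_x dual_vec_inner_jet_vec)

lemma dual_vec_lie_deriv_annihilated:
  fixes V Z :: "real ^ 'n::finite \<Rightarrow> real ^ 'n"
  assumes i: "2 \<le> i" "i \<le> CARD('n) - 2" and V: "horizontal_field V" and Z: "smooth_map Z"
    and zero: "\<And>q. dual_vec i (coord_x q) \<bullet> Z q = 0"
  shows "dual_vec i (coord_x q) \<bullet> lie_deriv V Z q = coord_x (V q) * (dual_vec (i - 1) (coord_x q) \<bullet> Z q)"
proof -
  obtain D where D: "((\<lambda>q. dual_vec i (coord_x q) \<bullet> Z q) has_derivative D) (at q)"
    and L: "dual_vec i (coord_x q) \<bullet> lie_deriv V Z q = D (V q) +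
      (V q \<bullet> d_x) * (dual_vec (i - 1) (coord_x q) \<bullet> Z q) - (if i = 1 then V q \<bullet> d_y 0 * coord_x (Z q) else 0)"
    using dual_vec_lie_deriv[OF _ _ i(2) V Z, of q] i by force
  moreover have "((\<lambda>q. dual_vec i (coord_x q) \<bullet> Z q) has_derivative (\<lambda>v. 0)) (at q)"
    unfolding zero by (rule has_derivative_const)
  ultimately have "D = (\<lambda>v. 0)" by (metis has_derivative_unique)
  then show ?thesis using L i by (simp add: coord_x_inner)
qed

text \<open>The conditions are triangular: each expresses the y_i-component through lower ones, so
  x, y_0 and y_1 are coordinates on the common kernel.\<close>

lemma dim_annihilated:
  fixes \<xi> :: real
  assumes n: "CARD('n::finite) \<ge> 3"
  shows "dim {v :: real ^ 'n. \<forall>i\<in>{2..CARD('n) - 2}. dual_vec i \<xi> \<bullet> v = 0} \<le> 3" (is "dim ?L \<le> 3")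
proof -
  define g where "g v = (v \<bullet> d_x, v \<bullet> d_y 0, v \<bullet> d_y 1)" for v :: "real ^ 'n"
  have lin: "linear g" by (auto simp: g_def intro!: linearI simp: inner_add_left)
  have sub: "subspace ?L" by (auto simp: subspace_def inner_add_right)
  have inj: "v = 0" if v: "v \<in> ?L" and g: "g v = 0" for v
  proof -
    have "v \<bullet> d_y i = 0" if "i \<le> CARD('n) - 2" for i
      using that
    proof (induction i rule: less_induct)
      case (less i)
      show ?case
      proof (cases "i \<le> 1")
        case True
        then have "i = 0 \<or> i = 1" by auto
        then show ?thesis using g by (auto simp: g_def zero_prod_def)
      next
        case False
        have "0 = dual_vec i \<xi> \<bullet> v" using v less.prems False by auto
        also have "\<dots> = (\<Sum>j\<le>i. (- \<xi>) ^ (i - j) / fact (i - j) * (v \<bullet> d_y j))"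
          by (simp add: dual_vec_def inner_sum_right inner_commute[of _ v])
        also have "\<dots> = (\<Sum>j\<in>{i}. (- \<xi>) ^ (i - j) / fact (i - j) * (v \<bullet> d_y j))"
          using less by (intro sum.mono_neutral_right) auto
        finally show ?thesis by simp
      qed
    qed
    moreover have "v \<bullet> d_x = 0" using g by (simp add: g_def zero_prod_def)
    ultimately have "v $ k = 0" for k
      using coord_ix_cases[of k] n by (auto simp: d_x_def d_y_def inner_axis)
    then show ?thesis by (simp add: vec_eq_iff)
  qed
  have "inj_on g ?L"
  proof (rule inj_onI)
    fix v w assume vw: "v \<in> ?L" "w \<in> ?L" "g v = g w"
    then have "v - w \<in> ?L" using subspace_diff[OF sub] by blast
    moreover have "g (v - w) = 0" using vw(3) linear_diff[OF lin] by simp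
    ultimately show "v = w" using inj by fastforce
  qed
  then have "dim ?L = dim (g ` ?L)"
    using dim_image_eq[OF lin, of ?L] sub by (simp add: span_eq_iff[THEN iffD2])
  also have "\<dots> \<le> 3" using dim_subset_UNIV[of "g ` ?L"] by simp
  finally show ?thesis .
qed

text \<open>One Lie derivative of a horizontal field is annihilated by all coframe elements from
  index 2 on, at every point. For the second one their values carry the x-velocity as a factor, and
  this is 0 at time t.\<close>

lemma flag3_dim_le:
  fixes \<gamma> :: "real \<Rightarrow> real ^ 'n::finite"
  assumes n: "CARD('n) \<ge> 3" and T: "T > 0" and t: "t \<in> {0..T}"
    and \<gamma>': "(\<gamma> has_vector_derivative v) (at t within {0..T})" "coord_x v = 0"
  shows "dim (flag T \<gamma> 3 t) \<le> 3"
proof -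
  let ?L = "{v :: real ^ 'n. \<forall>i\<in>{2..CARD('n) - 2}. dual_vec i (coord_x (\<gamma> t)) \<bullet> v = 0}"
  have "(lie_deriv V ^^ j) X (\<gamma> t) \<in> ?L"
    if V: "horizontal_field V" and e: "extends_velocity T \<gamma> t V" and X: "horizontal_field X" and j: "j < 3" for V X j
  proof -
    have "V (\<gamma> t) = v"
      using vector_derivative_unique_within_closed_interval[OF T, of t \<gamma> "V (\<gamma> t)" v] \<gamma>'(1) e t
      by (auto simp: extends_velocity_def)
    then have V0: "coord_x (V (\<gamma> t)) = 0" using \<gamma>'(2) by simp
    have smX: "smooth_map X" and smV: "smooth_map V" and hX: "\<And>q. X q \<in> hor q"
      using X V by (auto simp: horizontal_field_def)
    have 0: "dual_vec i (coord_x q) \<bullet> X q = 0" if "1 \<le> i" "i \<le> CARD('n) - 2" for i q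
      by (rule horizontal_annihilated[OF hX that])
    have 1: "dual_vec i (coord_x q) \<bullet> lie_deriv V X q = 0" if "2 \<le> i" "i \<le> CARD('n) - 2" for i q
      using dual_vec_lie_deriv_annihilated[OF that V smX, of q] 0 that by simp
    have 2: "dual_vec i (coord_x (\<gamma> t)) \<bullet> lie_deriv V (lie_deriv V X) (\<gamma> t) = 0" if "2 \<le> i" "i \<le> CARD('n) - 2" for i
      using dual_vec_lie_deriv_annihilated[OF that V smooth_lie_deriv[OF smV smX] 1[OF that], of "\<gamma> t"] V0 by simp
    have "j = 0 \<or> j = 1 \<or> j = 2" using j by auto
    then show ?thesis using 0 1 2 by (auto simp: numeral_2_eq_2)
  qed
  then have "flag T \<gamma> 3 t \<subseteq> ?L"
    unfolding flag_def by (intro span_minimal) (auto simp: subspace_def inner_add_right)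
  then show ?thesis using dim_subset dim_annihilated[OF n] order_trans by blast
qed

text \<open>Along an extremal h_1 is an affine function of position: a constant \<open>v\<close>
  with v . X_2 = p . X_3 makes u + v . \<gamma> a conserved quantity. The velocity is thereby the
  restriction of one globally smooth horizontal field.\<close>

lemma extremal_velocity_extension:
  fixes \<gamma> :: "real \<Rightarrow> real ^ 'n::finite"
  assumes n: "CARD('n) \<ge> 3" and T: "T > 0" and ext: "extremal T \<gamma> p u" and t: "t \<in> {0..T}"
  shows "\<exists>V. horizontal_field V \<and> extends_velocity T \<gamma> t V \<and> coord_x (V (\<gamma> t)) = u t"
proof -
  obtain m where m: "CARD('n) = m + 3" using n by (metis add.commute le_Suc_ex)
  define v where "v = (\<Sum>j\<le>m. (p \<bullet> d_y (Suc j)) *\<^sub>R (d_y j :: real ^ 'n))"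
  have vY: "v \<bullet> jet_vec 0 \<xi> = p \<bullet> jet_vec 1 \<xi>" for \<xi>
  proof -
    have "v \<bullet> jet_vec 0 \<xi> = (\<Sum>j\<le>m. (p \<bullet> d_y (Suc j)) * (\<xi> ^ j / fact j))"
      using m by (auto simp: v_def inner_sum_left inner_commute[of "d_y _" "jet_vec 0 \<xi>"] jet_vec_inner_d_y intro!: sum.cong)
    also have "\<dots> = (\<Sum>j = 0..m. \<xi> ^ (Suc j - 1) / fact (Suc j - 1) * (p \<bullet> d_y (Suc j)))"
      by (simp add: atLeast0AtMost mult.commute)
    also have "\<dots> = (\<Sum>j = 1..Suc m. \<xi> ^ (j - 1) / fact (j - 1) * (p \<bullet> d_y j))"
      by (simp add: sum.atLeast_Suc_atMost_Suc_shift del: sum.cl_ivl_Suc)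
    also have "\<dots> = p \<bullet> jet_vec 1 \<xi>"
      using m by (simp add: jet_vec_def inner_sum_right del: sum.cl_ivl_Suc)
    finally show ?thesis .
  qed
  have vx: "v \<bullet> d_x = 0" using m by (auto simp: v_def inner_sum_left d_x_inner_d_y intro!: sum.neutral)
  have \<gamma>': "(\<gamma> has_vector_derivative u s *\<^sub>R d_x + (p \<bullet> jet_vec 0 (coord_x (\<gamma> s))) *\<^sub>R jet_vec 0 (coord_x (\<gamma> s)))
       (at s within {0..T})"
    and u': "(u has_vector_derivative - ((p \<bullet> jet_vec 0 (coord_x (\<gamma> s))) * (p \<bullet> jet_vec 1 (coord_x (\<gamma> s))))) (at s within {0..T})"
    if "s \<in> {0..T}" for s
    using ext that by (auto simp: extremal_def has_real_derivative_iff_has_vector_derivative)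
  have "((\<lambda>s. u s + v \<bullet> \<gamma> s) has_vector_derivative 0) (at s within {0..T})" if s: "s \<in> {0..T}" for s
    using has_vector_derivative_add[OF u'[OF s] bounded_linear.has_vector_derivative[OF bounded_linear_inner_right \<gamma>'[OF s], of v]]
    by (simp add: inner_add_right vx vY)
  then have "\<exists>C. \<forall>s\<in>{0..T}. u s + v \<bullet> \<gamma> s = C"
    by (intro has_derivative_zero_constant) (auto simp: has_vector_derivative_def)
  then obtain C where C: "\<And>s. s \<in> {0..T} \<Longrightarrow> u s = C - v \<bullet> \<gamma> s" by (metis add_diff_cancel_right')
  define V where "V q = (C - v \<bullet> q) *\<^sub>R d_x + (p \<bullet> jet_vec 0 (coord_x q)) *\<^sub>R (jet_vec 0 (coord_x q) :: real ^ 'n)" for q :: "real ^ 'n"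
  have "smooth_map (\<lambda>q :: real ^ 'n. C - v \<bullet> q)"
    unfolding smooth_map_def by (intro allI Ck_diff Ck_const Ck_bounded_linear bounded_linear_inner_right)
  moreover have "smooth_map (\<lambda>q :: real ^ 'n. p \<bullet> jet_vec 0 (coord_x q))"
    using Ck_linear_image[OF _ bounded_linear_inner_right[of p], of _ "\<lambda>q :: real ^ 'n. jet_vec 0 (coord_x q)"] smooth_jet_vec[where 'n='n, of 0]
    unfolding smooth_map_def by blast
  ultimately have "horizontal_field V" unfolding V_def by (rule horizontal_fieldI)
  moreover have "extends_velocity T \<gamma> t V"
    unfolding extends_velocity_def V_def using \<gamma>' C by (intro exI[of _ 1]) simp
  moreover have "coord_x (V (\<gamma> t)) = u t" using n C[OF t] by (simp add: V_def)
  ultimately show ?thesis by blast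
qed

text \<open>The coordinates x, y_0 and the coframe elements 1 and 2 are triangular on X_1, X_2 and
  the first two Lie derivatives of X_2, with diagonal 1, 1, a, a^2, where a is the
  x-velocity.\<close>

lemma flag3_dim_ge:
  fixes \<gamma> :: "real \<Rightarrow> real ^ 'n::finite"
  assumes n: "CARD('n) \<ge> 4" and V: "horizontal_field V" "extends_velocity T \<gamma> t V" and a: "coord_x (V (\<gamma> t)) \<noteq> 0"
  shows "dim (flag T \<gamma> 3 t) \<ge> 4"
proof -
  define q where "q = \<gamma> t"
  define Y where "Y q = (jet_vec 0 (coord_x q) :: real ^ 'n)" for q :: "real ^ 'n"
  have sm: "smooth_map (\<lambda>q :: real ^ 'n. c :: real)" for c by (simp add: smooth_map_def Ck_const)
  have X1: "horizontal_field (\<lambda>q. d_x :: real ^ 'n)" and X2: "horizontal_field Y"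
    using horizontal_fieldI[OF sm[of 1] sm[of 0]] horizontal_fieldI[OF sm[of 0] sm[of 1]] by (simp_all add: Y_def[abs_def])
  have smV: "smooth_map V" and smY: "smooth_map Y" using V X2 by (auto simp: horizontal_field_def)
  have mem: "(lie_deriv V ^^ j) X q \<in> flag T \<gamma> 3 t" if "horizontal_field X" "j < 3" for j X
    unfolding flag_def q_def using V that by (intro span_base) blast
  have m: "d_x \<in> flag T \<gamma> 3 t" "Y q \<in> flag T \<gamma> 3 t" "lie_deriv V Y q \<in> flag T \<gamma> 3 t" "lie_deriv V (lie_deriv V Y) q \<in> flag T \<gamma> 3 t"
    using mem[OF X1, of 0] mem[OF X2, of 0] mem[OF X2, of 1] mem[OF X2, of 2] by (simp_all add: numeral_2_eq_2)
  have i: "1 \<le> CARD('n) - 2" "2 \<le> CARD('n) - 2" "CARD('n) \<ge> 2" using n by auto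
  have Y0: "dual_vec i (coord_x q) \<bullet> Y q = 0" if "1 \<le> i" "i \<le> CARD('n) - 2" for i q
    using horizontal_annihilated[of "Y q" q, OF _ that] X2 by (simp add: horizontal_field_def)
  have d2: "dual_vec 2 (coord_x q) \<bullet> lie_deriv V Y q = 0" for q
    using dual_vec_lie_deriv_annihilated[OF order_refl i(2) V(1) smY Y0] Y0[of 1] i by simp
  have d1: "dual_vec 1 (coord_x q) \<bullet> lie_deriv V Y q = coord_x (V q)" for q
  proof -
    obtain D where D: "((\<lambda>q. dual_vec 1 (coord_x q) \<bullet> Y q) has_derivative D) (at q)"
      and L: "dual_vec 1 (coord_x q) \<bullet> lie_deriv V Y q = D (V q) +
        (V q \<bullet> d_x) * (dual_vec (1 - 1) (coord_x q) \<bullet> Y q) - (if 1 = (1::nat) then V q \<bullet> d_y 0 * coord_x (Y q) else 0)"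
      using dual_vec_lie_deriv[OF i(3) order_refl i(1) V(1) smY, of q] by blast
    have "((\<lambda>q. dual_vec 1 (coord_x q) \<bullet> Y q) has_derivative (\<lambda>v. 0)) (at q)"
      unfolding Y0[OF order_refl i(1)] by (rule has_derivative_const)
    then have "D = (\<lambda>v. 0)" by (rule has_derivative_unique[OF D])
    then show ?thesis using L i dual_vec_inner_jet_vec[where 'n='n, of 0 "coord_x q"] by (simp add: coord_x_inner Y_def)
  qed
  have d3: "dual_vec 2 (coord_x q) \<bullet> lie_deriv V (lie_deriv V Y) q = (coord_x (V q))\<^sup>2"
    using dual_vec_lie_deriv_annihilated[OF order_refl i(2) V(1) smooth_lie_deriv[OF smV smY] d2, of q] d1
    by (simp add: power2_eq_square)
  define g where "g v = (v \<bullet> d_x, v \<bullet> d_y 0, dual_vec 1 (coord_x q) \<bullet> v, dual_vec 2 (coord_x q) \<bullet> v)" for v :: "real ^ 'n"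
  have lin: "linear g" by (auto simp: g_def intro!: linearI simp: inner_add_left inner_add_right)
  define a where "a = coord_x (V q)"
  have a0: "a \<noteq> 0" using a by (simp add: a_def q_def)
  let ?F = "flag T \<gamma> 3 t"
  have sub: "subspace ?F" by (simp add: flag_def)
  have "z \<in> g ` ?F" for z
  proof -
    obtain z1 z2 z3 z4 where z: "z = (z1, z2, z3, z4)" by (metis prod_cases4)
    define L1 L2 where "L1 = lie_deriv V Y q" and "L2 = lie_deriv V (lie_deriv V Y) q"
    define k4 where "k4 = z4 / a\<^sup>2"
    define k3 where "k3 = (z3 - k4 * (dual_vec 1 (coord_x q) \<bullet> L2)) / a"
    define r where "r = k3 *\<^sub>R L1 + k4 *\<^sub>R L2"
    define y where "y = (z1 - r \<bullet> d_x) *\<^sub>R d_x + (z2 - r \<bullet> d_y 0) *\<^sub>R Y q + r"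
    have "y \<in> ?F" unfolding y_def r_def L1_def L2_def using m by (intro subspace_add subspace_scale sub)
    moreover have "g y = z"
      using i a0 d1[of q] d2[of q] d3 Y0[of 1 q] Y0[of 2 q] dual_vec_inner_d_x[where 'n='n, of 1 "coord_x q"] dual_vec_inner_d_x[where 'n='n, of 2 "coord_x q"]
      by (simp add: g_def z y_def r_def inner_add_left inner_add_right Y_def L1_def[symmetric] L2_def[symmetric] a_def[symmetric] k3_def k4_def d_x_inner_d_y)
    ultimately show ?thesis by blast
  qed
  then have "g ` ?F = UNIV" by blast
  then have "dim (g ` ?F) = 4" by (simp add: dim_UNIV)
  then show ?thesis using dim_image_le[OF lin, of ?F] by simp
qed

lemma ample_equiregular_velocity:
  fixes \<gamma> :: "real \<Rightarrow> real ^ 'n::finite"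
  assumes n: "CARD('n) \<ge> 3" and T: "T > 0" and ext: "extremal T \<gamma> p u"
    and ample: "ample T \<gamma>" and equi: "equiregular T \<gamma>"
  shows "CARD('n) \<ge> 4 \<Longrightarrow> u 0 \<noteq> 0" and "u 0 \<noteq> 0 \<or> p \<bullet> jet_vec 0 (coord_x (\<gamma> 0)) \<noteq> 0"
proof -
  have z: "0 \<in> {0..T}" using T by simp
  define v where "v s = u s *\<^sub>R d_x + (p \<bullet> jet_vec 0 (coord_x (\<gamma> s))) *\<^sub>R (jet_vec 0 (coord_x (\<gamma> s)) :: real ^ 'n)" for s
  have \<gamma>': "(\<gamma> has_vector_derivative v s) (at s within {0..T})" if "s \<in> {0..T}" for s
    using ext that by (auto simp: extremal_def v_def)
  have vx: "coord_x (v s) = u s" and vy: "v s \<bullet> d_y 0 = p \<bullet> jet_vec 0 (coord_x (\<gamma> s))" for s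
    using n by (simp_all add: v_def inner_add_left d_x_inner_d_y)
  obtain m where m: "flag T \<gamma> m 0 = UNIV" using ample z unfolding ample_def by blast
  have no: False if "1 \<le> k" "k \<le> CARD('n) - 2" "\<epsilon> > 0"
    "\<And>s. s \<in> {0..T} \<Longrightarrow> s < \<epsilon> \<Longrightarrow> u s = 0 \<and> (k = 1 \<longrightarrow> p \<bullet> jet_vec 0 (coord_x (\<gamma> s)) = 0)" for k \<epsilon>
  proof -
    \<comment> \<open>Ampleness would force the coframe element of index k to annihilate even
      \<open>d_y k\<close>, on which it takes the value 1.\<close>
    have "dual_vec k (coord_x (\<gamma> 0)) \<bullet> (d_y k :: real ^ 'n) = 0"
      by (rule flag_annihilated[OF T that(1,2,3), where m=m and \<gamma>'=v]) (use \<gamma>' vx vy that(4) m in auto)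
    then show False using dual_vec_inner_d_y[where 'n='n, of k "coord_x (\<gamma> 0)"] that n by simp
  qed
  show "u 0 \<noteq> 0 \<or> p \<bullet> jet_vec 0 (coord_x (\<gamma> 0)) \<noteq> 0"
  proof (rule ccontr)
    assume "\<not> ?thesis"
    moreover have "1 \<le> CARD('n) - 2" using n by simp
    ultimately show False using no[of 1 1] extremal_stationary[OF n T ext] by simp
  qed
  assume n4: "CARD('n) \<ge> 4"
  show "u 0 \<noteq> 0"
  proof
    assume u0: "u 0 = 0"
    obtain \<epsilon> where \<epsilon>: "\<epsilon> > 0" "\<And>s. s \<in> {0..T} \<Longrightarrow> \<bar>s\<bar> < \<epsilon> \<Longrightarrow> growth_vector T \<gamma> s = growth_vector T \<gamma> 0"
      using equi z unfolding equiregular_def by force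
    have "dim (flag T \<gamma> 3 0) \<le> 3"
      by (rule flag3_dim_le[OF n T z \<gamma>'[OF z]]) (simp add: vx u0)
    then have le: "growth_vector T \<gamma> 0 3 \<le> 3" by (simp add: growth_vector_def)
    have "u s = 0" if s: "s \<in> {0..T}" "s < \<epsilon>" for s
    proof (rule ccontr)
      assume us: "u s \<noteq> 0"
      obtain V where "horizontal_field V" "extends_velocity T \<gamma> s V" "coord_x (V (\<gamma> s)) = u s"
        using extremal_velocity_extension[OF n T ext s(1)] by blast
      then have "dim (flag T \<gamma> 3 s) \<ge> 4" using flag3_dim_ge[OF n4] us by metis
      then have "growth_vector T \<gamma> s 3 \<ge> 4" by (simp add: growth_vector_def)
      moreover have "growth_vector T \<gamma> s = growth_vector T \<gamma> 0" using \<epsilon>(2)[of s] s by auto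
      ultimately show False using le by simp
    qed
    moreover have "2 \<le> CARD('n) - 2" using n4 by simp
    ultimately show False using no[of 2 \<epsilon>] \<epsilon>(1) by simp
  qed
qed

section \<open>The quarter turn of the Heisenberg group\<close>

text \<open>For \<open>n = 3\<close> this is an isometry that maps \<open>X\<^sub>1\<close> to \<open>-X\<^sub>2\<close> and \<open>X\<^sub>2\<close> to \<open>X\<^sub>1\<close>.\<close>

definition quarter_turn :: "real ^ 'n::finite \<Rightarrow> real ^ 'n" where
  "quarter_turn q = (q \<bullet> d_y 0) *\<^sub>R d_x - coord_x q *\<^sub>R d_y 0 + (q \<bullet> d_y 1 - coord_x q * (q \<bullet> d_y 0)) *\<^sub>R d_y 1"

definition quarter_turn' :: "real ^ 'n::finite \<Rightarrow> real ^ 'n \<Rightarrow> real ^ 'n" where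
  "quarter_turn' q v = (v \<bullet> d_y 0) *\<^sub>R d_x - coord_x v *\<^sub>R d_y 0 +
     (v \<bullet> d_y 1 - coord_x v * (q \<bullet> d_y 0) - coord_x q * (v \<bullet> d_y 0)) *\<^sub>R d_y 1"

lemma quarter_turn_has_derivative: "(quarter_turn has_derivative quarter_turn' q) (at q within S)"
proof -
  have "((\<lambda>q. (q \<bullet> d_y 0) *\<^sub>R d_x - coord_x q *\<^sub>R d_y 0 + (q \<bullet> d_y 1 - coord_x q * (q \<bullet> d_y 0)) *\<^sub>R d_y 1) has_derivative
    (\<lambda>v. (v \<bullet> d_y 0) *\<^sub>R d_x - coord_x v *\<^sub>R d_y 0 + (v \<bullet> d_y 1 - (coord_x q * (v \<bullet> d_y 0) + coord_x v * (q \<bullet> d_y 0))) *\<^sub>R d_y 1))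
    (at q within S)"
    by (intro has_derivative_add has_derivative_diff has_derivative_scaleR_left has_derivative_mult
      bounded_linear_imp_has_derivative bounded_linear_inner_left bounded_linear_coord_x)
  then show ?thesis
    by (simp add: quarter_turn_def[abs_def] quarter_turn'_def[abs_def] algebra_simps)
qed

context
  assumes n3: "CARD('n::finite) = 3"
begin

lemma heisenberg_frame: "jet_vec 0 \<xi> = d_y 0 + \<xi> *\<^sub>R (d_y (Suc 0) :: real ^ 'n)" "jet_vec (Suc 0) \<xi> = (d_y (Suc 0) :: real ^ 'n)"
  "jet_vec 2 \<xi> = (0 :: real ^ 'n)"
  using n3 by (simp_all add: jet_vec_def)

lemma heisenberg_inner:
  "d_x \<bullet> (d_y 0 :: real ^ 'n) = 0" "d_x \<bullet> (d_y (Suc 0) :: real ^ 'n) = 0" "d_y 0 \<bullet> (d_y (Suc 0) :: real ^ 'n) = 0"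
  "d_y (Suc 0) \<bullet> (d_y 0 :: real ^ 'n) = 0" "d_y 0 \<bullet> (d_y 0 :: real ^ 'n) = 1" "d_y (Suc 0) \<bullet> (d_y (Suc 0) :: real ^ 'n) = 1"
  "coord_x (d_y 0 :: real ^ 'n) = 0" "coord_x (d_y (Suc 0) :: real ^ 'n) = 0"
  using n3 by (simp_all add: d_y_inner d_x_inner_d_y coord_x_inner)

lemma heisenberg_eqI:
  assumes "coord_x q = coord_x (q' :: real ^ 'n)" "q \<bullet> d_y 0 = q' \<bullet> d_y 0" "q \<bullet> d_y 1 = q' \<bullet> d_y 1"
  shows "q = q'"
proof -
  have "q $ k = q' $ k" for k
  proof (cases k rule: coord_ix_cases)
    case 1
    then show ?thesis using assms by (simp add: coord_x_def)
  next
    case (2 j)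
    then have "j = 0 \<or> j = 1" using n3 by auto
    then show ?thesis using 2 assms by (auto simp: d_y_def inner_axis)
  qed
  then show ?thesis by (simp add: vec_eq_iff)
qed

lemma quarter_turn_coords:
  fixes q :: "real ^ 'n"
  shows "coord_x (quarter_turn q) = q \<bullet> d_y 0" "quarter_turn q \<bullet> d_y 0 = - coord_x q"
    "quarter_turn q \<bullet> d_y (Suc 0) = q \<bullet> d_y (Suc 0) - coord_x q * (q \<bullet> d_y 0)"
  by (simp_all add: quarter_turn_def inner_add_left inner_diff_left heisenberg_inner)

text \<open>Order four replaces an explicit inverse: the third iterate carries curves back, which
  gives the reverse inclusion for the sets of lengths.\<close>

lemma quarter_turn_4: "quarter_turn (quarter_turn (quarter_turn (quarter_turn q))) = (q :: real ^ 'n)"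
  by (rule heisenberg_eqI) (simp_all add: quarter_turn_coords)

lemma quarter_turn'_frame:
  "quarter_turn' q (a *\<^sub>R d_x + b *\<^sub>R jet_vec 0 (coord_x q)) =
    b *\<^sub>R d_x + (- a) *\<^sub>R jet_vec 0 (coord_x (quarter_turn (q :: real ^ 'n)))"
  by (rule heisenberg_eqI)
    (simp_all add: quarter_turn'_def quarter_turn_coords heisenberg_frame inner_add_left inner_diff_left heisenberg_inner algebra_simps)

lemma quarter_turn_hor:
  assumes "v \<in> hor (q :: real ^ 'n)"
  shows "quarter_turn' q v \<in> hor (quarter_turn q)"
    "sr_metric (quarter_turn q) (quarter_turn' q v) (quarter_turn' q v) = sr_metric q v v"
proof -
  obtain a b where v: "v = a *\<^sub>R d_x + b *\<^sub>R jet_vec 0 (coord_x q)" using assms by (auto simp: hor_iff)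
  show "quarter_turn' q v \<in> hor (quarter_turn q)" unfolding v quarter_turn'_frame by (rule horI)
  show "sr_metric (quarter_turn q) (quarter_turn' q v) (quarter_turn' q v) = sr_metric q v v"
    unfolding v quarter_turn'_frame using n3 by (subst (1 2) sr_metric_frame) (simp_all del: scaleR_minus_left)
qed

text \<open>The map is quadratic, hence Lipschitz only on bounded sets; an admissible curve has a
  compact image.\<close>

lemma quarter_turn_lipschitz:
  assumes "bounded (S :: (real ^ 'n) set)"
  shows "\<exists>K. K-lipschitz_on S quarter_turn"
proof -
  obtain R where R: "R > 0" "S \<subseteq> cball 0 R"
    using assms by (auto simp: bounded_pos subset_iff)
  have d: "norm (d_x :: real ^ 'n) = 1" "norm (d_y j :: real ^ 'n) = 1" for j
    by (simp_all add: d_x_def d_y_def)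
  have "onorm (quarter_turn' q) \<le> 3 + 2 * R" if q: "q \<in> cball 0 R" for q :: "real ^ 'n"
  proof (rule onorm_le)
    fix v :: "real ^ 'n"
    have qR: "norm q \<le> R" using q by simp
    have ip: "\<bar>v \<bullet> d_y j\<bar> \<le> norm v" "\<bar>coord_x v\<bar> \<le> norm v" for j and v :: "real ^ 'n"
      using Cauchy_Schwarz_ineq2[of v "d_y j"] Cauchy_Schwarz_ineq2[of v d_x] by (simp_all add: d coord_x_inner)
    have "\<bar>coord_x v * (q \<bullet> d_y 0)\<bar> \<le> norm v * R" "\<bar>coord_x q * (v \<bullet> d_y 0)\<bar> \<le> R * norm v"
      unfolding abs_mult by (rule mult_mono[OF ip(2) order_trans[OF ip(1) qR]], simp_all)
        (rule mult_mono[OF order_trans[OF ip(2) qR] ip(1)], use R in simp_all)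
    moreover have "norm (quarter_turn' q v) \<le> \<bar>v \<bullet> d_y 0\<bar> + \<bar>coord_x v\<bar> +
        \<bar>v \<bullet> d_y 1 - coord_x v * (q \<bullet> d_y 0) - coord_x q * (v \<bullet> d_y 0)\<bar>"
      unfolding quarter_turn'_def
      by (rule norm_triangle_le, rule add_mono[OF order_trans[OF norm_triangle_ineq4]]) (simp_all add: d)
    ultimately show "norm (quarter_turn' q v) \<le> (3 + 2 * R) * norm v"
      using ip(1)[of v 0] ip(1)[of v 1] ip(2)[of v] by (simp add: algebra_simps)
  qed
  then have "(3 + 2 * R)-lipschitz_on (cball 0 R) (quarter_turn :: real ^ 'n \<Rightarrow> _)"
    using R by (intro bounded_derivative_imp_lipschitz[OF quarter_turn_has_derivative]) auto
  then show ?thesis using lipschitz_on_subset R(2) by blast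
qed

lemma quarter_turn_curve:
  fixes c :: "real \<Rightarrow> real ^ 'n"
  assumes "admissible_curve a b c"
  shows "admissible_curve a b (\<lambda>s. quarter_turn (c s)) \<and> sr_length a b (\<lambda>s. quarter_turn (c s)) = sr_length a b c"
proof -
  obtain L where ab: "a \<le> b" and L: "L-lipschitz_on {a..b} c"
    and ae: "AE s in lebesgue_on {a..b}. c differentiable (at s) \<and> vector_derivative c (at s) \<in> hor (c s)"
    using assms by (auto simp: admissible_curve_def)
  have "bounded (c ` {a..b})"
    using lipschitz_on_continuous_on[OF L] by (intro compact_imp_bounded compact_continuous_image) auto
  then obtain K where "K-lipschitz_on (c ` {a..b}) quarter_turn" using quarter_turn_lipschitz by blast
  then have lip: "\<exists>L. L-lipschitz_on {a..b} (\<lambda>s. quarter_turn (c s))"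
    using lipschitz_on_compose2[OF L] by blast
  have D: "((\<lambda>s. quarter_turn (c s)) has_vector_derivative quarter_turn' (c s) (vector_derivative c (at s))) (at s)"
    if "c differentiable (at s)" for s
    using vector_derivative_diff_chain_within[OF that[unfolded vector_derivative_works] quarter_turn_has_derivative]
    by (simp add: o_def)
  have ae': "(\<lambda>s. quarter_turn (c s)) differentiable (at s) \<and>
      vector_derivative (\<lambda>s. quarter_turn (c s)) (at s) \<in> hor (quarter_turn (c s))"
    if "c differentiable (at s) \<and> vector_derivative c (at s) \<in> hor (c s)" for s
    using D[of s] that quarter_turn_hor(1) by (auto simp: vector_derivative_at differentiable_def has_vector_derivative_def)
  obtain N where N: "negligible N" "\<And>s. s \<in> {a..b} - N \<Longrightarrow> c differentiable (at s) \<and> vector_derivative c (at s) \<in> hor (c s)"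
    by (rule AE_lebesgue_on_negligible[OF ae]) auto
  have "sr_length a b (\<lambda>s. quarter_turn (c s)) = sr_length a b c"
    unfolding sr_length_def
  proof (rule integral_spike[OF N(1)])
    fix s assume "s \<in> {a..b} - N"
    from N(2)[OF this] show "sqrt (sr_metric (c s) (vector_derivative c (at s)) (vector_derivative c (at s))) =
      sqrt (sr_metric (quarter_turn (c s)) (vector_derivative (\<lambda>s. quarter_turn (c s)) (at s)) (vector_derivative (\<lambda>s. quarter_turn (c s)) (at s)))"
      using D[of s] quarter_turn_hor(2) by (simp add: vector_derivative_at)
  qed
  moreover have "AE s in lebesgue_on {a..b}. (\<lambda>s. quarter_turn (c s)) differentiable (at s) \<and>
      vector_derivative (\<lambda>s. quarter_turn (c s)) (at s) \<in> hor (quarter_turn (c s))"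
    using ae by eventually_elim (rule ae')
  ultimately show ?thesis using ab lip by (simp add: admissible_curve_def)
qed

lemma sr_dist_quarter_turn: "sr_dist (quarter_turn p) (quarter_turn q) = sr_dist p (q :: real ^ 'n)"
proof -
  define S where "S p q = {sr_length a b c | a b c. admissible_curve a b c \<and> c a = p \<and> c b = q}" for p q :: "real ^ 'n"
  have sub: "S p q \<subseteq> S (quarter_turn p) (quarter_turn q)" for p q
  proof
    fix l assume "l \<in> S p q"
    then obtain a b c where c: "l = sr_length a b c" "admissible_curve a b c" "c a = p" "c b = q" by (auto simp: S_def)
    have "l = sr_length a b (\<lambda>s. quarter_turn (c s)) \<and> admissible_curve a b (\<lambda>s. quarter_turn (c s)) \<and>
      quarter_turn (c a) = quarter_turn p \<and> quarter_turn (c b) = quarter_turn q"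
      using quarter_turn_curve[OF c(2)] c by simp
    then show "l \<in> S (quarter_turn p) (quarter_turn q)" unfolding S_def by blast
  qed
  have "S (quarter_turn p) (quarter_turn q) \<subseteq> S p q"
    using sub[of "quarter_turn p" "quarter_turn q"] sub[of "quarter_turn (quarter_turn p)" "quarter_turn (quarter_turn q)"]
      sub[of "quarter_turn (quarter_turn (quarter_turn p))" "quarter_turn (quarter_turn (quarter_turn q))"]
    by (simp add: quarter_turn_4)
  then have "S (quarter_turn p) (quarter_turn q) = S p q" using sub by blast
  then show ?thesis by (simp add: sr_dist_def S_def)
qed

lemma geod_cost_dot_quarter_turn:
  fixes \<gamma> :: "real \<Rightarrow> real ^ 'n"
  shows "geod_cost_dot (\<lambda>s. quarter_turn (\<gamma> s)) t (quarter_turn x) = geod_cost_dot \<gamma> t x"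
  by (simp add: geod_cost_dot_def geod_cost_def sr_dist_quarter_turn)

lemma extremal_quarter_turn:
  fixes \<gamma> :: "real \<Rightarrow> real ^ 'n"
  assumes T: "T > 0" and ext: "extremal T \<gamma> p u"
  shows "\<exists>p'. extremal T (\<lambda>s. quarter_turn (\<gamma> s)) p' (\<lambda>t. p \<bullet> jet_vec 0 (coord_x (\<gamma> t))) \<and>
    p' \<bullet> jet_vec 0 (coord_x (quarter_turn (\<gamma> 0))) = - u 0 \<and> (\<forall>\<xi>. p' \<bullet> jet_vec 1 \<xi> = p \<bullet> jet_vec 1 \<xi>)"
proof -
  define h where "h = p \<bullet> d_y 1"
  define w where "w t = p \<bullet> jet_vec 0 (coord_x (\<gamma> t))" for t
  have z: "0 \<in> {0..T}" using T by simp
  have \<gamma>': "(\<gamma> has_vector_derivative u t *\<^sub>R d_x + w t *\<^sub>R jet_vec 0 (coord_x (\<gamma> t))) (at t within {0..T})"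
    and u': "(u has_vector_derivative - (w t * h)) (at t within {0..T})" if "t \<in> {0..T}" for t
    using ext that by (auto simp: extremal_def w_def h_def heisenberg_frame has_real_derivative_iff_has_vector_derivative)
  have "((\<lambda>t. u t + h * (\<gamma> t \<bullet> d_y 0)) has_vector_derivative 0) (at t within {0..T})" if t: "t \<in> {0..T}" for t
  proof -
    have "((\<lambda>t. \<gamma> t \<bullet> d_y 0) has_vector_derivative w t) (at t within {0..T})"
      using bounded_linear.has_vector_derivative[OF bounded_linear_inner_left \<gamma>'[OF t], of "d_y 0"]
      by (simp add: inner_add_left heisenberg_inner heisenberg_frame)
    from has_vector_derivative_add[OF u'[OF t] has_vector_derivative_mult_right[OF this, of h]] show ?thesis by (simp add: mult.commute)
  qed
  then have "\<exists>C. \<forall>t\<in>{0..T}. u t + h * (\<gamma> t \<bullet> d_y 0) = C"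
    by (intro has_derivative_zero_constant) (auto simp: has_vector_derivative_def)
  then obtain C where C: "\<And>t. t \<in> {0..T} \<Longrightarrow> u t + h * (\<gamma> t \<bullet> d_y 0) = C" by blast
  \<comment> \<open>The last momentum h is kept. The first one comes from the conserved quantity C:
    since the turned abscissa is y_0, the pairing with X_2 becomes -C + h y_0 = -u.\<close>
  define p' where "p' = (- C) *\<^sub>R d_y 0 + h *\<^sub>R (d_y 1 :: real ^ 'n)"
  have p'0: "p' \<bullet> jet_vec 0 (coord_x (quarter_turn (\<gamma> t))) = - u t" if "t \<in> {0..T}" for t
    using C[OF that] by (simp add: p'_def heisenberg_frame inner_add_left inner_diff_left inner_add_right heisenberg_inner quarter_turn_coords mult.commute[of h])
  have p'1: "p' \<bullet> jet_vec 1 \<xi> = h" for \<xi>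
    by (simp add: p'_def heisenberg_frame inner_add_left inner_diff_left heisenberg_inner)
  have "extremal T (\<lambda>s. quarter_turn (\<gamma> s)) p' w"
    unfolding extremal_def
  proof (intro ballI conjI)
    fix t assume t: "t \<in> {0..T}"
    have "((\<lambda>s. quarter_turn (\<gamma> s)) has_vector_derivative quarter_turn' (\<gamma> t) (u t *\<^sub>R d_x + w t *\<^sub>R jet_vec 0 (coord_x (\<gamma> t)))) (at t within {0..T})"
      using vector_derivative_diff_chain_within[OF \<gamma>'[OF t] quarter_turn_has_derivative] by (simp add: o_def)
    then show "((\<lambda>s. quarter_turn (\<gamma> s)) has_vector_derivative w t *\<^sub>R d_x +
        (p' \<bullet> jet_vec 0 (coord_x (quarter_turn (\<gamma> t)))) *\<^sub>R jet_vec 0 (coord_x (quarter_turn (\<gamma> t)))) (at t within {0..T})"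
      by (simp only: quarter_turn'_frame p'0[OF t])
    have x': "((\<lambda>t. coord_x (\<gamma> t)) has_real_derivative u t) (at t within {0..T})"
      using coord_x_has_vector_derivative[OF \<gamma>'[OF t]] n3 by (simp add: has_real_derivative_iff_has_vector_derivative)
    have "(w has_real_derivative h * u t) (at t within {0..T})"
      using DERIV_image_chain[OF inner_jet_vec_has_derivative x', of p 0]
      by (simp add: w_def[abs_def] o_def h_def heisenberg_frame)
    then show "(w has_real_derivative - ((p' \<bullet> jet_vec 0 (coord_x (quarter_turn (\<gamma> t)))) * (p' \<bullet> jet_vec 1 (coord_x (quarter_turn (\<gamma> t))))))
        (at t within {0..T})"
      by (simp add: p'0[OF t] p'1[unfolded One_nat_def] mult.commute)
  qed
  then show ?thesis
    using p'0[OF z] p'1 unfolding w_def by (intro exI[of _ p']) (simp add: h_def heisenberg_frame)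
qed

text \<open>The representation by E is transported by composition and needs only the first
  derivative of the isometry, whereas transporting a second differential directly would involve its
  second derivative.\<close>

lemma cost_expansion_at_quarter_turn:
  fixes \<gamma> :: "real \<Rightarrow> real ^ 'n"
  assumes "cost_expansion_at (\<lambda>s. quarter_turn (\<gamma> s)) t h2 (- h1) F"
  shows "cost_expansion_at \<gamma> t h1 h2 F"
proof -
  let ?q = "\<gamma> 0"
  obtain E :: "real ^ 'n \<Rightarrow> real \<times> real" and E' S K where H: "open S \<and> quarter_turn ?q \<in> S \<and> E (quarter_turn ?q) = 0 \<and>
      (\<forall>x\<in>S. geod_cost_dot (\<lambda>s. quarter_turn (\<gamma> s)) t x = 1 / 2 * (E x \<bullet> E x) - K) \<and>
      (\<forall>x\<in>S. (E has_derivative E' x) (at x)) \<and>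
      (\<forall>v. ((\<lambda>x. E' x v) \<longlongrightarrow> E' (quarter_turn ?q) v) (at (quarter_turn ?q))) \<and>
      (\<forall>v1 v2. E' (quarter_turn ?q) (v1 *\<^sub>R d_x + v2 *\<^sub>R jet_vec 0 (coord_x (quarter_turn ?q))) \<bullet>
        E' (quarter_turn ?q) (v1 *\<^sub>R d_x + v2 *\<^sub>R jet_vec 0 (coord_x (quarter_turn ?q))) =
          ((v1 * h2 + v2 * - h1)\<^sup>2 + F * (v2 * h2 - v1 * - h1)\<^sup>2) / ((h2\<^sup>2 + (- h1)\<^sup>2) * t\<^sup>2))"
    using assms unfolding cost_expansion_at_def Let_def by (elim exE) (rule that)
  then have S: "open S" "quarter_turn ?q \<in> S" "E (quarter_turn ?q) = 0"
    and C: "\<And>x. x \<in> S \<Longrightarrow> geod_cost_dot (\<lambda>s. quarter_turn (\<gamma> s)) t x = 1 / 2 * (E x \<bullet> E x) - K"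
    and E': "\<And>x. x \<in> S \<Longrightarrow> (E has_derivative E' x) (at x)"
    and lim: "\<And>v. ((\<lambda>x. E' x v) \<longlongrightarrow> E' (quarter_turn ?q) v) (at (quarter_turn ?q))"
    by (elim conjE, blast)+
  have Q: "E' (quarter_turn ?q) (v1 *\<^sub>R d_x + v2 *\<^sub>R jet_vec 0 (coord_x (quarter_turn ?q))) \<bullet>
        E' (quarter_turn ?q) (v1 *\<^sub>R d_x + v2 *\<^sub>R jet_vec 0 (coord_x (quarter_turn ?q))) =
          ((v1 * h2 + v2 * - h1)\<^sup>2 + F * (v2 * h2 - v1 * - h1)\<^sup>2) / ((h2\<^sup>2 + (- h1)\<^sup>2) * t\<^sup>2)" for v1 v2
    using H by (elim conjE) (drule spec, erule spec)
  have cont: "continuous_on UNIV (quarter_turn :: real ^ 'n \<Rightarrow> _)"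
    using quarter_turn_has_derivative by (rule has_derivative_continuous_on)
  define S' where "S' = quarter_turn -` S"
  have S': "open S'" "?q \<in> S'"
    unfolding S'_def using S continuous_open_preimage[OF cont] by (auto simp: vimage_def)
  define G where "G x v = E' (quarter_turn x) (quarter_turn' x v)" for x v
  have G: "((\<lambda>x. E (quarter_turn x)) has_derivative G x) (at x)" if "x \<in> S'" for x
    using has_derivative_compose[OF quarter_turn_has_derivative E'] that by (simp add: G_def[abs_def] S'_def)
  have inj: "quarter_turn x \<noteq> quarter_turn ?q" if "x \<noteq> ?q" for x
    using that quarter_turn_4 by metis
  have tends: "(quarter_turn \<longlongrightarrow> quarter_turn ?q) (at ?q)"
    using cont by (simp add: continuous_on_def)
  have flt: "filterlim quarter_turn (at (quarter_turn ?q)) (at ?q)"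
    unfolding filterlim_at using tends inj by (auto simp: eventually_at_filter)
  \<comment> \<open>The limits of \<open>E'\<close> are known for fixed directions only, while the
    turned direction moves with x; hence the expansion in the basis.\<close>
  have Gsum: "G x v = (\<Sum>b\<in>Basis. (quarter_turn' x v \<bullet> b) *\<^sub>R E' (quarter_turn x) b)" if "x \<in> S'" for x v
  proof -
    interpret linear "E' (quarter_turn x)"
      using E'[of "quarter_turn x"] that by (intro has_derivative_linear) (auto simp: S'_def)
    have "G x v = E' (quarter_turn x) (\<Sum>b\<in>Basis. (quarter_turn' x v \<bullet> b) *\<^sub>R b)"
      by (simp only: euclidean_representation G_def)
    then show ?thesis by (simp only: sum scaleR)
  qed
  have "((\<lambda>x. G x v) \<longlongrightarrow> G ?q v) (at ?q)" for v
  proof -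
    have "((\<lambda>x. quarter_turn' x v) \<longlongrightarrow> quarter_turn' ?q v) (at ?q)"
      unfolding quarter_turn'_def by (intro tendsto_intros)
    then have "((\<lambda>x. \<Sum>b\<in>Basis. (quarter_turn' x v \<bullet> b) *\<^sub>R E' (quarter_turn x) b) \<longlongrightarrow>
        (\<Sum>b\<in>Basis. (quarter_turn' ?q v \<bullet> b) *\<^sub>R E' (quarter_turn ?q) b)) (at ?q)"
      by (intro tendsto_intros filterlim_compose[OF lim flt])
    then have "((\<lambda>x. \<Sum>b\<in>Basis. (quarter_turn' x v \<bullet> b) *\<^sub>R E' (quarter_turn x) b) \<longlongrightarrow> G ?q v) (at ?q)"
      by (simp only: Gsum[OF S'(2)])
    then show ?thesis
      by (rule tendsto_cong[THEN iffD1, rotated])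
        (use eventually_at_in_open'[OF S'] in eventually_elim, simp add: Gsum)
  qed
  moreover have "G ?q (v1 *\<^sub>R d_x + v2 *\<^sub>R jet_vec 0 (coord_x ?q)) \<bullet> G ?q (v1 *\<^sub>R d_x + v2 *\<^sub>R jet_vec 0 (coord_x ?q)) =
      ((v1 * h1 + v2 * h2)\<^sup>2 + F * (v2 * h1 - v1 * h2)\<^sup>2) / ((h1\<^sup>2 + h2\<^sup>2) * t\<^sup>2)" for v1 v2
    unfolding G_def quarter_turn'_frame Q
    by (simp add: power2_commute[of "v2 * h1"] algebra_simps)
  moreover have "geod_cost_dot \<gamma> t x = 1 / 2 * (E (quarter_turn x) \<bullet> E (quarter_turn x)) - K" if "x \<in> S'" for x
    using C[of "quarter_turn x"] that by (simp add: S'_def geod_cost_dot_quarter_turn)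
  ultimately show ?thesis
    unfolding cost_expansion_at_def Let_def using S' S(3) G
    by (intro exI[of _ "\<lambda>x. E (quarter_turn x)"] exI[of _ G] exI[of _ S'] exI[of _ K]) simp
qed

end

proposition ample_equiregular_cost_expansion:
  fixes \<gamma> :: "real \<Rightarrow> real ^ 'n::finite"
  assumes n: "CARD('n) \<ge> 3" and T: "T > 0" and ext: "extremal T \<gamma> p u"
    and ample: "ample T \<gamma>" and equi: "equiregular T \<gamma>"
  defines "N \<equiv> real CARD('n) - 1" and "h2 \<equiv> p \<bullet> jet_vec 0 (coord_x (\<gamma> 0))"
  shows "u 0 \<noteq> 0 \<or> h2 \<noteq> 0"
    and "\<exists>\<epsilon> F. \<epsilon> > 0 \<and> Cn 3 {0..\<epsilon>} F \<and>
    jet2 F (N\<^sup>2) 0 (N / (4 * N\<^sup>2 - 1) * curvature_form (real CARD('n)) (u 0) h2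
      (p \<bullet> jet_vec 1 (coord_x (\<gamma> 0))) (p \<bullet> jet_vec 2 (coord_x (\<gamma> 0)))) \<and>
    (\<forall>t\<in>{0<..<\<epsilon>}. cost_expansion_at \<gamma> t (u 0) h2 (F t))"
proof -
  note vel = ample_equiregular_velocity[OF n T ext ample equi]
  show ne: "u 0 \<noteq> 0 \<or> h2 \<noteq> 0" using vel(2) by (simp add: h2_def)
  show "\<exists>\<epsilon> F. \<epsilon> > 0 \<and> Cn 3 {0..\<epsilon>} F \<and>
    jet2 F (N\<^sup>2) 0 (N / (4 * N\<^sup>2 - 1) * curvature_form (real CARD('n)) (u 0) h2
      (p \<bullet> jet_vec 1 (coord_x (\<gamma> 0))) (p \<bullet> jet_vec 2 (coord_x (\<gamma> 0)))) \<and>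
    (\<forall>t\<in>{0<..<\<epsilon>}. cost_expansion_at \<gamma> t (u 0) h2 (F t))"
  proof (cases "u 0 = 0")
    case False
    from extremal_cost_expansion[OF n T ext False] show ?thesis unfolding N_def h2_def .
  next
    case True
    then have n3: "CARD('n) = 3" using vel(1) n by linarith
    have h2: "h2 \<noteq> 0" using True ne by simp
    obtain p' where ext': "extremal T (\<lambda>s. quarter_turn (\<gamma> s)) p' (\<lambda>t. p \<bullet> jet_vec 0 (coord_x (\<gamma> t)))"
      and p': "p' \<bullet> jet_vec 0 (coord_x (quarter_turn (\<gamma> 0))) = - u 0" "\<And>\<xi>. p' \<bullet> jet_vec 1 \<xi> = p \<bullet> jet_vec 1 \<xi>"
      using extremal_quarter_turn[OF n3 T ext] by blast
    have two: "q \<bullet> jet_vec 2 \<xi> = 0" for q :: "real ^ 'n" and \<xi> by (simp add: heisenberg_frame[OF n3])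
    have one: "p \<bullet> jet_vec 1 \<xi> = p \<bullet> d_y 1" for \<xi> by (simp add: heisenberg_frame[OF n3])
    \<comment> \<open>For n = 3 the term with the quotient h_2^2 / h_1^2 carries the factor n - 3 =
      0 and h_4 is 0, so the value depends on h_3 alone, on either side of the turn.\<close>
    have curv: "curvature_form (real CARD('n)) h2 (- u 0) h3 0 = curvature_form (real CARD('n)) (u 0) h2 h3 0" for h3
      using True n3 by (simp add: curvature_form_def)
    from extremal_cost_expansion[OF n T ext' h2[unfolded h2_def]]
    obtain \<epsilon> F where \<epsilon>: "\<epsilon> > 0" "Cn 3 {0..\<epsilon>} F"
      and J: "jet2 F (N\<^sup>2) 0 (N / (4 * N\<^sup>2 - 1) * curvature_form (real CARD('n)) h2 (- u 0) (p \<bullet> d_y 1) 0)"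
      and C: "\<And>t. t \<in> {0<..<\<epsilon>} \<Longrightarrow> cost_expansion_at (\<lambda>s. quarter_turn (\<gamma> s)) t h2 (- u 0) (F t)"
      unfolding p' two one N_def[symmetric] h2_def[symmetric] by blast
    show ?thesis
      using \<epsilon> J[unfolded curv] cost_expansion_at_quarter_turn[OF n3 C] unfolding two one by blast
  qed
qed

section \<open>The second differential of the cost\<close>

text \<open>A product rule in which the second factor merely has a limit: because E vanishes at x,
  the variation of G is multiplied by something of first order and disappears from the linear
  part.\<close>

lemma has_derivative_inner_zero:
  fixes E G :: "'a::real_normed_vector \<Rightarrow> 'b::real_inner"
  assumes E: "(E has_derivative E') (at x)" "E x = 0" and G: "(G \<longlongrightarrow> L) (at x)"
  shows "((\<lambda>y. E y \<bullet> G y) has_derivative (\<lambda>h. E' h \<bullet> L)) (at x)"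
  unfolding has_derivative_at_within
proof
  have bl: "bounded_linear E'" and lim: "((\<lambda>y. (E y - E' (y - x)) /\<^sub>R norm (y - x)) \<longlongrightarrow> 0) (at x)"
    using E by (simp_all add: has_derivative_at_within)
  show "bounded_linear (\<lambda>h. E' h \<bullet> L)"
    using bl by (rule bounded_linear_inner_left_comp)
  obtain K where K: "\<And>h. norm (E' h) \<le> norm h * K" using bounded_linear.bounded[OF bl] by blast
  have 1: "((\<lambda>y. ((E y - E' (y - x)) /\<^sub>R norm (y - x)) \<bullet> G y) \<longlongrightarrow> 0) (at x)"
    using tendsto_inner[OF lim G] by simp
  have 2: "((\<lambda>y. (E' (y - x) /\<^sub>R norm (y - x)) \<bullet> (G y - L)) \<longlongrightarrow> 0) (at x)"
  proof (rule Lim_null_comparison)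
    show "\<forall>\<^sub>F y in at x. norm ((E' (y - x) /\<^sub>R norm (y - x)) \<bullet> (G y - L)) \<le> K * norm (G y - L)"
    proof (rule eventually_at_filter[THEN iffD2], rule always_eventually, intro allI impI)
      fix y assume y: "y \<noteq> x"
      have "norm (E' (y - x) /\<^sub>R norm (y - x)) = norm (E' (y - x)) / norm (y - x)" by (simp add: divide_inverse_commute)
      also have "\<dots> \<le> K" using y K[of "y - x"] by (simp add: pos_divide_le_eq mult.commute)
      finally have "norm (E' (y - x) /\<^sub>R norm (y - x)) * norm (G y - L) \<le> K * norm (G y - L)"
        by (rule mult_right_mono) simp
      then show "norm ((E' (y - x) /\<^sub>R norm (y - x)) \<bullet> (G y - L)) \<le> K * norm (G y - L)"
        using Cauchy_Schwarz_ineq2[of "E' (y - x) /\<^sub>R norm (y - x)" "G y - L"] unfolding real_norm_def by linarith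
    qed
    show "((\<lambda>y. K * norm (G y - L)) \<longlongrightarrow> 0) (at x)"
      using tendsto_mult_right_zero[OF tendsto_norm_zero[OF LIM_zero[OF G]], of K] .
  qed
  have "((\<lambda>y. ((E y - E' (y - x)) /\<^sub>R norm (y - x)) \<bullet> G y + (E' (y - x) /\<^sub>R norm (y - x)) \<bullet> (G y - L)) \<longlongrightarrow> 0) (at x)"
    using tendsto_add[OF 1 2] by simp
  moreover have "((E y - E' (y - x)) /\<^sub>R norm (y - x)) \<bullet> G y + (E' (y - x) /\<^sub>R norm (y - x)) \<bullet> (G y - L) =
      (E y \<bullet> G y - E x \<bullet> G x - E' (y - x) \<bullet> L) /\<^sub>R norm (y - x)" for y
    by (simp add: E(2) inner_diff_left inner_diff_right right_diff_distrib)
  ultimately show "((\<lambda>y. (E y \<bullet> G y - E x \<bullet> G x - E' (y - x) \<bullet> L) /\<^sub>R norm (y - x)) \<longlongrightarrow> 0) (at x)"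
    by (simp only:)
qed

lemma second_diff_cost:
  fixes \<gamma> :: "real \<Rightarrow> real ^ 'n::finite"
  assumes "cost_expansion_at \<gamma> t h1 h2 F"
  shows "second_diff (geod_cost_dot \<gamma> t) (\<gamma> 0) (v1 *\<^sub>R d_x + v2 *\<^sub>R jet_vec 0 (coord_x (\<gamma> 0))) =
    ((v1 * h1 + v2 * h2)\<^sup>2 + F * (v2 * h1 - v1 * h2)\<^sup>2) / ((h1\<^sup>2 + h2\<^sup>2) * t\<^sup>2)"
proof -
  define v where "v = v1 *\<^sub>R d_x + v2 *\<^sub>R (jet_vec 0 (coord_x (\<gamma> 0)) :: real ^ 'n)"
  obtain E :: "real ^ 'n \<Rightarrow> real \<times> real" and E' S K where H: "open S \<and> \<gamma> 0 \<in> S \<and> E (\<gamma> 0) = 0 \<and>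
      (\<forall>x\<in>S. geod_cost_dot \<gamma> t x = 1 / 2 * (E x \<bullet> E x) - K) \<and>
      (\<forall>x\<in>S. (E has_derivative E' x) (at x)) \<and>
      (\<forall>v. ((\<lambda>x. E' x v) \<longlongrightarrow> E' (\<gamma> 0) v) (at (\<gamma> 0))) \<and>
      (\<forall>v1 v2. E' (\<gamma> 0) (v1 *\<^sub>R d_x + v2 *\<^sub>R jet_vec 0 (coord_x (\<gamma> 0))) \<bullet> E' (\<gamma> 0) (v1 *\<^sub>R d_x + v2 *\<^sub>R jet_vec 0 (coord_x (\<gamma> 0))) =
          ((v1 * h1 + v2 * h2)\<^sup>2 + F * (v2 * h1 - v1 * h2)\<^sup>2) / ((h1\<^sup>2 + h2\<^sup>2) * t\<^sup>2))"
    using assms unfolding cost_expansion_at_def Let_def by (elim exE) (rule that)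
  then have S: "open S" "\<gamma> 0 \<in> S" "E (\<gamma> 0) = 0"
    and C: "\<And>x. x \<in> S \<Longrightarrow> geod_cost_dot \<gamma> t x = 1 / 2 * (E x \<bullet> E x) - K"
    and E': "\<And>x. x \<in> S \<Longrightarrow> (E has_derivative E' x) (at x)"
    and lim: "\<And>v. ((\<lambda>x. E' x v) \<longlongrightarrow> E' (\<gamma> 0) v) (at (\<gamma> 0))"
    by (elim conjE, blast)+
  have Q: "E' (\<gamma> 0) v \<bullet> E' (\<gamma> 0) v = ((v1 * h1 + v2 * h2)\<^sup>2 + F * (v2 * h1 - v1 * h2)\<^sup>2) / ((h1\<^sup>2 + h2\<^sup>2) * t\<^sup>2)"
    unfolding v_def using H by (elim conjE) (drule spec, erule spec)
  have D: "frechet_derivative (geod_cost_dot \<gamma> t) (at y) w = E y \<bullet> E' y w" if y: "y \<in> S" for y w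
  proof -
    have "((\<lambda>x. 1 / 2 * (E x \<bullet> E x) - K) has_derivative (\<lambda>h. 1 / 2 * (E y \<bullet> E' y h + E' y h \<bullet> E y) - 0)) (at y)"
      by (intro has_derivative_diff has_derivative_mult_right has_derivative_inner E'[OF y] has_derivative_const)
    then have "(geod_cost_dot \<gamma> t has_derivative (\<lambda>h. 1 / 2 * (E y \<bullet> E' y h + E' y h \<bullet> E y) - 0)) (at y)"
      by (rule has_derivative_transform_within_open[OF _ S(1) y]) (simp add: C)
    from frechet_derivative_at[OF this, symmetric] show ?thesis by (simp add: inner_commute[of "E' y _"])
  qed
  have "((\<lambda>y. E y \<bullet> E' y v) has_derivative (\<lambda>h. E' (\<gamma> 0) h \<bullet> E' (\<gamma> 0) v)) (at (\<gamma> 0))"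
    by (rule has_derivative_inner_zero[OF E'[OF S(2)] S(3) lim])
  then have "((\<lambda>y. frechet_derivative (geod_cost_dot \<gamma> t) (at y) v) has_derivative (\<lambda>h. E' (\<gamma> 0) h \<bullet> E' (\<gamma> 0) v)) (at (\<gamma> 0))"
    by (rule has_derivative_transform_within_open[OF _ S(1,2)]) (simp add: D)
  from frechet_derivative_at[OF this, symmetric] show ?thesis
    unfolding second_diff_def v_def[symmetric] by (simp add: Q)
qed

section \<open>Symmetric operators in an orthonormal basis\<close>

context
  fixes x :: "real ^ 'n::finite" and e :: "2 \<Rightarrow> real ^ 'n"
  assumes n: "CARD('n) \<ge> 2" and e: "hor_orthonormal_basis x e"
begin

lemma basis_hor: "a *\<^sub>R e 1 + b *\<^sub>R e 2 \<in> hor x"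
proof -
  have "range e \<subseteq> hor x" using e by (simp add: hor_orthonormal_basis_def)
  then show ?thesis unfolding hor_def by (intro subspace_add subspace_scale subspace_span) (auto simp: hor_def)
qed

lemma basis_hor_cases: "v \<in> hor x \<Longrightarrow> \<exists>a b. v = a *\<^sub>R e 1 + b *\<^sub>R e 2"
proof -
  assume "v \<in> hor x"
  moreover have "range e = {e 1, e 2}" by (auto simp: UNIV_2)
  ultimately have "v \<in> span {e 1, e 2}" using e by (simp add: hor_orthonormal_basis_def)
  then show ?thesis
    unfolding span_insert span_empty by (auto simp: algebra_simps)
qed

lemma basis_metric:
  "sr_metric x (a *\<^sub>R e 1 + b *\<^sub>R e 2) (a' *\<^sub>R e 1 + b' *\<^sub>R e 2) = a * a' + b * b'"
proof -
  have h: "e i \<in> hor x" and o: "sr_metric x (e i) (e j) = (if i = j then 1 else 0)" for i j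
    using e by (auto simp: hor_orthonormal_basis_def)
  have "sr_metric x (a *\<^sub>R e 1 + b *\<^sub>R e 2) (a' *\<^sub>R e 1 + b' *\<^sub>R e 2) =
    a * a' * sr_metric x (e 1) (e 1) + (a * b' + b * a') * sr_metric x (e 1) (e 2) + b * b' * sr_metric x (e 2) (e 2)"
    unfolding sr_metric_eq[OF n basis_hor basis_hor] sr_metric_eq[OF n h h]
    by (simp add: inner_add_left algebra_simps)
  then show ?thesis by (simp add: o)
qed

text \<open>Polarization singles out the operator: symmetry equates the off-diagonal entries, and
  the values of the form at e 1, e 2 and e 1 + e 2 then determine all entries.\<close>

lemma hor_operator_of_form:
  assumes q: "\<And>a b. q (a *\<^sub>R e 1 + b *\<^sub>R e 2) = \<alpha> * a\<^sup>2 + \<beta> * b\<^sup>2"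
  defines "A \<equiv> THE A. hor_operator x A \<and> hor_symmetric x A \<and> (\<forall>v\<in>hor x. q v = sr_metric x (A v) v)"
  shows "A (a *\<^sub>R e 1 + b *\<^sub>R e 2) = (\<alpha> * a) *\<^sub>R e 1 + (\<beta> * b) *\<^sub>R e 2"
proof -
  define M where "M v = (if v \<in> hor x then (\<alpha> * sr_metric x v (e 1)) *\<^sub>R e 1 + (\<beta> * sr_metric x v (e 2)) *\<^sub>R e 2 else 0)" for v
  have M: "M (a *\<^sub>R e 1 + b *\<^sub>R e 2) = (\<alpha> * a) *\<^sub>R e 1 + (\<beta> * b) *\<^sub>R e 2" for a b
    using basis_hor[of a b] basis_metric[of a b 1 0] basis_metric[of a b 0 1] by (simp add: M_def)
  have add: "(a *\<^sub>R e 1 + b *\<^sub>R e 2) + (a' *\<^sub>R e 1 + b' *\<^sub>R e 2) = (a + a') *\<^sub>R e 1 + (b + b') *\<^sub>R e 2"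
    and scale: "c *\<^sub>R (a *\<^sub>R e 1 + b *\<^sub>R e 2) = (c * a) *\<^sub>R e 1 + (c * b) *\<^sub>R e 2" for a b a' b' c
    by (simp_all add: algebra_simps)
  have "hor_operator x M"
    unfolding hor_operator_def
  proof (intro conjI ballI allI impI)
    fix v w c assume "v \<in> hor x" "w \<in> hor x"
    then obtain a b a' b' where v: "v = a *\<^sub>R e 1 + b *\<^sub>R e 2" "w = a' *\<^sub>R e 1 + b' *\<^sub>R e 2" using basis_hor_cases by blast
    show "M (v + w) = M v + M w" unfolding v add M by (simp add: distrib_left)
  next
    fix v c assume "v \<in> hor x"
    then obtain a b where v: "v = a *\<^sub>R e 1 + b *\<^sub>R e 2" using basis_hor_cases by blast
    show "M v \<in> hor x" unfolding v M by (rule basis_hor)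
    show "M (c *\<^sub>R v) = c *\<^sub>R M v" unfolding v scale M by (simp add: mult.left_commute)
  qed (simp add: M_def)
  moreover have "hor_symmetric x M"
    unfolding hor_symmetric_def
  proof (intro ballI)
    fix v w assume "v \<in> hor x" "w \<in> hor x"
    then obtain a b a' b' where v: "v = a *\<^sub>R e 1 + b *\<^sub>R e 2" "w = a' *\<^sub>R e 1 + b' *\<^sub>R e 2" using basis_hor_cases by blast
    show "sr_metric x (M v) w = sr_metric x v (M w)" unfolding v M basis_metric by simp
  qed
  moreover have "q v = sr_metric x (M v) v" if hv: "v \<in> hor x" for v
  proof -
    obtain a b where v: "v = a *\<^sub>R e 1 + b *\<^sub>R e 2" using basis_hor_cases[OF hv] by blast
    show ?thesis unfolding v q M basis_metric by (simp add: power2_eq_square)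
  qed
  moreover have "B = M" if B: "hor_operator x B \<and> hor_symmetric x B \<and> (\<forall>v\<in>hor x. q v = sr_metric x (B v) v)" for B
  proof
    fix v
    have Bo: "\<And>v. v \<in> hor x \<Longrightarrow> B v \<in> hor x" "\<And>v. v \<notin> hor x \<Longrightarrow> B v = 0"
        "\<And>v w. v \<in> hor x \<Longrightarrow> w \<in> hor x \<Longrightarrow> B (v + w) = B v + B w" "\<And>c v. v \<in> hor x \<Longrightarrow> B (c *\<^sub>R v) = c *\<^sub>R B v"
      and Bs: "\<And>v w. v \<in> hor x \<Longrightarrow> w \<in> hor x \<Longrightarrow> sr_metric x (B v) w = sr_metric x v (B w)"
      and Bq: "\<And>v. v \<in> hor x \<Longrightarrow> q v = sr_metric x (B v) v"
      using B unfolding hor_operator_def hor_symmetric_def by blast+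
    show "B v = M v"
    proof (cases "v \<in> hor x")
      case False
      then show ?thesis using Bo(2) by (simp add: M_def)
    next
      case True
      then obtain a b where v: "v = a *\<^sub>R e 1 + b *\<^sub>R e 2" using basis_hor_cases by blast
      have e1: "e 1 \<in> hor x" and e2: "e 2 \<in> hor x" using basis_hor[of 1 0] basis_hor[of 0 1] by simp_all
      then have "B (e 1) \<in> hor x" "B (e 2) \<in> hor x" using Bo(1) by blast+
      then obtain a1 b1 a2 b2 where Be: "B (e 1) = a1 *\<^sub>R e 1 + b1 *\<^sub>R e 2" "B (e 2) = a2 *\<^sub>R e 1 + b2 *\<^sub>R e 2"
        using basis_hor_cases by blast
      have lin: "B (a *\<^sub>R e 1 + b *\<^sub>R e 2) = (a * a1 + b * a2) *\<^sub>R e 1 + (a * b1 + b * b2) *\<^sub>R e 2" for a b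
      proof -
        have "a *\<^sub>R e 1 \<in> hor x" "b *\<^sub>R e 2 \<in> hor x" using basis_hor[of a 0] basis_hor[of 0 b] by simp_all
        then have "B (a *\<^sub>R e 1 + b *\<^sub>R e 2) = a *\<^sub>R B (e 1) + b *\<^sub>R B (e 2)"
          using Bo(3)[of "a *\<^sub>R e 1" "b *\<^sub>R e 2"] Bo(4)[OF e1] Bo(4)[OF e2] by (simp only:)
        then show ?thesis by (simp add: Be algebra_simps)
      qed
      have form: "\<alpha> * a\<^sup>2 + \<beta> * b\<^sup>2 = (a * a1 + b * a2) * a + (a * b1 + b * b2) * b" for a b
        using Bq[OF basis_hor, of a b] by (simp only: q lin basis_metric)
      have "sr_metric x (B (e 1)) (e 2) = sr_metric x (e 1) (B (e 2))"
        by (rule Bs[OF e1 e2])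
      then have "b1 = a2"
        using basis_metric[of a1 b1 0 1] basis_metric[of 1 0 a2 b2] by (simp add: Be)
      moreover have "a1 = \<alpha>" "b2 = \<beta>" using form[of 1 0] form[of 0 1] by simp_all
      moreover have "\<alpha> + \<beta> = a1 + a2 + (b1 + b2)" using form[of 1 1] by simp
      ultimately have "a1 = \<alpha>" "b2 = \<beta>" "a2 = 0" "b1 = 0" by linarith+
      then show ?thesis unfolding v lin M by (simp add: mult.commute)
    qed
  qed
  ultimately have "A = M" unfolding A_def by (intro the_equality conjI ballI) blast+
  then show ?thesis using M by simp
qed

lemma op_matrix_diagonal:
  assumes "A (e 1) = \<alpha> *\<^sub>R e 1" "A (e 2) = \<beta> *\<^sub>R e 2"
  shows "op_matrix x e A = vector [vector [\<alpha>, 0], vector [0, \<beta>]]"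
  using basis_metric[of \<alpha> 0 1 0] basis_metric[of \<alpha> 0 0 1] basis_metric[of 0 \<beta> 1 0] basis_metric[of 0 \<beta> 0 1]
  by (simp add: op_matrix_def vec_eq_iff forall_2 assms)

end

text \<open>On a fixed eigenvector both operators reduce to the scalar F, and the factor of the
  curvature is 3/2 times F''(0) = 2 c.\<close>

lemma I_op_R_op_eigenvector:
  assumes d: "\<delta> > 0" and Q: "\<And>t. t \<in> {0<..<\<delta>} \<Longrightarrow> Q_op \<gamma> t v = (F t / t\<^sup>2) *\<^sub>R v"
    and F: "Cn 3 {0..\<delta>} F" "jet2 F a b c"
  shows "I_op \<gamma> v = a *\<^sub>R v" and "R_op \<gamma> v = (3 * c) *\<^sub>R v"
proof -
  obtain F' where F0: "F 0 = a" and F': "\<And>t. t \<in> {0..\<delta>} \<Longrightarrow> (F has_real_derivative F' t) (at t within {0..\<delta>})"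
    and F'': "(F' has_real_derivative 2 * c) (at 0 within {0..\<delta>})"
    using jet2_Cn3_derivs[OF d F] by blast
  have eq: "t\<^sup>2 *\<^sub>R Q_op \<gamma> t v = F t *\<^sub>R v" if "t \<in> {0<..<\<delta>}" for t
    using that by (simp add: Q)
  have ev: "\<forall>\<^sub>F t in at_right 0. t\<^sup>2 *\<^sub>R Q_op \<gamma> t v = F t *\<^sub>R v"
    unfolding eventually_at_right_field using eq d by auto
  have "(F \<longlongrightarrow> F 0) (at 0 within {0..\<delta>})"
    using Cn_continuous_on[OF F(1)] d by (auto simp: continuous_on_def)
  then have "(F \<longlongrightarrow> a) (at_right 0)"
    using d F0 by (simp add: at_within_Icc_at_right)
  then have "((\<lambda>t. F t *\<^sub>R v) \<longlongrightarrow> a *\<^sub>R v) (at_right 0)" by (intro tendsto_intros)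
  then have "((\<lambda>t. t\<^sup>2 *\<^sub>R Q_op \<gamma> t v) \<longlongrightarrow> a *\<^sub>R v) (at_right 0)"
    by (rule tendsto_cong[THEN iffD2, OF ev])
  then show I: "I_op \<gamma> v = a *\<^sub>R v"
    unfolding I_op_def by (intro tendsto_Lim) auto
  have tQ: "tQ_ext \<gamma> v t = F t *\<^sub>R v" if "t \<in> {0..<\<delta>}" for t
    using that eq by (cases "t = 0") (auto simp: tQ_ext_def I F0)
  \<comment> \<open>Derivatives in \<open>R_op\<close> are taken within [0, \<infinity>), while F is
    controlled on [0, \<delta>] only; at times below \<delta> the two notions agree.\<close>
  have W: "at t within {0..} = at t within {0..\<delta>}" if "t \<in> {0..<\<delta>}" for t :: real
    by (rule at_within_nhd[of t "{..<\<delta>}"]) (use that in auto)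
  have "vector_derivative (tQ_ext \<gamma> v) (at t within {0..}) = F' t *\<^sub>R v" if t: "t \<in> {0..<\<delta>}" for t
  proof -
    have "((\<lambda>t. F t *\<^sub>R v) has_vector_derivative F' t *\<^sub>R v) (at t within {0..\<delta>})"
      using has_vector_derivative_scaleR[OF F' has_vector_derivative_const, of t v] t by simp
    then have "(tQ_ext \<gamma> v has_vector_derivative F' t *\<^sub>R v) (at t within {0..\<delta>})"
      by (rule has_vector_derivative_transform_within[where d="\<delta> - t"]) (use t tQ in \<open>auto simp: dist_real_def\<close>)
    then show ?thesis
      unfolding W[OF t] using t d by (intro vector_derivative_within_closed_interval) auto
  qed
  note tQ' = this
  have "((\<lambda>t. F' t *\<^sub>R v) has_vector_derivative (2 * c) *\<^sub>R v) (at 0 within {0..\<delta>})"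
    using has_vector_derivative_scaleR[OF F'' has_vector_derivative_const, of v] by simp
  then have "((\<lambda>t. vector_derivative (tQ_ext \<gamma> v) (at t within {0..})) has_vector_derivative (2 * c) *\<^sub>R v) (at 0 within {0..\<delta>})"
    by (rule has_vector_derivative_transform_within[where d=\<delta>]) (use d tQ' in \<open>auto simp: dist_real_def\<close>)
  then have "vector_derivative (\<lambda>t. vector_derivative (tQ_ext \<gamma> v) (at t within {0..})) (at 0 within {0..}) = (2 * c) *\<^sub>R v"
    using d W[of 0] by (simp add: vector_derivative_within_closed_interval)
  then show "R_op \<gamma> v = (3 * c) *\<^sub>R v" by (simp add: R_op_def)
qed

text \<open>With (h_1, h_2) the initial velocity, \<open>1\<close> indexes the unit normal and the
  other index the unit tangent, in the order in which the theorem lists the eigenvalues.\<close>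

lemma hor_orthonormal_basis_rotation:
  fixes x :: "real ^ 'n::finite"
  assumes n: "CARD('n) \<ge> 2" and c: "c > 0" "c\<^sup>2 = h1\<^sup>2 + h2\<^sup>2"
  defines "Y \<equiv> jet_vec 0 (coord_x x)"
  shows "hor_orthonormal_basis x (\<lambda>i. if i = 1 then (- h2 / c) *\<^sub>R d_x + (h1 / c) *\<^sub>R Y else (h1 / c) *\<^sub>R d_x + (h2 / c) *\<^sub>R Y)"
    (is "hor_orthonormal_basis x ?e")
proof -
  have cc: "h1 * h1 + h2 * h2 = c * c" using c by (simp add: power2_eq_square)
  have "a *\<^sub>R d_x + b *\<^sub>R Y \<in> hor x" for a b unfolding Y_def by (rule horI)
  then have sub: "range ?e \<subseteq> hor x" by (simp only: image_subset_iff split: if_split) blast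
  have "d_x \<in> span (range ?e)" "Y \<in> span (range ?e)"
  proof -
    have "?e 1 \<in> span (range ?e)" "?e 2 \<in> span (range ?e)" by (intro span_base rangeI)+
    then have m: "a *\<^sub>R ?e 1 + b *\<^sub>R ?e 2 \<in> span (range ?e)" for a b by (intro span_add span_scale)
    have "(- h2 / c) *\<^sub>R ?e 1 + (h1 / c) *\<^sub>R ?e 2 = ((h1 * h1 + h2 * h2) / (c * c)) *\<^sub>R d_x"
      by (simp add: algebra_simps add_divide_distrib)
    then show "d_x \<in> span (range ?e)" using m[of "- h2 / c" "h1 / c"] c(1) unfolding cc by simp
    have "(h1 / c) *\<^sub>R ?e 1 + (h2 / c) *\<^sub>R ?e 2 = ((h1 * h1 + h2 * h2) / (c * c)) *\<^sub>R Y"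
      by (simp add: algebra_simps add_divide_distrib)
    then show "Y \<in> span (range ?e)" using m[of "h1 / c" "h2 / c"] c(1) unfolding cc by simp
  qed
  then have "hor x \<subseteq> span (range ?e)"
    unfolding hor_def jet_field_frame Y_def[symmetric] by (intro span_minimal) auto
  moreover have "span (range ?e) \<subseteq> hor x"
    using sub unfolding hor_def by (rule span_minimal) simp
  moreover have "sr_metric x (?e i) (?e j) = (if i = j then 1 else 0)" for i j :: 2
  proof -
    define E1 E2 where "E1 = (- h2 / c) *\<^sub>R d_x + (h1 / c) *\<^sub>R Y" and "E2 = (h1 / c) *\<^sub>R d_x + (h2 / c) *\<^sub>R Y"
    have "sr_metric x E1 E1 = 1" "sr_metric x E2 E2 = 1" "sr_metric x E1 E2 = 0" "sr_metric x E2 E1 = 0"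
      unfolding E1_def E2_def Y_def sr_metric_frame[OF n]
      using c(1) cc by (simp_all add: add_divide_distrib[symmetric] add.commute)
    note g = this
    have "i = j" if "i \<noteq> 1" "j \<noteq> 1" using that exhaust_2[of i] exhaust_2[of j] by blast
    then show ?thesis
      unfolding E1_def[symmetric] E2_def[symmetric] by (cases "i = 1"; cases "j = 1") (simp_all add: g)
  qed
  ultimately show ?thesis using sub unfolding hor_orthonormal_basis_def by (intro conjI allI equalityI)
qed

theorem theorem1p1:
  fixes \<gamma> :: "real \<Rightarrow> real ^ 'n::finite" and T :: real and x0 p0 :: "real ^ 'n"
  assumes "CARD('n) \<ge> 3" and "T > 0"
    and "normal_geodesic T \<gamma> (x0, p0)"
    and "ample T \<gamma>" and "equiregular T \<gamma>"
  shows "\<exists>e. hor_orthonormal_basis x0 e \<and>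
    (let n = real CARD('n);
         A = vector [vector [(n - 1)\<^sup>2, 0], vector [0, 1]] :: real ^ 2 ^ 2;
         B = vector [vector [3 * (n - 1) / (4 * (n - 1)\<^sup>2 - 1) * R11 (x0, p0), 0],
                     vector [0, 0]] :: real ^ 2 ^ 2
     in op_matrix x0 e (I_op \<gamma>) = A \<and>
        op_matrix x0 e (R_op \<gamma>) = B \<and>
        (\<lambda>t. norm (op_matrix x0 e (Q_op \<gamma> t) - ((1 / t\<^sup>2) *\<^sub>R A + (1/3) *\<^sub>R B)))
          \<in> O[at_right 0](\<lambda>t. t) \<and>
        (\<forall>a :: real ^ 2.
           (\<lambda>t. second_diff (geod_cost_dot \<gamma> t) x0 (\<Sum>i\<in>UNIV. a $ i *\<^sub>R e i)
                 - (1 / t\<^sup>2 * (a \<bullet> (A *v a)) + 1/3 * (a \<bullet> (B *v a))))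
             \<in> O[at_right 0](\<lambda>t. t)))"
proof -
  have n2: "CARD('n) \<ge> 2" using assms(1) by simp
  obtain u where \<gamma>0: "\<gamma> 0 = x0" and u0: "u 0 = coord_x p0" and ext: "extremal T \<gamma> p0 u"
    using normal_geodesic_extremal[OF n2 _ assms(3)] assms(2) by auto
  define N where "N = real CARD('n) - 1"
  define h1 h2 where "h1 = u 0" and "h2 = p0 \<bullet> jet_vec 0 (coord_x x0)"
  \<comment> \<open>One third of the curvature entry, that is, the constant term in the expansion of
    the normal eigenvalue.\<close>
  define r where "r = N / (4 * N\<^sup>2 - 1) * R11 (x0, p0)"
  have R11: "curvature_form (real CARD('n)) h1 h2 (p0 \<bullet> jet_vec 1 (coord_x x0)) (p0 \<bullet> jet_vec 2 (coord_x x0)) = R11 (x0, p0)"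
    unfolding R11_eq_curvature_form cov_h_def fst_conv snd_conv jet_field_frame h1_def h2_def u0 coord_x_inner ..
  have ne: "h1 \<noteq> 0 \<or> h2 \<noteq> 0"
    using ample_equiregular_cost_expansion(1)[OF assms(1,2) ext assms(4,5)] by (simp only: h1_def h2_def \<gamma>0)
  obtain \<epsilon> F where \<epsilon>: "\<epsilon> > 0" and F: "Cn 3 {0..\<epsilon>} F" "jet2 F (N\<^sup>2) 0 r"
    and C: "\<And>t. t \<in> {0<..<\<epsilon>} \<Longrightarrow> cost_expansion_at \<gamma> t h1 h2 (F t)"
    using ample_equiregular_cost_expansion(2)[OF assms(1,2) ext assms(4,5)]
    unfolding \<gamma>0 N_def[symmetric] h1_def[symmetric] h2_def[symmetric] R11 r_def[symmetric] by blast
  define c where "c = sqrt (h1\<^sup>2 + h2\<^sup>2)"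
  have c2: "c\<^sup>2 = h1\<^sup>2 + h2\<^sup>2" by (simp add: c_def)
  have c: "c > 0" using ne by (simp add: c_def sum_power2_gt_zero_iff)
  define Y where "Y = (jet_vec 0 (coord_x x0) :: real ^ 'n)"
  define e where "e = (\<lambda>i :: 2. if i = 1 then (- h2 / c) *\<^sub>R d_x + (h1 / c) *\<^sub>R Y else (h1 / c) *\<^sub>R d_x + (h2 / c) *\<^sub>R Y)"
  have e: "hor_orthonormal_basis x0 e"
    unfolding e_def Y_def by (rule hor_orthonormal_basis_rotation[OF n2 c c2])
  have frame: "a *\<^sub>R e 1 + b *\<^sub>R e 2 = ((b * h1 - a * h2) / c) *\<^sub>R d_x + ((a * h1 + b * h2) / c) *\<^sub>R Y" for a b
    by (simp add: e_def algebra_simps add_divide_distrib diff_divide_distrib)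
  have form: "second_diff (geod_cost_dot \<gamma> t) x0 (a *\<^sub>R e 1 + b *\<^sub>R e 2) = F t / t\<^sup>2 * a\<^sup>2 + 1 / t\<^sup>2 * b\<^sup>2"
    if t: "t \<in> {0<..<\<epsilon>}" for t a b
  proof -
    have cc: "y * (h1\<^sup>2 + h2\<^sup>2) / c = y * c" for y
      unfolding c2[symmetric] using c by (simp add: power2_eq_square)
    have 1: "(b * h1 - a * h2) / c * h1 + (a * h1 + b * h2) / c * h2 = b * c"
      unfolding cc[symmetric] by (simp add: algebra_simps power2_eq_square add_divide_distrib diff_divide_distrib)
    have 2: "(a * h1 + b * h2) / c * h1 - (b * h1 - a * h2) / c * h2 = a * c"
      unfolding cc[symmetric] by (simp add: algebra_simps power2_eq_square add_divide_distrib diff_divide_distrib)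
    have "second_diff (geod_cost_dot \<gamma> t) x0 (a *\<^sub>R e 1 + b *\<^sub>R e 2) = ((b * c)\<^sup>2 + F t * (a * c)\<^sup>2) / (c\<^sup>2 * t\<^sup>2)"
      using second_diff_cost[OF C[OF t], of "(b * h1 - a * h2) / c" "(a * h1 + b * h2) / c"]
      unfolding \<gamma>0 frame Y_def 1 2 c2 .
    also have "\<dots> = F t / t\<^sup>2 * a\<^sup>2 + 1 / t\<^sup>2 * b\<^sup>2"
      using c t by (simp add: power_mult_distrib field_simps)
    finally show ?thesis .
  qed
  have Q: "Q_op \<gamma> t (a *\<^sub>R e 1 + b *\<^sub>R e 2) = (F t / t\<^sup>2 * a) *\<^sub>R e 1 + (1 / t\<^sup>2 * b) *\<^sub>R e 2"
    if t: "t \<in> {0<..<\<epsilon>}" for t a b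
    unfolding Q_op_def \<gamma>0 by (rule hor_operator_of_form[OF n2 e form[OF t]])
  have Q1: "Q_op \<gamma> t (e 1) = (F t / t\<^sup>2) *\<^sub>R e 1" and Q2: "Q_op \<gamma> t (e 2) = (1 / t\<^sup>2) *\<^sub>R e 2" if "t \<in> {0<..<\<epsilon>}" for t
    using Q[OF that, of 1 0] Q[OF that, of 0 1] by simp_all
  have IR1: "I_op \<gamma> (e 1) = N\<^sup>2 *\<^sub>R e 1" "R_op \<gamma> (e 1) = (3 * r) *\<^sub>R e 1"
    using I_op_R_op_eigenvector[OF \<epsilon> _ F, of \<gamma> "e 1"] Q1 by blast+
  \<comment> \<open>In the tangent direction the eigenvalue is exactly 1 / t^2, the constant
    function 1 in place of F, so its curvature is 0.\<close>
  have IR2: "I_op \<gamma> (e 2) = 1 *\<^sub>R e 2" "R_op \<gamma> (e 2) = (3 * 0) *\<^sub>R e 2"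
    using I_op_R_op_eigenvector[OF \<epsilon> _ Cn_const jet2_const, of \<gamma> "e 2" 1] Q2 by blast+
  define A where "A = (vector [vector [N\<^sup>2, 0], vector [0, 1]] :: real ^ 2 ^ 2)"
  define B where "B = (vector [vector [3 * r, 0], vector [0, 0]] :: real ^ 2 ^ 2)"
  have B: "vector [vector [3 * N / (4 * N\<^sup>2 - 1) * R11 (x0, p0), 0], vector [0, 0]] = B"
    by (simp add: B_def r_def mult.assoc)
  have I: "op_matrix x0 e (I_op \<gamma>) = A"
    unfolding A_def by (rule op_matrix_diagonal[OF n2 e]) (simp_all add: IR1 IR2)
  have R: "op_matrix x0 e (R_op \<gamma>) = B"
    unfolding B_def by (rule op_matrix_diagonal[OF n2 e]) (simp_all add: IR1 IR2)
  \<comment> \<open>The whole error sits in the normal eigenvalue; it is the cubic remainder of F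
    divided by t^2.\<close>
  define d where "d t = F t / t\<^sup>2 - (N\<^sup>2 / t\<^sup>2 + r)" for t
  have dO: "d \<in> O[at_right 0](\<lambda>t. t)"
  proof -
    have "(\<lambda>t. (F t - (N\<^sup>2 + 0 * t + r * t\<^sup>2)) * (1 / t\<^sup>2)) \<in> O[at_right 0](\<lambda>t. t ^ 3 * (1 / t\<^sup>2))"
      using F(2) unfolding jet2_def by (rule landau_o.big.mult_right)
    moreover have "t ^ 3 * (1 / t\<^sup>2) = t" for t :: real
      by (cases "t = 0") (simp_all add: power2_eq_square power3_eq_cube)
    ultimately have mem: "(\<lambda>t. (F t - (N\<^sup>2 + 0 * t + r * t\<^sup>2)) * (1 / t\<^sup>2)) \<in> O[at_right 0](\<lambda>t. t)"
      by (simp only:)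
    have "\<forall>\<^sub>F t in at_right 0. (F t - (N\<^sup>2 + 0 * t + r * t\<^sup>2)) * (1 / t\<^sup>2) = d t"
      using eventually_at_right_less[of 0] by eventually_elim (simp add: d_def field_simps)
    from iffD1[OF landau_o.big.in_cong[OF this] mem] show ?thesis .
  qed
  have ev: "\<forall>\<^sub>F t in at_right 0. t \<in> {0<..<\<epsilon>}"
    using \<epsilon> by (rule eventually_at_right_real)
  have "(\<lambda>t. norm (op_matrix x0 e (Q_op \<gamma> t) - ((1 / t\<^sup>2) *\<^sub>R A + (1/3) *\<^sub>R B))) \<in> O[at_right 0](\<lambda>t. t)"
  proof -
    have "norm (op_matrix x0 e (Q_op \<gamma> t) - ((1 / t\<^sup>2) *\<^sub>R A + (1/3) *\<^sub>R B)) = norm (d t)" if t: "t \<in> {0<..<\<epsilon>}" for t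
    proof -
      have "op_matrix x0 e (Q_op \<gamma> t) - ((1 / t\<^sup>2) *\<^sub>R A + (1/3) *\<^sub>R B) = vector [vector [d t, 0], vector [0, 0]]"
        unfolding op_matrix_diagonal[OF n2 e, of "Q_op \<gamma> t", OF Q1[OF t] Q2[OF t]]
        by (simp add: A_def B_def d_def vec_eq_iff forall_2)
      then show ?thesis by (simp add: norm_vec_def L2_set_def sum_2)
    qed
    then have "\<forall>\<^sub>F t in at_right 0. norm (op_matrix x0 e (Q_op \<gamma> t) - ((1 / t\<^sup>2) *\<^sub>R A + (1/3) *\<^sub>R B)) = norm (d t)"
      using ev by (auto elim: eventually_mono)
    moreover have "(\<lambda>t. norm (d t)) \<in> O[at_right 0](\<lambda>t. t)" using dO by simp
    ultimately show ?thesis by (rule iffD2[OF landau_o.big.in_cong])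
  qed
  moreover have "(\<lambda>t. second_diff (geod_cost_dot \<gamma> t) x0 (\<Sum>i\<in>UNIV. a $ i *\<^sub>R e i)
      - (1 / t\<^sup>2 * (a \<bullet> (A *v a)) + 1/3 * (a \<bullet> (B *v a)))) \<in> O[at_right 0](\<lambda>t. t)" for a :: "real ^ 2"
  proof -
    have A: "a \<bullet> (A *v a) = N\<^sup>2 * (a $ 1)\<^sup>2 + (a $ 2)\<^sup>2" and B: "a \<bullet> (B *v a) = 3 * r * (a $ 1)\<^sup>2"
      by (simp_all add: A_def B_def inner_vec_def matrix_vector_mult_def sum_2 power2_eq_square)
    have "second_diff (geod_cost_dot \<gamma> t) x0 (\<Sum>i\<in>UNIV. a $ i *\<^sub>R e i)
      - (1 / t\<^sup>2 * (a \<bullet> (A *v a)) + 1/3 * (a \<bullet> (B *v a))) = (a $ 1)\<^sup>2 * d t" if "t \<in> {0<..<\<epsilon>}" for t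
      unfolding A B sum_2 form[OF that] d_def by (simp add: algebra_simps)
    then have "\<forall>\<^sub>F t in at_right 0. second_diff (geod_cost_dot \<gamma> t) x0 (\<Sum>i\<in>UNIV. a $ i *\<^sub>R e i)
      - (1 / t\<^sup>2 * (a \<bullet> (A *v a)) + 1/3 * (a \<bullet> (B *v a))) = (a $ 1)\<^sup>2 * d t"
      using ev by (auto elim: eventually_mono)
    from iffD2[OF landau_o.big.in_cong[OF this] bigo_const_mult[OF dO]] show ?thesis .
  qed
  ultimately show ?thesis
    unfolding Let_def N_def[symmetric] A_def[symmetric] B
    using e I R by blast
qed

end
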